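(* Let $d\ge 1$, let $b:\mathbb{R}^d\to\mathbb{R}^d$ and $\sigma\in\mathbb{R}^{d\times d}$ satisfy Assumption (Coeff), and let $h:\mathbb{R}^d\to\mathbb{R}$ be Lipschitz. There exists $\eta^{\ast}>0$ (sufficiently small) such that the following holds for every initial point $x\in\mathbb{R}^d$ and every step-size sequence $\{\eta_k\}_{k\ge1}\subset(0,1)$ satisfying Assumptions (Step-0), (Step-1) and (Step-2) with $\eta_1\le\eta^{\ast}$. Assume that the limit $$a(t):=\lim_{n\to\infty}\frac{T_{\lfloor nt\rfloor}}{T_n}\in[0,1]$$ exists for $t\in[0,1]$ and that $a$ satisfies Assumption (Time-change) with $T=1$. Then, as $n\to\infty$, $$\left\{\frac{\lfloor nt\rfloor}{\sqrt{T_n}}\big[\Pi_{\lfloor nt\rfloor}(h)-\pi(h)\big]\right\}_{t\in[0,1]}\Rightarrow\sqrt{\pi(|\sigma^{\intercal}\nabla\varphi|^2)}\,\{B^1_{a(t)}\}_{t\in[0,1]}$$ weakly on the Skorohod space $D[0,1]$, where $\{B^1_t\}_{t\ge0}$ is a one-dimensional standard Brownian motion and $\varphi$ solves the Poisson equation $h-\pi(h)=\mathcal{A}\varphi$.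
   Context: $|\cdot|$ is the Euclidean norm on vectors and the Frobenius norm on matrices; $A\preceq B$ means $B-A$ is positive semi-definite; $\langle A,B\rangle_{\mathrm{HS}}=\mathrm{tr}(A^{\intercal}B)$; $\pi(f)=\int f\,\mathrm{d}\pi$; $D[0,1]$ is the Skorohod space of càdlàg functions $[0,1]\to\mathbb{R}$. Assumption (Coeff): $b$ is continuous; there is $L>0$ with $|b(x)-b(y)|\le L|x-y|$ for all $x,y$; there are $K_1>0$, $K_2\ge0$ with $\langle b(x)-b(y),x-y\rangle\le -K_1|x-y|^2+K_2$ for all $x,y$; $\sigma$ is invertible and there is $K_3>1$ with $K_3^{-1}I_d\preceq\sigma\sigma^{\intercal}\preceq K_3I_d$. SDE: $\mathrm{d}X_t=b(X_t)\,\mathrm{d}t+\sigma\,\mathrm{d}B_t$, $X_0=x$, with $B$ a standard $d$-dimensional Brownian motion. Under (Coeff) it has a unique strong solution and a unique invariant probability measure, denoted $\pi$. Its generator is $\mathcal{A}f(x)=\langle b(x),\nabla f(x)\rangle+\frac12\langle\sigma\sigma^{\intercal},\nabla^2f(x)\rangle_{\mathrm{HS}}$. Euler--Maruyama chain: $\theta_0=x$, $\theta_{k+1}=\theta_k+\eta_{k+1}b(\theta_k)+\sqrt{\eta_{k+1}}\,\sigma\xi_{k+1}$, with $\xi_1,\xi_2,\dots$ i.i.d. $\mathcal{N}(0,I_d)$. Empirical measure: $\Pi_n=\frac1n\sum_{k=0}^{n-1}\delta_{\theta_k}$ for $n\ge1$, so $n[\Pi_n(h)-\pi(h)]=\sum_{k=0}^{n-1}[h(\theta_k)-\pi(h)]$,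 interpreted as $0$ when $n=0$. Also $t_0=0$, $t_n=\sum_{k=1}^n\eta_k$, $T_0=0$, $T_n=\sum_{k=1}^n\eta_k^{-1}$. Assumption (Step-0): $\{\eta_k\}$ is non-increasing, $\sum_{k\ge1}\eta_k=\infty$, and there is $c>0$ with $\eta_{k-1}-\eta_k\le c\,\eta_k^2$ for all $k\ge2$. Assumption (Step-1): for some $0<\epsilon<1$, $\sum_{k\ge1}\eta_k^{2-\epsilon}<\infty$; and there is a sequence $L_n\to\infty$ with $\frac{L_n}{\eta_n\sqrt{T_n}}\to0$ as $n\to\infty$. Assumption (Step-2): there is $p>1$ with $\frac{(1+t_n)^{1/p}}{\eta_n\sqrt{T_n}}\to0$ as $n\to\infty$. Assumption (Time-change), for given $T>0$: $a:[0,T]\to\mathbb{R}_+$ is strictly increasing and continuous with $a(0)=0$; and, for $\delta>0$, with $t_\delta^m=m\delta$ for $0\le m\le\lfloor\delta^{-1}T\rfloor$, $t_\delta^{\lfloor\delta^{-1}T\rfloor+1}=T$, $\tau_m(\delta)=a(t_\delta^{m+1})-a(t_\delta^m)$ and $\tau(\delta)=\sup_{0\le m\le\lfloor\delta^{-1}T\rfloor}\tau_m(\delta)$, one has $\lim_{\delta\to0}\tau(\delta)\log(\delta^{-1})=0$. Poisson equation: $\varphi$ denotes the ($C^2$) solution of $\mathcal{A}\varphi=h-\pi(h)$ for which it is known that, for some $C>0$, $|\nabla^k\varphi(x)|\le C(1+|x|^{k+2})$ for $k=0,1,2$ and $\sup_{0<|y-x|\le1}\frac{|\nabla^2\varphi(x)-\nabla^2\varphi(y)|}{|x-y|}\le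 C(1+|x|^5)$ for all $x$. *)

theory Defs
  imports "HOL-Probability.Probability"
begin

section \<open>Coefficients and the generator\<close>

definition psd :: "real^'n^'n \<Rightarrow> bool" where
  "psd A \<longleftrightarrow> transpose A = A \<and> (\<forall>x. 0 \<le> x \<bullet> (A *v x))"

definition loewner_le :: "real^'n^'n \<Rightarrow> real^'n^'n \<Rightarrow> bool" (infix \<open>\<preceq>\<^sub>L\<close> 50) where
  "A \<preceq>\<^sub>L B \<longleftrightarrow> psd (B - A)"

definition coeff_assumption :: "(real^'n \<Rightarrow> real^'n) \<Rightarrow> real^'n^'n \<Rightarrow> bool" where
  "coeff_assumption b \<sigma> \<longleftrightarrow>
     continuous_on UNIV b \<and>
     (\<exists>L>0. \<forall>x y. norm (b x - b y) \<le> L * norm (x - y)) \<and>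
     (\<exists>K1>0. \<exists>K2\<ge>0. \<forall>x y. (b x - b y) \<bullet> (x - y) \<le> - K1 * (norm (x - y))\<^sup>2 + K2) \<and>
     invertible \<sigma> \<and>
     (\<exists>K3>1. inverse K3 *\<^sub>R mat 1 \<preceq>\<^sub>L \<sigma> ** transpose \<sigma> \<and>
              \<sigma> ** transpose \<sigma> \<preceq>\<^sub>L K3 *\<^sub>R mat 1)"

definition grad :: "(real^'n \<Rightarrow> real) \<Rightarrow> real^'n \<Rightarrow> real^'n" where
  "grad f x = (\<chi> i. frechet_derivative f (at x) (axis i 1))"

definition hess :: "(real^'n \<Rightarrow> real) \<Rightarrow> real^'n \<Rightarrow> real^'n^'n" where
  "hess f x = matrix (frechet_derivative (grad f) (at x))"

definition C2 :: "(real^'n \<Rightarrow> real) \<Rightarrow> bool" where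
  "C2 f \<longleftrightarrow> (\<forall>x. f differentiable at x) \<and> (\<forall>x. grad f differentiable at x) \<and>
     continuous_on UNIV (hess f)"

definition hs_inner :: "real^'n^'n \<Rightarrow> real^'n^'n \<Rightarrow> real" where
  "hs_inner A B = trace (transpose A ** B)"

definition generator ::
  "(real^'n \<Rightarrow> real^'n) \<Rightarrow> real^'n^'n \<Rightarrow> (real^'n \<Rightarrow> real) \<Rightarrow> real^'n \<Rightarrow> real" where
  "generator b \<sigma> f x = b x \<bullet> grad f x + 1/2 * hs_inner (\<sigma> ** transpose \<sigma>) (hess f x)"

text \<open>The growth bounds are part of the definition: the equation alone has further solutions of
  faster growth, and the bounds single out the intended one (up to an additive constant).
  The norm of \<^typ>\<open>real^'n^'n\<close> is the Frobenius norm.\<close>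

definition poisson_solution ::
  "(real^'n \<Rightarrow> real^'n) \<Rightarrow> real^'n^'n \<Rightarrow> (real^'n) measure \<Rightarrow> (real^'n \<Rightarrow> real) \<Rightarrow>
   (real^'n \<Rightarrow> real) \<Rightarrow> bool" where
  "poisson_solution b \<sigma> \<pi> h \<phi> \<longleftrightarrow>
     C2 \<phi> \<and>
     (\<forall>x. generator b \<sigma> \<phi> x = h x - (\<integral>y. h y \<partial>\<pi>)) \<and>
     (\<exists>C>0. \<forall>x.
        \<bar>\<phi> x\<bar> \<le> C * (1 + norm x ^ 2) \<and>
        norm (grad \<phi> x) \<le> C * (1 + norm x ^ 3) \<and>
        norm (hess \<phi> x) \<le> C * (1 + norm x ^ 4) \<and>
        (\<forall>y. 0 < norm (y - x) \<and> norm (y - x) \<le> 1 \<longrightarrow>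
           norm (hess \<phi> x - hess \<phi> y) / norm (x - y) \<le> C * (1 + norm x ^ 5)))"

section \<open>Brownian motion, the SDE and its invariant measure\<close>

text \<open>Lebesgue density of the centred Gaussian with covariance \<open>v\<close> times the identity,
  for \<open>v > 0\<close>.\<close>

definition gaussian_density :: "real \<Rightarrow> 'a::euclidean_space \<Rightarrow> real" where
  "gaussian_density v x = (\<Prod>i\<in>Basis. normal_density 0 (sqrt v) (x \<bullet> i))"

definition brownian_motion :: "'w measure \<Rightarrow> (real \<Rightarrow> 'w \<Rightarrow> 'a::euclidean_space) \<Rightarrow> bool" where
  "brownian_motion M B \<longleftrightarrow>
     prob_space M \<and>
     (\<forall>t\<ge>0. B t \<in> borel_measurable M) \<and>
     (AE \<omega> in M. B 0 \<omega> = 0) \<and>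
     (\<forall>\<omega>\<in>space M. continuous_on {0..} (\<lambda>t. B t \<omega>)) \<and>
     (\<forall>s t. 0 \<le> s \<and> s < t \<longrightarrow>
        distributed M lborel (\<lambda>\<omega>. B t \<omega> - B s \<omega>) (gaussian_density (t - s))) \<and>
     (\<forall>(r::nat \<Rightarrow> real) m. 0 \<le> r 0 \<and> strict_mono r \<longrightarrow>
        prob_space.indep_vars M (\<lambda>_. borel) (\<lambda>i \<omega>. B (r (Suc i)) \<omega> - B (r i) \<omega>) {..<m})"

definition augmented_filtration ::
  "'w measure \<Rightarrow> (real \<Rightarrow> 'w \<Rightarrow> 'a::euclidean_space) \<Rightarrow> real \<Rightarrow> 'w measure" where
  "augmented_filtration M B t =
     sigma (space M) ({B s -` A \<inter> space M | s A. s \<in> {0..t} \<and> A \<in> sets borel} \<union> null_sets M)"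

text \<open>As \<open>\<sigma>\<close> is constant, the stochastic integral of \<open>\<sigma>\<close> up to time \<open>t\<close> is \<open>\<sigma> B\<^sub>t\<close>
  (with \<open>B\<^sub>0 = 0\<close>), so the integral form of the SDE involves only a pathwise integral.\<close>

definition strong_solution ::
  "'w measure \<Rightarrow> (real \<Rightarrow> 'w \<Rightarrow> real^'n) \<Rightarrow> (real^'n \<Rightarrow> real^'n) \<Rightarrow> real^'n^'n \<Rightarrow> real^'n \<Rightarrow>
   (real \<Rightarrow> 'w \<Rightarrow> real^'n) \<Rightarrow> bool" where
  "strong_solution M B b \<sigma> x X \<longleftrightarrow>
     (\<forall>t\<ge>0. X t \<in> borel_measurable (augmented_filtration M B t)) \<and>
     (\<forall>\<omega>\<in>space M. continuous_on {0..} (\<lambda>t. X t \<omega>)) \<and>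
     (AE \<omega> in M. \<forall>t\<ge>0. X t \<omega> = x + integral {0..t} (\<lambda>s. b (X s \<omega>)) + \<sigma> *v B t \<omega>)"

text \<open>Here \<open>X x\<close> is the solution started at \<open>x\<close>, and \<open>distr M borel (X x t)\<close> is the transition
  probability from \<open>x\<close> in time \<open>t\<close>.\<close>

definition invariant_measure ::
  "'w measure \<Rightarrow> (real^'n \<Rightarrow> real \<Rightarrow> 'w \<Rightarrow> real^'n) \<Rightarrow> (real^'n) measure \<Rightarrow> bool" where
  "invariant_measure M X \<pi> \<longleftrightarrow>
     prob_space \<pi> \<and> sets \<pi> = sets borel \<and>
     (\<forall>t\<ge>0. \<forall>A\<in>sets borel. (\<integral>\<^sup>+x. emeasure (distr M borel (X x t)) A \<partial>\<pi>) = emeasure \<pi> A)"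

section \<open>The Euler--Maruyama chain\<close>

text \<open>Sequences written with indices starting at 1 (\<open>\<eta>\<close>, \<open>\<xi>\<close>) are functions on \<^typ>\<open>nat\<close> whose
  value at 0 is never used.\<close>

definition iid_std_gaussian :: "'v measure \<Rightarrow> (nat \<Rightarrow> 'v \<Rightarrow> real^'n) \<Rightarrow> bool" where
  "iid_std_gaussian N \<xi> \<longleftrightarrow>
     prob_space N \<and>
     prob_space.indep_vars N (\<lambda>_. borel) \<xi> {1..} \<and>
     (\<forall>k\<ge>1. distributed N lborel (\<xi> k) (gaussian_density 1))"

primrec em_chain ::
  "(real^'n \<Rightarrow> real^'n) \<Rightarrow> real^'n^'n \<Rightarrow> (nat \<Rightarrow> real) \<Rightarrow> real^'n \<Rightarrow> (nat \<Rightarrow> 'v \<Rightarrow> real^'n) \<Rightarrow>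
   nat \<Rightarrow> 'v \<Rightarrow> real^'n" where
  "em_chain b \<sigma> \<eta> x \<xi> 0 \<omega> = x"
| "em_chain b \<sigma> \<eta> x \<xi> (Suc k) \<omega> =
     em_chain b \<sigma> \<eta> x \<xi> k \<omega> + \<eta> (Suc k) *\<^sub>R b (em_chain b \<sigma> \<eta> x \<xi> k \<omega>)
       + sqrt (\<eta> (Suc k)) *\<^sub>R (\<sigma> *v \<xi> (Suc k) \<omega>)"

text \<open>The average of the point masses at \<open>\<theta> 0, \<dots>, \<theta> (n - 1)\<close>; the null measure if \<open>n = 0\<close>.\<close>

definition empirical_measure :: "(nat \<Rightarrow> 'a::euclidean_space) \<Rightarrow> nat \<Rightarrow> 'a measure" where
  "empirical_measure \<theta> n = distr (uniform_count_measure {..<n}) borel \<theta>"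

lemma integral_empirical_measure:
  fixes f :: "'a::euclidean_space \<Rightarrow> real"
  assumes "f \<in> borel_measurable borel"
  shows "(\<integral>y. f y \<partial>empirical_measure \<theta> n) = (\<Sum>k<n. f (\<theta> k)) / real n"
proof -
  have "\<theta> \<in> measurable (uniform_count_measure {..<n}) borel"
    by (simp add: measurable_def space_uniform_count_measure sets_uniform_count_measure)
  then have "(\<integral>y. f y \<partial>empirical_measure \<theta> n)
      = (\<integral>k. f (\<theta> k) \<partial>uniform_count_measure {..<n})"
    unfolding empirical_measure_def using assms by (rule integral_distr)
  also have "\<dots> = (\<Sum>k<n. f (\<theta> k)) / real n"
    by (simp add: uniform_count_measure_def lebesgue_integral_point_measure_finite
        sum_divide_distrib)
  finally show ?thesis .
qed

section \<open>Step sizes and time change\<close>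

definition step_t :: "(nat \<Rightarrow> real) \<Rightarrow> nat \<Rightarrow> real" where
  "step_t \<eta> n = (\<Sum>k=1..n. \<eta> k)"

definition step_T :: "(nat \<Rightarrow> real) \<Rightarrow> nat \<Rightarrow> real" where
  "step_T \<eta> n = (\<Sum>k=1..n. inverse (\<eta> k))"

definition step0 :: "(nat \<Rightarrow> real) \<Rightarrow> bool" where
  "step0 \<eta> \<longleftrightarrow>
     (\<forall>k\<ge>1. \<eta> (Suc k) \<le> \<eta> k) \<and>
     filterlim (step_t \<eta>) at_top sequentially \<and>
     (\<exists>c>0. \<forall>k\<ge>2. \<eta> (k - 1) - \<eta> k \<le> c * (\<eta> k)\<^sup>2)"

definition step1 :: "(nat \<Rightarrow> real) \<Rightarrow> bool" where
  "step1 \<eta> \<longleftrightarrow>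
     (\<exists>\<epsilon>. 0 < \<epsilon> \<and> \<epsilon> < 1 \<and> summable (\<lambda>k. \<eta> (Suc k) powr (2 - \<epsilon>))) \<and>
     (\<exists>L::nat \<Rightarrow> real. filterlim L at_top sequentially \<and>
        (\<lambda>n. L n / (\<eta> n * sqrt (step_T \<eta> n))) \<longlonglongrightarrow> 0)"

definition step2 :: "(nat \<Rightarrow> real) \<Rightarrow> bool" where
  "step2 \<eta> \<longleftrightarrow>
     (\<exists>p>1. (\<lambda>n. (1 + step_t \<eta> n) powr (1 / p) / (\<eta> n * sqrt (step_T \<eta> n))) \<longlonglongrightarrow> 0)"

definition time_grid :: "real \<Rightarrow> real \<Rightarrow> nat \<Rightarrow> real" where
  "time_grid T \<delta> m = (if m \<le> nat \<lfloor>inverse \<delta> * T\<rfloor> then real m * \<delta> else T)"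

definition time_modulus :: "real \<Rightarrow> (real \<Rightarrow> real) \<Rightarrow> real \<Rightarrow> real" where
  "time_modulus T a \<delta> =
     (SUP m\<in>{0..nat \<lfloor>inverse \<delta> * T\<rfloor>}. a (time_grid T \<delta> (Suc m)) - a (time_grid T \<delta> m))"

definition time_change :: "real \<Rightarrow> (real \<Rightarrow> real) \<Rightarrow> bool" where
  "time_change T a \<longleftrightarrow>
     (\<forall>t\<in>{0..T}. 0 \<le> a t) \<and> strict_mono_on {0..T} a \<and> continuous_on {0..T} a \<and> a 0 = 0 \<and>
     ((\<lambda>\<delta>. time_modulus T a \<delta> * ln (inverse \<delta>)) \<longlongrightarrow> 0) (at_right 0)"

section \<open>Weak convergence on the Skorohod space\<close>

text \<open>Functions on \<open>[0,1]\<close> are represented as total functions that are \<open>undefined\<close> elsewhere.\<close>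

definition D01 :: "(real \<Rightarrow> real) set" where
  "D01 = {x \<in> extensional {0..1}.
     (\<forall>t\<in>{0..<1}. (x \<longlongrightarrow> x t) (at_right t)) \<and> (\<forall>t\<in>{0<..1}. \<exists>l. (x \<longlongrightarrow> l) (at_left t))}"

definition skorohod_dist :: "(real \<Rightarrow> real) \<Rightarrow> (real \<Rightarrow> real) \<Rightarrow> real" where
  "skorohod_dist x y = Inf {e. 0 < e \<and>
     (\<exists>\<mu>. strict_mono_on {0..1} \<mu> \<and> continuous_on {0..1} \<mu> \<and> \<mu> ` {0..1} = {0..1} \<and>
        (\<forall>t\<in>{0..1}. \<bar>\<mu> t - t\<bar> \<le> e \<and> \<bar>x t - y (\<mu> t)\<bar> \<le> e))}"

definition skorohod_topology :: "(real \<Rightarrow> real) topology" where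
  "skorohod_topology = topology (\<lambda>U. U \<subseteq> D01 \<and>
     (\<forall>x\<in>U. \<exists>e>0. \<forall>y\<in>D01. skorohod_dist x y < e \<longrightarrow> y \<in> U))"

lemma openin_skorohod_topology:
  "openin skorohod_topology U \<longleftrightarrow>
     U \<subseteq> D01 \<and> (\<forall>x\<in>U. \<exists>e>0. \<forall>y\<in>D01. skorohod_dist x y < e \<longrightarrow> y \<in> U)"
proof -
  have "istopology (\<lambda>U. U \<subseteq> D01 \<and> (\<forall>x\<in>U. \<exists>e>0. \<forall>y\<in>D01. skorohod_dist x y < e \<longrightarrow> y \<in> U))"
    (is "istopology ?P")
    unfolding istopology_def
  proof (intro conjI allI impI)
    fix S T assume "?P S" "?P T"
    then show "S \<inter> T \<subseteq> D01" by blast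
    show "\<forall>x\<in>S \<inter> T. \<exists>e>0. \<forall>y\<in>D01. skorohod_dist x y < e \<longrightarrow> y \<in> S \<inter> T"
    proof
      fix x assume "x \<in> S \<inter> T"
      then obtain d e where "d > 0" "\<forall>y\<in>D01. skorohod_dist x y < d \<longrightarrow> y \<in> S"
        "e > 0" "\<forall>y\<in>D01. skorohod_dist x y < e \<longrightarrow> y \<in> T"
        using \<open>?P S\<close> \<open>?P T\<close> by blast
      then show "\<exists>e>0. \<forall>y\<in>D01. skorohod_dist x y < e \<longrightarrow> y \<in> S \<inter> T"
        by (intro exI[of _ "min d e"]) auto
    qed
  next
    fix K assume K: "\<forall>S\<in>K. ?P S"
    then show "\<Union>K \<subseteq> D01" by blast
    show "\<forall>x\<in>\<Union>K. \<exists>e>0. \<forall>y\<in>D01. skorohod_dist x y < e \<longrightarrow> y \<in> \<Union>K"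
      using K by (meson UnionE UnionI)
  qed
  then show ?thesis
    by (simp add: skorohod_topology_def topology_inverse')
qed

lemma topspace_skorohod_topology: "topspace skorohod_topology = D01"
  unfolding topspace_def openin_skorohod_topology by (auto intro!: exI[of _ D01] exI[of _ 1])

definition skorohod_borel :: "(real \<Rightarrow> real) measure" where
  "skorohod_borel = sigma D01 {U. openin skorohod_topology U}"

text \<open>\<open>Y n\<close> and \<open>Z\<close> are required to be random elements of the Skorohod space, so that the
  expectations are meaningful.\<close>

definition converges_weakly_D ::
  "'v measure \<Rightarrow> (nat \<Rightarrow> 'v \<Rightarrow> real \<Rightarrow> real) \<Rightarrow> 'u measure \<Rightarrow> ('u \<Rightarrow> real \<Rightarrow> real) \<Rightarrow> bool" where
  "converges_weakly_D N Y P Z \<longleftrightarrow>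
     (\<forall>n. Y n \<in> measurable N skorohod_borel) \<and> Z \<in> measurable P skorohod_borel \<and>
     (\<forall>F. continuous_map skorohod_topology euclideanreal F \<and> bounded (F ` D01) \<longrightarrow>
        (\<lambda>n. \<integral>\<omega>. F (Y n \<omega>) \<partial>N) \<longlonglongrightarrow> (\<integral>\<omega>. F (Z \<omega>) \<partial>P))"

end

theory Submission
  imports Defs
begin

text \<open>Taylor expansion of the Poisson solution along the chain gives
  \<open>h(\<theta>\<^sub>j) - \<pi>(h) = (\<phi>(\<theta>\<^sub>j\<^sub>+\<^sub>1) - \<phi>(\<theta>\<^sub>j))/\<eta>\<^sub>j\<^sub>+\<^sub>1 - \<langle>\<nabla>\<phi>(\<theta>\<^sub>j), \<sigma>\<xi>\<^sub>j\<^sub>+\<^sub>1\<rangle>/\<surd>\<eta>\<^sub>j\<^sub>+\<^sub>1 - \<zeta>\<^sub>j - \<rho>\<^sub>j\<close>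
  with \<open>\<zeta>\<^sub>j\<close> conditionally centred and \<open>\<rho>\<^sub>j\<close> of order \<open>\<surd>\<eta>\<^sub>j\<^sub>+\<^sub>1\<close>. Summation by parts together with a maximal
  inequality for \<open>1 + \<bar>\<theta>\<bar>\<^sup>2\<close> shows that after division by \<open>\<surd>T\<^sub>n\<close> only the second term survives, uniformly
  in time; this is where (Step-2) enters.

  The second term is a martingale with conditionally Gaussian increments whose bracket at time \<open>nt\<close> converges
  to \<open>\<pi>(\<bar>\<sigma>\<^sup>T\<nabla>\<phi>\<bar>\<^sup>2) a(t)\<close> by a weighted law of large numbers. The latter follows from geometric mixing of the
  chain (Lyapunov function and a discrete Harnack inequality, combined by Harris' argument) and from
  the convergence of Euler schemes to the diffusion, which identifies the limit as an integral over \<open>\<pi>\<close>.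

  Increments over finitely many blocks are compared with independent Gaussians by trading bracket for
  variance exactly, and an exponential inequality controls
  the oscillation inside the blocks. As the approximation is uniform in time, bounded functionals that
  are Lipschitz for the uniform distance suffice, and inf-convolution reduces Skorohod
  continuous functionals to these.\<close>

section \<open>Standard Gaussian vectors\<close>

text \<open>The chain is inhomogeneous in time, so an estimate is usable only if it depends on the
  steps through the elapsed time \<open>step_t\<close> and the bound \<open>es\<close> alone. This
  dictates contraction over blocks of elapsed time between 1 and 2 and a Harnack constant
  \<open>cH\<close> that sees only elapsed time. Correlations then decay in elapsed time while the
  averages carry the weights 1/\<eta>; pairs of indices close in elapsed time contribute at most a
  multiple of 1/(\<eta>_n^2 T_n), which vanishes by (Step-2).

  Identifying the limit takes no rate for the Euler scheme over long times: mixing makes the start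
  irrelevant first, so only a last stretch of bounded length is compared with the diffusion, which
  preserves \<pi>. No moments of \<pi> are given in advance; they come out of the law of large
  numbers by truncation.

  (Step-1) enters as summability of \<eta>^2, which by Cauchy-Schwarz makes the sum of
  sqrt(\<eta>_k) small against sqrt(T_n). The power p in (Step-2) is the moment of the Lyapunov
  function in its maximal inequality, rounded up to an integer.\<close>

definition std_gauss :: "'a::euclidean_space measure" where
  "std_gauss = density lborel (\<lambda>x. ennreal (gaussian_density 1 x))"

lemma sets_std_gauss [simp, measurable_cong]: "sets std_gauss = sets borel"
  and space_std_gauss [simp]: "space std_gauss = UNIV"
  by (simp_all add: std_gauss_def)

lemma borel_measurable_gaussian_density [measurable]:
  "gaussian_density v \<in> borel_measurable (borel :: 'a::euclidean_space measure)"
  unfolding gaussian_density_def by measurable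

lemma gaussian_density_nonneg [simp]: "0 \<le> gaussian_density v x"
  unfolding gaussian_density_def by (intro prod_nonneg) auto

lemma PiM_std_normal:
  "(\<Pi>\<^sub>M b\<in>(Basis::'a::euclidean_space set). std_normal_distribution) =
    density (\<Pi>\<^sub>M b\<in>(Basis::'a set). lborel) (\<lambda>x. \<Prod>b\<in>Basis. ennreal (std_normal_density (x b)))"
proof -
  interpret S: product_sigma_finite "\<lambda>_::'a. (lborel :: real measure)" ..
  interpret N: prob_space std_normal_distribution
    by (rule prob_space_normal_density) simp
  interpret T: product_sigma_finite "\<lambda>_::'a. std_normal_distribution" ..
  show ?thesis
  proof (rule T.PiM_eqI[symmetric])
    show "sets (density (\<Pi>\<^sub>M b\<in>(Basis::'a set). lborel) (\<lambda>x. \<Prod>b\<in>Basis. ennreal (std_normal_density (x b))))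
        = sets (\<Pi>\<^sub>M b\<in>(Basis::'a set). std_normal_distribution)"
      by (simp cong: sets_PiM_cong)
    fix A :: "'a \<Rightarrow> real set" assume A: "\<And>i. i \<in> Basis \<Longrightarrow> A i \<in> sets std_normal_distribution"
    have A': "i \<in> Basis \<Longrightarrow> A i \<in> sets borel" for i using A by simp
    have "emeasure (density (\<Pi>\<^sub>M b\<in>(Basis::'a set). lborel) (\<lambda>x. \<Prod>b\<in>Basis. ennreal (std_normal_density (x b)))) (Pi\<^sub>E Basis A)
      = (\<integral>\<^sup>+x. (\<Prod>b\<in>Basis. ennreal (std_normal_density (x b))) * indicator (Pi\<^sub>E Basis A) x \<partial>(\<Pi>\<^sub>M b\<in>(Basis::'a set). lborel))"
      by (rule emeasure_density) (auto intro!: sets_PiM_I_finite A' cong: sets_PiM_cong)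
    also have "\<dots> = (\<integral>\<^sup>+x. (\<Prod>b\<in>Basis. ennreal (std_normal_density (x b)) * indicator (A b) (x b)) \<partial>(\<Pi>\<^sub>M b\<in>(Basis::'a set). lborel))"
    proof (rule nn_integral_cong)
      fix x assume "x \<in> space (\<Pi>\<^sub>M b\<in>(Basis::'a set). lborel :: real measure)"
      then have "x \<in> extensional Basis" by (simp add: space_PiM PiE_def)
      then have "indicator (Pi\<^sub>E Basis A) x = (\<Prod>b\<in>Basis. indicator (A b) (x b) :: ennreal)"
        by (auto simp: indicator_def PiE_def Pi_def)
      then show "(\<Prod>b\<in>Basis. ennreal (std_normal_density (x b))) * indicator (Pi\<^sub>E Basis A) x
        = (\<Prod>b\<in>Basis. ennreal (std_normal_density (x b)) * indicator (A b) (x b))"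
        by (simp add: prod.distrib)
    qed
    also have "\<dots> = (\<Prod>b\<in>Basis. \<integral>\<^sup>+x. ennreal (std_normal_density x) * indicator (A b) x \<partial>lborel)"
      using A' by (intro S.product_nn_integral_prod) auto
    also have "\<dots> = (\<Prod>b\<in>Basis. emeasure std_normal_distribution (A b))"
      using A' by (intro prod.cong refl) (simp add: emeasure_density)
    finally show "emeasure (density (\<Pi>\<^sub>M b\<in>(Basis::'a set). lborel) (\<lambda>x. \<Prod>b\<in>Basis. ennreal (std_normal_density (x b)))) (Pi\<^sub>E Basis A)
      = (\<Prod>b\<in>Basis. emeasure std_normal_distribution (A b))" .
  qed simp
qed

text \<open>The product form turns integrals of functions that factor over the coordinates into
  products of one-dimensional integrals; total mass one and the characteristic function come from
  it.\<close>

lemma std_gauss_eq_PiM: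
  "(std_gauss :: 'a::euclidean_space measure) =
     distr (\<Pi>\<^sub>M b\<in>Basis. std_normal_distribution) borel (\<lambda>f. \<Sum>b\<in>Basis. f b *\<^sub>R b)"
    (is "_ = distr ?P _ ?h")
proof (rule measure_eqI)
  fix A :: "'a set" assume "A \<in> sets std_gauss"
  then have A[measurable]: "A \<in> sets borel" by simp
  have h[measurable]: "?h \<in> measurable (\<Pi>\<^sub>M b\<in>(Basis::'a set). lborel) borel"
    by measurable
  have gd: "ennreal (gaussian_density 1 (?h f)) = (\<Prod>b\<in>Basis. ennreal (std_normal_density (f b)))" for f
  proof -
    have "gaussian_density 1 (?h f) = (\<Prod>b\<in>Basis. std_normal_density (f b))"
      unfolding gaussian_density_def by (intro prod.cong) auto
    then show ?thesis by (simp add: prod_ennreal)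
  qed
  have "emeasure std_gauss A = (\<integral>\<^sup>+x. ennreal (gaussian_density 1 x) * indicator A x \<partial>lborel)"
    unfolding std_gauss_def by (rule emeasure_density) auto
  also have "\<dots> = (\<integral>\<^sup>+f. ennreal (gaussian_density 1 (?h f)) * indicator A (?h f) \<partial>(\<Pi>\<^sub>M b\<in>(Basis::'a set). lborel))"
    by (subst lborel_eq, subst nn_integral_distr) auto
  also have "\<dots> = (\<integral>\<^sup>+f. indicator A (?h f) \<partial>?P)"
    unfolding PiM_std_normal gd by (subst nn_integral_density) (auto intro!: nn_integral_cong)
  also have "\<dots> = (\<integral>\<^sup>+x. indicator A x \<partial>distr ?P borel ?h)"
    by (subst nn_integral_distr) auto
  also have "\<dots> = emeasure (distr ?P borel ?h) A"
    by simp
  finally show "emeasure std_gauss A = emeasure (distr ?P borel ?h) A" .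
qed simp

lemma prob_space_std_gauss: "prob_space (std_gauss :: 'a::euclidean_space measure)"
proof -
  interpret N: prob_space std_normal_distribution
    by (rule prob_space_normal_density) simp
  interpret T: product_prob_space "\<lambda>_::'a. std_normal_distribution" "Basis" ..
  show ?thesis
    unfolding std_gauss_eq_PiM by (rule prob_space.prob_space_distr[OF T.prob_space_axioms]) measurable
qed

interpretation std_gauss: prob_space "std_gauss :: 'a::euclidean_space measure"
  by (rule prob_space_std_gauss)

text \<open>By Levy's uniqueness theorem it suffices to compare characteristic functions: over an
  orthonormal basis they multiply, and the exponents add up to the squared norm of
  \<open>v\<close>.\<close>

lemma distr_std_gauss_inner:
  fixes v :: "'a::euclidean_space"
  shows "distr std_gauss borel (\<lambda>x. v \<bullet> x) = distr std_normal_distribution borel (\<lambda>z. norm v * z)"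
proof (rule Levy_uniqueness)
  interpret N: real_distribution std_normal_distribution by (rule real_dist_normal_dist)
  interpret S: product_sigma_finite "\<lambda>_::'a. std_normal_distribution" ..
  show "real_distribution (distr std_gauss borel (\<lambda>x. v \<bullet> x))"
    by (intro std_gauss.real_distribution_distr) simp
  show "real_distribution (distr std_normal_distribution borel (\<lambda>z. norm v * z))"
    by (intro N.real_distribution_distr) simp
  show "char (distr std_gauss borel (\<lambda>x. v \<bullet> x)) = char (distr std_normal_distribution borel (\<lambda>z. norm v * z))"
  proof
    fix t
    have intg: "integrable std_normal_distribution (\<lambda>z. iexp (c * z))" for c :: real
      by (intro N.integrable_iexp) auto
    have ch: "(CLINT z|std_normal_distribution. iexp (c * z)) = exp (- (c\<^sup>2) / 2)" for c :: real
      using fun_cong[OF char_std_normal_distribution, of c] by (simp add: char_def)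
    have "char (distr std_gauss borel (\<lambda>x. v \<bullet> x)) t = (CLINT x|std_gauss. iexp (t * (v \<bullet> x)))"
      unfolding char_def by (rule integral_distr) auto
    also have "\<dots> = (CLINT f|(\<Pi>\<^sub>M b\<in>(Basis::'a set). std_normal_distribution). iexp (t * (v \<bullet> (\<Sum>b\<in>Basis. f b *\<^sub>R b))))"
      unfolding std_gauss_eq_PiM by (rule integral_distr) auto
    also have "\<dots> = (CLINT f|(\<Pi>\<^sub>M b\<in>(Basis::'a set). std_normal_distribution). \<Prod>b\<in>Basis. iexp ((t * (v \<bullet> b)) * f b))"
      by (simp add: inner_sum_right sum_distrib_left exp_sum[symmetric] mult_ac)
    also have "\<dots> = (\<Prod>b\<in>Basis. CLINT z|std_normal_distribution. iexp ((t * (v \<bullet> b)) * z))"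
      by (rule S.product_integral_prod) (use intg in \<open>simp_all del: of_real_mult\<close>)
    also have "\<dots> = (\<Prod>b\<in>Basis. of_real (exp (- ((t * (v \<bullet> b))\<^sup>2) / 2)))"
      by (simp only: ch)
    also have "\<dots> = of_real (exp (\<Sum>b\<in>Basis. - ((t * (v \<bullet> b))\<^sup>2) / 2))"
      by (simp add: exp_sum)
    also have "(\<Sum>b\<in>Basis. - ((t * (v \<bullet> b))\<^sup>2) / 2) = - ((t * norm v)\<^sup>2) / 2"
    proof -
      have "(\<Sum>b\<in>Basis. (v \<bullet> b)\<^sup>2) = (norm v)\<^sup>2"
        by (simp only: power2_norm_eq_inner euclidean_inner[of v v]) (simp add: power2_eq_square)
      then show ?thesis
        by (simp add: power_mult_distrib sum_distrib_left[symmetric] sum_negf sum_divide_distrib[symmetric])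
    qed
    also have "of_real (exp (- ((t * norm v)\<^sup>2) / 2)) = (CLINT z|std_normal_distribution. iexp ((t * norm v) * z))"
      by (simp only: ch)
    also have "\<dots> = char (distr std_normal_distribution borel (\<lambda>z. norm v * z)) t"
      unfolding char_def by (subst integral_distr) (auto simp: mult_ac)
    finally show "char (distr std_gauss borel (\<lambda>x. v \<bullet> x)) t = char (distr std_normal_distribution borel (\<lambda>z. norm v * z)) t" .
  qed
qed

text \<open>Variances of independent Gaussians add. The identity is exact, so trading an increment
  of a martingale for independent noise in \<open>heat_step\<close> produces no error term and calls
  for no Lindeberg condition.\<close>

lemma distr_gauss_add:
  fixes c :: "'a::euclidean_space" and r :: real
  assumes "(norm c)\<^sup>2 \<le> r"
  shows "distr (std_gauss \<Otimes>\<^sub>M std_normal_distribution) borel (\<lambda>(x, z). c \<bullet> x + sqrt (r - (norm c)\<^sup>2) * z)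
    = distr std_normal_distribution borel (\<lambda>z. sqrt r * z)" (is "distr ?P _ ?f = _")
proof (rule Levy_uniqueness)
  interpret N: real_distribution std_normal_distribution by (rule real_dist_normal_dist)
  interpret P: pair_prob_space "std_gauss :: 'a measure" std_normal_distribution ..
  show "real_distribution (distr ?P borel ?f)"
    by (intro P.real_distribution_distr) simp
  show "real_distribution (distr std_normal_distribution borel (\<lambda>z. sqrt r * z))"
    by (intro N.real_distribution_distr) simp
  show "char (distr ?P borel ?f) = char (distr std_normal_distribution borel (\<lambda>z. sqrt r * z))"
  proof
    fix t
    have ch: "(CLINT z|std_normal_distribution. iexp (c * z)) = exp (- (c\<^sup>2) / 2)" for c :: real
      using fun_cong[OF char_std_normal_distribution, of c] by (simp add: char_def)
    have ch2: "(CLINT x|std_gauss. iexp (t * (c \<bullet> x))) = exp (- ((t * norm c)\<^sup>2) / 2)"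
    proof -
      have "(CLINT x|std_gauss. iexp (t * (c \<bullet> x))) = (CLINT y|distr std_gauss borel (\<lambda>x. c \<bullet> x). iexp (t * y))"
        by (subst integral_distr) auto
      also have "\<dots> = (CLINT z|std_normal_distribution. iexp ((t * norm c) * z))"
        unfolding distr_std_gauss_inner by (subst integral_distr) (auto simp: mult_ac)
      finally show ?thesis by (simp only: ch)
    qed
    let ?s = "sqrt (r - (norm c)\<^sup>2)"
    have "char (distr ?P borel ?f) t = (CLINT w|?P. iexp (t * (c \<bullet> fst w + ?s * snd w)))"
      unfolding char_def by (subst integral_distr) (auto simp: split_beta)
    also have "\<dots> = (CLINT x|std_gauss. CLINT z|std_normal_distribution. iexp (t * (c \<bullet> x + ?s * z)))"
      by (subst P.integral_fst'[symmetric]) (auto intro!: P.integrable_iexp)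
    also have "\<dots> = (CLINT x|std_gauss. iexp (t * (c \<bullet> x)) * (CLINT z|std_normal_distribution. iexp ((t * ?s) * z)))"
      by (intro Bochner_Integration.integral_cong refl, subst integral_mult_right_zero[symmetric])
         (auto simp: exp_add[symmetric] algebra_simps intro!: Bochner_Integration.integral_cong)
    also have "\<dots> = exp (- ((t * norm c)\<^sup>2) / 2) * exp (- ((t * ?s)\<^sup>2) / 2)"
      by (simp only: integral_mult_left_zero of_real_mult[symmetric] ch ch2)
    also have "exp (- ((t * norm c)\<^sup>2) / 2) * exp (- ((t * ?s)\<^sup>2) / 2) = exp (- ((t * sqrt r)\<^sup>2) / 2)"
    proof -
      have "0 \<le> r" using assms by (meson order_trans zero_le_power2)
      then have "(t * norm c)\<^sup>2 + (t * ?s)\<^sup>2 = (t * sqrt r)\<^sup>2"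
        using assms by (simp add: power_mult_distrib algebra_simps)
      then show ?thesis by (simp add: exp_add[symmetric] add_divide_distrib[symmetric])
    qed
    also have "complex_of_real \<dots> = (CLINT z|std_normal_distribution. iexp ((t * sqrt r) * z))"
      by (simp only: ch)
    also have "\<dots> = char (distr std_normal_distribution borel (\<lambda>z. sqrt r * z)) t"
      unfolding char_def by (subst integral_distr) (auto simp: mult_ac)
    finally show "char (distr ?P borel ?f) t = char (distr std_normal_distribution borel (\<lambda>z. sqrt r * z)) t" .
  qed
qed

section \<open>Moments of Gaussian vectors\<close>

lemma integral_std_gauss_inner_fun:
  fixes f :: "real \<Rightarrow> 'b::{banach, second_countable_topology}" and v :: "'a::euclidean_space"
  assumes [measurable]: "f \<in> borel_measurable borel"
  shows "(\<integral>x. f (v \<bullet> x) \<partial>std_gauss) = (\<integral>z. f (norm v * z) \<partial>std_normal_distribution)"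
proof -
  have "(\<integral>x. f (v \<bullet> x) \<partial>std_gauss) = (\<integral>y. f y \<partial>distr std_gauss borel (\<lambda>x. v \<bullet> x))"
    by (rule integral_distr[symmetric]) auto
  then show ?thesis
    unfolding distr_std_gauss_inner by (simp add: integral_distr)
qed

lemma integrable_std_gauss_inner_power: "integrable std_gauss (\<lambda>x. (v \<bullet> x) ^ k)"
proof -
  have "integrable (distr std_gauss borel (\<lambda>x. v \<bullet> x)) (\<lambda>y. y ^ k)"
    unfolding distr_std_gauss_inner
    by (subst integrable_distr_eq)
       (auto simp: power_mult_distrib intro!: integrable_std_normal_distribution_moment)
  then show ?thesis
    by (subst (asm) integrable_distr_eq) auto
qed

lemma integral_std_gauss_inner [simp]: "(\<integral>x. v \<bullet> x \<partial>std_gauss) = 0"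
  using integral_std_gauss_inner_fun[of "\<lambda>y. y" v] integral_std_normal_distribution_moment_odd[of 1]
  by simp

lemma integral_std_gauss_inner_sq: "(\<integral>x. (v \<bullet> x)\<^sup>2 \<partial>std_gauss) = (norm v)\<^sup>2"
  using integral_std_gauss_inner_fun[of "\<lambda>y. y\<^sup>2" v] std_normal_distribution_even_moments(1)[of 1]
  by (simp add: power_mult_distrib)

lemma integrable_std_gauss_inner [simp]: "integrable std_gauss (\<lambda>x. v \<bullet> x)"
  using integrable_std_gauss_inner_power[of v 1] by simp

text \<open>Polarization reduces the mixed moment to two squares; the outcome says that the
  covariance of \<open>std_gauss\<close> is the identity.\<close>

lemma integrable_std_gauss_inner2: "integrable std_gauss (\<lambda>x. (v \<bullet> x) * (w \<bullet> x))"
  and integral_std_gauss_inner2: "(\<integral>x. (v \<bullet> x) * (w \<bullet> x) \<partial>std_gauss) = v \<bullet> w"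
proof -
  have eq: "(v \<bullet> x) * (w \<bullet> x) = (((v + w) \<bullet> x)\<^sup>2 - ((v - w) \<bullet> x)\<^sup>2) / 4" for x :: 'a
    by (simp add: inner_simps power2_eq_square algebra_simps)
  have i: "integrable std_gauss (\<lambda>x. (u \<bullet> x)\<^sup>2)" for u :: 'a
    using integrable_std_gauss_inner_power[of u 2] by simp
  show "integrable std_gauss (\<lambda>x. (v \<bullet> x) * (w \<bullet> x))"
    unfolding eq by (intro integrable_divide Bochner_Integration.integrable_diff i)
  have "(\<integral>x. (v \<bullet> x) * (w \<bullet> x) \<partial>std_gauss) = ((norm (v + w))\<^sup>2 - (norm (v - w))\<^sup>2) / 4"
    unfolding eq by (simp add: Bochner_Integration.integral_diff[OF i i] integral_std_gauss_inner_sq)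
  also have "\<dots> = v \<bullet> w"
    by (simp add: power2_norm_eq_inner inner_simps inner_commute)
  finally show "(\<integral>x. (v \<bullet> x) * (w \<bullet> x) \<partial>std_gauss) = v \<bullet> w" .
qed

lemma integrable_std_gauss_norm_power: "integrable std_gauss (\<lambda>x::'a::euclidean_space. norm x ^ k)"
proof (rule Bochner_Integration.integrable_bound)
  have "integrable std_gauss (\<lambda>x::'a. real DIM('a) ^ k * (\<Sum>b\<in>Basis. (1 + (b \<bullet> x) ^ (2 * k))))"
    by (intro integrable_mult_right Bochner_Integration.integrable_sum Bochner_Integration.integrable_add
        integrable_std_gauss_inner_power) auto
  then show "integrable std_gauss (\<lambda>x::'a. real DIM('a) ^ k * (\<Sum>b\<in>Basis. (1 + (b \<bullet> x) ^ (2 * k))))" .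
  show "AE x::'a in std_gauss. norm (norm x ^ k) \<le> norm (real DIM('a) ^ k * (\<Sum>b\<in>Basis. (1 + (b \<bullet> x) ^ (2 * k))))"
  proof (rule AE_I2)
    fix x :: 'a
    \<comment> \<open>The largest coordinate: the norm is at most the dimension times
      \<open>m\<close>, and a power of \<open>m\<close> is at most one plus its square, which is an
      even power of a single coordinate.\<close>
    define m where "m = Max ((\<lambda>b. \<bar>x \<bullet> b\<bar>) ` Basis)"
    have "m \<in> (\<lambda>b. \<bar>x \<bullet> b\<bar>) ` Basis" unfolding m_def by (rule Max_in) auto
    then obtain b where b: "b \<in> Basis" "m = \<bar>x \<bullet> b\<bar>" by auto
    have le: "\<bar>x \<bullet> c\<bar> \<le> m" if "c \<in> Basis" for c unfolding m_def using that by (intro Max_ge) auto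
    have "norm x \<le> (\<Sum>c\<in>Basis. \<bar>x \<bullet> c\<bar>)" by (rule norm_le_l1)
    also have "\<dots> \<le> (\<Sum>c\<in>(Basis::'a set). m)" by (rule sum_mono) (rule le)
    finally have "norm x \<le> real DIM('a) * m" by simp
    then have "norm x ^ k \<le> (real DIM('a) * m) ^ k" by (rule power_mono) simp
    also have "\<dots> = real DIM('a) ^ k * m ^ k" by (simp add: power_mult_distrib)
    also have "\<dots> \<le> real DIM('a) ^ k * (\<Sum>b\<in>Basis. (1 + (b \<bullet> x) ^ (2 * k)))"
    proof (rule mult_left_mono)
      have "m ^ k \<le> 1 + (m ^ k)\<^sup>2"
        using sum_squares_bound[of 1 "m ^ k"] zero_le_power[OF order_trans[OF abs_ge_zero le[OF b(1)]], of k]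
        unfolding one_power2 mult_1_right by linarith
      also have "(m ^ k)\<^sup>2 = (b \<bullet> x) ^ (2 * k)"
        by (simp add: b power_even_abs inner_commute power_mult[symmetric] mult.commute)
      also have "1 + (b \<bullet> x) ^ (2 * k) \<le> (\<Sum>b\<in>Basis. (1 + (b \<bullet> x) ^ (2 * k)))"
        using b by (intro member_le_sum) (auto simp: zero_le_even_power)
      finally show "m ^ k \<le> (\<Sum>b\<in>Basis. (1 + (b \<bullet> x) ^ (2 * k)))" .
    qed simp
    finally show "norm (norm x ^ k) \<le> norm (real DIM('a) ^ k * (\<Sum>b\<in>Basis. (1 + (b \<bullet> x) ^ (2 * k))))"
      by simp
  qed
qed simp

lemma integrable_std_gauss_poly: "integrable std_gauss (\<lambda>x::'a::euclidean_space. (1 + norm x) ^ k)"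
proof -
  have "(1 + norm x) ^ k = (\<Sum>i\<le>k. real (k choose i) * norm x ^ (k - i))" for x :: 'a
    by (simp add: binomial_ring)
  then show ?thesis
    by (simp add: integrable_std_gauss_norm_power)
qed

section \<open>Translations and dilations of Gaussian vectors\<close>

lemma gaussian_density_shift:
  "gaussian_density 1 (x - u) = gaussian_density 1 x * exp (u \<bullet> x - (norm u)\<^sup>2 / 2)"
proof -
  have 1: "std_normal_density ((x - u) \<bullet> b) =
      std_normal_density (x \<bullet> b) * exp ((u \<bullet> b) * (x \<bullet> b) - (u \<bullet> b)\<^sup>2 / 2)" for b
  proof -
    have "- ((x - u) \<bullet> b)\<^sup>2 / 2 = - (x \<bullet> b)\<^sup>2 / 2 + ((u \<bullet> b) * (x \<bullet> b) - (u \<bullet> b)\<^sup>2 / 2)"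
      by (simp add: inner_diff_left power2_eq_square field_simps)
    then show ?thesis
      unfolding std_normal_density_def by (simp only: exp_add mult.assoc)
  qed
  have 2: "(\<Sum>b\<in>Basis. (u \<bullet> b)\<^sup>2) = (norm u)\<^sup>2"
    by (simp only: power2_norm_eq_inner euclidean_inner[of u u]) (simp add: power2_eq_square)
  have 3: "(\<Sum>b\<in>Basis. (u \<bullet> b) * (x \<bullet> b) - (u \<bullet> b)\<^sup>2 / 2) = u \<bullet> x - (norm u)\<^sup>2 / 2"
    unfolding 2[symmetric] by (simp add: sum_subtractf sum_divide_distrib euclidean_inner[of u x])
  show ?thesis
    unfolding gaussian_density_def 3[symmetric] by (simp add: 1 prod.distrib exp_sum)
qed

text \<open>The Cameron-Martin formula, here in the role of a one-step Girsanov transformation: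
  shifting the noise by \<open>u\<close> costs the exponential weight.\<close>

lemma integral_std_gauss_shift:
  fixes f :: "'a::euclidean_space \<Rightarrow> real"
  assumes [measurable]: "f \<in> borel_measurable borel"
  shows "(\<integral>x. f (x + u) \<partial>std_gauss) = (\<integral>x. f x * exp (u \<bullet> x - (norm u)\<^sup>2 / 2) \<partial>std_gauss)"
proof -
  have "(\<integral>x. f (x + u) \<partial>std_gauss) = (\<integral>x. gaussian_density 1 x * f (x + u) \<partial>lborel)"
    unfolding std_gauss_def by (subst integral_density) auto
  also have "\<dots> = (\<integral>x. gaussian_density 1 (x - u) * f x \<partial>distr lborel borel ((+) u))"
    by (subst integral_distr) (auto simp: add.commute)
  also have "\<dots> = (\<integral>x. gaussian_density 1 x * (f x * exp (u \<bullet> x - (norm u)\<^sup>2 / 2)) \<partial>lborel)"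
    unfolding lborel_distr_plus gaussian_density_shift by (simp add: mult_ac)
  also have "\<dots> = (\<integral>x. f x * exp (u \<bullet> x - (norm u)\<^sup>2 / 2) \<partial>std_gauss)"
    unfolding std_gauss_def by (subst integral_density) auto
  finally show ?thesis .
qed

lemma has_bochner_integral_std_gauss_exp:
  fixes u :: "'a::euclidean_space"
  shows "has_bochner_integral std_gauss (\<lambda>x. exp (u \<bullet> x)) (exp ((norm u)\<^sup>2 / 2))"
proof -
  have 1: "(\<integral>x. exp (u \<bullet> x - (norm u)\<^sup>2 / 2) \<partial>std_gauss) = 1"
    using integral_std_gauss_shift[of "\<lambda>_. 1" u] by (simp add: std_gauss.prob_space[simplified])
  \<comment> \<open>A non-integrable function has Bochner integral 0, so the value 1 already proves
    integrability.\<close>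
  then have i: "integrable std_gauss (\<lambda>x. exp (u \<bullet> x - (norm u)\<^sup>2 / 2))"
    using not_integrable_integral_eq by fastforce
  have eq: "exp (u \<bullet> x) = exp ((norm u)\<^sup>2 / 2) * exp (u \<bullet> x - (norm u)\<^sup>2 / 2)" for x
    by (simp add: exp_add[symmetric])
  show ?thesis
    unfolding has_bochner_integral_iff eq by (simp add: i 1)
qed

text \<open>Normalizes the Brownian increment over a step of length \<open>v\<close> to unit noise.
  The factor \<open>sqrt v ^ DIM('a)\<close> in the proof is the Jacobian of the dilation.\<close>

lemma distributed_gaussian_scale:
  fixes X :: "'w \<Rightarrow> 'a::euclidean_space"
  assumes X: "distributed M lborel X (gaussian_density v)" and v: "0 < v"
  shows "distr M borel (\<lambda>w. (1 / sqrt v) *\<^sub>R X w) = std_gauss"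
proof (rule measure_eqI)
  fix A :: "'a set" assume "A \<in> sets (distr M borel (\<lambda>w. (1 / sqrt v) *\<^sub>R X w))"
  then have A[measurable]: "A \<in> sets borel" by simp
  have Xm[measurable]: "X \<in> measurable M borel"
    using distributed_measurable[OF X] by simp
  have d: "distr M lborel X = density lborel (\<lambda>x. ennreal (gaussian_density v x))"
    using distributed_distr_eq_density[OF X] .
  have gd: "gaussian_density v (sqrt v *\<^sub>R x) * sqrt v ^ DIM('a) = gaussian_density 1 x" for x :: 'a
  proof -
    have "normal_density 0 (sqrt v) (sqrt v * c) * sqrt v = normal_density 0 1 c" for c
      using v by (simp add: normal_density_def power_mult_distrib real_sqrt_mult)
    then have "(\<Prod>b\<in>(Basis::'a set). normal_density 0 (sqrt v) (sqrt v * (x \<bullet> b)) * sqrt v) = gaussian_density 1 x"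
      unfolding gaussian_density_def by (intro prod.cong) auto
    then show ?thesis unfolding gaussian_density_def by (simp add: prod.distrib)
  qed
  have "emeasure (distr M borel (\<lambda>w. (1 / sqrt v) *\<^sub>R X w)) A =
      (\<integral>\<^sup>+w. indicator A ((1 / sqrt v) *\<^sub>R X w) \<partial>M)"
    by (subst nn_integral_indicator[symmetric], simp, subst nn_integral_distr) auto
  also have "\<dots> = (\<integral>\<^sup>+x. indicator A ((1 / sqrt v) *\<^sub>R x) \<partial>distr M lborel X)"
    by (subst nn_integral_distr) auto
  also have "\<dots> = (\<integral>\<^sup>+x. ennreal (gaussian_density v x) * indicator A ((1 / sqrt v) *\<^sub>R x) \<partial>lborel)"
    unfolding d by (subst nn_integral_density) auto
  also have "\<dots> = (\<integral>\<^sup>+x. ennreal (gaussian_density v x) * indicator A ((1 / sqrt v) *\<^sub>R x)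
      \<partial>density (distr lborel borel (\<lambda>x. 0 + sqrt v *\<^sub>R x)) (\<lambda>_. ennreal (\<bar>sqrt v\<bar> ^ DIM('a))))"
    using v by (subst lborel_affine[of "sqrt v" 0]) auto
  also have "\<dots> = (\<integral>\<^sup>+x. ennreal (gaussian_density v (sqrt v *\<^sub>R x) * sqrt v ^ DIM('a)) * indicator A x \<partial>lborel)"
    using v by (simp add: nn_integral_density nn_integral_distr ennreal_mult mult_ac)
  also have "\<dots> = emeasure std_gauss A"
    unfolding gd std_gauss_def by (subst emeasure_density) auto
  finally show "emeasure (distr M borel (\<lambda>w. (1 / sqrt v) *\<^sub>R X w)) A = emeasure std_gauss A" .
qed simp

lemma distributed_gaussian_1:
  assumes "distributed M lborel X (gaussian_density 1)"
  shows "distr M borel X = std_gauss"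
  using distributed_gaussian_scale[OF assms] by simp

text \<open>The integral of \<open>(f x - t * g x)\<^sup>2\<close> is a nonnegative polynomial of
  degree at most two in \<open>t\<close>; its discriminant gives the inequality.\<close>

lemma Cauchy_Schwarz_integral:
  fixes f g :: "'b \<Rightarrow> real"
  assumes [measurable]: "f \<in> borel_measurable M" "g \<in> borel_measurable M"
    and f: "integrable M (\<lambda>x. (f x)\<^sup>2)" and g: "integrable M (\<lambda>x. (g x)\<^sup>2)"
  shows "integrable M (\<lambda>x. f x * g x)"
    and "(\<integral>x. f x * g x \<partial>M)\<^sup>2 \<le> (\<integral>x. (f x)\<^sup>2 \<partial>M) * (\<integral>x. (g x)\<^sup>2 \<partial>M)"
proof -
  show fg: "integrable M (\<lambda>x. f x * g x)"
  proof (rule Bochner_Integration.integrable_bound)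
    show "integrable M (\<lambda>x. (f x)\<^sup>2 + (g x)\<^sup>2)" using f g by simp
    show "AE x in M. norm (f x * g x) \<le> norm ((f x)\<^sup>2 + (g x)\<^sup>2)"
    proof (rule AE_I2)
      fix x
      have "2 * \<bar>f x\<bar> * \<bar>g x\<bar> \<le> (f x)\<^sup>2 + (g x)\<^sup>2"
        using sum_squares_bound[of "\<bar>f x\<bar>" "\<bar>g x\<bar>"] by simp
      moreover have "0 \<le> \<bar>f x\<bar> * \<bar>g x\<bar>" by simp
      ultimately have "\<bar>f x\<bar> * \<bar>g x\<bar> \<le> (f x)\<^sup>2 + (g x)\<^sup>2" by linarith
      then show "norm (f x * g x) \<le> norm ((f x)\<^sup>2 + (g x)\<^sup>2)"
        by (simp add: abs_mult)
    qed
  qed measurable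
  let ?A = "\<integral>x. (f x)\<^sup>2 \<partial>M" and ?B = "\<integral>x. f x * g x \<partial>M" and ?C = "\<integral>x. (g x)\<^sup>2 \<partial>M"
  have quad: "0 \<le> ?A - 2 * t * ?B + t\<^sup>2 * ?C" for t
  proof -
    have "0 \<le> (\<integral>x. (f x - t * g x)\<^sup>2 \<partial>M)" by simp
    also have "(\<lambda>x. (f x - t * g x)\<^sup>2) = (\<lambda>x. (f x)\<^sup>2 - 2 * t * (f x * g x) + t\<^sup>2 * (g x)\<^sup>2)"
      by (auto simp: power2_eq_square algebra_simps)
    also have "(\<integral>x. (f x)\<^sup>2 - 2 * t * (f x * g x) + t\<^sup>2 * (g x)\<^sup>2 \<partial>M) = ?A - 2 * t * ?B + t\<^sup>2 * ?C"
      using f g fg by simp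
    finally show ?thesis .
  qed
  show "?B\<^sup>2 \<le> ?A * ?C"
  proof (cases "?C = 0")
    case True
    have "?B = 0"
    proof (rule ccontr)
      assume "?B \<noteq> 0"
      \<comment> \<open>With vanishing quadratic term the chosen \<open>t\<close> makes the
        polynomial equal to -1.\<close>
      then show False using quad[of "(?A + 1) / (2 * ?B)"] True by simp
    qed
    then show ?thesis using True by simp
  next
    case False
    moreover have "0 \<le> ?C" by simp
    ultimately have C: "0 < ?C" by linarith
    have "0 \<le> ?A - ?B\<^sup>2 / ?C"
      using quad[of "?B / ?C"] C by (simp add: power2_eq_square field_simps)
    then show ?thesis using C by (simp add: field_simps)
  qed
qed

section \<open>The noise filtration and the law of the chain\<close>

lemma borel_measurable_matrix_vector_mult [measurable]:
  fixes A :: "real^'n^'m" and f :: "'b \<Rightarrow> real^'n"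
  assumes [measurable]: "f \<in> borel_measurable M"
  shows "(\<lambda>x. A *v f x) \<in> borel_measurable M"
proof -
  have "continuous_on UNIV ((*v) A)"
    by (intro linear_continuous_on linear_linear[THEN iffD2] matrix_vector_mul_linear)
  then have "(*v) A \<in> borel_measurable borel" by (rule borel_measurable_continuous_onI)
  from measurable_compose[OF assms this] show ?thesis .
qed

lemma measurable_mono_sets:
  assumes "sets A \<subseteq> sets B" "space A = space B" "f \<in> measurable A S"
  shows "f \<in> measurable B S"
  using assms unfolding measurable_def by auto

text \<open>Independence is expressed as a product law so that Fubini's theorem can stand in for
  conditional expectations. Preimages under \<open>Z\<close> are preimages under the family indexed
  by \<open>I\<close>, which reduces the claim to independence of two disjoint groups of
  variables.\<close>

lemma (in prob_space) distr_pair_indep_next: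
  assumes ind: "indep_vars M' X (insert k I)" and k: "k \<notin> I"
    and Z: "Z \<in> measurable (vimage_algebra (space M) (\<lambda>w. \<lambda>i\<in>I. X i w) (PiM I M')) S"
  shows "distr M (S \<Otimes>\<^sub>M M' k) (\<lambda>w. (Z w, X k w)) = distr M S Z \<Otimes>\<^sub>M distr M (M' k) (X k)"
proof -
  let ?R = "\<lambda>w. \<lambda>i\<in>I. X i w" and ?P = "PiM I M'"
  have rv: "X i \<in> measurable M (M' i)" if "i \<in> insert k I" for i
    using ind that by (auto simp: indep_vars_def)
  have R: "?R \<in> measurable M ?P" by (intro measurable_restrict rv) auto
  have Xk: "X k \<in> measurable M (M' k)" by (intro rv) auto
  have sub: "sets (vimage_algebra (space M) ?R ?P) \<subseteq> sets M"
    by (rule sets_image_in_sets[OF refl R])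
  have ZM: "Z \<in> measurable M S"
    by (rule measurable_mono_sets[OF sub _ Z]) simp
  have iv: "indep_var ?P ?R (PiM {k} M') (\<lambda>w. \<lambda>i\<in>{k}. X i w)"
    using k by (intro indep_var_restrict[OF ind]) auto
  have "distr M S Z \<Otimes>\<^sub>M distr M (M' k) (X k) = distr M (S \<Otimes>\<^sub>M M' k) (\<lambda>w. (Z w, X k w))"
  proof (rule pair_measure_eqI)
    show "sigma_finite_measure (distr M S Z)"
      using prob_space_distr[OF ZM] by (simp add: prob_space_imp_sigma_finite)
    show "sigma_finite_measure (distr M (M' k) (X k))"
      using prob_space_distr[OF Xk] by (simp add: prob_space_imp_sigma_finite)
    fix A B assume A: "A \<in> sets (distr M S Z)" and B: "B \<in> sets (distr M (M' k) (X k))"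
    have "Z -` A \<inter> space M \<in> sets (vimage_algebra (space M) ?R ?P)"
      using measurable_sets[OF Z, of A] A by simp
    then obtain A' where A': "A' \<in> sets ?P" "Z -` A \<inter> space M = ?R -` A' \<inter> space M"
      by (subst (asm) sets_vimage_algebra2) (use measurable_space[OF R] in auto)
    define B' where "B' = (\<lambda>f. f k) -` B \<inter> space (PiM {k} M')"
    have B'm: "B' \<in> sets (PiM {k} M')"
      unfolding B'_def using B by (intro measurable_sets[OF measurable_component_singleton]) auto
    have B': "(\<lambda>i\<in>{k}. X i w) \<in> B' \<longleftrightarrow> X k w \<in> B" if "w \<in> space M" for w
      using measurable_space[OF Xk that] by (auto simp: B'_def space_PiM PiE_def)
    have "emeasure (distr M (S \<Otimes>\<^sub>M M' k) (\<lambda>w. (Z w, X k w))) (A \<times> B)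
        = emeasure M ((\<lambda>w. (Z w, X k w)) -` (A \<times> B) \<inter> space M)"
      using A B ZM Xk by (intro emeasure_distr) auto
    also have "(\<lambda>w. (Z w, X k w)) -` (A \<times> B) \<inter> space M = (\<lambda>w. (?R w, \<lambda>i\<in>{k}. X i w)) -` (A' \<times> B') \<inter> space M"
      using A'(2) B' by auto
    also have "emeasure M \<dots> = emeasure M (?R -` A' \<inter> space M) * emeasure M ((\<lambda>w. \<lambda>i\<in>{k}. X i w) -` B' \<inter> space M)"
      using indep_varD[OF iv A'(1), of B'] B'm by (simp add: emeasure_eq_measure ennreal_mult)
    also have "(\<lambda>w. \<lambda>i\<in>{k}. X i w) -` B' \<inter> space M = X k -` B \<inter> space M"
      using B' by auto
    also have "emeasure M (?R -` A' \<inter> space M) * emeasure M (X k -` B \<inter> space M) = emeasure (distr M S Z) A * emeasure (distr M (M' k) (X k)) B"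
      using A B ZM Xk A'(2) by (simp add: emeasure_distr)
    finally show "emeasure (distr M S Z) A * emeasure (distr M (M' k) (X k)) B
        = emeasure (distr M (S \<Otimes>\<^sub>M M' k) (\<lambda>w. (Z w, X k w))) (A \<times> B)" ..
  qed simp
  then show ?thesis ..
qed

locale gauss_seq = prob_space N for N :: "'v measure" +
  fixes \<xi> :: "nat \<Rightarrow> 'v \<Rightarrow> real^'n"
  assumes indep: "indep_vars (\<lambda>_. borel) \<xi> {1..}"
    and law: "\<And>k. k \<ge> 1 \<Longrightarrow> distr N borel (\<xi> k) = std_gauss"

lemma iid_std_gaussian_imp_gauss_seq:
  assumes "iid_std_gaussian N \<xi>"
  shows "gauss_seq N \<xi>"
proof -
  interpret prob_space N using assms by (simp add: iid_std_gaussian_def)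
  show ?thesis
    using assms by unfold_locales (auto simp: iid_std_gaussian_def intro: distributed_gaussian_1)
qed

context gauss_seq
begin

text \<open>The filtration of the noise as a pull-back along the tuple of the first \<open>k\<close>
  variables, the form in which \<open>distr_pair_indep_next\<close> applies. \<open>F 0\<close> is
  trivial.\<close>

definition F :: "nat \<Rightarrow> 'v measure" where
  "F k = vimage_algebra (space N) (\<lambda>w. \<lambda>i\<in>{1..k}. \<xi> i w) (\<Pi>\<^sub>M i\<in>{1..k}. borel)"

lemma rv: "k \<ge> 1 \<Longrightarrow> \<xi> k \<in> borel_measurable N"
  using indep by (auto simp: indep_vars_def)

lemma rv_Suc [measurable]: "\<xi> (Suc k) \<in> borel_measurable N"
  by (rule rv) simp

lemma space_F [simp]: "space (F k) = space N"
  by (simp add: F_def)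

lemma F_rv:
  assumes "1 \<le> i" "i \<le> k"
  shows "\<xi> i \<in> borel_measurable (F k)"
proof -
  have "(\<lambda>w. \<lambda>i\<in>{1..k}. \<xi> i w) \<in> measurable (F k) (\<Pi>\<^sub>M i\<in>{1..k}. borel)"
    unfolding F_def by (rule measurable_vimage_algebra1) (auto simp: space_PiM)
  from measurable_compose[OF this measurable_component_singleton[of i]] assms
  show ?thesis by simp
qed

lemma sets_F_le: "sets (F k) \<subseteq> sets N"
  unfolding F_def by (intro sets_image_in_sets refl measurable_restrict rv) simp

lemma sets_F_mono: assumes "k \<le> l" shows "sets (F k) \<subseteq> sets (F l)"
proof -
  have "(\<lambda>w. \<lambda>i\<in>{1..k}. \<xi> i w) \<in> measurable (F l) (\<Pi>\<^sub>M i\<in>{1..k}. borel)"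
    using assms by (intro measurable_restrict F_rv) auto
  then show ?thesis
    unfolding F_def[of k] by (intro sets_image_in_sets) auto
qed

lemma measurable_F_N: "f \<in> measurable (F k) S \<Longrightarrow> f \<in> measurable N S"
  by (rule measurable_mono_sets[OF sets_F_le]) simp

lemma measurable_F_mono: "f \<in> measurable (F k) S \<Longrightarrow> k \<le> l \<Longrightarrow> f \<in> measurable (F l) S"
  by (rule measurable_mono_sets[OF sets_F_mono]) simp_all

lemma distr_next:
  assumes "Z \<in> measurable (F k) S"
  shows "distr N (S \<Otimes>\<^sub>M borel) (\<lambda>w. (Z w, \<xi> (Suc k) w)) = distr N S Z \<Otimes>\<^sub>M std_gauss"
proof -
  have "indep_vars (\<lambda>_. borel) \<xi> (insert (Suc k) {1..k})"
    by (rule indep_vars_subset[OF indep]) auto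
  from distr_pair_indep_next[OF this _ assms[unfolded F_def]] show ?thesis
    by (simp add: law)
qed

text \<open>Integrating out the next noise variable with the past frozen replaces conditioning on
  \<open>F k\<close>. The nonnegative version has no integrability premise and is the one that
  establishes integrability; \<open>integral_next\<close> then evaluates.\<close>

lemma nn_integral_next:
  assumes Z: "Z \<in> measurable (F k) S" and f[measurable]: "f \<in> borel_measurable (S \<Otimes>\<^sub>M borel)"
  shows "(\<integral>\<^sup>+w. f (Z w, \<xi> (Suc k) w) \<partial>N) = (\<integral>\<^sup>+w. (\<integral>\<^sup>+z. f (Z w, z) \<partial>std_gauss) \<partial>N)"
proof -
  note [measurable] = measurable_F_N[OF Z]
  have "(\<integral>\<^sup>+w. f (Z w, \<xi> (Suc k) w) \<partial>N) = (\<integral>\<^sup>+p. f p \<partial>distr N (S \<Otimes>\<^sub>M borel) (\<lambda>w. (Z w, \<xi> (Suc k) w)))"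
    by (subst nn_integral_distr) auto
  also have "\<dots> = (\<integral>\<^sup>+x. (\<integral>\<^sup>+z. f (x, z) \<partial>std_gauss) \<partial>distr N S Z)"
    unfolding distr_next[OF Z]
    by (subst std_gauss.nn_integral_fst[symmetric]) (auto cong: measurable_cong_sets)
  also have "\<dots> = (\<integral>\<^sup>+w. (\<integral>\<^sup>+z. f (Z w, z) \<partial>std_gauss) \<partial>N)"
    by (subst nn_integral_distr) (auto cong: measurable_cong_sets)
  finally show ?thesis .
qed

lemma integral_next:
  fixes f :: "_ \<Rightarrow> real"
  assumes Z: "Z \<in> measurable (F k) S" and f[measurable]: "f \<in> borel_measurable (S \<Otimes>\<^sub>M borel)"
    and int: "integrable N (\<lambda>w. f (Z w, \<xi> (Suc k) w))"
  shows "integrable N (\<lambda>w. \<integral>z. f (Z w, z) \<partial>std_gauss)"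
    and "(\<integral>w. f (Z w, \<xi> (Suc k) w) \<partial>N) = (\<integral>w. (\<integral>z. f (Z w, z) \<partial>std_gauss) \<partial>N)"
proof -
  note [measurable] = measurable_F_N[OF Z]
  interpret D: prob_space "distr N S Z" by (rule prob_space_distr) measurable
  interpret P: pair_sigma_finite "distr N S Z" "std_gauss :: (real^'n) measure" ..
  have i: "integrable (distr N S Z \<Otimes>\<^sub>M std_gauss) f"
    unfolding distr_next[OF Z, symmetric] using int by (subst integrable_distr_eq) auto
  have "integrable (distr N S Z) (\<lambda>x. \<integral>z. f (x, z) \<partial>std_gauss)"
    by (rule P.integrable_fst'[OF i])
  then show "integrable N (\<lambda>w. \<integral>z. f (Z w, z) \<partial>std_gauss)"
    by (subst (asm) integrable_distr_eq) (auto cong: measurable_cong_sets)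
  have "(\<integral>w. f (Z w, \<xi> (Suc k) w) \<partial>N) = (\<integral>p. f p \<partial>distr N (S \<Otimes>\<^sub>M borel) (\<lambda>w. (Z w, \<xi> (Suc k) w)))"
    by (subst integral_distr) auto
  also have "\<dots> = (\<integral>x. (\<integral>z. f (x, z) \<partial>std_gauss) \<partial>distr N S Z)"
    unfolding distr_next[OF Z] by (rule P.integral_fst'[OF i, symmetric])
  also have "\<dots> = (\<integral>w. (\<integral>z. f (Z w, z) \<partial>std_gauss) \<partial>N)"
    by (subst integral_distr) (auto cong: measurable_cong_sets)
  finally show "(\<integral>w. f (Z w, \<xi> (Suc k) w) \<partial>N) = (\<integral>w. (\<integral>z. f (Z w, z) \<partial>std_gauss) \<partial>N)" .
qed

lemma integrable_F_bounded:
  fixes f :: "'v \<Rightarrow> real"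
  assumes "f \<in> borel_measurable N" "\<And>w. \<bar>f w\<bar> \<le> B"
  shows "integrable N f"
  using assms by (intro integrable_const_bound[where B=B]) auto

end

section \<open>Transition operators and the Markov property of the chain\<close>

definition em_step :: "(real^'n \<Rightarrow> real^'n) \<Rightarrow> real^'n^'n \<Rightarrow> real \<Rightarrow> real^'n \<Rightarrow> real^'n \<Rightarrow> real^'n" where
  "em_step b \<sigma> e x z = x + e *\<^sub>R b x + sqrt e *\<^sub>R (\<sigma> *v z)"

lemma em_chain_Suc: "em_chain b \<sigma> \<eta> x \<xi> (Suc k) w = em_step b \<sigma> (\<eta> (Suc k)) (em_chain b \<sigma> \<eta> x \<xi> k w) (\<xi> (Suc k) w)"
  by (simp add: em_step_def)

lemma measurable_em_step [measurable]:
  assumes [measurable]: "b \<in> borel_measurable borel" "f \<in> borel_measurable M" "g \<in> borel_measurable M"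
  shows "(\<lambda>w. em_step b \<sigma> e (f w) (g w)) \<in> borel_measurable M"
  unfolding em_step_def by measurable

text \<open>The step sequence seen by the chain after \<open>i\<close> steps. Restarting an
  inhomogeneous chain changes its steps, so the Markov property below reads
  \<open>Q (shift \<eta> i)\<close>.\<close>

definition shift :: "(nat \<Rightarrow> real) \<Rightarrow> nat \<Rightarrow> nat \<Rightarrow> real" where
  "shift \<eta> i = (\<lambda>k. \<eta> (i + k))"

lemma shift_0 [simp]: "shift \<eta> 0 = \<eta>"
  and shift_shift [simp]: "shift (shift \<eta> i) j = shift \<eta> (i + j)"
  by (simp_all add: shift_def add.assoc)

definition em_op :: "(real^'n \<Rightarrow> real^'n) \<Rightarrow> real^'n^'n \<Rightarrow> real \<Rightarrow> (real^'n \<Rightarrow> real) \<Rightarrow> real^'n \<Rightarrow> real" where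
  "em_op b \<sigma> e f x = (\<integral>z. f (em_step b \<sigma> e x z) \<partial>std_gauss)"

lemma measurable_em_op [measurable]:
  assumes [measurable]: "b \<in> borel_measurable borel" "f \<in> borel_measurable borel"
  shows "em_op b \<sigma> e f \<in> borel_measurable borel"
  unfolding em_op_def by measurable

text \<open>Holds for arbitrary \<open>f\<close>, measurable or not: the integral of a
  non-integrable function is 0, and \<open>0 \<le> B\<close>.\<close>

lemma integral_prob_bounded:
  fixes f :: "'b \<Rightarrow> real"
  assumes "prob_space M" "\<And>x. \<bar>f x\<bar> \<le> B"
  shows "\<bar>\<integral>x. f x \<partial>M\<bar> \<le> B"
proof -
  interpret prob_space M by fact
  have B: "0 \<le> B" using assms(2)[of undefined] by linarith
  show ?thesis
  proof (cases "integrable M f")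
    case True
    have "\<bar>\<integral>x. f x \<partial>M\<bar> \<le> (\<integral>x. \<bar>f x\<bar> \<partial>M)" by (rule integral_abs_bound)
    also have "\<dots> \<le> B" using True assms(2) by (intro integral_le_const) auto
    finally show ?thesis .
  qed (simp add: not_integrable_integral_eq B)
qed

locale em_law = gauss_seq N \<xi> for N :: "'v measure" and \<xi> :: "nat \<Rightarrow> 'v \<Rightarrow> real^'n" +
  fixes b :: "real^'n \<Rightarrow> real^'n" and \<sigma> :: "real^'n^'n"
  assumes b_meas [measurable]: "b \<in> borel_measurable borel"
begin

abbreviation chain :: "(nat \<Rightarrow> real) \<Rightarrow> real^'n \<Rightarrow> nat \<Rightarrow> 'v \<Rightarrow> real^'n" where
  "chain \<eta> x \<equiv> em_chain b \<sigma> \<eta> x \<xi>"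

text \<open>The transition operator of the inhomogeneous chain over its first \<open>m\<close>
  steps.\<close>

definition Q :: "(nat \<Rightarrow> real) \<Rightarrow> nat \<Rightarrow> (real^'n \<Rightarrow> real) \<Rightarrow> real^'n \<Rightarrow> real" where
  "Q \<eta> m f x = (\<integral>w. f (chain \<eta> x m w) \<partial>N)"

lemma chain_F: "chain \<eta> x k \<in> borel_measurable (F k)"
proof (induction k)
  case (Suc k)
  note [measurable] = measurable_F_mono[OF Suc le_SucI[OF order_refl]] F_rv[of "Suc k" "Suc k", simplified]
  show ?case unfolding em_chain_Suc by measurable
qed (simp add: em_chain.simps(1)[abs_def])

lemma chain_F_le: "k \<le> l \<Longrightarrow> chain \<eta> x k \<in> borel_measurable (F l)"
  by (rule measurable_F_mono[OF chain_F])

lemma chain_N [measurable]: "chain \<eta> x k \<in> borel_measurable N"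
  by (rule measurable_F_N[OF chain_F])

lemma chain_pair [measurable]: "(\<lambda>(x, w). chain \<eta> x k w) \<in> borel_measurable (borel \<Otimes>\<^sub>M N)"
proof (induction k)
  case 0
  show ?case by (simp add: em_chain.simps(1)[abs_def])
next
  case (Suc k)
  note Suc[measurable]
  show ?case unfolding em_chain_Suc by measurable
qed

lemma Q_meas [measurable]:
  assumes [measurable]: "f \<in> borel_measurable borel"
  shows "Q \<eta> m f \<in> borel_measurable borel"
  unfolding Q_def by measurable

lemma Q_0 [simp]: "Q \<eta> 0 f = f"
  by (simp add: Q_def fun_eq_iff prob_space)

lemma Q_bound: "(\<And>x. \<bar>f x\<bar> \<le> B) \<Longrightarrow> \<bar>Q \<eta> m f x\<bar> \<le> B"
  unfolding Q_def by (rule integral_prob_bounded[OF prob_space_axioms]) auto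

lemma em_op_bound: "(\<And>x. \<bar>f x\<bar> \<le> B) \<Longrightarrow> \<bar>em_op b \<sigma> e f x\<bar> \<le> B"
  unfolding em_op_def by (rule integral_prob_bounded[OF prob_space_std_gauss]) auto

lemma integral_chain_step:
  assumes Z: "Z \<in> borel_measurable (F k)" and ZB: "\<And>w. \<bar>Z w\<bar> \<le> B"
    and f[measurable]: "f \<in> borel_measurable borel" and fB: "\<And>x. \<bar>f x\<bar> \<le> C"
  shows "(\<integral>w. Z w * f (chain \<eta> x (Suc k) w) \<partial>N) = (\<integral>w. Z w * em_op b \<sigma> (\<eta> (Suc k)) f (chain \<eta> x k w) \<partial>N)"
proof -
  note [measurable] = Z chain_F measurable_F_N[OF Z]
  let ?g = "\<lambda>p. fst (fst p) * f (em_step b \<sigma> (\<eta> (Suc k)) (snd (fst p)) (snd p))"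
  have Zp: "(\<lambda>w. (Z w, chain \<eta> x k w)) \<in> measurable (F k) (borel \<Otimes>\<^sub>M borel)" by measurable
  have g: "?g \<in> borel_measurable ((borel \<Otimes>\<^sub>M borel) \<Otimes>\<^sub>M borel)" by measurable
  have "\<bar>Z w * f y\<bar> \<le> B * C" for w y
    using mult_mono[OF ZB[of w] fB[of y]] order_trans[OF abs_ge_zero ZB] by (simp add: abs_mult)
  then have "integrable N (\<lambda>w. ?g ((Z w, chain \<eta> x k w), \<xi> (Suc k) w))"
    by (intro integrable_F_bounded[where B="B * C"]) (auto, measurable)
  from integral_next(2)[OF Zp g this] show ?thesis
    unfolding em_chain_Suc em_op_def by simp
qed

lemma Q_Suc:
  assumes [measurable]: "f \<in> borel_measurable borel" and fB: "\<And>x. \<bar>f x\<bar> \<le> C"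
  shows "Q \<eta> (Suc m) f x = Q \<eta> m (em_op b \<sigma> (\<eta> (Suc m)) f) x"
  using integral_chain_step[where Z="\<lambda>_. 1" and k=m and B=1 and f=f and C=C and \<eta>=\<eta> and x=x] assms unfolding Q_def by simp

text \<open>The Markov property at time \<open>i\<close>, tested against bounded
  \<open>F i\<close>-measurable \<open>Z\<close>. The induction removes the last step of the chain,
  where \<open>Q_Suc\<close> can absorb it as an operator acting on \<open>f\<close>.\<close>

lemma tower:
  assumes Z: "Z \<in> borel_measurable (F i)" and ZB: "\<And>w. \<bar>Z w\<bar> \<le> B"
    and f: "f \<in> borel_measurable borel" and fB: "\<And>x. \<bar>f x\<bar> \<le> C"
  shows "(\<integral>w. Z w * f (chain \<eta> x (i + m) w) \<partial>N) = (\<integral>w. Z w * Q (shift \<eta> i) m f (chain \<eta> x i w) \<partial>N)"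
  using f fB
proof (induction m arbitrary: f)
  case (Suc m)
  note [measurable] = Suc.prems(1)
  have "(\<integral>w. Z w * f (chain \<eta> x (i + Suc m) w) \<partial>N)
      = (\<integral>w. Z w * em_op b \<sigma> (\<eta> (i + Suc m)) f (chain \<eta> x (i + m) w) \<partial>N)"
    using integral_chain_step[OF measurable_F_mono[OF Z, of "i + m"] ZB Suc.prems] by simp
  also have "\<dots> = (\<integral>w. Z w * Q (shift \<eta> i) m (em_op b \<sigma> (\<eta> (i + Suc m)) f) (chain \<eta> x i w) \<partial>N)"
    by (rule Suc.IH) (auto intro: em_op_bound Suc.prems)
  also have "\<dots> = (\<integral>w. Z w * Q (shift \<eta> i) (Suc m) f (chain \<eta> x i w) \<partial>N)"
    using Q_Suc[OF Suc.prems, of "shift \<eta> i" m] by (simp add: shift_def)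
  finally show ?case .
qed simp

lemma Q_add:
  assumes "f \<in> borel_measurable borel" "\<And>x. \<bar>f x\<bar> \<le> C"
  shows "Q \<eta> (i + m) f x = Q \<eta> i (Q (shift \<eta> i) m f) x"
  using tower[where Z="\<lambda>_. 1" and i=i and B=1 and f=f and C=C and \<eta>=\<eta> and x=x and m=m] assms unfolding Q_def[of \<eta>] by simp

lemma Q_1: "f \<in> borel_measurable borel \<Longrightarrow> (\<And>x. \<bar>f x\<bar> \<le> C) \<Longrightarrow> Q \<eta> 1 f x = em_op b \<sigma> (\<eta> 1) f x"
  using Q_Suc[of f C \<eta> 0 x] by simp

lemma integral_Q_chain:
  assumes "f \<in> borel_measurable borel" "\<And>x. \<bar>f x\<bar> \<le> C"
  shows "(\<integral>w. Q (shift \<eta> i) m f (chain \<eta> x i w) \<partial>N) = (\<integral>w. f (chain \<eta> x (i + m) w) \<partial>N)"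
  using Q_add[OF assms, of \<eta> i m x] unfolding Q_def[of \<eta>] by simp

end

text \<open>\<open>Q\<close> depends on the law of the noise only. This is used to move the chain to
  the space of the Brownian motion, where it can be compared pathwise with the diffusion.\<close>

lemma Q_cong_space:
  assumes "em_law N \<xi> b" "em_law M \<zeta> b" and f: "f \<in> borel_measurable borel" "\<And>x. \<bar>f x\<bar> \<le> C"
  shows "em_law.Q N \<xi> b \<sigma> \<eta> m f x = em_law.Q M \<zeta> b \<sigma> \<eta> m f x"
proof -
  interpret N: em_law N \<xi> b \<sigma> by fact
  interpret M: em_law M \<zeta> b \<sigma> by fact
  show ?thesis using f
  proof (induction m arbitrary: f)
    case (Suc m)
    note [measurable] = Suc.prems(1)
    show ?case
      by (subst N.Q_Suc[OF Suc.prems], subst M.Q_Suc[OF Suc.prems], rule Suc.IH)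
         (auto intro: N.em_op_bound Suc.prems)
  qed simp
qed

section \<open>Lyapunov function and Harnack inequality\<close>

text \<open>The linear term is kept exactly, since its Gaussian mean will be of the order of the
  step; only the quadratic rest is estimated, by a polynomial so that it has Gaussian
  moments.\<close>

lemma Bernoulli_upper_second_order:
  fixes d :: real
  assumes "0 \<le> 1 + d"
  shows "(1 + d) ^ p \<le> 1 + real p * d + (real p)\<^sup>2 * d\<^sup>2 * (1 + \<bar>d\<bar>) ^ p"
proof (induction p)
  case (Suc p)
  have "(1 + d) ^ Suc p \<le> (1 + d) * (1 + real p * d + (real p)\<^sup>2 * d\<^sup>2 * (1 + \<bar>d\<bar>) ^ p)"
    using Suc assms by (simp add: mult_left_mono)
  also have "\<dots> = 1 + real (Suc p) * d + real p * d\<^sup>2 + (real p)\<^sup>2 * d\<^sup>2 * ((1 + d) * (1 + \<bar>d\<bar>) ^ p)"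
    by (simp add: algebra_simps power2_eq_square)
  also have "\<dots> \<le> 1 + real (Suc p) * d + real p * d\<^sup>2 * (1 + \<bar>d\<bar>) ^ Suc p + (real p)\<^sup>2 * d\<^sup>2 * (1 + \<bar>d\<bar>) ^ Suc p"
  proof -
    have "real p * d\<^sup>2 * 1 \<le> real p * d\<^sup>2 * (1 + \<bar>d\<bar>) ^ Suc p"
      by (intro mult_left_mono one_le_power) auto
    moreover have "(real p)\<^sup>2 * d\<^sup>2 * ((1 + d) * (1 + \<bar>d\<bar>) ^ p) \<le> (real p)\<^sup>2 * d\<^sup>2 * (1 + \<bar>d\<bar>) ^ Suc p"
      by (auto intro!: mult_left_mono mult_right_mono)
    ultimately show ?thesis by linarith
  qed
  also have "\<dots> \<le> 1 + real (Suc p) * d + (real (Suc p))\<^sup>2 * d\<^sup>2 * (1 + \<bar>d\<bar>) ^ Suc p"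
  proof -
    have "(real p + (real p)\<^sup>2) * (d\<^sup>2 * (1 + \<bar>d\<bar>) ^ Suc p) \<le> (real (Suc p))\<^sup>2 * (d\<^sup>2 * (1 + \<bar>d\<bar>) ^ Suc p)"
    proof (rule mult_right_mono)
      show "real p + (real p)\<^sup>2 \<le> (real (Suc p))\<^sup>2" by (simp add: power2_eq_square algebra_simps)
    qed simp
    then show ?thesis by (simp add: algebra_simps)
  qed
  finally show ?case .
qed simp

text \<open>\<open>A\<close> is the Lyapunov function at the noise-free Euler point,
  \<open>D\<close> the effect of the noise, \<open>s\<close> the square root of the step. The
  relative change D/A is at most s G / sqrt A, so the quadratic term loses one power of
  \<open>A\<close> and becomes a lower-order perturbation.\<close>

lemma power_add_le_second_order:
  fixes A D s G :: real
  assumes A: "1 \<le> A" and D: "\<bar>D\<bar> \<le> s * sqrt A * G" and s: "0 \<le> s" "s \<le> 1" and G: "0 \<le> G"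
    and AD: "0 \<le> A + D"
  shows "(A + D) ^ Suc p \<le> A ^ Suc p + real (Suc p) * A ^ p * D
      + s\<^sup>2 * A ^ p * ((real (Suc p))\<^sup>2 * G\<^sup>2 * (1 + G) ^ Suc p)"
proof -
  define d where "d = D / A"
  have A0: "0 < A" using A by simp
  have sA: "1 \<le> sqrt A" "sqrt A \<le> A" using A by (auto simp: real_le_lsqrt power2_eq_square)
  have d1: "\<bar>d\<bar> * sqrt A \<le> s * G"
  proof -
    have "\<bar>d\<bar> * A \<le> s * sqrt A * G" using D A0 by (simp add: d_def)
    then have "(\<bar>d\<bar> * sqrt A) * sqrt A \<le> (s * G) * sqrt A" using A0 by (simp add: mult_ac)
    then show ?thesis using sA by (simp add: mult_le_cancel_right)
  qed
  have dG: "\<bar>d\<bar> \<le> G"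
  proof -
    have "\<bar>d\<bar> * 1 \<le> \<bar>d\<bar> * sqrt A" using sA by (intro mult_left_mono) auto
    also have "\<dots> \<le> s * G" by (rule d1)
    also have "\<dots> \<le> 1 * G" using s G by (intro mult_right_mono) auto
    finally show ?thesis by simp
  qed
  have d2: "d\<^sup>2 * A \<le> s\<^sup>2 * G\<^sup>2"
  proof -
    have "(\<bar>d\<bar> * sqrt A)\<^sup>2 \<le> (s * G)\<^sup>2" using d1 A0 by (intro power_mono) auto
    then show ?thesis using A0 by (simp add: power_mult_distrib)
  qed
  have D': "D = A * d" using A0 by (simp add: d_def)
  have "0 \<le> A * (1 + d)" using AD by (simp add: D' algebra_simps)
  then have d0: "0 \<le> 1 + d" using A0 by (simp add: zero_le_mult_iff)
  have "(A + D) ^ Suc p = A ^ Suc p * (1 + d) ^ Suc p"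
    by (simp add: D' power_mult_distrib[symmetric] algebra_simps)
  also have "\<dots> \<le> A ^ Suc p * (1 + real (Suc p) * d + (real (Suc p))\<^sup>2 * d\<^sup>2 * (1 + \<bar>d\<bar>) ^ Suc p)"
    using A0 by (intro mult_left_mono Bernoulli_upper_second_order d0) auto
  also have "\<dots> = A ^ Suc p + real (Suc p) * A ^ p * D + A ^ p * ((real (Suc p))\<^sup>2 * (d\<^sup>2 * A) * (1 + \<bar>d\<bar>) ^ Suc p)"
    unfolding D' by (simp add: algebra_simps)
  also have "\<dots> \<le> A ^ Suc p + real (Suc p) * A ^ p * D + A ^ p * ((real (Suc p))\<^sup>2 * (s\<^sup>2 * G\<^sup>2) * (1 + G) ^ Suc p)"
  proof -
    have 1: "(1 + \<bar>d\<bar>) ^ Suc p \<le> (1 + G) ^ Suc p" using dG by (intro power_mono) auto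
    have 2: "(real (Suc p))\<^sup>2 * (d\<^sup>2 * A) \<le> (real (Suc p))\<^sup>2 * (s\<^sup>2 * G\<^sup>2)"
      using d2 by (intro mult_left_mono) auto
    have "(real (Suc p))\<^sup>2 * (d\<^sup>2 * A) * (1 + \<bar>d\<bar>) ^ Suc p \<le> (real (Suc p))\<^sup>2 * (s\<^sup>2 * G\<^sup>2) * (1 + G) ^ Suc p"
      by (rule mult_mono[OF 2 1]) auto
    from mult_left_mono[OF this, of "A ^ p"] A0 show ?thesis by simp
  qed
  finally show ?thesis by (simp add: mult_ac)
qed

lemma power_diff_le:
  fixes a b :: real
  assumes "0 \<le> b" "b \<le> a"
  shows "a ^ Suc p - b ^ Suc p \<le> real (Suc p) * a ^ p * (a - b)"
proof (induction p)
  case (Suc p)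
  have bp: "b ^ Suc p \<le> a ^ Suc p" using assms by (intro power_mono)
  have "a ^ Suc (Suc p) - b ^ Suc (Suc p) = a * (a ^ Suc p - b ^ Suc p) + (a - b) * b ^ Suc p"
    by (simp add: algebra_simps)
  also have "\<dots> \<le> a * (real (Suc p) * a ^ p * (a - b)) + (a - b) * a ^ Suc p"
    using Suc assms bp by (intro add_mono mult_left_mono) auto
  also have "\<dots> = real (Suc (Suc p)) * a ^ Suc p * (a - b)"
    by (simp add: algebra_simps)
  finally show ?case .
qed simp

text \<open>For large \<open>V\<close> both perturbations together use up half of the contraction;
  for \<open>V\<close> below the threshold everything is bounded and goes into the constant
  \<open>C\<close>.\<close>

lemma drift_power:
  fixes c C0 C1 :: real
  assumes c: "0 < c" and C0: "0 \<le> C0" and C1: "0 \<le> C1"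
  shows "\<exists>C\<ge>0. \<forall>A V e. 0 \<le> A \<and> 1 \<le> V \<and> 0 \<le> e \<and> e \<le> 1 \<and> c * e \<le> 1 \<and>
      A \<le> (1 - c * e) * V + C0 * e \<longrightarrow>
      A ^ Suc p + C1 * e * A ^ p \<le> (1 - c * e / 2) * V ^ Suc p + C * e"
proof -
  \<comment> \<open>The threshold beyond which \<open>C0\<close> and \<open>C1\<close> are each at
    most a quarter of \<open>c * V\<close>.\<close>
  define R where "R = 1 + 4 * C0 / c + 4 * C1 / c"
  define R' where "R' = R + C0"
  define C where "C = real (Suc p) * R' ^ p * C0 + C1 * R' ^ p + c / 2 * R ^ Suc p"
  have R: "1 \<le> R" "1 \<le> R'" using assms by (auto simp: R_def R'_def)
  have C: "0 \<le> C" using assms R by (simp add: C_def)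
  have "A ^ Suc p + C1 * e * A ^ p \<le> (1 - c * e / 2) * V ^ Suc p + C * e"
    if A: "0 \<le> A" and V: "1 \<le> V" and e: "0 \<le> e" "e \<le> 1" "c * e \<le> 1" and le: "A \<le> (1 - c * e) * V + C0 * e"
    for A V e :: real
  proof (cases "R \<le> V")
    case True
    have "4 * C0 / c \<le> V" "4 * C1 / c \<le> V" using True assms by (auto simp: R_def intro: order_trans[rotated])
    then have C0V: "C0 \<le> c * V / 4" and C1V: "C1 \<le> c * V / 4" using c by (auto simp: field_simps)
    have "C0 * e \<le> c * V / 4 * e" using C0V e by (intro mult_right_mono)
    then have A1: "A \<le> (1 - 3 * (c * e) / 4) * V" using le by (simp add: algebra_simps)
    have ce: "0 \<le> c * e" using c e by simp
    have "(1 - 3 * (c * e) / 4) * V \<le> 1 * V" using V ce by (intro mult_right_mono) auto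
    then have A2: "A \<le> V" using A1 by simp
    have Ap: "A ^ p \<le> V ^ p" using A A2 by (intro power_mono)
    have V0: "0 \<le> V ^ p" using V by simp
    have "A ^ Suc p \<le> (1 - 3 * (c * e) / 4) * V * V ^ p"
      unfolding power_Suc using A1 A Ap V e(3) by (intro mult_mono) auto
    moreover have "C1 * e * A ^ p \<le> (c * V / 4) * e * V ^ p"
      using C1V e C1 Ap A V c by (intro mult_mono) auto
    ultimately have "A ^ Suc p + C1 * e * A ^ p \<le> (1 - c * e / 2) * V ^ Suc p"
      by (simp add: algebra_simps)
    also have "\<dots> \<le> (1 - c * e / 2) * V ^ Suc p + C * e" using \<open>0 \<le> C\<close> e by simp
    finally show ?thesis .
  next
    case False
    have AV: "A \<le> V + C0 * e"
    proof -
      have "(1 - c * e) * V \<le> 1 * V" using V c e by (intro mult_right_mono) auto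
      then show ?thesis using le by simp
    qed
    have "C0 * e \<le> C0 * 1" using C0 e by (intro mult_left_mono)
    then have AR: "A \<le> R'" using AV False by (simp add: R'_def)
    have Ap: "A ^ p \<le> R' ^ p" using A AR by (intro power_mono)
    have 1: "A ^ Suc p \<le> V ^ Suc p + real (Suc p) * R' ^ p * C0 * e"
    proof (cases "V \<le> A")
      case True
      have "A ^ Suc p - V ^ Suc p \<le> real (Suc p) * A ^ p * (A - V)" using V True by (intro power_diff_le) auto
      also have "\<dots> \<le> real (Suc p) * R' ^ p * (C0 * e)" using Ap AV True A R by (intro mult_mono) auto
      finally show ?thesis by simp
    next
      case False
      then have "A ^ Suc p \<le> V ^ Suc p" using A by (intro power_mono) auto
      moreover have "0 \<le> real (Suc p) * R' ^ p * C0 * e" using R C0 e by simp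
      ultimately show ?thesis by linarith
    qed
    have 2: "C1 * e * A ^ p \<le> C1 * e * R' ^ p" using Ap C1 e by (intro mult_left_mono) auto
    have 3: "c * e / 2 * V ^ Suc p \<le> c * e / 2 * R ^ Suc p"
      using False V c e by (intro mult_left_mono power_mono) auto
    have "A ^ Suc p + C1 * e * A ^ p \<le> V ^ Suc p + real (Suc p) * R' ^ p * C0 * e + C1 * e * R' ^ p
        + (c * e / 2 * R ^ Suc p - c * e / 2 * V ^ Suc p)"
      using 1 2 3 by linarith
    also have "\<dots> = (1 - c * e / 2) * V ^ Suc p + C * e"
      unfolding C_def by (simp add: algebra_simps)
    finally show ?thesis .
  qed
  with C show ?thesis by blast
qed

text \<open>K/s is the cost of steering across a unit distance in time s at constant speed. After a
  step of length e the fraction s'/s of the distance is left; the cost of that step and of the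
  remaining journey add up to K/s again.\<close>

lemma bridge_cost_telescope:
  fixes s :: real
  assumes "0 < s'" "0 < e" and s: "s = e + s'"
  shows "K / s' * (s' / s)\<^sup>2 + K * e * (1 / s\<^sup>2) = K / s"
proof -
  have s0: "0 < s" using assms by simp
  have "K / s' * (s' / s)\<^sup>2 = K * s' / s\<^sup>2" using assms(1) by (simp add: power2_eq_square)
  then have "K / s' * (s' / s)\<^sup>2 + K * e * (1 / s\<^sup>2) = K * (s' + e) / s\<^sup>2"
    by (simp add: add_divide_distrib distrib_left)
  also have "s' + e = s" using s by simp
  finally show ?thesis using s0 by (simp add: power2_eq_square)
qed

lemma mult_le_trans_left:
  fixes a :: real
  shows "a \<le> c * q \<Longrightarrow> c \<le> d \<Longrightarrow> 0 \<le> q \<Longrightarrow> a \<le> d * q"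
  by (meson mult_right_mono order_trans)

section \<open>Lyapunov drift and moments of the chain\<close>

definition V :: "'a::real_normed_vector \<Rightarrow> real" where
  "V x = 1 + (norm x)\<^sup>2"

lemma V_ge_1 [simp]: "1 \<le> V x" and V_pos [simp]: "0 < V x" and V_nonneg [simp]: "0 \<le> V x"
  by (simp_all add: V_def add_pos_nonneg)

lemma measurable_V [measurable]: "f \<in> borel_measurable M \<Longrightarrow> (\<lambda>x. V (f x :: 'a::euclidean_space)) \<in> borel_measurable M"
  unfolding V_def by measurable

text \<open>\<open>es\<close> bounds the admissible steps, \<open>\<kappa>\<close> bounds the effect
  of the noise, and \<open>\<kappa>'\<close> the price in noise of a displacement:
  \<open>\<sigma>i\<close> is a right inverse of \<open>\<sigma>\<close>.\<close>

locale em_sys = em_law N \<xi> b \<sigma> for N :: "'v measure" and \<xi> :: "nat \<Rightarrow> 'v \<Rightarrow> real^'n" and b and \<sigma> +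
  fixes L :: real and \<kappa> :: real and \<kappa>' :: real and \<sigma>i :: "real^'n^'n" and c0 :: real and C0 :: real and es :: real
  assumes L0: "0 \<le> L" and Lip: "\<And>x y. norm (b x - b y) \<le> L * norm (x - y)"
    and \<kappa>0: "0 \<le> \<kappa>" and \<kappa>: "\<And>z. norm (\<sigma> *v z) \<le> \<kappa> * norm z"
    and \<kappa>'0: "0 \<le> \<kappa>'" and \<kappa>': "\<And>z. norm (\<sigma>i *v z) \<le> \<kappa>' * norm z"
    and \<sigma>i: "\<And>z. \<sigma> *v (\<sigma>i *v z) = z"
    and c0: "0 < c0" and C0: "0 \<le> C0" and es: "0 < es" "es \<le> 1" "c0 * es \<le> 1"
    and drift: "\<And>x e. 0 < e \<Longrightarrow> e \<le> es \<Longrightarrow> V (x + e *\<^sub>R b x) \<le> (1 - c0 * e) * V x + C0 * e"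
begin

definition good :: "(nat \<Rightarrow> real) \<Rightarrow> bool" where
  "good \<eta> \<longleftrightarrow> (\<forall>k\<ge>1. 0 < \<eta> k \<and> \<eta> k \<le> es)"

lemma good_shift: "good \<eta> \<Longrightarrow> good (shift \<eta> i)"
  by (auto simp: good_def shift_def)

lemma goodD: "good \<eta> \<Longrightarrow> 0 < \<eta> (Suc k)" "good \<eta> \<Longrightarrow> \<eta> (Suc k) \<le> es" "good \<eta> \<Longrightarrow> \<eta> (Suc k) \<le> 1"
  using es unfolding good_def by (auto intro: order_trans)

definition lyap_const :: "nat \<Rightarrow> real \<Rightarrow> bool" where
  "lyap_const p C \<longleftrightarrow> 0 \<le> C \<and> (\<forall>e x. 0 < e \<and> e \<le> es \<longrightarrow>
     integrable std_gauss (\<lambda>z. V (em_step b \<sigma> e x z) ^ Suc p) \<and>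
     (\<integral>z. V (em_step b \<sigma> e x z) ^ Suc p \<partial>std_gauss) \<le> (1 - c0 * e / 2) * V x ^ Suc p + C * e)"

lemma lyap_constD:
  assumes "lyap_const p C"
  shows "0 \<le> C" "0 < e \<Longrightarrow> e \<le> es \<Longrightarrow> integrable std_gauss (\<lambda>z. V (em_step b \<sigma> e x z) ^ Suc p)"
    "0 < e \<Longrightarrow> e \<le> es \<Longrightarrow>
       (\<integral>z. V (em_step b \<sigma> e x z) ^ Suc p \<partial>std_gauss) \<le> (1 - c0 * e / 2) * V x ^ Suc p + C * e"
  using assms unfolding lyap_const_def by blast+

text \<open>Around the noise-free Euler point the function changes by \<open>D\<close>, whose linear
  part in the noise has mean zero and whose quadratic part is of the order of the step. The
  second-order expansion of the power then leads to the left-hand side of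
  \<open>drift_power\<close>, with all noise moments collected in \<open>C1\<close>.\<close>

lemma lyap_const_exists: "\<exists>C. lyap_const p C"
proof -
  \<comment> \<open>From the cross term and the square in the expansion of the norm: both are
    dominated by multiples of \<open>(1 + norm z)\<^sup>2\<close>.\<close>
  define g where "g = 2 * \<kappa> + \<kappa>\<^sup>2"
  define G where "G z = g * (1 + norm z)\<^sup>2" for z :: "real^'n"
  define H where "H z = (real (Suc p))\<^sup>2 * (G z)\<^sup>2 * (1 + G z) ^ Suc p" for z :: "real^'n"
  have g0: "0 \<le> g" using \<kappa>0 by (simp add: g_def)
  have G0: "0 \<le> G z" for z using g0 by (simp add: G_def)
  have H0: "0 \<le> H z" for z using G0 by (simp add: H_def)
  have Hm[measurable]: "H \<in> borel_measurable borel" unfolding H_def G_def by measurable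
  have Hint: "integrable std_gauss H"
  proof (rule Bochner_Integration.integrable_bound)
    show "integrable std_gauss (\<lambda>z::real^'n. (real (Suc p))\<^sup>2 * g\<^sup>2 * (1 + g) ^ Suc p * (1 + norm z) ^ (4 + 2 * Suc p))"
      by (intro integrable_mult_right integrable_std_gauss_poly)
    show "AE z in std_gauss. norm (H z) \<le> norm ((real (Suc p))\<^sup>2 * g\<^sup>2 * (1 + g) ^ Suc p * (1 + norm z) ^ (4 + 2 * Suc p))"
    proof (rule AE_I2)
      fix z :: "real^'n"
      have n1: "1 \<le> (1 + norm z)\<^sup>2" by (rule one_le_power) simp
      have "1 + G z \<le> (1 + g) * (1 + norm z)\<^sup>2" unfolding G_def using n1 by (simp add: algebra_simps)
      then have "(1 + G z) ^ Suc p \<le> ((1 + g) * (1 + norm z)\<^sup>2) ^ Suc p" using G0 by (intro power_mono) auto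
      also have "\<dots> = (1 + g) ^ Suc p * (1 + norm z) ^ (2 * Suc p)"
        by (simp only: power_mult_distrib power_mult)
      finally have 1: "(1 + G z) ^ Suc p \<le> (1 + g) ^ Suc p * (1 + norm z) ^ (2 * Suc p)" .
      have "H z \<le> (real (Suc p))\<^sup>2 * (G z)\<^sup>2 * ((1 + g) ^ Suc p * (1 + norm z) ^ (2 * Suc p))"
        unfolding H_def by (rule mult_left_mono[OF 1]) simp
      also have "(G z)\<^sup>2 = g\<^sup>2 * (1 + norm z) ^ 4"
        by (simp add: G_def power_mult_distrib flip: power_mult)
      finally have "H z \<le> (real (Suc p))\<^sup>2 * g\<^sup>2 * (1 + g) ^ Suc p * (1 + norm z) ^ (4 + 2 * Suc p)"
        by (simp only: power_add) (simp add: mult_ac)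
      then show "norm (H z) \<le> norm ((real (Suc p))\<^sup>2 * g\<^sup>2 * (1 + g) ^ Suc p * (1 + norm z) ^ (4 + 2 * Suc p))"
        using H0[of z] by (metis abs_of_nonneg order_trans real_norm_def)
    qed
  qed measurable
  define M2 where "M2 = (\<integral>z. (norm (z::real^'n))\<^sup>2 \<partial>std_gauss)"
  define C1 where "C1 = real (Suc p) * \<kappa>\<^sup>2 * M2 + (\<integral>z. H z \<partial>std_gauss)"
  have C10: "0 \<le> C1" using H0 by (auto simp: C1_def M2_def intro!: add_nonneg_nonneg mult_nonneg_nonneg Bochner_Integration.integral_nonneg)
  obtain C where C: "0 \<le> C" and Cdrift: "\<forall>A V e. 0 \<le> A \<and> 1 \<le> V \<and> 0 \<le> e \<and> e \<le> 1 \<and> c0 * e \<le> 1 \<and>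
      A \<le> (1 - c0 * e) * V + C0 * e \<longrightarrow> A ^ Suc p + C1 * e * A ^ p \<le> (1 - c0 * e / 2) * V ^ Suc p + C * e"
    using drift_power[OF c0 C0 C10, of p] by blast
  {
    fix e :: real and x :: "real^'n" assume e: "0 < e" "e \<le> es"
    then have e1: "e \<le> 1" using es by simp
    define y where "y = x + e *\<^sub>R b x"
    define A where "A = V y"
    define D where "D z = 2 * sqrt e * (y \<bullet> (\<sigma> *v z)) + e * (norm (\<sigma> *v z))\<^sup>2" for z
    have step: "V (em_step b \<sigma> e x z) = A + D z" for z
      unfolding em_step_def V_def A_def D_def y_def[symmetric] using e
      by (simp add: power2_norm_eq_inner inner_simps inner_commute power2_eq_square[of "sqrt e"])
    have Dm[measurable]: "D \<in> borel_measurable borel" unfolding D_def by measurable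
    have A1: "1 \<le> A" by (simp add: A_def)
    have Db: "\<bar>D z\<bar> \<le> sqrt e * sqrt A * G z" for z
    proof -
      have yA: "norm y \<le> sqrt A" unfolding A_def V_def by (rule real_le_rsqrt) simp
      have sA: "1 \<le> sqrt A" using A1 by simp
      have se: "e \<le> sqrt e" using e e1 by (intro real_le_rsqrt) (simp add: power2_eq_square mult_left_le_one_le)
      have "\<bar>y \<bullet> (\<sigma> *v z)\<bar> \<le> norm y * norm (\<sigma> *v z)" by (rule Cauchy_Schwarz_ineq2)
      also have "\<dots> \<le> sqrt A * (\<kappa> * norm z)" using yA \<kappa>[of z] A1 by (intro mult_mono) auto
      finally have 1: "\<bar>2 * sqrt e * (y \<bullet> (\<sigma> *v z))\<bar> \<le> 2 * sqrt e * (sqrt A * (\<kappa> * norm z))"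
        using e by (simp add: abs_mult)
      have "e * (norm (\<sigma> *v z))\<^sup>2 \<le> (sqrt e * sqrt A) * (\<kappa> * norm z)\<^sup>2"
      proof (rule mult_mono)
        have "e * 1 \<le> sqrt e * sqrt A" using se sA e by (intro mult_mono) auto
        then show "e \<le> sqrt e * sqrt A" by simp
        show "(norm (\<sigma> *v z))\<^sup>2 \<le> (\<kappa> * norm z)\<^sup>2" using \<kappa> by (intro power_mono) auto
      qed (use e A1 in auto)
      then have 2: "\<bar>e * (norm (\<sigma> *v z))\<^sup>2\<bar> \<le> (sqrt e * sqrt A) * (\<kappa>\<^sup>2 * (norm z)\<^sup>2)"
        using e by (simp add: power_mult_distrib)
      have "\<bar>D z\<bar> \<le> (sqrt e * sqrt A) * (2 * \<kappa> * norm z + \<kappa>\<^sup>2 * (norm z)\<^sup>2)"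
        using 1 2 unfolding D_def by (simp add: algebra_simps)
      also have "\<dots> \<le> (sqrt e * sqrt A) * G z"
      proof (rule mult_left_mono)
        have "2 * \<kappa> * norm z \<le> 2 * \<kappa> * (1 + norm z)\<^sup>2" using \<kappa>0
          by (intro mult_left_mono) (auto simp: power2_eq_square algebra_simps)
        moreover have "\<kappa>\<^sup>2 * (norm z)\<^sup>2 \<le> \<kappa>\<^sup>2 * (1 + norm z)\<^sup>2" by (intro mult_left_mono power_mono) auto
        ultimately show "2 * \<kappa> * norm z + \<kappa>\<^sup>2 * (norm z)\<^sup>2 \<le> G z"
          unfolding G_def g_def by (simp add: algebra_simps)
      qed (use e A1 in auto)
      finally show ?thesis by simp
    qed
    have ub: "V (em_step b \<sigma> e x z) ^ Suc p \<le> A ^ Suc p + real (Suc p) * A ^ p * D z + e * A ^ p * H z" for z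
    proof -
      have "0 \<le> A + D z" unfolding step[symmetric] by simp
      from power_add_le_second_order[OF A1 Db _ _ G0 this, of p] show ?thesis
        unfolding step H_def using e e1 by simp
    qed
    have iN: "integrable std_gauss (\<lambda>z. (norm (\<sigma> *v z))\<^sup>2)"
    proof (rule Bochner_Integration.integrable_bound)
      show "integrable std_gauss (\<lambda>z::real^'n. \<kappa>\<^sup>2 * norm z ^ 2)"
        by (intro integrable_mult_right integrable_std_gauss_norm_power)
      show "AE z in std_gauss. norm ((norm (\<sigma> *v z))\<^sup>2) \<le> norm (\<kappa>\<^sup>2 * norm z ^ 2)"
        using power_mono[OF \<kappa> norm_ge_zero, where n=2] by (simp add: power_mult_distrib)
    qed measurable
    have N2: "(\<integral>z. (norm (\<sigma> *v z))\<^sup>2 \<partial>std_gauss) \<le> \<kappa>\<^sup>2 * M2"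
      unfolding M2_def integral_mult_right_zero[symmetric]
      using power_mono[OF \<kappa> norm_ge_zero, where n=2]
      by (intro integral_mono iN integrable_mult_right integrable_std_gauss_norm_power) (simp add: power_mult_distrib)
    have inner_eq: "y \<bullet> (\<sigma> *v z) = (transpose \<sigma> *v y) \<bullet> z" for z
      by (simp add: dot_lmul_matrix matrix_transpose_mul transpose_matrix_vector)
    have iy: "integrable std_gauss (\<lambda>z. y \<bullet> (\<sigma> *v z))" unfolding inner_eq by simp
    have iD: "integrable std_gauss D" unfolding D_def
      by (intro Bochner_Integration.integrable_add integrable_mult_right iy iN)
    have "(\<integral>z. D z \<partial>std_gauss) = 2 * sqrt e * (\<integral>z. y \<bullet> (\<sigma> *v z) \<partial>std_gauss) + e * (\<integral>z. (norm (\<sigma> *v z))\<^sup>2 \<partial>std_gauss)"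
      unfolding D_def by (subst Bochner_Integration.integral_add) (auto intro: integrable_mult_right iy iN)
    also have "(\<integral>z. y \<bullet> (\<sigma> *v z) \<partial>std_gauss) = 0" unfolding inner_eq by (rule integral_std_gauss_inner)
    finally have D2: "(\<integral>z. D z \<partial>std_gauss) \<le> e * (\<kappa>\<^sup>2 * M2)" using N2 e by simp
    have iub: "integrable std_gauss (\<lambda>z. A ^ Suc p + real (Suc p) * A ^ p * D z + e * A ^ p * H z)"
      by (intro Bochner_Integration.integrable_add integrable_mult_right iD Hint) simp
    have iV: "integrable std_gauss (\<lambda>z. V (em_step b \<sigma> e x z) ^ Suc p)"
    proof (rule Bochner_Integration.integrable_bound[OF iub])
      show "AE z in std_gauss. norm (V (em_step b \<sigma> e x z) ^ Suc p) \<le> norm (A ^ Suc p + real (Suc p) * A ^ p * D z + e * A ^ p * H z)"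
      proof (rule AE_I2)
        fix z
        show "norm (V (em_step b \<sigma> e x z) ^ Suc p) \<le> norm (A ^ Suc p + real (Suc p) * A ^ p * D z + e * A ^ p * H z)"
          using order_trans[OF ub[of z] abs_ge_self] by (simp only: real_norm_def abs_of_nonneg[OF zero_le_power[OF V_nonneg]])
      qed
    qed measurable
    then have "(\<integral>z. V (em_step b \<sigma> e x z) ^ Suc p \<partial>std_gauss) \<le> (\<integral>z. A ^ Suc p + real (Suc p) * A ^ p * D z + e * A ^ p * H z \<partial>std_gauss)"
      by (intro integral_mono iub ub)
    also have "\<dots> = A ^ Suc p + real (Suc p) * A ^ p * (\<integral>z. D z \<partial>std_gauss) + e * A ^ p * (\<integral>z. H z \<partial>std_gauss)"
      using iD Hint by (simp add: std_gauss.prob_space[simplified])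
    also have "\<dots> \<le> A ^ Suc p + real (Suc p) * A ^ p * (e * (\<kappa>\<^sup>2 * M2)) + e * A ^ p * (\<integral>z. H z \<partial>std_gauss)"
      using D2 A1 e by (intro add_mono mult_left_mono) auto
    also have "\<dots> = A ^ Suc p + C1 * e * A ^ p" unfolding C1_def by (simp add: algebra_simps)
    also have "\<dots> \<le> (1 - c0 * e / 2) * V x ^ Suc p + C * e"
    proof (rule Cdrift[rule_format], intro conjI)
      have "c0 * e \<le> c0 * es" using c0 e by (intro mult_left_mono) auto
      then show "c0 * e \<le> 1" using es by simp
      show "A \<le> (1 - c0 * e) * V x + C0 * e" unfolding A_def y_def by (rule drift[OF e])
    qed (use A1 e e1 in auto)
    finally have "(\<integral>z. V (em_step b \<sigma> e x z) ^ Suc p \<partial>std_gauss) \<le> (1 - c0 * e / 2) * V x ^ Suc p + C * e" .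
    note iV this
  }
  with C show ?thesis unfolding lyap_const_def by blast
qed

text \<open>The weight \<open>Z\<close> will be the indicator of an event known at time
  \<open>k\<close>, as the maximal inequality demands. Integrability is obtained first, from the
  nonnegative integral.\<close>

lemma lyapunov_chain_step:
  assumes \<eta>: "good \<eta>"
    and lc: "lyap_const p C"
    and i: "integrable N (\<lambda>w. V (chain \<eta> x k w) ^ Suc p)"
  shows "integrable N (\<lambda>w. V (chain \<eta> x (Suc k) w) ^ Suc p)"
    and "Z \<in> borel_measurable (F k) \<Longrightarrow> (\<And>w. 0 \<le> Z w \<and> Z w \<le> 1) \<Longrightarrow>
      (\<integral>w. Z w * V (chain \<eta> x (Suc k) w) ^ Suc p \<partial>N) \<le>
      (1 - c0 * \<eta> (Suc k) / 2) * (\<integral>w. Z w * V (chain \<eta> x k w) ^ Suc p \<partial>N) + C * \<eta> (Suc k)"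
proof -
  let ?e = "\<eta> (Suc k)"
  have e: "0 < ?e" "?e \<le> es" using goodD[OF \<eta>] by auto
  have ce: "0 \<le> 1 - c0 * ?e / 2"
    using mult_left_mono[OF e(2) less_imp_le[OF c0]] es by linarith
  note C = lyap_constD[OF lc]
  let ?h = "\<lambda>y. (1 - c0 * ?e / 2) * V y ^ Suc p + C * ?e"
  have h0: "0 \<le> ?h y" for y using ce C(1) e by simp
  have hi: "integrable N (\<lambda>w. ?h (chain \<eta> x k w))" using i by simp
  have "(\<integral>\<^sup>+w. ennreal (V (chain \<eta> x (Suc k) w) ^ Suc p) \<partial>N)
      = (\<integral>\<^sup>+w. (\<integral>\<^sup>+z. ennreal (V (em_step b \<sigma> ?e (chain \<eta> x k w) z) ^ Suc p) \<partial>std_gauss) \<partial>N)"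
    unfolding em_chain_Suc
    by (rule nn_integral_next[OF chain_F, of "\<lambda>p'. ennreal (V (em_step b \<sigma> ?e (fst p') (snd p')) ^ Suc p)", simplified fst_conv snd_conv])
       measurable
  also have "\<dots> \<le> (\<integral>\<^sup>+w. ennreal (?h (chain \<eta> x k w)) \<partial>N)"
    using C(2,3)[OF e] by (intro nn_integral_mono) (subst nn_integral_eq_integral, auto intro!: ennreal_leI)
  also have "\<dots> < \<infinity>"
    using hi h0 by (subst nn_integral_eq_integral) auto
  finally show int: "integrable N (\<lambda>w. V (chain \<eta> x (Suc k) w) ^ Suc p)"
    by (intro integrableI_nonneg) auto
  assume Z: "Z \<in> borel_measurable (F k)" and Z01: "\<And>w. 0 \<le> Z w \<and> Z w \<le> 1"
  note [measurable] = Z chain_F measurable_F_N[OF Z]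
  have bnd: "integrable N (\<lambda>w. Z w * f w)" if "integrable N f" "\<And>w. 0 \<le> f w" for f
  proof (rule Bochner_Integration.integrable_bound[OF that(1)])
    show "AE w in N. norm (Z w * f w) \<le> norm (f w)"
      using Z01 that(2) by (auto simp: abs_mult intro!: mult_left_le_one_le)
    show "(\<lambda>w. Z w * f w) \<in> borel_measurable N" using that(1) by measurable
  qed
  let ?g = "\<lambda>q. fst (fst q) * V (em_step b \<sigma> ?e (snd (fst q)) (snd q)) ^ Suc p"
  have Zp: "(\<lambda>w. (Z w, chain \<eta> x k w)) \<in> measurable (F k) (borel \<Otimes>\<^sub>M borel)" by measurable
  have g: "?g \<in> borel_measurable ((borel \<Otimes>\<^sub>M borel) \<Otimes>\<^sub>M borel)" by measurable
  have gi: "integrable N (\<lambda>w. ?g ((Z w, chain \<eta> x k w), \<xi> (Suc k) w))"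
    using bnd[OF int] unfolding em_chain_Suc by simp
  have "(\<integral>w. Z w * V (chain \<eta> x (Suc k) w) ^ Suc p \<partial>N)
      = (\<integral>w. Z w * (\<integral>z. V (em_step b \<sigma> ?e (chain \<eta> x k w) z) ^ Suc p \<partial>std_gauss) \<partial>N)"
    using integral_next(2)[OF Zp g gi] unfolding em_chain_Suc by simp
  also have "\<dots> \<le> (\<integral>w. Z w * ?h (chain \<eta> x k w) \<partial>N)"
  proof (rule integral_mono)
    show "integrable N (\<lambda>w. Z w * (\<integral>z. V (em_step b \<sigma> ?e (chain \<eta> x k w) z) ^ Suc p \<partial>std_gauss))"
      using integral_next(1)[OF Zp g gi] by simp
    show "integrable N (\<lambda>w. Z w * ?h (chain \<eta> x k w))" by (rule bnd[OF hi h0])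
  qed (use C(3)[OF e] Z01 in \<open>auto intro!: mult_left_mono\<close>)
  also have "\<dots> = (1 - c0 * ?e / 2) * (\<integral>w. Z w * V (chain \<eta> x k w) ^ Suc p \<partial>N) + C * ?e * (\<integral>w. Z w \<partial>N)"
  proof -
    have iZ: "integrable N Z" using bnd[of "\<lambda>_. 1"] by simp
    have "(\<lambda>w. Z w * ?h (chain \<eta> x k w)) = (\<lambda>w. (1 - c0 * ?e / 2) * (Z w * V (chain \<eta> x k w) ^ Suc p) + C * ?e * Z w)"
      by (simp add: algebra_simps)
    then show ?thesis using bnd[OF i] iZ by simp
  qed
  also have "\<dots> \<le> (1 - c0 * ?e / 2) * (\<integral>w. Z w * V (chain \<eta> x k w) ^ Suc p \<partial>N) + C * ?e"
  proof -
    have "(\<integral>w. Z w \<partial>N) \<le> 1"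
      using Z01 bnd[of "\<lambda>_. 1"] by (intro integral_le_const) auto
    then show ?thesis using C(1) e by (simp add: mult_left_le)
  qed
  finally show "(\<integral>w. Z w * V (chain \<eta> x (Suc k) w) ^ Suc p \<partial>N) \<le>
      (1 - c0 * ?e / 2) * (\<integral>w. Z w * V (chain \<eta> x k w) ^ Suc p \<partial>N) + C * ?e" .
qed

lemma integrable_V_chain:
  assumes \<eta>: "good \<eta>"
  shows "integrable N (\<lambda>w. V (chain \<eta> x k w) ^ Suc p)"
proof -
  obtain C where "lyap_const p C" using lyap_const_exists by blast
  then show ?thesis
    by (induction k) (simp, rule lyapunov_chain_step(1)[OF \<eta>])
qed

lemmas V_chain_supermartingale = lyapunov_chain_step(2)[OF _ _ integrable_V_chain]

lemma V_chain_moments: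
  "\<exists>C\<ge>0. \<forall>\<eta> x k. good \<eta> \<longrightarrow>
     (\<integral>w. V (chain \<eta> x k w) ^ Suc p \<partial>N) \<le> exp (- (c0 / 2) * step_t \<eta> k) * V x ^ Suc p + C"
proof -
  obtain C where lc: "lyap_const p C" using lyap_const_exists by blast
  note C = lyap_constD(1)[OF lc]
  \<comment> \<open>The fixed point of \<open>m \<mapsto> (1 - c0 * e / 2) * m + C * e\<close>, the
    same for every step \<open>e\<close>.\<close>
  let ?K = "2 * C / c0"
  {
    fix \<eta> x k assume \<eta>: "good \<eta>"
    have "(\<integral>w. V (chain \<eta> x k w) ^ Suc p \<partial>N) \<le> exp (- (c0 / 2) * step_t \<eta> k) * V x ^ Suc p + ?K"
    proof (induction k)
      case 0
      show ?case using C c0 by (simp add: prob_space step_t_def)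
    next
      case (Suc k)
      let ?e = "\<eta> (Suc k)"
      have e: "0 < ?e" "?e \<le> es" using goodD[OF \<eta>] by auto
      have ce: "0 \<le> 1 - c0 * ?e / 2" using mult_left_mono[OF e(2) less_imp_le[OF c0]] es by linarith
      have "(\<integral>w. V (chain \<eta> x (Suc k) w) ^ Suc p \<partial>N) \<le>
          (1 - c0 * ?e / 2) * (\<integral>w. V (chain \<eta> x k w) ^ Suc p \<partial>N) + C * ?e"
        using V_chain_supermartingale[OF \<eta> lc \<eta>, of "\<lambda>_. 1" k x] by simp
      also have "\<dots> \<le> (1 - c0 * ?e / 2) * (exp (- (c0 / 2) * step_t \<eta> k) * V x ^ Suc p + ?K) + C * ?e"
        using Suc ce by (intro add_right_mono mult_left_mono)
      also have "\<dots> = (1 - c0 * ?e / 2) * (exp (- (c0 / 2) * step_t \<eta> k) * V x ^ Suc p) + ?K"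
        using c0 by (simp add: field_simps)
      also have "\<dots> \<le> exp (- (c0 * ?e / 2)) * (exp (- (c0 / 2) * step_t \<eta> k) * V x ^ Suc p) + ?K"
        using exp_ge_add_one_self[of "- (c0 * ?e / 2)"] by (intro add_right_mono mult_right_mono) auto
      also have "\<dots> = exp (- (c0 / 2) * step_t \<eta> (Suc k)) * V x ^ Suc p + ?K"
      proof -
        have "- (c0 / 2) * step_t \<eta> (Suc k) = - (c0 * ?e / 2) + - (c0 / 2) * step_t \<eta> k"
          by (simp add: step_t_def algebra_simps)
        then show ?thesis by (simp only: exp_add mult.assoc)
      qed
      finally show ?case .
    qed
  }
  then show ?thesis using C c0 by (intro exI[of _ ?K]) simp
qed

text \<open>The point reached from \<open>y\<close>, displaced by \<open>w\<close>, is the point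
  reached from \<open>x\<close> with the noise shifted by \<open>u\<close>. Cauchy-Schwarz separates
  the square root of \<open>g\<close> from the Girsanov weight, whose second moment is
  \<open>exp ((norm u)\<^sup>2)\<close>. Hypothesis and conclusion have the same quadratic shape,
  which allows iteration.\<close>

lemma em_op_Harnack:
  fixes f g :: "real^'n \<Rightarrow> real"
  assumes [measurable]: "f \<in> borel_measurable borel" "g \<in> borel_measurable borel"
    and f: "\<And>u. 0 \<le> f u" "\<And>u. f u \<le> B" and g: "\<And>u. 0 \<le> g u" "\<And>u. g u \<le> B'"
    and E: "0 \<le> E" and fg: "\<And>u. (f u)\<^sup>2 \<le> E\<^sup>2 * g (u + w)" and e: "0 < e"
    and u: "sqrt e *\<^sub>R (\<sigma> *v u) = (y + e *\<^sub>R b y) + w - (x + e *\<^sub>R b x)"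
  shows "(em_op b \<sigma> e f y)\<^sup>2 \<le> E\<^sup>2 * exp ((norm u)\<^sup>2) * em_op b \<sigma> e g x"
proof -
  have sh: "em_step b \<sigma> e y z + w = em_step b \<sigma> e x (z + u)" for z
    unfolding em_step_def matrix_vector_right_distrib scaleR_add_right u by (simp add: algebra_simps)
  let ?h = "\<lambda>z. sqrt (g (em_step b \<sigma> e x z))"
  have B': "0 \<le> B'" using g order_trans by blast
  have hb: "?h z \<le> sqrt B'" for z using g by simp
  have f_le: "f (em_step b \<sigma> e y z) \<le> E * ?h (z + u)" for z
  proof -
    have "f (em_step b \<sigma> e y z) \<le> sqrt (E\<^sup>2 * g (em_step b \<sigma> e y z + w))"
      using fg f by (intro real_le_rsqrt) auto
    then show ?thesis using E by (simp add: real_sqrt_mult sh)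
  qed
  have i1: "integrable std_gauss (\<lambda>z. f (em_step b \<sigma> e y z))"
    using f by (intro std_gauss.integrable_const_bound[where B=B]) auto
  have i2: "integrable std_gauss (\<lambda>z. ?h (z + u))"
    using hb g by (intro std_gauss.integrable_const_bound[where B="sqrt B'"]) auto
  have i3: "integrable std_gauss (\<lambda>z. (?h z)\<^sup>2)"
    using g by (intro std_gauss.integrable_const_bound[where B=B']) auto
  have e2: "(exp (u \<bullet> z - (norm u)\<^sup>2 / 2))\<^sup>2 = exp (- ((norm u)\<^sup>2)) * exp ((2 *\<^sub>R u) \<bullet> z)" for z
    by (simp add: exp_double[symmetric] exp_add[symmetric] algebra_simps)
  have ex: "integrable std_gauss (\<lambda>z. exp ((2 *\<^sub>R u) \<bullet> z))" "(\<integral>z. exp ((2 *\<^sub>R u) \<bullet> z) \<partial>std_gauss) = exp (2 * (norm u)\<^sup>2)"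
    using has_bochner_integral_std_gauss_exp[of "2 *\<^sub>R u"] by (auto simp: has_bochner_integral_iff power_mult_distrib)
  have i4: "integrable std_gauss (\<lambda>z. (exp (u \<bullet> z - (norm u)\<^sup>2 / 2))\<^sup>2)"
    unfolding e2 by (intro integrable_mult_right ex)
  have I4: "(\<integral>z. (exp (u \<bullet> z - (norm u)\<^sup>2 / 2))\<^sup>2 \<partial>std_gauss) = exp ((norm u)\<^sup>2)"
    unfolding e2 integral_mult_right_zero ex by (simp add: exp_add[symmetric])
  have "em_op b \<sigma> e f y \<le> (\<integral>z. E * ?h (z + u) \<partial>std_gauss)"
    unfolding em_op_def by (intro integral_mono i1 integrable_mult_right i2 f_le)
  also have "\<dots> = E * (\<integral>z. ?h z * exp (u \<bullet> z - (norm u)\<^sup>2 / 2) \<partial>std_gauss)"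
    by (subst integral_std_gauss_shift[symmetric]) auto
  finally have "em_op b \<sigma> e f y \<le> E * (\<integral>z. ?h z * exp (u \<bullet> z - (norm u)\<^sup>2 / 2) \<partial>std_gauss)" .
  moreover have "0 \<le> em_op b \<sigma> e f y" unfolding em_op_def using f by (intro Bochner_Integration.integral_nonneg)
  ultimately have "(em_op b \<sigma> e f y)\<^sup>2 \<le> (E * (\<integral>z. ?h z * exp (u \<bullet> z - (norm u)\<^sup>2 / 2) \<partial>std_gauss))\<^sup>2"
    by (intro power_mono)
  also have "\<dots> = E\<^sup>2 * (\<integral>z. ?h z * exp (u \<bullet> z - (norm u)\<^sup>2 / 2) \<partial>std_gauss)\<^sup>2"
    by (simp add: power_mult_distrib)
  also have "\<dots> \<le> E\<^sup>2 * ((\<integral>z. (?h z)\<^sup>2 \<partial>std_gauss) * (\<integral>z. (exp (u \<bullet> z - (norm u)\<^sup>2 / 2))\<^sup>2 \<partial>std_gauss))"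
    by (intro mult_left_mono Cauchy_Schwarz_integral(2) i3 i4) auto
  also have "\<dots> = E\<^sup>2 * exp ((norm u)\<^sup>2) * em_op b \<sigma> e g x"
    unfolding I4 em_op_def using g by simp
  finally show ?thesis .
qed

text \<open>Price of bridging a unit distance in time \<open>s\<close>: the first term pays for the
  speed of the bridge, the second makes up for the difference of the drifts along it. The twos come
  from squaring a sum.\<close>

definition cH :: "real \<Rightarrow> real" where
  "cH s = 2 * \<kappa>'\<^sup>2 / s + 2 * \<kappa>'\<^sup>2 * L\<^sup>2 * s"

lemma Q_nonneg: "(\<And>u. 0 \<le> f u) \<Longrightarrow> 0 \<le> Q \<eta> m f x"
  unfolding Q_def by (intro Bochner_Integration.integral_nonneg) auto

lemma \<sigma>i_sq: "(norm (\<sigma>i *v z))\<^sup>2 \<le> \<kappa>'\<^sup>2 * (norm z)\<^sup>2"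
  using power_mono[OF \<kappa>' norm_ge_zero, of z 2] by (simp add: power_mult_distrib)

text \<open>A discrete form of Wang's Harnack inequality: at every step the noise is shifted so that the
  chain from \<open>y\<close> approaches the chain from \<open>x\<close> along a straight line and meets it at the end; the
  Girsanov weights of the shifts make up the constant.\<close>

lemma Q_Harnack:
  assumes "good \<eta>" "f \<in> borel_measurable borel" "\<And>u. 0 \<le> f u" "\<And>u. f u \<le> 1"
  shows "(Q \<eta> (Suc m) f y)\<^sup>2 \<le> exp (cH (step_t \<eta> (Suc m)) * (norm (x - y))\<^sup>2) * Q \<eta> (Suc m) (\<lambda>u. (f u)\<^sup>2) x"
  using assms
proof (induction m arbitrary: \<eta> f x y)
  case 0
  note [measurable] = 0(2)
  let ?e = "\<eta> 1"
  have e: "0 < ?e" "?e \<le> 1" using goodD[OF 0(1), of 0] by auto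
  define d where "d = (y + ?e *\<^sub>R b y) - (x + ?e *\<^sub>R b x)"
  define u where "u = (1 / sqrt ?e) *\<^sub>R (\<sigma>i *v d)"
  have f2: "(f u)\<^sup>2 \<le> 1" for u using 0 by (simp add: power_le_one)
  have su: "sqrt ?e *\<^sub>R (\<sigma> *v u) = (y + ?e *\<^sub>R b y) + 0 - (x + ?e *\<^sub>R b x)"
    using e by (simp add: u_def matrix_vector_mult_scaleR \<sigma>i d_def)
  have "(em_op b \<sigma> ?e f y)\<^sup>2 \<le> 1\<^sup>2 * exp ((norm u)\<^sup>2) * em_op b \<sigma> ?e (\<lambda>u. (f u)\<^sup>2) x"
    by (rule em_op_Harnack[where w=0 and B=1 and B'=1]) (use 0 f2 e su in auto)
  moreover have "exp ((norm u)\<^sup>2) \<le> exp (cH ?e * (norm (x - y))\<^sup>2)"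
  proof -
    have "d = (y - x) + ?e *\<^sub>R (b y - b x)" by (simp add: d_def algebra_simps)
    then have "norm d \<le> norm (y - x) + norm (?e *\<^sub>R (b y - b x))" by (metis norm_triangle_ineq)
    also have "\<dots> \<le> norm (x - y) + ?e * (L * norm (x - y))"
      using Lip[of x y] e by (simp add: norm_minus_commute)
    finally have "(norm d)\<^sup>2 \<le> (norm (x - y) + ?e * (L * norm (x - y)))\<^sup>2" by (intro power_mono) auto
    also have "\<dots> \<le> 2 * (norm (x - y))\<^sup>2 + 2 * (?e * (L * norm (x - y)))\<^sup>2"
      using sum_squares_bound[of "norm (x - y)" "?e * (L * norm (x - y))"] by (simp add: power2_sum)
    finally have "\<kappa>'\<^sup>2 * (norm d)\<^sup>2 / ?e \<le> \<kappa>'\<^sup>2 * (2 * (norm (x - y))\<^sup>2 + 2 * (?e * (L * norm (x - y)))\<^sup>2) / ?e"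
      using e by (intro divide_right_mono mult_left_mono) auto
    also have "\<dots> = cH ?e * (norm (x - y))\<^sup>2"
      using e unfolding cH_def by (simp add: power2_eq_square field_simps)
    finally have "\<kappa>'\<^sup>2 * (norm d)\<^sup>2 / ?e \<le> cH ?e * (norm (x - y))\<^sup>2" .
    moreover have "(norm u)\<^sup>2 \<le> \<kappa>'\<^sup>2 * (norm d)\<^sup>2 / ?e"
      using e divide_right_mono[OF \<sigma>i_sq[of d], of ?e] by (simp add: u_def power_divide)
    ultimately show ?thesis by simp
  qed
  moreover have "0 \<le> em_op b \<sigma> ?e (\<lambda>u. (f u)\<^sup>2) x" unfolding em_op_def by (intro Bochner_Integration.integral_nonneg) auto
  ultimately have Hk: "(em_op b \<sigma> ?e f y)\<^sup>2 \<le> exp (cH ?e * (norm (x - y))\<^sup>2) * em_op b \<sigma> ?e (\<lambda>u. (f u)\<^sup>2) x"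
    using mult_le_trans_left[of "(em_op b \<sigma> ?e f y)\<^sup>2" "exp ((norm u)\<^sup>2)"] by simp
  show ?case
    using Hk 0 f2 by (simp add: Q_1[where C=1, unfolded One_nat_def] step_t_def)
next
  case (Suc m)
  note [measurable] = Suc.prems(2)
  let ?e = "\<eta> 1" and ?s' = "step_t (shift \<eta> 1) (Suc m)"
  let ?s = "step_t \<eta> (Suc (Suc m))"
  have e: "0 < ?e" "?e \<le> 1" using goodD[OF Suc.prems(1), of 0] by auto
  have s: "?s = ?e + ?s'"
    unfolding step_t_def shift_def by (simp add: sum.atLeast_Suc_atMost_Suc_shift sum.atLeast_Suc_atMost del: sum.cl_ivl_Suc)
  have s': "0 < ?s'" unfolding step_t_def
    using good_shift[OF Suc.prems(1), of 1] by (intro sum_pos) (auto simp: good_def)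
  define f' where "f' = Q (shift \<eta> 1) (Suc m) f"
  define g' where "g' = Q (shift \<eta> 1) (Suc m) (\<lambda>u. (f u)\<^sup>2)"
  have [measurable]: "f' \<in> borel_measurable borel" "g' \<in> borel_measurable borel"
    unfolding f'_def g'_def by measurable
  have fb: "\<bar>f u\<bar> \<le> 1" "\<bar>(f u)\<^sup>2\<bar> \<le> 1" for u using Suc.prems by (auto simp: power_le_one)
  have f'b: "0 \<le> f' u" "f' u \<le> 1" "0 \<le> g' u" "g' u \<le> 1" for u
    using Suc.prems Q_bound[of f 1 "shift \<eta> 1" "Suc m" u] Q_bound[of "\<lambda>u. (f u)\<^sup>2" 1 "shift \<eta> 1" "Suc m" u] fb
    unfolding f'_def g'_def by (auto intro!: Q_nonneg)
  \<comment> \<open>The displacement still to be bridged after the first step when the separation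
    shrinks linearly in elapsed time.\<close>
  define w where "w = (?s' / ?s) *\<^sub>R (x - y)"
  define d where "d = (y + ?e *\<^sub>R b y) + w - (x + ?e *\<^sub>R b x)"
  define u where "u = (1 / sqrt ?e) *\<^sub>R (\<sigma>i *v d)"
  define E where "E = exp (cH ?s' * (norm w)\<^sup>2 / 2)"
  have E2: "E\<^sup>2 = exp (cH ?s' * (norm w)\<^sup>2)" by (simp add: E_def flip: exp_double)
  have fg: "(f' v)\<^sup>2 \<le> E\<^sup>2 * g' (v + w)" for v
    using Suc.IH[OF good_shift[OF Suc.prems(1), of 1] Suc.prems(2-4), of v "v + w"]
    unfolding f'_def g'_def E2 by simp
  have su: "sqrt ?e *\<^sub>R (\<sigma> *v u) = (y + ?e *\<^sub>R b y) + w - (x + ?e *\<^sub>R b x)"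
    using e by (simp add: u_def matrix_vector_mult_scaleR \<sigma>i d_def)
  have main: "(em_op b \<sigma> ?e f' y)\<^sup>2 \<le> E\<^sup>2 * exp ((norm u)\<^sup>2) * em_op b \<sigma> ?e g' x"
    by (rule em_op_Harnack[where w=w and B=1 and B'=1]) (use f'b fg e su in \<open>auto simp: E_def\<close>)
  have "E\<^sup>2 * exp ((norm u)\<^sup>2) \<le> exp (cH ?s * (norm (x - y))\<^sup>2)"
  proof -
    \<comment> \<open>The shift therefore pays only for the part of the distance covered in this
      step and for the mismatch of the drifts.\<close>
    have "d = (- (?e / ?s)) *\<^sub>R (x - y) + ?e *\<^sub>R (b y - b x)"
    proof -
      have "?s' / ?s = 1 - ?e / ?s" using s s' e by (simp add: field_simps)
      then have "w = (x - y) - (?e / ?s) *\<^sub>R (x - y)" by (simp only: w_def scaleR_diff_left scaleR_one)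
      then show ?thesis unfolding d_def by (simp add: algebra_simps)
    qed
    then have "norm d \<le> norm ((- (?e / ?s)) *\<^sub>R (x - y)) + norm (?e *\<^sub>R (b y - b x))" by (metis norm_triangle_ineq)
    also have "\<dots> \<le> ?e / ?s * norm (x - y) + ?e * (L * norm (x - y))"
      using Lip[of x y] e s s' by (intro add_mono) (auto simp: norm_minus_commute)
    finally have "(norm d)\<^sup>2 \<le> (?e / ?s * norm (x - y) + ?e * (L * norm (x - y)))\<^sup>2" by (intro power_mono) auto
    also have "\<dots> \<le> 2 * (?e / ?s * norm (x - y))\<^sup>2 + 2 * (?e * (L * norm (x - y)))\<^sup>2"
      using sum_squares_bound[of "?e / ?s * norm (x - y)" "?e * (L * norm (x - y))"] by (simp add: power2_sum)
    finally have "\<kappa>'\<^sup>2 * (norm d)\<^sup>2 / ?e \<le> \<kappa>'\<^sup>2 * (2 * (?e / ?s * norm (x - y))\<^sup>2 + 2 * (?e * (L * norm (x - y)))\<^sup>2) / ?e"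
      using e by (intro divide_right_mono mult_left_mono) auto
    also have "\<dots> = 2 * \<kappa>'\<^sup>2 * ?e * (1 / ?s\<^sup>2 + L\<^sup>2) * (norm (x - y))\<^sup>2"
      using e s s' by (simp add: power2_eq_square field_simps)
    finally have un: "(norm u)\<^sup>2 \<le> 2 * \<kappa>'\<^sup>2 * ?e * (1 / ?s\<^sup>2 + L\<^sup>2) * (norm (x - y))\<^sup>2"
      using e divide_right_mono[OF \<sigma>i_sq[of d], of ?e] by (simp add: u_def power_divide)
    have "cH ?s' * (norm w)\<^sup>2 = cH ?s' * (?s' / ?s)\<^sup>2 * (norm (x - y))\<^sup>2"
      by (simp add: w_def power_mult_distrib power_divide)
    then have "cH ?s' * (norm w)\<^sup>2 + (norm u)\<^sup>2 \<le>
        (cH ?s' * (?s' / ?s)\<^sup>2 + 2 * \<kappa>'\<^sup>2 * ?e * (1 / ?s\<^sup>2 + L\<^sup>2)) * (norm (x - y))\<^sup>2"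
      using un unfolding distrib_right by linarith
    also have "\<dots> \<le> cH ?s * (norm (x - y))\<^sup>2"
    proof (rule mult_right_mono)
      have "2 * \<kappa>'\<^sup>2 / ?s' * (?s' / ?s)\<^sup>2 + 2 * \<kappa>'\<^sup>2 * ?e * (1 / ?s\<^sup>2) = 2 * \<kappa>'\<^sup>2 / ?s"
        using bridge_cost_telescope[OF s' e(1) s, of "2 * \<kappa>'\<^sup>2"] .
      moreover have "2 * \<kappa>'\<^sup>2 * L\<^sup>2 * ?s' * (?s' / ?s)\<^sup>2 + 2 * \<kappa>'\<^sup>2 * ?e * L\<^sup>2 \<le> 2 * \<kappa>'\<^sup>2 * L\<^sup>2 * ?s"
      proof -
        have "(?s' / ?s)\<^sup>2 \<le> 1" using s s' e by (intro power_le_one) (auto simp: field_simps)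
        then have "2 * \<kappa>'\<^sup>2 * L\<^sup>2 * ?s' * (?s' / ?s)\<^sup>2 \<le> 2 * \<kappa>'\<^sup>2 * L\<^sup>2 * ?s' * 1"
          using s' by (intro mult_left_mono) auto
        then show ?thesis unfolding s by (simp add: algebra_simps)
      qed
      ultimately show "cH ?s' * (?s' / ?s)\<^sup>2 + 2 * \<kappa>'\<^sup>2 * ?e * (1 / ?s\<^sup>2 + L\<^sup>2) \<le> cH ?s"
        unfolding cH_def by (simp add: distrib_left distrib_right)
    qed simp
    finally show ?thesis unfolding E2 by (simp add: exp_add[symmetric])
  qed
  moreover have "0 \<le> em_op b \<sigma> ?e g' x" unfolding em_op_def using f'b by (intro Bochner_Integration.integral_nonneg) auto
  ultimately have "(em_op b \<sigma> ?e f' y)\<^sup>2 \<le> exp (cH ?s * (norm (x - y))\<^sup>2) * em_op b \<sigma> ?e g' x"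
    by (rule mult_le_trans_left[OF main])
  moreover have "Q \<eta> (Suc (Suc m)) f y = em_op b \<sigma> ?e f' y"
    using Q_add[of f 1 \<eta> 1 "Suc m" y] Q_1[of f' 1 \<eta> y] fb f'b unfolding f'_def by simp
  moreover have "Q \<eta> (Suc (Suc m)) (\<lambda>u. (f u)\<^sup>2) x = em_op b \<sigma> ?e g' x"
    using Q_add[of "\<lambda>u. (f u)\<^sup>2" 1 \<eta> 1 "Suc m" x] Q_1[of g' 1 \<eta> x] fb f'b unfolding g'_def by simp
  ultimately show ?case by simp
qed

end

section \<open>Geometric mixing of the chain\<close>

context em_sys
begin

text \<open>With a suitable constant \<open>c\<close>, \<open>f = c + r f1 + f2\<close> where \<open>\<bar>f1\<bar> \<le> 1\<close> and \<open>\<bar>f2\<bar> \<le> r \<beta> V\<close>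
  (Hairer and Mattingly's form of Harris' theorem).\<close>

lemma Q_diff_le:
  assumes \<eta>: "good \<eta>" and [measurable]: "f \<in> borel_measurable borel" and r: "0 < r" and \<beta>: "0 \<le> \<beta>"
    and fB: "\<And>u. \<bar>f u\<bar> \<le> B"
    and osc: "\<And>u v. \<bar>f u - f v\<bar> \<le> r * (2 + \<beta> * V u + \<beta> * V v)"
    and T: "\<And>g. g \<in> borel_measurable borel \<Longrightarrow> (\<And>u. \<bar>g u\<bar> \<le> 1) \<Longrightarrow> \<bar>Q \<eta> m g x - Q \<eta> m g y\<bar> \<le> T"
  shows "\<bar>Q \<eta> m f x - Q \<eta> m f y\<bar> \<le>
    r * (T + \<beta> * ((\<integral>w. V (chain \<eta> x m w) \<partial>N) + (\<integral>w. V (chain \<eta> y m w) \<partial>N)))"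
proof -
  \<comment> \<open>The infimum of f + r (1 + \<beta> V). By \<open>osc\<close> it lies above f - r
    (1 + \<beta> V) everywhere, so one constant separates the two functions.\<close>
  define c where "c = (INF u. f u + r * (1 + \<beta> * V u))"
  have bdd: "bdd_below (range (\<lambda>u. f u + r * (1 + \<beta> * V u)))"
  proof (rule bdd_belowI2)
    fix u :: "real^'n"
    have "0 \<le> r * (1 + \<beta> * V u)" using r \<beta> by simp
    then show "- B \<le> f u + r * (1 + \<beta> * V u)" using fB[of u] by linarith
  qed
  have c1: "c \<le> f u + r * (1 + \<beta> * V u)" for u
    unfolding c_def by (rule cINF_lower[OF bdd]) simp
  have c2: "f u - r * (1 + \<beta> * V u) \<le> c" for u
    unfolding c_def
  proof (rule cINF_greatest)
    fix v
    show "f u - r * (1 + \<beta> * V u) \<le> f v + r * (1 + \<beta> * V v)"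
      using osc[of u v] by (simp add: algebra_simps abs_le_iff)
  qed simp
  define f1 where "f1 u = max (- 1) (min 1 ((f u - c) / r))" for u
  define f2 where "f2 u = f u - c - r * f1 u" for u
  have [measurable]: "f1 \<in> borel_measurable borel" "f2 \<in> borel_measurable borel"
    unfolding f1_def f2_def by measurable
  have f1b: "\<bar>f1 u\<bar> \<le> 1" for u by (auto simp: f1_def)
  have f2b: "\<bar>f2 u\<bar> \<le> r * \<beta> * V u" for u
  proof -
    have bV: "0 \<le> r * \<beta> * V u" using r \<beta> by simp
    consider "\<bar>(f u - c) / r\<bar> \<le> 1" | "(f u - c) / r > 1" | "(f u - c) / r < -1" by linarith
    then show ?thesis
    proof cases
      case 1
      then have "f1 u = (f u - c) / r" unfolding f1_def by (simp only: abs_le_iff) linarith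
      then show ?thesis using r bV by (simp add: f2_def)
    next
      case 2
      then have "f1 u = 1" by (auto simp: f1_def)
      moreover have "f u - c > r" using 2 r by (simp add: field_simps)
      ultimately show ?thesis using c2[of u] bV by (simp add: f2_def algebra_simps abs_le_iff)
    next
      case 3
      then have "f1 u = -1" by (auto simp: f1_def)
      moreover have "f u - c < - r" using 3 r by (simp add: field_simps)
      ultimately show ?thesis using c1[of u] bV by (simp add: f2_def algebra_simps abs_le_iff)
    qed
  qed
  have iV: "integrable N (\<lambda>w. V (chain \<eta> z m w))" for z
    using integrable_V_chain[OF \<eta>, of z m 0] by simp
  have i1: "integrable N (\<lambda>w. f1 (chain \<eta> z m w))" for z
    by (rule integrable_F_bounded[where B=1]) (use f1b in auto)
  have i2: "integrable N (\<lambda>w. f2 (chain \<eta> z m w))" for z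
  proof (rule Bochner_Integration.integrable_bound)
    show "integrable N (\<lambda>w. r * \<beta> * V (chain \<eta> z m w))" by (intro integrable_mult_right iV)
    show "AE w in N. norm (f2 (chain \<eta> z m w)) \<le> norm (r * \<beta> * V (chain \<eta> z m w))"
      using order_trans[OF f2b abs_ge_self] by simp
  qed measurable
  have split: "Q \<eta> m f z = c + r * Q \<eta> m f1 z + Q \<eta> m f2 z" for z
  proof -
    have "Q \<eta> m f z = (\<integral>w. c + r * f1 (chain \<eta> z m w) + f2 (chain \<eta> z m w) \<partial>N)"
      unfolding Q_def f2_def by simp
    then show ?thesis unfolding Q_def using i1 i2 by (simp add: prob_space)
  qed
  have Q2: "\<bar>Q \<eta> m f2 z\<bar> \<le> r * \<beta> * (\<integral>w. V (chain \<eta> z m w) \<partial>N)" for z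
  proof -
    have "\<bar>Q \<eta> m f2 z\<bar> \<le> (\<integral>w. \<bar>f2 (chain \<eta> z m w)\<bar> \<partial>N)" unfolding Q_def by (rule integral_abs_bound)
    also have "\<dots> \<le> (\<integral>w. r * \<beta> * V (chain \<eta> z m w) \<partial>N)"
      using f2b by (intro integral_mono integrable_abs i2 integrable_mult_right iV)
    finally show ?thesis by simp
  qed
  have "\<bar>Q \<eta> m f x - Q \<eta> m f y\<bar> \<le> r * \<bar>Q \<eta> m f1 x - Q \<eta> m f1 y\<bar> + \<bar>Q \<eta> m f2 x\<bar> + \<bar>Q \<eta> m f2 y\<bar>"
  proof -
    have "Q \<eta> m f x - Q \<eta> m f y = r * (Q \<eta> m f1 x - Q \<eta> m f1 y) + Q \<eta> m f2 x - Q \<eta> m f2 y"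
      unfolding split by (simp add: algebra_simps)
    then have "\<bar>Q \<eta> m f x - Q \<eta> m f y\<bar> \<le> \<bar>r * (Q \<eta> m f1 x - Q \<eta> m f1 y)\<bar> + \<bar>Q \<eta> m f2 x\<bar> + \<bar>Q \<eta> m f2 y\<bar>"
      by linarith
    then show ?thesis using r by (simp add: abs_mult)
  qed
  also have "\<dots> \<le> r * T + r * \<beta> * (\<integral>w. V (chain \<eta> x m w) \<partial>N) + r * \<beta> * (\<integral>w. V (chain \<eta> y m w) \<partial>N)"
    using r Q2 T[of f1] f1b by (intro add_mono mult_left_mono) auto
  finally show ?thesis by (simp add: algebra_simps)
qed

text \<open>Harnack's inequality keeps the total variation distance of the two laws away from 2.\<close>

lemma Q_minorization:
  "\<exists>\<alpha>. 0 < \<alpha> \<and> \<alpha> \<le> 1 \<and> (\<forall>\<eta> m x y g. good \<eta> \<and> 1 \<le> step_t \<eta> m \<and> step_t \<eta> m \<le> 2 \<and> V x + V y \<le> R \<and>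
     g \<in> borel_measurable borel \<and> (\<forall>u. \<bar>g u\<bar> \<le> 1) \<longrightarrow> \<bar>Q \<eta> m g x - Q \<eta> m g y\<bar> \<le> 2 * (1 - \<alpha>))"
proof -
  define c where "c = 2 * \<kappa>'\<^sup>2 + 4 * \<kappa>'\<^sup>2 * L\<^sup>2"
  define K where "K = max 2 (exp (c * (2 * \<bar>R\<bar>)))"
  have K: "2 \<le> K" by (simp add: K_def)
  have c0': "0 \<le> c" by (simp add: c_def)
  have key: "Q \<eta> m f x - Q \<eta> m f y \<le> 1 - 1 / K"
    if \<eta>: "good \<eta>" and s: "1 \<le> step_t \<eta> m" "step_t \<eta> m \<le> 2" and R: "V x + V y \<le> R"
      and f: "f \<in> borel_measurable borel" "\<And>u. 0 \<le> f u" "\<And>u. f u \<le> 1" for \<eta> m x y f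
  proof -
    note [measurable] = f(1)
    obtain m' where m: "m = Suc m'" using s by (cases m) (auto simp: step_t_def)
    \<comment> \<open>Since \<open>f\<close> has values in [0, 1], its square is at most
      \<open>f\<close>, which removes the square from the right-hand side of Harnack's
      inequality.\<close>
    have fb: "\<bar>f u\<bar> \<le> 1" "\<bar>(f u)\<^sup>2\<bar> \<le> 1" "(f u)\<^sup>2 \<le> f u" for u
      using f(2,3)[of u] by (auto simp: power_le_one) (simp add: power2_eq_square mult_left_le)
    have c: "cH (step_t \<eta> m) \<le> c"
    proof -
      have "2 * \<kappa>'\<^sup>2 / step_t \<eta> m \<le> 2 * \<kappa>'\<^sup>2 / 1" using s by (intro divide_left_mono) auto
      moreover have "2 * \<kappa>'\<^sup>2 * L\<^sup>2 * step_t \<eta> m \<le> 2 * \<kappa>'\<^sup>2 * L\<^sup>2 * 2" using s by (intro mult_left_mono) auto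
      ultimately show ?thesis by (simp add: cH_def c_def algebra_simps)
    qed
    have n: "(norm (y - x))\<^sup>2 \<le> 2 * \<bar>R\<bar>"
    proof -
      have "norm (y - x) \<le> norm y + norm x" by (rule norm_triangle_ineq4)
      then have "(norm (y - x))\<^sup>2 \<le> (norm y + norm x)\<^sup>2" by (intro power_mono) auto
      also have "\<dots> \<le> 2 * (norm y)\<^sup>2 + 2 * (norm x)\<^sup>2"
        using sum_squares_bound[of "norm y" "norm x"] by (simp add: power2_sum)
      finally show ?thesis using R by (simp add: V_def)
    qed
    have "cH (step_t \<eta> m) * (norm (y - x))\<^sup>2 \<le> c * (2 * \<bar>R\<bar>)"
      using c n c0' by (intro mult_mono) auto
    then have ex: "exp (cH (step_t \<eta> m) * (norm (y - x))\<^sup>2) \<le> K" unfolding K_def by (meson exp_le_cancel_iff max.coboundedI2)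
    have Q0: "0 \<le> Q \<eta> m (\<lambda>u. (f u)\<^sup>2) y" by (rule Q_nonneg) simp
    have "(Q \<eta> m f x)\<^sup>2 \<le> K * Q \<eta> m (\<lambda>u. (f u)\<^sup>2) y"
      using Q_Harnack[OF \<eta> f, of m' x y] ex Q0 unfolding m by (rule mult_le_trans_left)
    also have "\<dots> \<le> K * Q \<eta> m f y"
      unfolding Q_def using K fb
      by (intro mult_left_mono integral_mono) (auto intro!: integrable_F_bounded[where B=1])
    finally have h: "(Q \<eta> m f x)\<^sup>2 / K \<le> Q \<eta> m f y" using K by (simp add: field_simps)
    \<comment> \<open>The difference is at most \<open>q - q\<^sup>2 / K\<close>, which on [0, 1] is
      largest at \<open>q = 1\<close> because \<open>K\<close> is at least 2.\<close>
    define q where "q = Q \<eta> m f x"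
    have q: "0 \<le> q" "q \<le> 1" unfolding q_def using Q_nonneg[of f] f Q_bound[of f 1 \<eta> m x] fb by auto
    have "(1 - q) * (K - 1 - q) \<ge> 0" using q K by (intro mult_nonneg_nonneg) auto
    then have "0 \<le> (1 - q) * (K - 1 - q) / K" using K by simp
    also have "(1 - q) * (K - 1 - q) / K = (1 - 1 / K) - (q - q\<^sup>2 / K)"
      using K by (simp add: field_simps power2_eq_square)
    finally have "q - q\<^sup>2 / K \<le> 1 - 1 / K" by simp
    then show ?thesis using h unfolding q_def by simp
  qed
  show ?thesis
  proof (intro exI[of _ "1 / K"] conjI allI impI)
    show "0 < 1 / K" "1 / K \<le> 1" using K by auto
    fix \<eta> m and x y :: "real^'n" and g :: "real^'n \<Rightarrow> real"
    assume A: "good \<eta> \<and> 1 \<le> step_t \<eta> m \<and> step_t \<eta> m \<le> 2 \<and> V x + V y \<le> R \<and>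
     g \<in> borel_measurable borel \<and> (\<forall>u. \<bar>g u\<bar> \<le> 1)"
    then have [measurable]: "g \<in> borel_measurable borel" and gb: "\<bar>g u\<bar> \<le> 1" for u by auto
    have g': "- 1 \<le> g u" "g u \<le> 1" for u using gb[of u] by auto
    let ?f = "\<lambda>u. (1 + g u) / 2"
    have f: "?f \<in> borel_measurable borel" "0 \<le> ?f u" "?f u \<le> 1" for u
      using g'[of u] by auto
    have eq: "Q \<eta> m ?f z = (1 + Q \<eta> m g z) / 2" for z
      unfolding Q_def using gb
      by (subst integral_divide_zero) (simp add: integrable_F_bounded[where B=1] prob_space)
    have "Q \<eta> m ?f x - Q \<eta> m ?f y \<le> 1 - 1 / K" "Q \<eta> m ?f y - Q \<eta> m ?f x \<le> 1 - 1 / K"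
      using A by (auto intro!: key f)
    then show "\<bar>Q \<eta> m g x - Q \<eta> m g y\<bar> \<le> 2 * (1 - 1 / K)"
      unfolding eq by (simp add: field_simps abs_le_iff)
  qed
qed

text \<open>Where V x + V y is at most \<open>R\<close>, the minorization yields the contraction,
  with \<beta> small enough for the growth of V not to spoil it; beyond \<open>R\<close> the
  Lyapunov drift alone is strong enough.\<close>

lemma Harris_contraction:
  "\<exists>\<rho> \<beta>. 0 \<le> \<rho> \<and> \<rho> < 1 \<and> 0 < \<beta> \<and> (\<forall>\<eta> m f r B x y. good \<eta> \<and> 1 \<le> step_t \<eta> m \<and> step_t \<eta> m \<le> 2 \<and>
     f \<in> borel_measurable borel \<and> (\<forall>u. \<bar>f u\<bar> \<le> B) \<and> 0 < r \<and>
     (\<forall>u v. \<bar>f u - f v\<bar> \<le> r * (2 + \<beta> * V u + \<beta> * V v)) \<longrightarrow>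
     \<bar>Q \<eta> m f x - Q \<eta> m f y\<bar> \<le> (\<rho> * r) * (2 + \<beta> * V x + \<beta> * V y))"
proof -
  obtain C where C: "0 \<le> C" and
    mom: "\<forall>\<eta> x k. good \<eta> \<longrightarrow> (\<integral>w. V (chain \<eta> x k w) ^ Suc 0 \<partial>N) \<le> exp (- (c0 / 2) * step_t \<eta> k) * V x ^ Suc 0 + C"
    using V_chain_moments[of 0] by blast
  define \<gamma> where "\<gamma> = exp (- (c0 / 2))"
  have \<gamma>: "0 < \<gamma>" "\<gamma> < 1" using c0 by (auto simp: \<gamma>_def)
  have mom': "(\<integral>w. V (chain \<eta> x m w) \<partial>N) \<le> \<gamma> * V x + C" if "good \<eta>" "1 \<le> step_t \<eta> m" for \<eta> x m
  proof -
    have "exp (- (c0 / 2) * step_t \<eta> m) \<le> \<gamma>" unfolding \<gamma>_def using that c0 by simp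
    then have "exp (- (c0 / 2) * step_t \<eta> m) * V x \<le> \<gamma> * V x" by (intro mult_right_mono) auto
    then show ?thesis using mom[rule_format, OF that(1), of x m] unfolding power_Suc power_0 mult_1_right by linarith
  qed
  \<comment> \<open>Above this level the additive constant \<open>2 * C\<close> is at most half of
    what the drift takes away.\<close>
  define R where "R = 4 * C / (1 - \<gamma>) + 1"
  have R: "0 < R" using C \<gamma> by (simp add: R_def add_nonneg_pos)
  obtain \<alpha> where \<alpha>: "0 < \<alpha>" "\<alpha> \<le> 1" and minor: "\<forall>\<eta> m x y g. good \<eta> \<and> 1 \<le> step_t \<eta> m \<and> step_t \<eta> m \<le> 2 \<and> V x + V y \<le> R \<and>
     g \<in> borel_measurable borel \<and> (\<forall>u. \<bar>g u\<bar> \<le> 1) \<longrightarrow> \<bar>Q \<eta> m g x - Q \<eta> m g y\<bar> \<le> 2 * (1 - \<alpha>)"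
    using Q_minorization[of R] by blast
  \<comment> \<open>Small enough that \<open>2 * \<beta> * C \<le> \<alpha>\<close>: the additive
    growth of V uses at most half of the gain \<open>2 * \<alpha>\<close>.\<close>
  define \<beta> where "\<beta> = \<alpha> / (2 * (C + 1))"
  have \<beta>: "0 < \<beta>" using \<alpha> C by (simp add: \<beta>_def)
  have \<beta>C: "2 * \<beta> * C \<le> \<alpha>" using \<alpha> C by (simp add: \<beta>_def field_simps)
  define \<gamma>1 where "\<gamma>1 = (1 + \<gamma>) / 2"
  have \<gamma>1: "0 < \<gamma>1" "\<gamma>1 < 1" using \<gamma> by (auto simp: \<gamma>1_def)
  define \<rho>1 where "\<rho>1 = (2 + \<beta> * \<gamma>1 * R) / (2 + \<beta> * R)"
  have \<beta>R: "0 < \<beta> * R" using \<beta> R by simp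
  have \<rho>1: "\<rho>1 < 1" "\<gamma>1 \<le> \<rho>1"
  proof -
    have "\<beta> * \<gamma>1 * R < \<beta> * R" using mult_strict_right_mono[OF \<gamma>1(2) \<beta>R] by (simp add: mult_ac)
    then show "\<rho>1 < 1" using \<beta>R by (simp add: \<rho>1_def)
    show "\<gamma>1 \<le> \<rho>1" using \<beta>R \<gamma>1 by (simp add: \<rho>1_def field_simps)
  qed
  define \<rho> where "\<rho> = max \<rho>1 (max (1 - \<alpha> / 2) \<gamma>)"
  have \<rho>: "0 \<le> \<rho>" "\<rho> < 1" "\<rho>1 \<le> \<rho>" "1 - \<alpha> / 2 \<le> \<rho>" "\<gamma> \<le> \<rho>" using \<rho>1 \<alpha> \<gamma> by (auto simp: \<rho>_def)
  show ?thesis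
  proof (rule exI[of _ \<rho>], rule exI[of _ \<beta>], intro conjI allI impI)
    fix \<eta> m r B and x y :: "real^'n" and f :: "real^'n \<Rightarrow> real"
    assume A: "good \<eta> \<and> 1 \<le> step_t \<eta> m \<and> step_t \<eta> m \<le> 2 \<and>
     f \<in> borel_measurable borel \<and> (\<forall>u. \<bar>f u\<bar> \<le> B) \<and> 0 < r \<and>
     (\<forall>u v. \<bar>f u - f v\<bar> \<le> r * (2 + \<beta> * V u + \<beta> * V v))"
    then have r: "0 < r" by blast
    define S where "S = V x + V y"
    have S0: "0 \<le> S" by (simp add: S_def add_nonneg_nonneg)
    have EV: "\<beta> * ((\<integral>w. V (chain \<eta> x m w) \<partial>N) + (\<integral>w. V (chain \<eta> y m w) \<partial>N)) \<le> \<beta> * (\<gamma> * S + 2 * C)"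
      using mom'[of \<eta> m x] mom'[of \<eta> m y] A \<beta> by (intro mult_left_mono) (auto simp: S_def algebra_simps)
    have main: "\<bar>Q \<eta> m f x - Q \<eta> m f y\<bar> \<le> r * (T + \<beta> * (\<gamma> * S + 2 * C))"
      if "\<And>g. g \<in> borel_measurable borel \<Longrightarrow> (\<And>u. \<bar>g u\<bar> \<le> 1) \<Longrightarrow> \<bar>Q \<eta> m g x - Q \<eta> m g y\<bar> \<le> T" for T
    proof -
      have "\<bar>Q \<eta> m f x - Q \<eta> m f y\<bar> \<le> r * (T + \<beta> * ((\<integral>w. V (chain \<eta> x m w) \<partial>N) + (\<integral>w. V (chain \<eta> y m w) \<partial>N)))"
        using A \<beta> that by (intro Q_diff_le[where B=B]) auto
      also have "\<dots> \<le> r * (T + \<beta> * (\<gamma> * S + 2 * C))" using EV r by (intro mult_left_mono) auto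
      finally show ?thesis .
    qed
    have "\<bar>Q \<eta> m f x - Q \<eta> m f y\<bar> \<le> r * (\<rho> * (2 + \<beta> * S))"
    proof (cases "S \<le> R")
      case True
      have "\<bar>Q \<eta> m f x - Q \<eta> m f y\<bar> \<le> r * (2 * (1 - \<alpha>) + \<beta> * (\<gamma> * S + 2 * C))"
        by (rule main) (use minor A True in \<open>auto simp: S_def\<close>)
      also have "\<dots> \<le> r * (\<rho> * (2 + \<beta> * S))"
      proof (rule mult_left_mono)
        have "\<gamma> * (\<beta> * S) \<le> \<rho> * (\<beta> * S)" using \<rho> \<beta> S0 by (intro mult_right_mono) auto
        then show "2 * (1 - \<alpha>) + \<beta> * (\<gamma> * S + 2 * C) \<le> \<rho> * (2 + \<beta> * S)"
          using \<beta>C \<rho>(4) by (simp add: algebra_simps)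
      qed (use r in simp)
      finally show ?thesis .
    next
      case False
      have "\<bar>Q \<eta> m f x - Q \<eta> m f y\<bar> \<le> r * (2 + \<beta> * (\<gamma> * S + 2 * C))"
      proof (rule main)
        fix g :: "real^'n \<Rightarrow> real" assume "\<And>u. \<bar>g u\<bar> \<le> 1"
        then show "\<bar>Q \<eta> m g x - Q \<eta> m g y\<bar> \<le> 2"
          using Q_bound[of g 1 \<eta> m x] Q_bound[of g 1 \<eta> m y] by (simp add: abs_le_iff)
      qed
      also have "\<dots> \<le> r * (\<rho> * (2 + \<beta> * S))"
      proof (rule mult_left_mono)
        have "4 * C / (1 - \<gamma>) \<le> S" using False by (simp add: R_def)
        then have "2 * C \<le> (1 - \<gamma>) / 2 * S" using \<gamma> by (simp add: field_simps)
        then have "\<beta> * (\<gamma> * S + 2 * C) \<le> \<beta> * (\<gamma>1 * S)" using \<beta> unfolding \<gamma>1_def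
          by (intro mult_left_mono) (auto simp: field_simps)
        then have 1: "2 + \<beta> * (\<gamma> * S + 2 * C) \<le> 2 + \<gamma>1 * (\<beta> * S)" by (simp add: mult_ac)
        have "2 + \<gamma>1 * (\<beta> * S) = (2 + \<gamma>1 * (\<beta> * R)) + \<gamma>1 * (\<beta> * (S - R))" by (simp add: algebra_simps)
        also have "2 + \<gamma>1 * (\<beta> * R) = \<rho>1 * (2 + \<beta> * R)" using \<beta>R by (simp add: \<rho>1_def mult_ac)
        also have "\<rho>1 * (2 + \<beta> * R) + \<gamma>1 * (\<beta> * (S - R)) \<le> \<rho>1 * (2 + \<beta> * R) + \<rho>1 * (\<beta> * (S - R))"
          using \<rho>1 \<beta> False by (intro add_left_mono mult_right_mono) auto
        also have "\<dots> = \<rho>1 * (2 + \<beta> * S)" by (simp add: algebra_simps)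
        also have "\<dots> \<le> \<rho> * (2 + \<beta> * S)" using \<rho> \<beta> S0 by (intro mult_right_mono) auto
        finally show "2 + \<beta> * (\<gamma> * S + 2 * C) \<le> \<rho> * (2 + \<beta> * S)" using 1 by linarith
      qed (use r in simp)
      finally show ?thesis .
    qed
    then show "\<bar>Q \<eta> m f x - Q \<eta> m f y\<bar> \<le> (\<rho> * r) * (2 + \<beta> * V x + \<beta> * V y)"
      by (simp add: S_def algebra_simps)
  qed (use \<rho> \<beta> in auto)
qed

lemma step_t_shift: "step_t (shift \<eta> i) m = step_t \<eta> (i + m) - step_t \<eta> i"
proof (induction m)
  case (Suc m)
  then show ?case by (simp add: step_t_def shift_def)
qed (simp add: step_t_def)

text \<open>Stop when the elapsed time first reaches 1; a step is at most 1, so the overshoot is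
  too.\<close>

lemma split_unit_block:
  assumes \<eta>: "good \<eta>" and m: "1 \<le> step_t \<eta> m"
  obtains m1 where "m1 \<le> m" "1 \<le> step_t \<eta> m1" "step_t \<eta> m1 \<le> 2"
proof -
  define m1 where "m1 = (LEAST j. 1 \<le> step_t \<eta> j)"
  have 1: "1 \<le> step_t \<eta> m1" unfolding m1_def using m by (rule LeastI)
  have 2: "m1 \<le> m" unfolding m1_def using m by (rule Least_le)
  have "m1 \<noteq> 0" using 1 by (auto simp: step_t_def intro: gr0I)
  then obtain j where j: "m1 = Suc j" using not0_implies_Suc by blast
  have "\<not> 1 \<le> step_t \<eta> j" using j not_less_Least[of j "\<lambda>j. 1 \<le> step_t \<eta> j"] by (auto simp: m1_def)
  then have "step_t \<eta> m1 \<le> 2" using goodD(3)[OF \<eta>, of j] unfolding j by (simp add: step_t_def)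
  with 1 2 that show ?thesis by blast
qed

text \<open>A block of elapsed time between 1 and 2 contributes one contraction factor, and 2n units
  of time leave room for n such blocks. What is passed along the induction is the oscillation
  relative to V.\<close>

theorem Q_mixing:
  "\<exists>\<rho> \<beta>. 0 \<le> \<rho> \<and> \<rho> < 1 \<and> 0 < \<beta> \<and> (\<forall>n \<eta> m f x y. good \<eta> \<and> 2 * real n \<le> step_t \<eta> m \<and>
     f \<in> borel_measurable borel \<and> (\<forall>u. \<bar>f u\<bar> \<le> 1) \<longrightarrow>
     \<bar>Q \<eta> m f x - Q \<eta> m f y\<bar> \<le> \<rho> ^ n * (2 + \<beta> * V x + \<beta> * V y))"
proof -
  obtain \<rho> \<beta> where \<rho>: "0 \<le> \<rho>" "\<rho> < 1" and \<beta>: "0 < \<beta>" and H: "\<forall>\<eta> m f r B x y. good \<eta> \<and> 1 \<le> step_t \<eta> m \<and> step_t \<eta> m \<le> 2 \<and>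
     f \<in> borel_measurable borel \<and> (\<forall>u. \<bar>f u\<bar> \<le> B) \<and> 0 < r \<and>
     (\<forall>u v. \<bar>f u - f v\<bar> \<le> r * (2 + \<beta> * V u + \<beta> * V v)) \<longrightarrow>
     \<bar>Q \<eta> m f x - Q \<eta> m f y\<bar> \<le> (\<rho> * r) * (2 + \<beta> * V x + \<beta> * V y)"
    using Harris_contraction by blast
  \<comment> \<open>Harris' contraction is applied with \<open>r = \<rho>' ^ n\<close>, which must
    be positive; hence the lower bound 1/2.\<close>
  define \<rho>' where "\<rho>' = max \<rho> (1/2)"
  have \<rho>': "0 < \<rho>'" "\<rho>' < 1" "\<rho> \<le> \<rho>'" using \<rho> by (auto simp: \<rho>'_def)
  have bV: "0 \<le> 2 + \<beta> * V x + \<beta> * V y" for x y :: "real^'n" using \<beta> by (simp add: add_nonneg_nonneg)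
  have "\<bar>Q \<eta> m f x - Q \<eta> m f y\<bar> \<le> \<rho>' ^ n * (2 + \<beta> * V x + \<beta> * V y)"
    if "good \<eta>" "2 * real n \<le> step_t \<eta> m" "f \<in> borel_measurable borel" "\<And>u. \<bar>f u\<bar> \<le> 1" for n \<eta> m f x y
    using that
  proof (induction n arbitrary: \<eta> m x y)
    case 0
    have "\<bar>Q \<eta> m f x - Q \<eta> m f y\<bar> \<le> 2"
      using Q_bound[of f 1 \<eta> m x] Q_bound[of f 1 \<eta> m y] 0(4) by (simp add: abs_le_iff)
    moreover have "0 \<le> \<beta> * V x + \<beta> * V y" using \<beta> by (simp add: add_nonneg_nonneg)
    ultimately show ?case by simp
  next
    case (Suc n)
    obtain m1 where m1: "m1 \<le> m" "1 \<le> step_t \<eta> m1" "step_t \<eta> m1 \<le> 2"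
      using Suc.prems by (elim split_unit_block[of \<eta> m]) auto
    obtain m2 where m2: "m = m1 + m2" using m1 by (metis le_add_diff_inverse)
    define g where "g = Q (shift \<eta> m1) m2 f"
    have g: "g \<in> borel_measurable borel" "\<bar>g u\<bar> \<le> 1" for u
      unfolding g_def using Suc.prems by (auto intro: Q_bound)
    have "\<bar>g u - g v\<bar> \<le> \<rho>' ^ n * (2 + \<beta> * V u + \<beta> * V v)" for u v
      unfolding g_def using Suc.prems m1 m2
      by (intro Suc.IH good_shift) (auto simp: step_t_shift)
    then have "\<bar>Q \<eta> m1 g x - Q \<eta> m1 g y\<bar> \<le> (\<rho> * \<rho>' ^ n) * (2 + \<beta> * V x + \<beta> * V y)"
      using g m1 Suc.prems(1) \<rho>' by (intro H[rule_format, of \<eta> m1 g 1 "\<rho>' ^ n"]) auto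
    also have "\<dots> \<le> (\<rho>' * \<rho>' ^ n) * (2 + \<beta> * V x + \<beta> * V y)"
      using \<rho>' bV by (intro mult_right_mono) auto
    finally show ?case
      unfolding m2 g_def using Q_add[OF Suc.prems(3,4)] by simp
  qed
  then show ?thesis using \<rho>' \<beta> by (rule_tac exI[of _ \<rho>'], rule_tac exI[of _ \<beta>]) auto
qed

end

section \<open>Euler schemes and the invariant measure\<close>

text \<open>The noise is additive, so it cancels from the difference of the two recursions and the
  comparison is pathwise: only the oscillation \<rho> of the solution within a step enters,
  amplified by a discrete Gronwall argument.\<close>

lemma euler_path_error:
  fixes X w :: "real \<Rightarrow> 'a::euclidean_space" and b :: "'a \<Rightarrow> 'a"
  assumes L: "0 \<le> L" and Lip: "\<And>x y. norm (b x - b y) \<le> L * norm (x - y)" and bc: "continuous_on UNIV b"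
    and X: "continuous_on {0..S} X"
    and eq: "\<And>t. t \<in> {0..S} \<Longrightarrow> X t = x + integral {0..t} (\<lambda>s. b (X s)) + w t" and w0: "w 0 = 0"
    and e: "\<And>k. k \<ge> 1 \<Longrightarrow> 0 < e k" and m: "step_t e m \<le> S"
    and osc: "\<And>u v. u \<in> {0..S} \<Longrightarrow> v \<in> {0..S} \<Longrightarrow> \<bar>u - v\<bar> \<le> \<delta> \<Longrightarrow> norm (X u - X v) \<le> \<rho>"
    and e\<delta>: "\<And>k. 1 \<le> k \<Longrightarrow> k \<le> m \<Longrightarrow> e k \<le> \<delta>" and \<rho>: "0 \<le> \<rho>"
    and \<theta>0: "\<theta> 0 = x"
    and \<theta>: "\<And>k. \<theta> (Suc k) = \<theta> k + e (Suc k) *\<^sub>R b (\<theta> k) + (w (step_t e (Suc k)) - w (step_t e k))"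
  shows "k \<le> m \<Longrightarrow> norm (X (step_t e k) - \<theta> k) \<le> (exp (L * step_t e k) - 1) * \<rho>"
proof (induction k)
  case 0
  have "0 \<le> S" using m order_trans[OF sum_nonneg[of "{1..m}" e] m[unfolded step_t_def]] e by fastforce
  then show ?case using eq[of 0] w0 \<theta>0 by (simp add: step_t_def)
next
  case (Suc k)
  let ?s = "step_t e k" and ?s' = "step_t e (Suc k)" and ?e = "e (Suc k)"
  have s': "?s' = ?s + ?e" by (simp add: step_t_def)
  have e0: "0 < ?e" by (rule e) simp
  have s0: "0 \<le> ?s" unfolding step_t_def by (intro sum_nonneg) (use e in \<open>auto intro: less_imp_le\<close>)
  have "?s' \<le> step_t e m"
    unfolding step_t_def by (rule sum_mono2) (use Suc.prems e in \<open>auto intro: less_imp_le\<close>)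
  then have s'S: "?s' \<le> S" using m by linarith
  define r where "r = norm (X ?s - \<theta> k)"
  have bX: "continuous_on {0..S} (\<lambda>u. b (X u))"
    by (rule continuous_on_compose2[OF bc X]) auto
  have sub: "continuous_on {0..?s'} (\<lambda>u. b (X u))" "continuous_on {?s..?s'} (\<lambda>u. b (X u))"
    using s0 s'S by (auto intro!: continuous_on_subset[OF bX])
  have comb: "integral {0..?s'} (\<lambda>u. b (X u)) = integral {0..?s} (\<lambda>u. b (X u)) + integral {?s..?s'} (\<lambda>u. b (X u))"
    using s0 e0 s' by (intro Henstock_Kurzweil_Integration.integral_combine[symmetric] integrable_continuous_interval sub) auto
  have cst: "integral {?s..?s'} (\<lambda>u. b (\<theta> k)) = ?e *\<^sub>R b (\<theta> k)"
    using e0 s' by simp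
  have "X ?s' - \<theta> (Suc k) = (X ?s - \<theta> k) + (integral {?s..?s'} (\<lambda>u. b (X u)) - ?e *\<^sub>R b (\<theta> k))"
    using eq[of ?s] eq[of ?s'] s0 s'S e0 s' comb \<theta>[of k] by (simp add: algebra_simps)
  also have "integral {?s..?s'} (\<lambda>u. b (X u)) - ?e *\<^sub>R b (\<theta> k) = integral {?s..?s'} (\<lambda>u. b (X u) - b (\<theta> k))"
    unfolding cst[symmetric] by (intro integral_diff[symmetric] integrable_continuous_interval sub) auto
  finally have "norm (X ?s' - \<theta> (Suc k)) \<le> r + norm (integral {?s..?s'} (\<lambda>u. b (X u) - b (\<theta> k)))"
    unfolding r_def by (metis norm_triangle_ineq)
  also have "norm (integral {?s..?s'} (\<lambda>u. b (X u) - b (\<theta> k))) \<le> L * (\<rho> + r) * (?s' - ?s)"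
  proof (rule integral_bound)
    show "continuous_on {?s..?s'} (\<lambda>u. b (X u) - b (\<theta> k))" by (intro continuous_intros sub)
    fix u assume u: "u \<in> {?s..?s'}"
    have "?e \<le> \<delta>" using e\<delta> Suc.prems by simp
    then have "norm (X u - X ?s) \<le> \<rho>" using u s0 s'S s' by (intro osc) auto
    moreover have "norm (X u - \<theta> k) \<le> norm (X u - X ?s) + norm (X ?s - \<theta> k)"
      using norm_triangle_ineq[of "X u - X ?s" "X ?s - \<theta> k"] by simp
    ultimately have "norm (X u - \<theta> k) \<le> \<rho> + r" by (simp add: r_def)
    then have "L * norm (X u - \<theta> k) \<le> L * (\<rho> + r)" using L by (intro mult_left_mono)
    then show "norm (b (X u) - b (\<theta> k)) \<le> L * (\<rho> + r)" using Lip order_trans by blast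
  qed (use e0 s' in simp)
  finally have "norm (X ?s' - \<theta> (Suc k)) \<le> (1 + ?e * L) * r + ?e * L * \<rho>"
    by (simp add: s' algebra_simps)
  also have "\<dots> \<le> (1 + ?e * L) * ((exp (L * ?s) - 1) * \<rho>) + ?e * L * \<rho>"
    using Suc L e0 by (intro add_right_mono mult_left_mono) (auto simp: r_def)
  also have "\<dots> = ((1 + L * ?e) * exp (L * ?s) - 1) * \<rho>" by (simp add: algebra_simps)
  also have "\<dots> \<le> (exp (L * ?e) * exp (L * ?s) - 1) * \<rho>"
    using \<rho> by (intro mult_right_mono diff_right_mono exp_ge_add_one_self) auto
  also have "\<dots> = (exp (L * ?s') - 1) * \<rho>" by (simp add: s' exp_add[symmetric] algebra_simps)
  finally show ?case .
qed

text \<open>Brownian increments are numbered from 0, the noise from 1. Independence of an infinite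
  family concerns finite subfamilies only, and those lie in an initial segment.\<close>

lemma (in prob_space) indep_vars_reindex_pred:
  assumes "\<And>m. indep_vars (\<lambda>_. borel) (\<lambda>i w. Y (Suc i) w :: 'b::euclidean_space) {..<m::nat}"
  shows "indep_vars (\<lambda>_. borel) Y {1::nat..}"
  unfolding indep_vars_def
proof (intro conjI ballI)
  fix i :: nat assume "i \<in> {1..}"
  then obtain j where "i = Suc j" by (auto dest: le_Suc_ex)
  then show "Y i \<in> measurable M borel"
    using assms[of "Suc j"] by (auto simp: indep_vars_def)
next
  let ?G = "\<lambda>i. sigma_sets (space M) {Y i -` A \<inter> space M |A. A \<in> sets borel}"
  show "indep_sets ?G {1..}"
  proof (rule indep_setsI)
    fix i :: nat assume "i \<in> {1..}"
    then obtain j where j: "i = Suc j" by (auto dest: le_Suc_ex)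
    then have "Y i \<in> measurable M borel"
      using assms[of "Suc j"] by (auto simp: indep_vars_def)
    then show "?G i \<subseteq> events" by (auto intro!: sets.sigma_sets_subset measurable_sets)
  next
    fix A J assume J: "J \<noteq> {}" "J \<subseteq> {1::nat..}" "finite J" and A: "\<forall>j\<in>J. A j \<in> ?G j"
    define J' where "J' = (\<lambda>j. j - 1) ` J"
    have JJ': "J = Suc ` J'" using J by (force simp: J'_def image_image)
    define m where "m = Suc (Max J')"
    have J'm: "J' \<noteq> {}" "J' \<subseteq> {..<m}" "finite J'" using J by (auto simp: J'_def m_def less_Suc_eq_le)
    have "indep_sets (\<lambda>i. sigma_sets (space M) {Y (Suc i) -` A \<inter> space M |A. A \<in> sets borel}) {..<m}"
      using assms[of m] by (simp add: indep_vars_def)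
    from indep_setsD[OF this J'm(2,1,3), of "\<lambda>i. A (Suc i)"] A
    have "prob (\<Inter>j\<in>J'. A (Suc j)) = (\<Prod>j\<in>J'. prob (A (Suc j)))" by (auto simp: JJ')
    then show "prob (\<Inter>j\<in>J. A j) = (\<Prod>j\<in>J. prob (A j))"
      unfolding JJ' by (simp add: prod.reindex)
  qed
qed

text \<open>With these normalized increments as noise, the chain becomes the Euler scheme driven by
  the same Brownian path as the diffusion.\<close>

definition bm_noise :: "(real \<Rightarrow> 'w \<Rightarrow> 'a::euclidean_space) \<Rightarrow> (nat \<Rightarrow> real) \<Rightarrow> nat \<Rightarrow> 'w \<Rightarrow> 'a" where
  "bm_noise B e k w = (1 / sqrt (e k)) *\<^sub>R (B (step_t e k) w - B (step_t e (k - 1)) w)"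

lemma step_t_Suc [simp]: "step_t e (Suc k) = step_t e k + e (Suc k)"
  and step_t_0 [simp]: "step_t e 0 = 0"
  by (simp_all add: step_t_def)

lemma gauss_seq_bm_noise:
  fixes B :: "real \<Rightarrow> 'w \<Rightarrow> real^'n"
  assumes B: "brownian_motion M B" and e: "\<And>k. k \<ge> 1 \<Longrightarrow> 0 < e k"
  shows "gauss_seq M (bm_noise B e)"
proof -
  interpret prob_space M using B by (simp add: brownian_motion_def)
  have mono: "strict_mono (step_t e)"
    unfolding strict_mono_Suc_iff using e by simp
  show ?thesis
  proof
    show "indep_vars (\<lambda>_. borel) (bm_noise B e) {1..}"
    proof (rule indep_vars_reindex_pred)
      fix m
      have "indep_vars (\<lambda>_. borel) (\<lambda>i w. B (step_t e (Suc i)) w - B (step_t e i) w) {..<m}"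
        using B mono unfolding brownian_motion_def by (auto simp del: step_t_Suc)
      from indep_vars_compose2[OF this, of "\<lambda>i x. (1 / sqrt (e (Suc i))) *\<^sub>R x" "\<lambda>_. borel"]
      show "indep_vars (\<lambda>_. borel) (\<lambda>i w. bm_noise B e (Suc i) w) {..<m}"
        by (simp add: bm_noise_def del: step_t_Suc)
    qed
    fix k :: nat assume k: "1 \<le> k"
    then obtain j where j: "k = Suc j" by (cases k) auto
    have s: "0 \<le> step_t e j" unfolding step_t_def by (intro sum_nonneg) (use e in \<open>auto intro: less_imp_le\<close>)
    have "0 \<le> step_t e j \<and> step_t e j < step_t e k" using s e[OF k] by (simp add: j)
    then have "distributed M lborel (\<lambda>w. B (step_t e k) w - B (step_t e j) w) (gaussian_density (step_t e k - step_t e j))"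
      using B unfolding brownian_motion_def by blast
    moreover have "step_t e k - step_t e j = e k" by (simp add: j)
    ultimately have "distributed M lborel (\<lambda>w. B (step_t e k) w - B (step_t e j) w) (gaussian_density (e k))"
      by simp
    from distributed_gaussian_scale[OF this e[OF k]]
    show "distr M borel (bm_noise B e k) = std_gauss"
      unfolding bm_noise_def[abs_def] by (simp add: j del: step_t_Suc)
  qed
qed

lemma measurable_augmented_filtration:
  assumes B: "brownian_motion M B" and f: "f \<in> measurable (augmented_filtration M B t) S"
  shows "f \<in> measurable M S"
proof (rule measurable_mono_sets[OF _ _ f])
  let ?G = "{B s -` A \<inter> space M | s A. s \<in> {0..t} \<and> A \<in> sets borel} \<union> null_sets M"
  have G: "?G \<subseteq> sets M"
    using B by (auto simp: brownian_motion_def null_sets_def)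
  then have "?G \<subseteq> Pow (space M)" using sets.sets_into_space by blast
  then show "sets (augmented_filtration M B t) \<subseteq> sets M"
    unfolding augmented_filtration_def using sets.sigma_sets_subset[OF G] by simp
  show "space (augmented_filtration M B t) = space M"
    unfolding augmented_filtration_def by (simp add: space_measure_of_conv)
qed

locale sde_sys = em_sys N \<xi> b \<sigma> L \<kappa> \<kappa>' \<sigma>i c0 C0 es
  for N :: "'v measure" and \<xi> :: "nat \<Rightarrow> 'v \<Rightarrow> real^'n" and b \<sigma> L \<kappa> \<kappa>' \<sigma>i c0 C0 es +
  fixes M :: "'w measure" and B :: "real \<Rightarrow> 'w \<Rightarrow> real^'n" and X :: "real^'n \<Rightarrow> real \<Rightarrow> 'w \<Rightarrow> real^'n"
    and \<pi> :: "(real^'n) measure"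
  assumes bm: "brownian_motion M B" and sol: "\<And>x. strong_solution M B b \<sigma> x (X x)"
    and inv: "invariant_measure M X \<pi>"
begin

lemma M_prob: "prob_space M" using bm by (simp add: brownian_motion_def)

lemma \<pi>_prob: "prob_space \<pi>" and sets_\<pi> [simp, measurable_cong]: "sets \<pi> = sets borel"
  using inv by (auto simp: invariant_measure_def)

lemma space_\<pi> [simp]: "space \<pi> = UNIV" using sets_eq_imp_space_eq[OF sets_\<pi>] by simp

lemma X_meas: "0 \<le> t \<Longrightarrow> X x t \<in> borel_measurable M"
  using sol[of x] measurable_augmented_filtration[OF bm] unfolding strong_solution_def by blast

lemma b_cont: "continuous_on UNIV b"
proof (rule lipschitz_on_continuous_on)
  show "L-lipschitz_on UNIV b" by (rule lipschitz_onI) (use Lip L0 in \<open>auto simp: dist_norm\<close>)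
qed

text \<open>The schemes may change arbitrarily with \<open>n\<close> as long as the mesh tends to 0
  and the horizon stays below \<open>S\<close>. On the space of the Brownian motion the error tends
  to 0 for almost every path, and dominated convergence turns this into convergence of
  expectations.\<close>

lemma euler_scheme_converges:
  assumes e: "\<And>n k. k \<ge> 1 \<Longrightarrow> 0 < e n k" and m: "\<And>n. step_t (e n) (m n) \<le> S"
    and \<delta>: "\<delta> \<longlonglongrightarrow> 0" and e\<delta>: "\<And>n k. 1 \<le> k \<Longrightarrow> k \<le> m n \<Longrightarrow> e n k \<le> \<delta> n"
    and f: "continuous_on UNIV f" and fB: "\<And>u. \<bar>f u\<bar> \<le> C"
  shows "(\<lambda>n. Q (e n) (m n) f x - (\<integral>w. f (X x (step_t (e n) (m n)) w) \<partial>M)) \<longlonglongrightarrow> 0"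
proof -
  interpret M: prob_space M by (rule M_prob)
  have fm[measurable]: "f \<in> borel_measurable borel" using f by (rule borel_measurable_continuous_onI)
  have em: "em_law M (bm_noise B (e n)) b" for n
    unfolding em_law_def em_law_axioms_def using gauss_seq_bm_noise[OF bm e] b_meas by auto
  let ?\<theta> = "\<lambda>n w k. em_chain b \<sigma> (e n) x (bm_noise B (e n)) k w"
  have \<theta>m[measurable]: "(\<lambda>w. ?\<theta> n w k) \<in> borel_measurable M" for n k
    by (rule em_law.chain_N[OF em])
  have s0: "0 \<le> step_t (e n) k" for n k
    unfolding step_t_def by (intro sum_nonneg) (use e in \<open>auto intro: less_imp_le\<close>)
  have Xm[measurable]: "X x (step_t (e n) k) \<in> borel_measurable M" for n k
    by (rule X_meas[OF s0])
  have Qeq: "Q (e n) (m n) f x = (\<integral>w. f (?\<theta> n w (m n)) \<partial>M)" for n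
    using Q_cong_space[OF em_law_axioms em[of n] fm fB] unfolding em_law.Q_def[OF em] .
  have int: "integrable M (\<lambda>w. f (?\<theta> n w (m n)))" "integrable M (\<lambda>w. f (X x (step_t (e n) (m n)) w))" for n
    using fB by (intro M.integrable_const_bound[where B=C]; simp)+
  have "(\<lambda>n. \<integral>w. f (?\<theta> n w (m n)) - f (X x (step_t (e n) (m n)) w) \<partial>M) \<longlonglongrightarrow> (\<integral>w. 0 \<partial>M)"
  proof (rule integral_dominated_convergence[where w="\<lambda>_. 2 * C"])
    show "AE w in M. norm (f (?\<theta> n w (m n)) - f (X x (step_t (e n) (m n)) w)) \<le> 2 * C" for n
    proof (rule AE_I2)
      fix w
      show "norm (f (?\<theta> n w (m n)) - f (X x (step_t (e n) (m n)) w)) \<le> 2 * C"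
        using fB[of "?\<theta> n w (m n)"] fB[of "X x (step_t (e n) (m n)) w"] by (simp add: abs_le_iff)
    qed
    have ae1: "AE w in M. \<forall>t\<ge>0. X x t w = x + integral {0..t} (\<lambda>s. b (X x s w)) + \<sigma> *v B t w"
      using sol[of x] by (simp add: strong_solution_def)
    have ae2: "AE w in M. B 0 w = 0" using bm by (simp add: brownian_motion_def)
    have ae3: "AE w in M. continuous_on {0..} (\<lambda>t. X x t w)"
      using sol[of x] by (auto simp: strong_solution_def intro!: AE_I2)
    show "AE w in M. (\<lambda>n. f (?\<theta> n w (m n)) - f (X x (step_t (e n) (m n)) w)) \<longlonglongrightarrow> 0"
      using ae1 ae2 ae3
    proof eventually_elim
      fix w
      assume eq: "\<forall>t\<ge>0. X x t w = x + integral {0..t} (\<lambda>s. b (X x s w)) + \<sigma> *v B t w"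
        and B0: "B 0 w = 0" and cX: "continuous_on {0..} (\<lambda>t. X x t w)"
      have S0: "0 \<le> S" using s0[of 0 "m 0"] m[of 0] by simp
      have cXS: "continuous_on {0..S} (\<lambda>t. X x t w)" by (rule continuous_on_subset[OF cX]) auto
      have "bounded ((\<lambda>t. X x t w) ` {0..S})"
        by (intro compact_imp_bounded compact_continuous_image cXS) auto
      then obtain R where "\<forall>y\<in>(\<lambda>t. X x t w) ` {0..S}. norm y \<le> R" unfolding bounded_iff by blast
      then have R: "norm (X x t w) \<le> R" if "t \<in> {0..S}" for t using that by blast
      have uf: "uniformly_continuous_on (cball 0 (R + 1)) f"
        by (rule compact_uniformly_continuous) (auto intro: continuous_on_subset[OF f])
      have uX: "uniformly_continuous_on {0..S} (\<lambda>t. X x t w)"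
        by (rule compact_uniformly_continuous[OF cXS]) auto
      show "(\<lambda>n. f (?\<theta> n w (m n)) - f (X x (step_t (e n) (m n)) w)) \<longlonglongrightarrow> 0"
      proof (rule LIMSEQ_I)
        fix r :: real assume r: "0 < r"
        obtain d where d: "0 < d" "\<And>u v. u \<in> cball 0 (R+1) \<Longrightarrow> v \<in> cball 0 (R+1) \<Longrightarrow> dist v u < d \<Longrightarrow> dist (f v) (f u) < r"
          using uf r unfolding uniformly_continuous_on_def by metis
        \<comment> \<open>After the Gronwall factor the error is at most half of \<open>d\<close>
          and of 1: close enough for \<open>f\<close>, and not leaving the ball of radius
          \<open>R + 1\<close>.\<close>
        define \<rho> where "\<rho> = min d 1 / (2 * exp (L * S))"
        have \<rho>: "0 < \<rho>" using d by (simp add: \<rho>_def)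
        obtain d' where d': "0 < d'" "\<And>u v. u \<in> {0..S} \<Longrightarrow> v \<in> {0..S} \<Longrightarrow> dist v u < d' \<Longrightarrow> dist (X x v w) (X x u w) < \<rho>"
          using uX \<rho> unfolding uniformly_continuous_on_def by metis
        obtain n0 where n0: "\<And>n. n \<ge> n0 \<Longrightarrow> \<bar>\<delta> n\<bar> < d'"
          using LIMSEQ_D[OF \<delta> d'(1)] by auto
        show "\<exists>no. \<forall>n\<ge>no. norm (f (?\<theta> n w (m n)) - f (X x (step_t (e n) (m n)) w) - 0) < r"
        proof (intro exI allI impI)
          fix n assume n: "n \<ge> n0"
          have err: "norm (X x (step_t (e n) (m n)) w - ?\<theta> n w (m n)) \<le> (exp (L * step_t (e n) (m n)) - 1) * \<rho>"
          proof (rule euler_path_error[where X="\<lambda>t. X x t w" and w="\<lambda>t. \<sigma> *v B t w" and \<theta>="?\<theta> n w" and \<delta>="\<delta> n"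
                and e="e n" and x=x and k="m n" and m="m n", OF L0 Lip b_cont cXS])
            show "norm (X x u w - X x v w) \<le> \<rho>" if "u \<in> {0..S}" "v \<in> {0..S}" "\<bar>u - v\<bar> \<le> \<delta> n" for u v
              using d'(2)[of v u] n0[OF n] that by (auto simp: dist_norm)
            show "?\<theta> n w (Suc k) = ?\<theta> n w k + e n (Suc k) *\<^sub>R b (?\<theta> n w k)
                + (\<sigma> *v B (step_t (e n) (Suc k)) w - \<sigma> *v B (step_t (e n) k) w)" for k
              using e[of "Suc k" n]
              by (simp add: bm_noise_def matrix_vector_mult_scaleR matrix_vector_mult_diff_distrib del: step_t_Suc)
          qed (use eq B0 e e\<delta> m \<rho> in auto)
          also have "\<dots> \<le> exp (L * S) * \<rho>"
          proof (rule mult_right_mono)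
            have "exp (L * step_t (e n) (m n)) \<le> exp (L * S)" using m[of n] L0 by (simp add: mult_left_mono)
            then show "exp (L * step_t (e n) (m n)) - 1 \<le> exp (L * S)" by linarith
          qed (use \<rho> in simp)
          also have "\<dots> = min d 1 / 2" by (simp add: \<rho>_def)
          finally have err': "norm (X x (step_t (e n) (m n)) w - ?\<theta> n w (m n)) \<le> min d 1 / 2" .
          have nX: "norm (X x (step_t (e n) (m n)) w) \<le> R" using R s0 m by auto
          have "norm (?\<theta> n w (m n)) \<le> R + 1"
            using norm_triangle_ineq2[of "?\<theta> n w (m n)" "X x (step_t (e n) (m n)) w"] err' nX d(1)
            by (simp add: norm_minus_commute min_def split: if_splits)
          then have "dist (f (?\<theta> n w (m n))) (f (X x (step_t (e n) (m n)) w)) < r"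
            using nX err' d(1) by (intro d(2)) (auto simp: dist_norm norm_minus_commute min_def split: if_splits)
          then show "norm (f (?\<theta> n w (m n)) - f (X x (step_t (e n) (m n)) w) - 0) < r"
            by (simp add: dist_norm)
        qed
      qed
    qed
  qed simp_all
  then show ?thesis unfolding Qeq using int by simp
qed

section \<open>Transition kernels of the diffusion\<close>

definition kern :: "real \<Rightarrow> real^'n \<Rightarrow> (real^'n) measure" where
  "kern t x = distr M borel (X x t)"

lemma kern_integral: "0 \<le> t \<Longrightarrow> f \<in> borel_measurable borel \<Longrightarrow> (\<integral>u. f u \<partial>kern t x) = (\<integral>w. (f (X x t w) :: real) \<partial>M)"
  unfolding kern_def by (rule integral_distr[OF X_meas])

text \<open>\<open>strong_solution\<close> says nothing on how the solution depends on its initial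
  point. Measurability in \<open>x\<close> is inherited from the Euler operators with
  \<open>n + 1\<close> equal steps, which converge pointwise.\<close>

lemma kern_integral_meas:
  fixes f :: "real^'n \<Rightarrow> real"
  assumes t: "0 < t" and f: "continuous_on UNIV f" and fB: "\<And>u. \<bar>f u\<bar> \<le> C"
  shows "(\<lambda>x. \<integral>u. f u \<partial>kern t x) \<in> borel_measurable borel"
proof -
  have fm[measurable]: "f \<in> borel_measurable borel" using f by (rule borel_measurable_continuous_onI)
  let ?e = "\<lambda>n (_::nat). t / real (Suc n)"
  have st: "step_t (?e n) (Suc n) = t" for n by (simp add: step_t_def)
  show ?thesis
  proof (rule borel_measurable_LIMSEQ_real)
    show "(\<lambda>n. Q (?e n) (Suc n) f x) \<longlonglongrightarrow> (\<integral>u. f u \<partial>kern t x)" for x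
    proof -
      have "(\<lambda>n. Q (?e n) (Suc n) f x - (\<integral>w. f (X x (step_t (?e n) (Suc n)) w) \<partial>M)) \<longlonglongrightarrow> 0"
      proof (rule euler_scheme_converges[where \<delta>="\<lambda>n. t / real (Suc n)" and S=t, OF _ _ _ _ f fB])
        show "(\<lambda>n. t / real (Suc n)) \<longlonglongrightarrow> 0"
          using LIMSEQ_Suc[OF lim_const_over_n[of t]] by simp
      qed (use t in \<open>simp_all add: st del: step_t_Suc of_nat_Suc\<close>)
      then show ?thesis unfolding st using t by (simp add: kern_integral LIM_zero_iff)
    qed
  qed (rule Q_meas[OF fm])
qed

text \<open>Closed sets generate the Borel sets and are stable under intersection, and the indicator
  of a nonempty closed set is a limit of the continuous functions \<open>h n\<close>, to which
  \<open>kern_integral_meas\<close> applies.\<close>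

lemma kern_measurable:
  assumes t: "0 < t"
  shows "kern t \<in> measurable borel (prob_algebra borel)"
proof (rule measurable_prob_algebra_generated[where \<Omega>=UNIV and G="{C. closed C}"])
  show "sets borel = sigma_sets UNIV {C::(real^'n) set. closed C}" by (simp add: borel_eq_closed)
  show "Int_stable {C::(real^'n) set. closed C}" by (auto simp: Int_stable_def)
  show pk: "prob_space (kern t a)" for a
    unfolding kern_def using t by (intro prob_space.prob_space_distr[OF M_prob] X_meas) simp
  show "sets (kern t a) = sets borel" for a by (simp add: kern_def)
  fix C :: "(real^'n) set" assume "C \<in> {C. closed C}"
  then have C: "closed C" by simp
  show "(\<lambda>a. emeasure (kern t a) C) \<in> borel_measurable borel"
  proof (cases "C = {}")
    case False
    define h where "h n u = max 0 (1 - real n * infdist u C)" for n and u :: "real^'n"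
    have hc: "continuous_on UNIV (h n)" for n
      unfolding h_def by (intro continuous_intros)
    have hm[measurable]: "h n \<in> borel_measurable borel" for n using hc by (rule borel_measurable_continuous_onI)
    have hb: "\<bar>h n u\<bar> \<le> 1" for n u by (auto simp: h_def infdist_nonneg)
    have hl: "(\<lambda>n. h n u) \<longlonglongrightarrow> indicator C u" for u
    proof (cases "u \<in> C")
      case True
      then have "infdist u C = 0" by simp
      then show ?thesis using True by (simp add: h_def)
    next
      case u: False
      have "0 < infdist u C" using C False u by (simp add: infdist_pos_not_in_closed)
      then obtain n0 where n0: "1 < real n0 * infdist u C" using reals_Archimedean3 by blast
      have "h n u = 0" if "n \<ge> n0" for n
      proof -
        have "real n0 * infdist u C \<le> real n * infdist u C" using that by (intro mult_right_mono) (auto simp: infdist_nonneg)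
        then show ?thesis using n0 by (simp add: h_def)
      qed
      then have "\<forall>\<^sub>F n in sequentially. h n u = indicator C u" using u by (auto simp: eventually_sequentially)
      then show ?thesis by (rule tendsto_eventually)
    qed
    have Cm[measurable]: "C \<in> sets borel" using C by (rule borel_closed)
    have "(\<lambda>a. measure (kern t a) C) \<in> borel_measurable borel"
    proof (rule borel_measurable_LIMSEQ_real)
      fix a
      interpret K: prob_space "kern t a" by (rule pk)
      have sK[measurable_cong]: "sets (kern t a) = sets borel" by (simp add: kern_def)
      have "(\<lambda>n. \<integral>u. h n u \<partial>kern t a) \<longlonglongrightarrow> (\<integral>u. indicator C u \<partial>kern t a)"
        by (rule integral_dominated_convergence[where w="\<lambda>_. 1"]) (use hl hb in auto)
      then show "(\<lambda>n. \<integral>u. h n u \<partial>kern t a) \<longlonglongrightarrow> measure (kern t a) C"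
        using sets_eq_imp_space_eq[OF sK] by simp
    qed (rule kern_integral_meas[OF t hc hb])
    moreover have "emeasure (kern t a) C = ennreal (measure (kern t a) C)" for a
    proof -
      interpret K: prob_space "kern t a" by (rule pk)
      show ?thesis by (rule K.emeasure_eq_measure)
    qed
    ultimately show ?thesis by simp
  qed simp
qed simp_all

text \<open>Invariance is given for sets; read as \<open>\<pi> \<bind> kern t = \<pi>\<close> it
  extends to functions.\<close>

lemma kern_invariant:
  assumes t: "0 < t" and f[measurable]: "f \<in> borel_measurable borel" and fB: "\<And>u. \<bar>f u\<bar> \<le> C"
  shows "(\<integral>x. (\<integral>u. f u \<partial>kern t x) \<partial>\<pi>) = (\<integral>x. (f x :: real) \<partial>\<pi>)"
proof -
  interpret P: prob_space \<pi> by (rule \<pi>_prob)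
  have K: "kern t \<in> measurable \<pi> (prob_algebra borel)"
    using kern_measurable[OF t] by (simp cong: measurable_cong_sets)
  have Ks: "kern t \<in> measurable \<pi> (subprob_algebra borel)" using K by (rule measurable_prob_algebraD)
  have eq: "\<pi> \<bind> kern t = \<pi>"
  proof (rule measure_eqI)
    have sb: "sets (\<pi> \<bind> kern t) = sets borel" by (rule sets_bind) (auto simp: kern_def)
    then show "sets (\<pi> \<bind> kern t) = sets \<pi>" by simp
    fix A assume "A \<in> sets (\<pi> \<bind> kern t)"
    then have A: "A \<in> sets borel" using sb by simp
    have "emeasure (\<pi> \<bind> kern t) A = (\<integral>\<^sup>+x. emeasure (kern t x) A \<partial>\<pi>)"
      by (rule emeasure_bind[OF _ Ks A]) simp
    also have "\<dots> = emeasure \<pi> A"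
      using inv t A unfolding invariant_measure_def kern_def by auto
    finally show "emeasure (\<pi> \<bind> kern t) A = emeasure \<pi> A" .
  qed
  have pk: "prob_space (kern t a)" for a
    unfolding kern_def using t by (intro prob_space.prob_space_distr[OF M_prob] X_meas) simp
  have pos: "(\<integral>x. (\<integral>u. g u \<partial>kern t x) \<partial>\<pi>) = (\<integral>x. g x \<partial>\<pi>)"
    if [measurable]: "g \<in> borel_measurable borel" and g0: "\<And>u. 0 \<le> g u" and gB: "\<And>u. g u \<le> 2 * C" for g :: "real^'n \<Rightarrow> real"
  proof -
    have nn: "(\<integral>\<^sup>+u. ennreal (g u) \<partial>kern t x) = ennreal (\<integral>u. g u \<partial>kern t x)" for x
    proof -
      interpret Kx: prob_space "kern t x" by (rule pk)
      have [measurable_cong]: "sets (kern t x) = sets borel" by (simp add: kern_def)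
      show ?thesis using g0 gB by (intro nn_integral_eq_integral Kx.integrable_const_bound[where B="2 * C"]) auto
    qed
    have "(\<integral>\<^sup>+x. ennreal (g x) \<partial>\<pi>) = (\<integral>\<^sup>+x. ennreal (g x) \<partial>(\<pi> \<bind> kern t))" by (simp add: eq)
    also have "\<dots> = (\<integral>\<^sup>+x. (\<integral>\<^sup>+u. ennreal (g u) \<partial>kern t x) \<partial>\<pi>)" by (rule nn_integral_bind[OF _ Ks]) simp
    also have "\<dots> = (\<integral>\<^sup>+x. ennreal (\<integral>u. g u \<partial>kern t x) \<partial>\<pi>)" by (simp add: nn)
    finally have 1: "(\<integral>\<^sup>+x. ennreal (g x) \<partial>\<pi>) = (\<integral>\<^sup>+x. ennreal (\<integral>u. g u \<partial>kern t x) \<partial>\<pi>)" .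
    have m: "(\<lambda>x. \<integral>u. g u \<partial>kern t x) \<in> borel_measurable \<pi>"
      by (rule measurable_compose[OF Ks]) (simp add: integral_measurable_subprob_algebra)
    show ?thesis
      using 1 g0 m by (simp add: integral_eq_nn_integral)
  qed
  have int: "integrable (kern t x) f" for x
  proof -
    interpret Kx: prob_space "kern t x" by (rule pk)
    have [measurable_cong]: "sets (kern t x) = sets borel" by (simp add: kern_def)
    show ?thesis using fB by (intro Kx.integrable_const_bound[where B=C]) auto
  qed
  \<comment> \<open>Adding \<open>C\<close> makes the function nonnegative, so that the nonnegative
    integral can be used.\<close>
  have "(\<integral>x. (\<integral>u. f u + C \<partial>kern t x) \<partial>\<pi>) = (\<integral>x. f x + C \<partial>\<pi>)"
    by (rule pos) (use fB in \<open>auto simp: abs_le_iff\<close>, smt (verit, best) fB abs_le_iff)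
  moreover have "(\<integral>u. f u + C \<partial>kern t x) = (\<integral>u. f u \<partial>kern t x) + C" for x
  proof -
    interpret Kx: prob_space "kern t x" by (rule pk)
    show ?thesis using int by (simp add: Kx.prob_space)
  qed
  moreover have "integrable \<pi> (\<lambda>x. \<integral>u. f u \<partial>kern t x)"
  proof (rule P.integrable_const_bound[where B=C])
    show "(\<lambda>x. \<integral>u. f u \<partial>kern t x) \<in> borel_measurable \<pi>"
      by (rule measurable_compose[OF Ks]) (simp add: integral_measurable_subprob_algebra)
    show "AE x in \<pi>. norm (\<integral>u. f u \<partial>kern t x) \<le> C"
      using integral_prob_bounded[OF pk fB] by simp
  qed
  moreover have "integrable \<pi> f"
    using fB by (intro P.integrable_const_bound[where B=C]) auto
  ultimately show ?thesis by (simp add: P.prob_space[simplified])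
qed

end

section \<open>Decorrelation along the chain\<close>

lemma step_T_eq: "step_T \<eta> n = (\<Sum>j<n. inverse (\<eta> (Suc j)))"
  unfolding step_T_def by (rule sum.reindex_bij_witness[of _ Suc "\<lambda>i. i - 1"]) auto

text \<open>The elapsed time between the first and the last index of the window is less than 2S; the
  step taken at the last index may reach beyond and adds at most 1.\<close>

lemma sum_steps_in_window:
  assumes e: "\<And>k. 0 < \<eta> (Suc k) \<and> \<eta> (Suc k) \<le> (1::real)" and S: "0 \<le> S"
  shows "(\<Sum>j\<in>{j. j < n \<and> \<bar>step_t \<eta> j - c\<bar> < S}. \<eta> (Suc j)) \<le> 2 * S + 1"
proof (cases "{j. j < n \<and> \<bar>step_t \<eta> j - c\<bar> < S} = {}")
  case True
  then show ?thesis using S by (simp only: sum.empty)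
next
  case False
  let ?J = "{j. j < n \<and> \<bar>step_t \<eta> j - c\<bar> < S}"
  have fin: "finite ?J" by simp
  define p q where "p = Min ?J" and "q = Max ?J"
  have pq: "p \<in> ?J" "q \<in> ?J" unfolding p_def q_def using False by (auto intro!: Min_in Max_in simp del: mem_Collect_eq)
  have sub: "?J \<subseteq> {p..<Suc q}" unfolding p_def q_def using fin by (auto simp: less_Suc_eq_le)
  have "p \<le> q" unfolding p_def using pq fin by (intro Min_le) auto
  have "(\<Sum>j\<in>?J. \<eta> (Suc j)) \<le> (\<Sum>j\<in>{p..<Suc q}. \<eta> (Suc j))"
    by (rule sum_mono2) (use sub e in \<open>auto intro: less_imp_le\<close>)
  also have "\<dots> = (\<Sum>j\<in>{p..<Suc q}. step_t \<eta> (Suc j) - step_t \<eta> j)" by simp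
  also have "\<dots> = step_t \<eta> (Suc q) - step_t \<eta> p" using \<open>p \<le> q\<close> by (intro sum_Suc_diff') simp
  also have "\<dots> \<le> 2 * S + 1" using pq e[of q] by (simp add: abs_less_iff)
  finally show ?thesis .
qed

lemma (in prob_space) integral_abs_le_sqrt:
  fixes f :: "'a \<Rightarrow> real"
  assumes [measurable]: "f \<in> borel_measurable M" and f: "integrable M (\<lambda>x. (f x)\<^sup>2)"
  shows "(\<integral>x. \<bar>f x\<bar> \<partial>M) \<le> sqrt (\<integral>x. (f x)\<^sup>2 \<partial>M)"
proof (rule real_le_rsqrt)
  show "(\<integral>x. \<bar>f x\<bar> \<partial>M)\<^sup>2 \<le> (\<integral>x. (f x)\<^sup>2 \<partial>M)"
    using Cauchy_Schwarz_integral(2)[of "\<lambda>x. \<bar>f x\<bar>" M "\<lambda>_. 1"] f by (simp add: prob_space)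
qed

context em_sys
begin

text \<open>The form in which the assumptions on the step sizes are used. The last clause says that
  the indices within a bounded elapsed time of a given one carry a negligible share of the weight
  \<open>step_T\<close>.\<close>

definition steps :: "(nat \<Rightarrow> real) \<Rightarrow> bool" where
  "steps \<eta> \<longleftrightarrow> good \<eta> \<and> (\<forall>k\<ge>1. \<eta> (Suc k) \<le> \<eta> k) \<and> \<eta> \<longlonglongrightarrow> 0 \<and>
     filterlim (step_T \<eta>) at_top sequentially \<and> (\<lambda>n. 1 / ((\<eta> n)\<^sup>2 * step_T \<eta> n)) \<longlonglongrightarrow> 0"

lemma steps_good: "steps \<eta> \<Longrightarrow> good \<eta>" by (simp add: steps_def)

lemma step_T_nonneg: "good \<eta> \<Longrightarrow> 0 \<le> step_T \<eta> n"
  unfolding step_T_def by (intro sum_nonneg) (auto simp: good_def intro: less_imp_le)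

lemma steps_antimono: "steps \<eta> \<Longrightarrow> 1 \<le> i \<Longrightarrow> i \<le> j \<Longrightarrow> \<eta> j \<le> \<eta> i"
proof (induction j)
  case (Suc j)
  show ?case
  proof (cases "i = Suc j")
    case False
    then have "\<eta> j \<le> \<eta> i" using Suc by simp
    moreover have "\<eta> (Suc j) \<le> \<eta> j" using Suc.prems False by (auto simp: steps_def)
    ultimately show ?thesis by simp
  qed simp
qed simp

lemma V_chain_moment_bound:
  assumes "good \<eta>"
  shows "\<exists>C\<ge>0. \<forall>k. (\<integral>w. V (chain \<eta> x k w) ^ p \<partial>N) \<le> C"
proof (cases p)
  case 0
  then show ?thesis by (intro exI[of _ 1]) (simp add: prob_space)
next
  case (Suc q)
  obtain C where C: "0 \<le> C" and m: "\<forall>\<eta> x k. good \<eta> \<longrightarrow> (\<integral>w. V (chain \<eta> x k w) ^ Suc q \<partial>N) \<le> exp (- (c0 / 2) * step_t \<eta> k) * V x ^ Suc q + C"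
    using V_chain_moments by blast
  have "(\<integral>w. V (chain \<eta> x k w) ^ Suc q \<partial>N) \<le> V x ^ Suc q + C" for k
  proof -
    have "0 \<le> step_t \<eta> k" unfolding step_t_def using assms by (intro sum_nonneg) (auto simp: good_def intro: less_imp_le)
    then have "exp (- (c0 / 2) * step_t \<eta> k) \<le> 1" using c0 by simp
    then have "exp (- (c0 / 2) * step_t \<eta> k) * V x ^ Suc q \<le> 1 * V x ^ Suc q"
      by (intro mult_right_mono) auto
    then show ?thesis using m[rule_format, OF assms, of x k] by linarith
  qed
  then show ?thesis unfolding Suc using C by (intro exI[of _ "V x ^ Suc q + C"]) auto
qed

lemma integrable_V_chain': "good \<eta> \<Longrightarrow> integrable N (\<lambda>w. V (chain \<eta> x k w) ^ p)"
  by (cases p) (auto simp del: power_Suc intro: integrable_V_chain)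

end

context sde_sys
begin

text \<open>Uniformity in \<open>m\<close> follows by contradiction: offending starting indices
  tending to infinity give Euler schemes of vanishing mesh over horizons at most \<open>S\<close>,
  for which the operators approach the kernels of the diffusion, and those preserve \<pi>.\<close>

lemma horizon_invariance:
  assumes st: "steps \<eta>" and f: "continuous_on UNIV f" and fB: "\<And>u. \<bar>f u\<bar> \<le> C" and \<epsilon>: "0 < \<epsilon>"
  shows "\<exists>K. \<forall>i\<ge>K. \<forall>m. step_t (shift \<eta> i) m \<le> S \<longrightarrow> \<bar>(\<integral>y. Q (shift \<eta> i) m f y \<partial>\<pi>) - (\<integral>y. f y \<partial>\<pi>)\<bar> \<le> \<epsilon>"
proof (rule ccontr)
  interpret P: prob_space \<pi> by (rule \<pi>_prob)
  have fm[measurable]: "f \<in> borel_measurable borel" using f by (rule borel_measurable_continuous_onI)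
  assume "\<not> ?thesis"
  then have "\<forall>K. \<exists>i m. K \<le> i \<and> step_t (shift \<eta> i) m \<le> S \<and> \<epsilon> < \<bar>(\<integral>y. Q (shift \<eta> i) m f y \<partial>\<pi>) - (\<integral>y. f y \<partial>\<pi>)\<bar>"
    by (auto simp: not_le)
  then obtain i m where im: "\<And>K. K \<le> i K" "\<And>K. step_t (shift \<eta> (i K)) (m K) \<le> S"
    "\<And>K. \<epsilon> < \<bar>(\<integral>y. Q (shift \<eta> (i K)) (m K) f y \<partial>\<pi>) - (\<integral>y. f y \<partial>\<pi>)\<bar>"
    by metis
  have gd: "good \<eta>" using st by (rule steps_good)
  let ?e = "\<lambda>K. shift \<eta> (i K)"
  have e0: "k \<ge> 1 \<Longrightarrow> 0 < ?e K k" for K k using good_shift[OF gd, of "i K"] by (simp add: good_def)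
  let ?s = "\<lambda>K. step_t (?e K) (m K)"
  have s0: "0 < ?s K" for K
  proof -
    \<comment> \<open>For \<open>m K = 0\<close> the operator is the identity and there is no
      deviation; a positive horizon is what the kernel lemmas require.\<close>
    have "m K \<noteq> 0" using im(3)[of K] \<epsilon> by (intro notI) simp
    then show ?thesis unfolding step_t_def using e0 by (intro sum_pos) auto
  qed
  let ?D = "\<lambda>K y. Q (?e K) (m K) f y - (\<integral>u. f u \<partial>kern (?s K) y)"
  have "(\<lambda>K. \<integral>y. ?D K y \<partial>\<pi>) \<longlonglongrightarrow> (\<integral>y. 0 \<partial>\<pi>)"
  proof (rule integral_dominated_convergence[where w="\<lambda>_. 2 * C"])
    show "AE y in \<pi>. (\<lambda>K. ?D K y) \<longlonglongrightarrow> 0"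
    proof (rule AE_I2)
      fix y
      have "(\<lambda>K. Q (?e K) (m K) f y - (\<integral>w. f (X y (?s K) w) \<partial>M)) \<longlonglongrightarrow> 0"
      proof (rule euler_scheme_converges[where \<delta>="\<lambda>K. \<eta> (Suc K)" and S=S, OF e0 im(2) _ _ f fB])
        show "(\<lambda>K. \<eta> (Suc K)) \<longlonglongrightarrow> 0" using st by (intro LIMSEQ_Suc) (simp add: steps_def)
        show "?e K k \<le> \<eta> (Suc K)" if "1 \<le> k" for K k
          unfolding shift_def using im(1)[of K] that by (intro steps_antimono[OF st]) auto
      qed
      then show "(\<lambda>K. ?D K y) \<longlonglongrightarrow> 0" using s0 by (simp add: kern_integral less_imp_le)
    qed
    show "AE y in \<pi>. norm (?D K y) \<le> 2 * C" for K
    proof (rule AE_I2)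
      fix y
      have "prob_space (kern (?s K) y)"
        unfolding kern_def using s0[of K] by (intro prob_space.prob_space_distr[OF M_prob] X_meas) simp
      then have "\<bar>\<integral>u. f u \<partial>kern (?s K) y\<bar> \<le> C" by (rule integral_prob_bounded[OF _ fB])
      moreover have "\<bar>Q (?e K) (m K) f y\<bar> \<le> C" by (rule Q_bound[OF fB])
      ultimately show "norm (?D K y) \<le> 2 * C" unfolding real_norm_def by linarith
    qed
    show "?D K \<in> borel_measurable \<pi>" for K
      using kern_integral_meas[OF s0 f fB] Q_meas[OF fm] by (simp cong: measurable_cong_sets)
  qed simp_all
  then have lim: "(\<lambda>K. \<integral>y. ?D K y \<partial>\<pi>) \<longlonglongrightarrow> 0" by simp
  have eq: "(\<integral>y. ?D K y \<partial>\<pi>) = (\<integral>y. Q (?e K) (m K) f y \<partial>\<pi>) - (\<integral>y. f y \<partial>\<pi>)" for K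
  proof -
    have 1: "integrable \<pi> (Q (?e K) (m K) f)"
      using Q_bound[of f C] fB Q_meas[OF fm]
      by (intro P.integrable_const_bound[where B=C]) (auto cong: measurable_cong_sets)
    have pk: "prob_space (kern (?s K) y)" for y
      unfolding kern_def using s0[of K] by (intro prob_space.prob_space_distr[OF M_prob] X_meas) simp
    have 2: "integrable \<pi> (\<lambda>y. \<integral>u. f u \<partial>kern (?s K) y)"
      using kern_integral_meas[OF s0 f fB] integral_prob_bounded[OF pk fB]
      by (intro P.integrable_const_bound[where B=C]) (auto cong: measurable_cong_sets)
    show ?thesis using kern_invariant[OF s0 fm fB, of K] 1 2 by simp
  qed
  have "\<exists>n. \<bar>\<integral>y. ?D n y \<partial>\<pi>\<bar> < \<epsilon>" using LIMSEQ_D[OF lim \<epsilon>] by auto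
  then show False using im(3) unfolding eq by (meson less_asym)
qed

text \<open>Only the last stretch of the \<open>m\<close> steps, of elapsed time between 2n and 2n +
  1, is examined. It is long enough for mixing to make the result almost independent of where it
  starts, and short enough for \<open>horizon_invariance\<close> to identify its value as the mean
  under \<pi>.\<close>

lemma decorrelation:
  assumes st: "steps \<eta>" and f: "continuous_on UNIV f" and fB: "\<And>u. \<bar>f u\<bar> \<le> 1" and \<epsilon>: "0 < \<epsilon>"
  shows "\<exists>S\<ge>0. \<exists>K. \<forall>i\<ge>K. \<forall>m. S \<le> step_t (shift \<eta> i) m \<longrightarrow>
    (\<integral>w. \<bar>Q (shift \<eta> i) m f (chain \<eta> x i w) - (\<integral>y. f y \<partial>\<pi>)\<bar> \<partial>N) \<le> \<epsilon>"
proof -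
  interpret P: prob_space \<pi> by (rule \<pi>_prob)
  have fm[measurable]: "f \<in> borel_measurable borel" using f by (rule borel_measurable_continuous_onI)
  have gd: "good \<eta>" using st by (rule steps_good)
  let ?pf = "\<integral>y. f y \<partial>\<pi>"
  obtain \<rho> \<beta> where \<rho>: "0 \<le> \<rho>" "\<rho> < 1" and \<beta>: "0 < \<beta>" and mix: "\<forall>n \<eta> m f x y. good \<eta> \<and> 2 * real n \<le> step_t \<eta> m \<and>
     f \<in> borel_measurable borel \<and> (\<forall>u. \<bar>f u\<bar> \<le> 1) \<longrightarrow>
     \<bar>Q \<eta> m f x - Q \<eta> m f y\<bar> \<le> \<rho> ^ n * (2 + \<beta> * V x + \<beta> * V y)"
    using Q_mixing by blast
  obtain Mx where Mx: "0 \<le> Mx" "\<And>k. (\<integral>w. V (chain \<eta> x k w) \<partial>N) \<le> Mx"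
    using V_chain_moment_bound[OF gd, of x 1] by auto
  \<comment> \<open>Tightness of the single measure \<pi> takes the place of a moment bound for
    it.\<close>
  have "(\<lambda>R. measure \<pi> {z. real R < V z}) \<longlonglongrightarrow> measure \<pi> (\<Inter>R. {z. real R < V z})"
    by (rule P.finite_Lim_measure_decseq) (auto simp: decseq_def intro: order_le_less_trans[rotated] measurable_sets_borel)
  moreover have "(\<Inter>R. {z::real^'n. real R < V z}) = {}"
  proof -
    have "\<exists>R. \<not> real R < V z" for z :: "real^'n"
      using reals_Archimedean2[of "V z"] less_asym by blast
    then show ?thesis by auto
  qed
  ultimately have "(\<lambda>R. measure \<pi> {z. real R < V z}) \<longlonglongrightarrow> 0" by simp
  then have "\<forall>\<^sub>F R in sequentially. measure \<pi> {z. real R < V z} < \<epsilon> / 8"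
    by (rule order_tendstoD(2)) (use \<epsilon> in simp)
  then obtain R0 where R0: "measure \<pi> {z. real R0 < V z} < \<epsilon> / 8"
    using eventually_happens by fastforce
  define R where "R = real R0"
  have R: "measure \<pi> {z. R < V z} \<le> \<epsilon> / 8" using R0 by (simp add: R_def)
  define B where "B = 2 + \<beta> * Mx + \<beta> * R"
  have B: "0 < B" using \<beta> Mx by (simp add: B_def R_def add_pos_nonneg)
  have "(\<lambda>n. \<rho> ^ n * B) \<longlonglongrightarrow> 0 * B" using \<rho> by (intro tendsto_mult LIMSEQ_power_zero) auto
  then have "\<forall>\<^sub>F n in sequentially. \<rho> ^ n * B < \<epsilon> / 4"
    by (rule order_tendstoD(2)) (use \<epsilon> in simp)
  then obtain n where n: "\<rho> ^ n * B < \<epsilon> / 4"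
    using eventually_happens by fastforce
  obtain K where K: "\<And>i m. i \<ge> K \<Longrightarrow> step_t (shift \<eta> i) m \<le> 2 * real n + 1 \<Longrightarrow>
      \<bar>(\<integral>y. Q (shift \<eta> i) m f y \<partial>\<pi>) - ?pf\<bar> \<le> \<epsilon> / 4"
    using horizon_invariance[OF st f fB, of "\<epsilon> / 4" "2 * real n + 1"] \<epsilon> by auto
  have "(\<integral>w. \<bar>Q (shift \<eta> i) m f (chain \<eta> x i w) - ?pf\<bar> \<partial>N) \<le> \<epsilon>" if i: "i \<ge> K" and m: "2 * real n \<le> step_t (shift \<eta> i) m" for i m
  proof -
    let ?A = "{j. j \<le> m \<and> 2 * real n \<le> step_t (shift \<eta> (i + j)) (m - j)}"
    \<comment> \<open>The latest splitting point that still leaves elapsed time 2n; one step later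
      the rest would fall below 2n, and a step is at most 1.\<close>
    define m0 where "m0 = Max ?A"
    have A: "0 \<in> ?A" "finite ?A" using m by auto
    have m0: "m0 \<in> ?A" unfolding m0_def using A by (intro Max_in) auto
    define m1 where "m1 = m - m0"
    have mm: "m = m0 + m1" using m0 by (simp add: m1_def)
    let ?i = "i + m0"
    have lo: "2 * real n \<le> step_t (shift \<eta> ?i) m1" using m0 by (simp add: m1_def)
    have hi: "step_t (shift \<eta> ?i) m1 \<le> 2 * real n + 1"
    proof (cases m1)
      case (Suc m2)
      have "Suc m0 \<notin> ?A"
      proof
        assume "Suc m0 \<in> ?A"
        then have "Suc m0 \<le> m0" using Max_ge[OF A(2)] unfolding m0_def[symmetric] by blast
        then show False by simp
      qed
      then have "step_t (shift \<eta> (Suc ?i)) m2 < 2 * real n" using Suc mm by (auto simp: not_le)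
      moreover have "step_t (shift \<eta> ?i) m1 = step_t (shift \<eta> (Suc ?i)) m2 + \<eta> (Suc ?i)"
        unfolding step_t_shift Suc by simp
      ultimately show ?thesis using goodD(3)[OF gd, of ?i] by linarith
    qed simp
    define g where "g = Q (shift \<eta> ?i) m1 f"
    have gm[measurable]: "g \<in> borel_measurable borel" unfolding g_def by (rule Q_meas[OF fm])
    have gb: "\<bar>g u\<bar> \<le> 1" for u unfolding g_def by (rule Q_bound) (rule fB)
    have pf1: "\<bar>?pf\<bar> \<le> 1" by (rule integral_prob_bounded[OF \<pi>_prob fB])
    have gpf: "\<bar>g u - ?pf\<bar> \<le> 2" for u using gb[of u] pf1 by (simp add: abs_le_iff)
    have gi: "integrable \<pi> g" using gb by (intro P.integrable_const_bound[where B=1]) auto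
    have gy: "\<bar>g y - ?pf\<bar> \<le> \<rho> ^ n * (2 + \<beta> * V y + \<beta> * R) + \<epsilon> / 2" for y
    proof -
      \<comment> \<open>Where V is large the mixing bound is useless and the trivial bound 2 is
        taken.\<close>
      let ?h = "\<lambda>z. \<rho> ^ n * (2 + \<beta> * V y + \<beta> * R) + 2 * indicator {z. R < V z} z"
      have c: "0 \<le> \<rho> ^ n * (2 + \<beta> * V y + \<beta> * R)" using \<rho> \<beta> by (simp add: R_def add_nonneg_nonneg)
      have [measurable]: "{z::real^'n. R < V z} \<in> sets borel" by measurable
      have pw: "\<bar>g y - g z\<bar> \<le> ?h z" for z
      proof (cases "R < V z")
        case True
        then show ?thesis using gb[of y] gb[of z] c by (simp add: abs_le_iff)
      next
        case False
        have "\<bar>g y - g z\<bar> \<le> \<rho> ^ n * (2 + \<beta> * V y + \<beta> * V z)"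
          unfolding g_def using mix good_shift[OF gd] lo fm fB by blast
        also have "\<dots> \<le> \<rho> ^ n * (2 + \<beta> * V y + \<beta> * R)"
          using False \<rho> \<beta> by (intro mult_left_mono add_left_mono) auto
        finally show ?thesis using False by simp
      qed
      have hint: "integrable \<pi> ?h"
        by (intro Bochner_Integration.integrable_add integrable_mult_right) (auto simp: P.emeasure_eq_measure)
      have "g y - (\<integral>z. g z \<partial>\<pi>) = (\<integral>z. g y - g z \<partial>\<pi>)" using gi by (simp add: P.prob_space[simplified])
      then have "\<bar>g y - (\<integral>z. g z \<partial>\<pi>)\<bar> \<le> (\<integral>z. \<bar>g y - g z\<bar> \<partial>\<pi>)" by (simp only: integral_abs_bound)
      also have "\<dots> \<le> (\<integral>z. ?h z \<partial>\<pi>)"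
        using pw by (intro integral_mono integrable_abs Bochner_Integration.integrable_diff gi hint) auto
      also have "\<dots> = \<rho> ^ n * (2 + \<beta> * V y + \<beta> * R) + 2 * measure \<pi> {z. R < V z}"
        by (subst Bochner_Integration.integral_add) (auto simp: P.prob_space[simplified] P.emeasure_eq_measure)
      also have "\<dots> \<le> \<rho> ^ n * (2 + \<beta> * V y + \<beta> * R) + \<epsilon> / 4" using R by simp
      finally have 1: "\<bar>g y - (\<integral>z. g z \<partial>\<pi>)\<bar> \<le> \<rho> ^ n * (2 + \<beta> * V y + \<beta> * R) + \<epsilon> / 4" .
      have "\<bar>(\<integral>z. g z \<partial>\<pi>) - ?pf\<bar> \<le> \<epsilon> / 4" unfolding g_def using i hi by (intro K) auto
      with 1 show ?thesis by linarith
    qed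
    let ?a = "\<lambda>u. \<bar>g u - ?pf\<bar>"
    have Qf1: "\<bar>Q (shift \<eta> i) m f u\<bar> \<le> 1" for u by (rule Q_bound) (rule fB)
    have Qm: "Q (shift \<eta> i) m f u = Q (shift \<eta> i) m0 g u" for u
      unfolding mm g_def using Q_add[OF fm fB, of "shift \<eta> i" m0 m1 u] by simp
    have le: "\<bar>Q (shift \<eta> i) m f u - ?pf\<bar> \<le> Q (shift \<eta> i) m0 ?a u" for u
    proof -
      have "Q (shift \<eta> i) m f u - ?pf = (\<integral>w. g (chain (shift \<eta> i) u m0 w) - ?pf \<partial>N)"
        unfolding Qm unfolding Q_def using gb by (simp add: integrable_F_bounded[where B=1] prob_space)
      then show ?thesis unfolding Q_def by (simp only: integral_abs_bound)
    qed
    have "(\<integral>w. \<bar>Q (shift \<eta> i) m f (chain \<eta> x i w) - ?pf\<bar> \<partial>N) \<le> (\<integral>w. Q (shift \<eta> i) m0 ?a (chain \<eta> x i w) \<partial>N)"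
    proof (rule integral_mono)
      show "integrable N (\<lambda>w. \<bar>Q (shift \<eta> i) m f (chain \<eta> x i w) - ?pf\<bar>)"
      proof (intro integrable_abs integrable_F_bounded[where B=2])
        fix w
        show "\<bar>Q (shift \<eta> i) m f (chain \<eta> x i w) - ?pf\<bar> \<le> 2"
          using Qf1[of "chain \<eta> x i w"] pf1 by linarith
      qed measurable
      show "integrable N (\<lambda>w. Q (shift \<eta> i) m0 ?a (chain \<eta> x i w))"
        using Q_bound[of ?a 2] gpf by (intro integrable_F_bounded[where B=2]) auto
    qed (rule le)
    also have "\<dots> = (\<integral>w. ?a (chain \<eta> x ?i w) \<partial>N)"
      by (rule integral_Q_chain[where C=2]) (use gpf in auto)
    also have "\<dots> \<le> (\<integral>w. \<rho> ^ n * (2 + \<beta> * V (chain \<eta> x ?i w) + \<beta> * R) + \<epsilon> / 2 \<partial>N)"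
    proof (rule integral_mono)
      show "integrable N (\<lambda>w. ?a (chain \<eta> x ?i w))"
        using gpf by (intro integrable_F_bounded[where B=2]) auto
      show "integrable N (\<lambda>w. \<rho> ^ n * (2 + \<beta> * V (chain \<eta> x ?i w) + \<beta> * R) + \<epsilon> / 2)"
        using integrable_V_chain[OF gd, of x ?i 0] by simp
    qed (rule gy)
    also have "\<dots> = \<rho> ^ n * (2 + \<beta> * (\<integral>w. V (chain \<eta> x ?i w) \<partial>N) + \<beta> * R) + \<epsilon> / 2"
      using integrable_V_chain[OF gd, of x ?i 0] by (simp add: prob_space)
    also have "\<dots> \<le> \<rho> ^ n * B + \<epsilon> / 2"
      unfolding B_def using Mx(2)[of ?i] \<rho> \<beta> by (intro add_right_mono mult_left_mono add_mono) auto
    also have "\<dots> \<le> \<epsilon>" using n \<epsilon> by simp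
    finally show ?thesis .
  qed
  then show ?thesis by (intro exI[of _ "2 * real n"]) auto
qed

end

section \<open>Law of large numbers\<close>

context sde_sys
begin

text \<open>The decorrelation estimate applies when both indices are late and separated in elapsed
  time. Each \<open>of_bool\<close> marks one way of failing, where 4, the product of two bounds 2,
  is used instead.\<close>

lemma correlation_bound:
  fixes f :: "real^'n \<Rightarrow> real"
  assumes st: "steps \<eta>" and f: "continuous_on UNIV f" and fB: "\<And>u. \<bar>f u\<bar> \<le> 1" and \<epsilon>: "0 < \<epsilon>"
  defines "g \<equiv> \<lambda>u. f u - (\<integral>y. f y \<partial>\<pi>)"
  shows "\<exists>S\<ge>0. \<exists>K. \<forall>i j. \<bar>\<integral>w. g (chain \<eta> x i w) * g (chain \<eta> x j w) \<partial>N\<bar> \<le>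
    \<epsilon> + 4 * of_bool (i < K) + 4 * of_bool (j < K) + 4 * of_bool (\<bar>step_t \<eta> j - step_t \<eta> i\<bar> < S)"
proof -
  have fm[measurable]: "f \<in> borel_measurable borel" using f by (rule borel_measurable_continuous_onI)
  have gd: "good \<eta>" using st by (rule steps_good)
  let ?pf = "\<integral>y. f y \<partial>\<pi>"
  have pf1: "\<bar>?pf\<bar> \<le> 1" by (rule integral_prob_bounded[OF \<pi>_prob fB])
  have gm[measurable]: "g \<in> borel_measurable borel" unfolding g_def by measurable
  have gb: "\<bar>g u\<bar> \<le> 2" for u using fB[of u] pf1 unfolding g_def by linarith
  have ggb: "\<bar>g u * g v\<bar> \<le> 4" for u v
    using mult_mono[OF gb[of u] gb[of v]] by (simp add: abs_mult)
  have E4: "\<bar>\<integral>w. g (chain \<eta> x i w) * g (chain \<eta> x j w) \<partial>N\<bar> \<le> 4" for i j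
    by (rule integral_prob_bounded[OF prob_space_axioms ggb])
  obtain S K where S: "0 \<le> S" and K: "\<And>i m. i \<ge> K \<Longrightarrow> S \<le> step_t (shift \<eta> i) m \<Longrightarrow>
    (\<integral>w. \<bar>Q (shift \<eta> i) m f (chain \<eta> x i w) - ?pf\<bar> \<partial>N) \<le> \<epsilon> / 2"
    using decorrelation[OF st f fB, of "\<epsilon> / 2" x] \<epsilon> by auto
  have key: "\<bar>\<integral>w. g (chain \<eta> x i w) * g (chain \<eta> x (i + m) w) \<partial>N\<bar> \<le> \<epsilon>"
    if i: "i \<ge> K" and m: "S \<le> step_t (shift \<eta> i) m" for i m
  proof -
    have Qg: "Q (shift \<eta> i) m g u = Q (shift \<eta> i) m f u - ?pf" for u
    proof -
      have "integrable N (\<lambda>w. f (chain (shift \<eta> i) u m w))"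
        by (rule integrable_F_bounded[where B=1]) (use fB in auto)
      then show ?thesis unfolding Q_def g_def by (simp add: prob_space)
    qed
    have Qb: "\<bar>Q (shift \<eta> i) m f u\<bar> \<le> 1" for u by (rule Q_bound[OF fB])
    have tw: "(\<integral>w. g (chain \<eta> x i w) * g (chain \<eta> x (i + m) w) \<partial>N)
        = (\<integral>w. g (chain \<eta> x i w) * Q (shift \<eta> i) m g (chain \<eta> x i w) \<partial>N)"
      by (rule tower[where B=2 and C=2]) (use gb measurable_compose[OF chain_F gm] in auto)
    have "\<bar>\<integral>w. g (chain \<eta> x i w) * Q (shift \<eta> i) m g (chain \<eta> x i w) \<partial>N\<bar> \<le> (\<integral>w. \<bar>g (chain \<eta> x i w) * Q (shift \<eta> i) m g (chain \<eta> x i w)\<bar> \<partial>N)"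
      by (rule integral_abs_bound)
    also have "\<dots> \<le> (\<integral>w. 2 * \<bar>Q (shift \<eta> i) m f (chain \<eta> x i w) - ?pf\<bar> \<partial>N)"
    proof (rule integral_mono)
      have q2: "\<bar>Q (shift \<eta> i) m f u - ?pf\<bar> \<le> 2" for u using Qb[of u] pf1 by linarith
      show "integrable N (\<lambda>w. 2 * \<bar>Q (shift \<eta> i) m f (chain \<eta> x i w) - ?pf\<bar>)"
        using q2 by (intro integrable_mult_right integrable_F_bounded[where B=2]) auto
      have "\<bar>g u * Q (shift \<eta> i) m g u\<bar> \<le> 4" for u
        using mult_mono[OF gb[of u] q2[of u]] by (simp add: abs_mult Qg)
      then show "integrable N (\<lambda>w. \<bar>g (chain \<eta> x i w) * Q (shift \<eta> i) m g (chain \<eta> x i w)\<bar>)"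
        by (intro integrable_F_bounded[where B=4]) auto
      show "\<bar>g (chain \<eta> x i w) * Q (shift \<eta> i) m g (chain \<eta> x i w)\<bar> \<le> 2 * \<bar>Q (shift \<eta> i) m f (chain \<eta> x i w) - ?pf\<bar>" for w
        unfolding abs_mult Qg using gb by (intro mult_right_mono) auto
    qed
    also have "\<dots> \<le> \<epsilon>" using K[OF i m] by simp
    finally show ?thesis unfolding tw .
  qed
  have "\<bar>\<integral>w. g (chain \<eta> x i w) * g (chain \<eta> x j w) \<partial>N\<bar> \<le>
    \<epsilon> + 4 * of_bool (i < K) + 4 * of_bool (j < K) + 4 * of_bool (\<bar>step_t \<eta> j - step_t \<eta> i\<bar> < S)" for i j
  proof (cases "K \<le> i \<and> K \<le> j \<and> S \<le> \<bar>step_t \<eta> j - step_t \<eta> i\<bar>")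
    case True
    have mono: "step_t \<eta> k \<le> step_t \<eta> l" if "k \<le> l" for k l
      unfolding step_t_def by (rule sum_mono2) (use gd that in \<open>auto simp: good_def intro: less_imp_le\<close>)
    have "\<bar>\<integral>w. g (chain \<eta> x i w) * g (chain \<eta> x j w) \<partial>N\<bar> \<le> \<epsilon>"
    proof (cases "i \<le> j")
      case ij: True
      then obtain m where m: "j = i + m" using le_Suc_ex by blast
      show ?thesis unfolding m by (rule key) (use True m mono[OF ij] in \<open>auto simp: step_t_shift\<close>)
    next
      case False
      then obtain m where m: "i = j + m" using le_Suc_ex by (metis nat_le_linear)
      have "\<bar>\<integral>w. g (chain \<eta> x j w) * g (chain \<eta> x (j + m) w) \<partial>N\<bar> \<le> \<epsilon>"
        by (rule key) (use True m mono[of j i] in \<open>auto simp: step_t_shift\<close>)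
      then show ?thesis unfolding m by (simp add: mult.commute)
    qed
    then show ?thesis by (auto intro: order_trans)
  next
    case False
    then show ?thesis using E4[of i j] \<epsilon> by (auto simp: not_le)
  qed
  then show ?thesis using S by blast
qed

text \<open>The second moment is a double sum of correlations with weights 1/\<eta>. Early indices
  have a fixed total weight and are lost against T_n; pairs close in elapsed time are rare by the
  window estimate.\<close>

lemma LLN_bounded:
  fixes f :: "real^'n \<Rightarrow> real"
  assumes st: "steps \<eta>" and f: "continuous_on UNIV f" and fB: "\<And>u. \<bar>f u\<bar> \<le> 1"
  defines "g \<equiv> \<lambda>u. f u - (\<integral>y. f y \<partial>\<pi>)"
  shows "(\<lambda>n. \<integral>w. \<bar>(\<Sum>j<n. inverse (\<eta> (Suc j)) * g (chain \<eta> x j w)) / step_T \<eta> n\<bar> \<partial>N) \<longlonglongrightarrow> 0"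
proof -
  have fm[measurable]: "f \<in> borel_measurable borel" using f by (rule borel_measurable_continuous_onI)
  have gd: "good \<eta>" using st by (rule steps_good)
  let ?w = "\<lambda>j. inverse (\<eta> (Suc j))"
  let ?T = "step_T \<eta>"
  let ?A = "\<lambda>n w. (\<Sum>j<n. ?w j * g (chain \<eta> x j w)) / ?T n"
  have w0: "0 \<le> ?w j" for j using goodD(1)[OF gd, of j] by simp
  have pf1: "\<bar>\<integral>y. f y \<partial>\<pi>\<bar> \<le> 1" by (rule integral_prob_bounded[OF \<pi>_prob fB])
  have gm[measurable]: "g \<in> borel_measurable borel" unfolding g_def by measurable
  have gb: "\<bar>g u\<bar> \<le> 2" for u using fB[of u] pf1 unfolding g_def by linarith
  have ggb: "\<bar>g u * g v\<bar> \<le> 4" for u v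
    using mult_mono[OF gb[of u] gb[of v]] by (simp add: abs_mult)
  have ggi: "integrable N (\<lambda>w. g (chain \<eta> x i w) * g (chain \<eta> x j w))" for i j
    using ggb by (intro integrable_F_bounded[where B=4]) auto
  have sqeq: "(?A n w)\<^sup>2 = (\<Sum>i<n. \<Sum>j<n. ?w i * ?w j * (g (chain \<eta> x i w) * g (chain \<eta> x j w))) / (?T n)\<^sup>2" for n w
    by (simp add: power_divide power2_eq_square sum_product mult_ac)
  have sqi: "integrable N (\<lambda>w. (?A n w)\<^sup>2)" for n
    unfolding sqeq by (intro integrable_divide Bochner_Integration.integrable_sum integrable_mult_right ggi)
  have Em: "?A n \<in> borel_measurable N" for n by measurable
  have T: "filterlim ?T at_top sequentially" and T2: "(\<lambda>n. 1 / ((\<eta> n)\<^sup>2 * ?T n)) \<longlonglongrightarrow> 0"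
    using st by (auto simp: steps_def)
  have sq0: "(\<lambda>n. \<integral>w. (?A n w)\<^sup>2 \<partial>N) \<longlonglongrightarrow> 0"
  proof (rule LIMSEQ_I)
    fix r :: real assume r: "0 < r"
    obtain S K where S: "0 \<le> S" and K: "\<And>i j. \<bar>\<integral>w. g (chain \<eta> x i w) * g (chain \<eta> x j w) \<partial>N\<bar> \<le>
        r / 4 + 4 * of_bool (i < K) + 4 * of_bool (j < K) + 4 * of_bool (\<bar>step_t \<eta> j - step_t \<eta> i\<bar> < S)"
      using correlation_bound[OF st f fB, of "r / 4" x] r unfolding g_def by auto
    have bound: "(\<integral>w. (?A n w)\<^sup>2 \<partial>N) \<le> r / 4 + 8 * ?T K / ?T n + 4 * (2 * S + 1) * (1 / ((\<eta> n)\<^sup>2 * ?T n))"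
      if n: "n \<ge> 1" "0 < ?T n" for n
    proof -
      have \<eta>n: "0 < \<eta> n" using gd n by (simp add: good_def)
      have TK: "(\<Sum>i<n. ?w i * of_bool (i < K)) \<le> ?T K"
      proof -
        have "(\<Sum>i<n. ?w i * of_bool (i < K)) = (\<Sum>i\<in>{..<n} \<inter> {..<K}. ?w i)"
          by (simp add: sum.inter_restrict[of "{..<n}"] of_bool_def if_distrib cong: if_cong)
        also have "\<dots> \<le> (\<Sum>i<K. ?w i)" by (rule sum_mono2) (use w0 in auto)
        finally show ?thesis by (simp add: step_T_eq)
      qed
      \<comment> \<open>Each weight is rewritten as step over squared step; monotonicity bounds it
        by \<eta>_(j+1)/\<eta>_n^2, and the steps in a window sum up to at most 2S + 1.\<close>
      have win: "(\<Sum>j<n. ?w j * of_bool (\<bar>step_t \<eta> j - step_t \<eta> i\<bar> < S)) \<le> (2 * S + 1) / (\<eta> n)\<^sup>2" for i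
      proof -
        let ?J = "{j. j < n \<and> \<bar>step_t \<eta> j - step_t \<eta> i\<bar> < S}"
        have "(\<Sum>j<n. ?w j * of_bool (\<bar>step_t \<eta> j - step_t \<eta> i\<bar> < S)) = (\<Sum>j\<in>{..<n} \<inter> {j. \<bar>step_t \<eta> j - step_t \<eta> i\<bar> < S}. ?w j)"
          by (simp add: sum.inter_restrict[of "{..<n}"] of_bool_def if_distrib cong: if_cong)
        also have "{..<n} \<inter> {j. \<bar>step_t \<eta> j - step_t \<eta> i\<bar> < S} = ?J" by auto
        also have "(\<Sum>j\<in>?J. ?w j) \<le> (\<Sum>j\<in>?J. \<eta> (Suc j) / (\<eta> n)\<^sup>2)"
        proof (rule sum_mono)
          fix j assume j: "j \<in> ?J"
          have e: "0 < \<eta> (Suc j)" by (rule goodD(1)[OF gd])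
          have "\<eta> n \<le> \<eta> (Suc j)" using j by (intro steps_antimono[OF st]) auto
          then have "(\<eta> n)\<^sup>2 \<le> (\<eta> (Suc j))\<^sup>2" using \<eta>n by (intro power_mono) auto
          then have "\<eta> (Suc j) / (\<eta> (Suc j))\<^sup>2 \<le> \<eta> (Suc j) / (\<eta> n)\<^sup>2"
            using e \<eta>n by (intro divide_left_mono) auto
          then show "?w j \<le> \<eta> (Suc j) / (\<eta> n)\<^sup>2" using e by (simp add: power2_eq_square inverse_eq_divide)
        qed
        also have "\<dots> = (\<Sum>j\<in>?J. \<eta> (Suc j)) / (\<eta> n)\<^sup>2" by (simp add: sum_divide_distrib)
        also have "\<dots> \<le> (2 * S + 1) / (\<eta> n)\<^sup>2"
          using sum_steps_in_window[of \<eta> S n "step_t \<eta> i"] goodD[OF gd] S by (intro divide_right_mono) auto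
        finally show ?thesis .
      qed
      have "(\<integral>w. (?A n w)\<^sup>2 \<partial>N) = (\<Sum>i<n. \<Sum>j<n. ?w i * ?w j * (\<integral>w. g (chain \<eta> x i w) * g (chain \<eta> x j w) \<partial>N)) / (?T n)\<^sup>2"
        unfolding sqeq using ggi by (simp add: Bochner_Integration.integral_sum)
      also have "\<dots> \<le> (\<Sum>i<n. \<Sum>j<n. ?w i * ?w j * (r / 4 + 4 * of_bool (i < K) + 4 * of_bool (j < K) + 4 * of_bool (\<bar>step_t \<eta> j - step_t \<eta> i\<bar> < S))) / (?T n)\<^sup>2"
        by (intro divide_right_mono sum_mono mult_left_mono order_trans[OF abs_ge_self K] mult_nonneg_nonneg w0 zero_le_power2)
      also have "(\<Sum>i<n. \<Sum>j<n. ?w i * ?w j * (r / 4 + 4 * of_bool (i < K) + 4 * of_bool (j < K) + 4 * of_bool (\<bar>step_t \<eta> j - step_t \<eta> i\<bar> < S)))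
          = (\<Sum>i<n. ?w i * (r / 4 * ?T n)) + (\<Sum>i<n. 4 * ?T n * (?w i * of_bool (i < K)))
            + (\<Sum>i<n. ?w i * (4 * (\<Sum>j<n. ?w j * of_bool (j < K))))
            + (\<Sum>i<n. ?w i * (4 * (\<Sum>j<n. ?w j * of_bool (\<bar>step_t \<eta> j - step_t \<eta> i\<bar> < S))))"
      proof -
        have "(\<Sum>j<n. ?w i * ?w j * (r / 4 + 4 * of_bool (i < K) + 4 * of_bool (j < K) + 4 * of_bool (\<bar>step_t \<eta> j - step_t \<eta> i\<bar> < S)))
          = ?w i * (r / 4 * ?T n) + 4 * ?T n * (?w i * of_bool (i < K)) + ?w i * (4 * (\<Sum>j<n. ?w j * of_bool (j < K)))
            + ?w i * (4 * (\<Sum>j<n. ?w j * of_bool (\<bar>step_t \<eta> j - step_t \<eta> i\<bar> < S)))" for i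
        proof -
          have "(\<Sum>j<n. ?w i * ?w j * (r / 4 + 4 * of_bool (i < K) + 4 * of_bool (j < K) + 4 * of_bool (\<bar>step_t \<eta> j - step_t \<eta> i\<bar> < S)))
            = (\<Sum>j<n. (?w i * (r / 4) + 4 * (?w i * of_bool (i < K))) * ?w j + (?w i * 4) * (?w j * of_bool (j < K))
               + (?w i * 4) * (?w j * of_bool (\<bar>step_t \<eta> j - step_t \<eta> i\<bar> < S)))"
            by (intro sum.cong refl) (simp add: algebra_simps)
          also have "\<dots> = (?w i * (r / 4) + 4 * (?w i * of_bool (i < K))) * ?T n + (?w i * 4) * (\<Sum>j<n. ?w j * of_bool (j < K))
               + (?w i * 4) * (\<Sum>j<n. ?w j * of_bool (\<bar>step_t \<eta> j - step_t \<eta> i\<bar> < S))"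
            by (simp only: sum.distrib sum_distrib_left[symmetric] step_T_eq)
          also have "\<dots> = ?w i * (r / 4 * ?T n) + 4 * ?T n * (?w i * of_bool (i < K)) + ?w i * (4 * (\<Sum>j<n. ?w j * of_bool (j < K)))
            + ?w i * (4 * (\<Sum>j<n. ?w j * of_bool (\<bar>step_t \<eta> j - step_t \<eta> i\<bar> < S)))"
            by (simp only: distrib_right distrib_left mult_ac)
          finally show ?thesis .
        qed
        then show ?thesis by (simp only: sum.distrib)
      qed
      also have "\<dots> \<le> (\<Sum>i<n. ?w i * (r / 4 * ?T n)) + 4 * ?T n * ?T K
            + (\<Sum>i<n. ?w i * (4 * ?T K)) + (\<Sum>i<n. ?w i * (4 * ((2 * S + 1) / (\<eta> n)\<^sup>2)))"
      proof (intro add_mono order_refl)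
        show "(\<Sum>i<n. 4 * ?T n * (?w i * of_bool (i < K))) \<le> 4 * ?T n * ?T K"
          unfolding sum_distrib_left[symmetric] using TK n by (intro mult_left_mono) auto
        show "(\<Sum>i<n. ?w i * (4 * (\<Sum>j<n. ?w j * of_bool (j < K)))) \<le> (\<Sum>i<n. ?w i * (4 * ?T K))"
          using TK w0 by (intro sum_mono mult_left_mono) auto
        show "(\<Sum>i<n. ?w i * (4 * (\<Sum>j<n. ?w j * of_bool (\<bar>step_t \<eta> j - step_t \<eta> i\<bar> < S)))) \<le> (\<Sum>i<n. ?w i * (4 * ((2 * S + 1) / (\<eta> n)\<^sup>2)))"
          using win w0 by (intro sum_mono mult_left_mono) auto
      qed
      also have "\<dots> = r / 4 * (?T n)\<^sup>2 + 8 * ?T K * ?T n + 4 * (2 * S + 1) / (\<eta> n)\<^sup>2 * ?T n"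
        unfolding sum_distrib_right[symmetric] step_T_eq[symmetric] by (simp add: power2_eq_square algebra_simps)
      also have "\<dots> / (?T n)\<^sup>2 = r / 4 + 8 * ?T K / ?T n + 4 * (2 * S + 1) * (1 / ((\<eta> n)\<^sup>2 * ?T n))"
        using n by (simp add: add_divide_distrib power2_eq_square)
      finally show ?thesis by (simp add: divide_right_mono)
    qed
    have lim: "(\<lambda>n. r / 4 + 8 * ?T K / ?T n + 4 * (2 * S + 1) * (1 / ((\<eta> n)\<^sup>2 * ?T n))) \<longlonglongrightarrow> r / 4 + 0 + 4 * (2 * S + 1) * 0"
      by (intro tendsto_add tendsto_const tendsto_mult T2 tendsto_divide_0[OF tendsto_const filterlim_at_top_imp_at_infinity[OF T]])
    have "\<forall>\<^sub>F n in sequentially. r / 4 + 8 * ?T K / ?T n + 4 * (2 * S + 1) * (1 / ((\<eta> n)\<^sup>2 * ?T n)) < r"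
      using r by (intro order_tendstoD(2)[OF lim]) simp
    moreover have "\<forall>\<^sub>F n in sequentially. 0 < ?T n" using T by (auto simp: filterlim_at_top_dense)
    moreover have "\<forall>\<^sub>F n in sequentially. n \<ge> 1" by (rule eventually_ge_at_top)
    ultimately have "\<forall>\<^sub>F n in sequentially. norm ((\<integral>w. (?A n w)\<^sup>2 \<partial>N) - 0) < r"
    proof eventually_elim
      case (elim n)
      have "0 \<le> (\<integral>w. (?A n w)\<^sup>2 \<partial>N)" by (rule Bochner_Integration.integral_nonneg) simp
      then show ?case using bound[OF elim(3,2)] elim(1) unfolding real_norm_def by linarith
    qed
    then show "\<exists>no. \<forall>n\<ge>no. norm ((\<integral>w. (?A n w)\<^sup>2 \<partial>N) - 0) < r"
      by (simp add: eventually_sequentially)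
  qed
  have "(\<lambda>n. sqrt (\<integral>w. (?A n w)\<^sup>2 \<partial>N)) \<longlonglongrightarrow> sqrt 0" by (intro tendsto_real_sqrt sq0)
  then have sq1: "(\<lambda>n. sqrt (\<integral>w. (?A n w)\<^sup>2 \<partial>N)) \<longlonglongrightarrow> 0" by simp
  show ?thesis
  proof (rule tendsto_sandwich[OF _ _ tendsto_const sq1]; rule always_eventually; rule allI)
    show "0 \<le> (\<integral>w. \<bar>?A n w\<bar> \<partial>N)" for n by (rule Bochner_Integration.integral_nonneg) simp
    show "(\<integral>w. \<bar>?A n w\<bar> \<partial>N) \<le> sqrt (\<integral>w. (?A n w)\<^sup>2 \<partial>N)" for n by (rule integral_abs_le_sqrt[OF Em sqi])
  qed
qed

text \<open>Truncation at level \<open>R\<close>. The error is controlled along the chain by second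
  moments uniformly in the index, hence also in the weighted averages. Integrability under \<pi> is
  part of the result: the means of the truncations under \<pi> stay bounded since they are limits of
  averages along the chain.\<close>

theorem LLN:
  fixes f :: "real^'n \<Rightarrow> real"
  assumes st: "steps \<eta>" and f: "continuous_on UNIV f" and f0: "\<And>u. 0 \<le> f u" and fV: "\<And>u. f u \<le> C * V u ^ p"
  shows "integrable \<pi> f"
    and "(\<lambda>n. \<integral>w. \<bar>(\<Sum>j<n. inverse (\<eta> (Suc j)) * f (chain \<eta> x j w)) / step_T \<eta> n - (\<integral>y. f y \<partial>\<pi>)\<bar> \<partial>N) \<longlonglongrightarrow> 0"
proof -
  interpret P: prob_space \<pi> by (rule \<pi>_prob)
  have fm[measurable]: "f \<in> borel_measurable borel" using f by (rule borel_measurable_continuous_onI)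
  have gd: "good \<eta>" using st by (rule steps_good)
  let ?w = "\<lambda>j. inverse (\<eta> (Suc j))"
  let ?T = "step_T \<eta>"
  have w0: "0 \<le> ?w j" for j using goodD(1)[OF gd, of j] by simp
  have T: "filterlim ?T at_top sequentially" using st by (auto simp: steps_def)
  have Tpos: "\<forall>\<^sub>F n in sequentially. 0 < ?T n" using T by (auto simp: filterlim_at_top_dense)
  let ?av = "\<lambda>h n w. (\<Sum>j<n. ?w j * h (chain \<eta> x j w)) / ?T n"
  define h where "h R u = min (f u) R" for R u
  have hm[measurable]: "h R \<in> borel_measurable borel" for R unfolding h_def by measurable
  have hc: "continuous_on UNIV (h R)" for R unfolding h_def by (intro continuous_intros f)
  have hb: "\<bar>h R u\<bar> \<le> R" if "0 < R" for R u using f0[of u] that by (auto simp: h_def)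
  have conv: "(\<lambda>n. \<integral>w. \<bar>?av (h R) n w - (\<integral>y. h R y \<partial>\<pi>)\<bar> \<partial>N) \<longlonglongrightarrow> 0" if R: "0 < R" for R
  proof -
    let ?f1 = "\<lambda>u. h R u / R"
    have c1: "continuous_on UNIV ?f1" by (intro continuous_intros hc) (use R in auto)
    have b1: "\<bar>?f1 u\<bar> \<le> 1" for u using hb[OF R, of u] R by (simp add: field_simps)
    let ?pf = "\<integral>y. ?f1 y \<partial>\<pi>"
    have pf: "(\<integral>y. h R y \<partial>\<pi>) = R * ?pf" using R by simp
    have "(\<lambda>n. R * (\<integral>w. \<bar>(\<Sum>j<n. ?w j * (?f1 (chain \<eta> x j w) - ?pf)) / ?T n\<bar> \<partial>N)) \<longlonglongrightarrow> R * 0"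
      by (intro tendsto_mult tendsto_const LLN_bounded[OF st c1 b1])
    then have l: "(\<lambda>n. R * (\<integral>w. \<bar>(\<Sum>j<n. ?w j * (?f1 (chain \<eta> x j w) - ?pf)) / ?T n\<bar> \<partial>N)) \<longlonglongrightarrow> 0" by simp
    have "\<forall>\<^sub>F n in sequentially. R * (\<integral>w. \<bar>(\<Sum>j<n. ?w j * (?f1 (chain \<eta> x j w) - ?pf)) / ?T n\<bar> \<partial>N)
        = (\<integral>w. \<bar>?av (h R) n w - (\<integral>y. h R y \<partial>\<pi>)\<bar> \<partial>N)"
      using Tpos
    proof eventually_elim
      case (elim n)
      have eq: "R * \<bar>(\<Sum>j<n. ?w j * (?f1 (chain \<eta> x j w) - ?pf)) / ?T n\<bar> = \<bar>?av (h R) n w - R * ?pf\<bar>" for w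
      proof -
        have "(\<Sum>j<n. ?w j * (?f1 (chain \<eta> x j w) - ?pf)) / ?T n = (\<Sum>j<n. ?w j * ?f1 (chain \<eta> x j w)) / ?T n - ?pf"
        proof -
          have "(\<Sum>j<n. ?w j * (?f1 (chain \<eta> x j w) - c)) = (\<Sum>j<n. ?w j * ?f1 (chain \<eta> x j w)) - ?T n * c" for c
            unfolding step_T_eq sum_distrib_right sum_subtractf[symmetric] right_diff_distrib ..
          then show ?thesis using elim by (simp add: diff_divide_distrib)
        qed
        moreover have "R * ((\<Sum>j<n. ?w j * ?f1 (chain \<eta> x j w)) / ?T n) = ?av (h R) n w"
          using R by (simp add: sum_distrib_left)
        ultimately have e1: "R * ((\<Sum>j<n. ?w j * (?f1 (chain \<eta> x j w) - ?pf)) / ?T n) = ?av (h R) n w - R * ?pf"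
          by (simp only: right_diff_distrib)
        show ?thesis unfolding e1[symmetric] by (simp only: abs_mult abs_of_pos[OF R])
      qed
      have "R * (\<integral>w. \<bar>(\<Sum>j<n. ?w j * (?f1 (chain \<eta> x j w) - ?pf)) / ?T n\<bar> \<partial>N)
          = (\<integral>w. R * \<bar>(\<Sum>j<n. ?w j * (?f1 (chain \<eta> x j w) - ?pf)) / ?T n\<bar> \<partial>N)"
        by (rule integral_mult_right_zero[symmetric])
      then show ?case by (simp only: eq pf)
    qed
    from Lim_transform_eventually[OF l this] show ?thesis .
  qed
  obtain C2 where C2: "0 \<le> C2" "\<And>k. (\<integral>w. V (chain \<eta> x k w) ^ (2 * p) \<partial>N) \<le> C2"
    using V_chain_moment_bound[OF gd, of x "2 * p"] by blast
  define D where "D = C\<^sup>2 * C2"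
  have D0: "0 \<le> D" using C2 by (simp add: D_def)
  have f2: "(f u)\<^sup>2 \<le> C\<^sup>2 * V u ^ (2 * p)" for u
    using power_mono[OF fV f0, of u 2] by (simp add: power_mult_distrib power_mult[symmetric] mult.commute)
  have f2i: "integrable N (\<lambda>w. (f (chain \<eta> x k w))\<^sup>2)" for k
    by (rule Bochner_Integration.integrable_bound[OF integrable_mult_right[OF integrable_V_chain'[OF gd, of x k "2 * p"], of "C\<^sup>2"]])
       (use f2 in auto)
  have Ef2: "(\<integral>w. (f (chain \<eta> x k w))\<^sup>2 \<partial>N) \<le> D" for k
  proof -
    have "(\<integral>w. (f (chain \<eta> x k w))\<^sup>2 \<partial>N) \<le> (\<integral>w. C\<^sup>2 * V (chain \<eta> x k w) ^ (2 * p) \<partial>N)"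
      by (intro integral_mono f2i integrable_mult_right integrable_V_chain'[OF gd] f2)
    also have "\<dots> \<le> D" unfolding D_def using C2(2)[of k] by (simp add: mult_left_mono)
    finally show ?thesis .
  qed
  have fi: "integrable N (\<lambda>w. f (chain \<eta> x k w))" for k
    by (rule Bochner_Integration.integrable_bound[OF integrable_mult_right[OF integrable_V_chain'[OF gd, of x k p], of C]])
       (use f0 fV in \<open>auto intro: order_trans[OF _ abs_ge_self]\<close>)
  have hi: "integrable N (\<lambda>w. h R (chain \<eta> x k w))" if "0 < R" for R k
    using hb[OF that] by (intro integrable_F_bounded[where B=R]) auto
  have tr: "(\<integral>w. f (chain \<eta> x k w) - h R (chain \<eta> x k w) \<partial>N) \<le> D / R" if R: "0 < R" for R k
  proof -
    \<comment> \<open>Where \<open>f\<close> exceeds \<open>R\<close> it is at most its square over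
      \<open>R\<close>; elsewhere the truncation is exact.\<close>
    have pw: "f u - h R u \<le> (f u)\<^sup>2 / R" for u
    proof (cases "f u \<le> R")
      case True
      then show ?thesis using R by (simp add: h_def)
    next
      case False
      then have "f u * R \<le> f u * f u" using f0 by (intro mult_left_mono) auto
      then have "f u \<le> (f u)\<^sup>2 / R" using R by (simp add: power2_eq_square field_simps)
      then show ?thesis using False R by (simp add: h_def)
    qed
    have "(\<integral>w. f (chain \<eta> x k w) - h R (chain \<eta> x k w) \<partial>N) \<le> (\<integral>w. (f (chain \<eta> x k w))\<^sup>2 / R \<partial>N)"
      by (intro integral_mono Bochner_Integration.integrable_diff fi hi R integrable_divide f2i pw)
    also have "\<dots> \<le> D / R" using Ef2[of k] R by (simp add: divide_right_mono)
    finally show ?thesis .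
  qed
  have avi: "integrable N (?av (h R) n)" if "0 < R" for R n
    by (intro integrable_divide Bochner_Integration.integrable_sum integrable_mult_right hi that)
  have avfi: "integrable N (?av f n)" for n
    by (intro integrable_divide Bochner_Integration.integrable_sum integrable_mult_right fi)
  have avtr: "(\<integral>w. \<bar>?av f n w - ?av (h R) n w\<bar> \<partial>N) \<le> D / R" if R: "0 < R" and n: "0 < ?T n" for R n
  proof -
    have eq: "\<bar>?av f n w - ?av (h R) n w\<bar> = (\<Sum>j<n. ?w j * (f (chain \<eta> x j w) - h R (chain \<eta> x j w))) / ?T n" for w
    proof -
      have "0 \<le> (\<Sum>j<n. ?w j * (f (chain \<eta> x j w) - h R (chain \<eta> x j w))) / ?T n"
        using w0 n by (intro divide_nonneg_pos sum_nonneg mult_nonneg_nonneg) (auto simp: h_def)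
      moreover have "?av f n w - ?av (h R) n w = (\<Sum>j<n. ?w j * (f (chain \<eta> x j w) - h R (chain \<eta> x j w))) / ?T n"
        by (simp add: diff_divide_distrib[symmetric] sum_subtractf[symmetric] right_diff_distrib)
      ultimately show ?thesis by (simp only: abs_of_nonneg)
    qed
    have "(\<integral>w. \<bar>?av f n w - ?av (h R) n w\<bar> \<partial>N) = (\<Sum>j<n. ?w j * (\<integral>w. f (chain \<eta> x j w) - h R (chain \<eta> x j w) \<partial>N)) / ?T n"
      unfolding eq using fi hi[OF R] by (simp add: Bochner_Integration.integral_sum)
    also have "\<dots> \<le> (\<Sum>j<n. ?w j * (D / R)) / ?T n"
      using w0 n tr[OF R] by (intro divide_right_mono sum_mono mult_left_mono) auto
    also have "\<dots> = D / R" unfolding sum_distrib_right[symmetric] step_T_eq[symmetric] using n by simp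
    finally show ?thesis .
  qed
  \<comment> \<open>A single \<open>n\<close> at which the average is within 1 of its limit in the
    mean suffices, since the averages have expectation at most \<open>D + 1\<close>.\<close>
  have ph: "(\<integral>y. h R y \<partial>\<pi>) \<le> D + 2" if R: "0 < R" for R
  proof -
    have "\<forall>\<^sub>F n in sequentially. (\<integral>w. \<bar>?av (h R) n w - (\<integral>y. h R y \<partial>\<pi>)\<bar> \<partial>N) < 1"
      by (intro order_tendstoD(2)[OF conv[OF R]]) simp
    from eventually_happens[OF eventually_conj[OF this Tpos]]
    obtain n where n: "(\<integral>w. \<bar>?av (h R) n w - (\<integral>y. h R y \<partial>\<pi>)\<bar> \<partial>N) < 1" "0 < ?T n" by auto
    have "(\<integral>y. h R y \<partial>\<pi>) - (\<integral>w. ?av (h R) n w \<partial>N) = (\<integral>w. (\<integral>y. h R y \<partial>\<pi>) - ?av (h R) n w \<partial>N)"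
      using avi[OF R, of n] by (simp add: prob_space)
    also have "\<dots> \<le> (\<integral>w. \<bar>?av (h R) n w - (\<integral>y. h R y \<partial>\<pi>)\<bar> \<partial>N)"
      using avi[OF R, of n] by (intro integral_mono) auto
    finally have 1: "(\<integral>y. h R y \<partial>\<pi>) \<le> (\<integral>w. ?av (h R) n w \<partial>N) + 1" using n by linarith
    have Ef: "(\<integral>w. h R (chain \<eta> x k w) \<partial>N) \<le> D + 1" for k
    proof -
      have "h R u \<le> (f u)\<^sup>2 + 1" for u
      proof -
        have "2 * f u * 1 \<le> (f u)\<^sup>2 + 1\<^sup>2" by (rule sum_squares_bound)
        then show ?thesis using f0[of u] by (simp add: h_def min_le_iff_disj)
      qed
      then have "(\<integral>w. h R (chain \<eta> x k w) \<partial>N) \<le> (\<integral>w. (f (chain \<eta> x k w))\<^sup>2 + 1 \<partial>N)"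
        by (intro integral_mono hi R Bochner_Integration.integrable_add f2i) auto
      also have "\<dots> \<le> D + 1" using Ef2[of k] f2i[of k] by (simp add: prob_space)
      finally show ?thesis .
    qed
    have "(\<integral>w. ?av (h R) n w \<partial>N) = (\<Sum>j<n. ?w j * (\<integral>w. h R (chain \<eta> x j w) \<partial>N)) / ?T n"
      using hi[OF R] by (simp add: Bochner_Integration.integral_sum)
    also have "\<dots> \<le> (\<Sum>j<n. ?w j * (D + 1)) / ?T n"
      using w0 n Ef by (intro divide_right_mono sum_mono mult_left_mono) auto
    also have "\<dots> = D + 1" unfolding sum_distrib_right[symmetric] step_T_eq[symmetric] using n by simp
    finally show ?thesis using 1 by linarith
  qed
  have hpi: "integrable \<pi> (h R)" if "0 < R" for R
    using hb[OF that] by (intro P.integrable_const_bound[where B=R]) auto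
  have hinc: "mono (\<lambda>i. h (real (Suc i)) u)" for u by (auto simp: mono_def h_def)
  have hlim: "(\<lambda>i. h (real (Suc i)) u) \<longlonglongrightarrow> f u" for u
  proof -
    obtain i0 where "f u < real i0" using reals_Archimedean2 by blast
    then have "\<forall>\<^sub>F i in sequentially. h (real (Suc i)) u = f u"
      unfolding eventually_sequentially by (intro exI[of _ i0]) (auto simp: h_def)
    then show ?thesis by (rule tendsto_eventually)
  qed
  have pinc: "mono (\<lambda>i. \<integral>y. h (real (Suc i)) y \<partial>\<pi>)"
    unfolding mono_def by (intro allI impI integral_mono hpi) (auto simp: h_def)
  have "convergent (\<lambda>i. \<integral>y. h (real (Suc i)) y \<partial>\<pi>)"
  proof (rule Bseq_mono_convergent)
    show "Bseq (\<lambda>i. \<integral>y. h (real (Suc i)) y \<partial>\<pi>)"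
    proof (rule BseqI'[of _ "D + 2"])
      fix i
      have "0 \<le> (\<integral>y. h (real (Suc i)) y \<partial>\<pi>)" using f0 by (intro Bochner_Integration.integral_nonneg) (auto simp: h_def)
      then show "norm (\<integral>y. h (real (Suc i)) y \<partial>\<pi>) \<le> D + 2" using ph[of "real (Suc i)"] by simp
    qed
  qed (use pinc in \<open>auto simp: mono_def\<close>)
  then obtain l where l: "(\<lambda>i. \<integral>y. h (real (Suc i)) y \<partial>\<pi>) \<longlonglongrightarrow> l" by (auto simp: convergent_def)
  have hb\<pi>: "has_bochner_integral \<pi> f l"
    by (rule has_bochner_integral_monotone_convergence[OF _ _ _ l])
       (use hpi hinc hlim in \<open>auto simp: mono_def\<close>)
  then show fpi: "integrable \<pi> f" by (rule integrable.intros)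
  have lf: "(\<integral>y. f y \<partial>\<pi>) = l" using hb\<pi> by (rule has_bochner_integral_integral_eq)
  show "(\<lambda>n. \<integral>w. \<bar>?av f n w - (\<integral>y. f y \<partial>\<pi>)\<bar> \<partial>N) \<longlonglongrightarrow> 0"
  proof (rule LIMSEQ_I)
    fix r :: real assume r: "0 < r"
    have Dl: "(\<lambda>i. D / real (Suc i)) \<longlonglongrightarrow> 0" using LIMSEQ_Suc[OF lim_const_over_n[of D]] .
    have "\<forall>\<^sub>F i in sequentially. D / real (Suc i) < r / 3" by (rule order_tendstoD(2)[OF Dl]) (use r in simp)
    moreover have "\<forall>\<^sub>F i in sequentially. \<bar>(\<integral>y. h (real (Suc i)) y \<partial>\<pi>) - l\<bar> < r / 3"
      using tendstoD[OF l, of "r / 3"] r by (simp add: dist_real_def)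
    ultimately obtain i where i: "D / real (Suc i) < r / 3" "\<bar>(\<integral>y. h (real (Suc i)) y \<partial>\<pi>) - l\<bar> < r / 3"
      using eventually_happens[OF eventually_conj] by fastforce
    let ?R = "real (Suc i)"
    have R: "0 < ?R" by simp
    have "\<forall>\<^sub>F n in sequentially. (\<integral>w. \<bar>?av (h ?R) n w - (\<integral>y. h ?R y \<partial>\<pi>)\<bar> \<partial>N) < r / 3"
      by (intro order_tendstoD(2)[OF conv[OF R]]) (use r in simp)
    then have "\<forall>\<^sub>F n in sequentially. norm ((\<integral>w. \<bar>?av f n w - (\<integral>y. f y \<partial>\<pi>)\<bar> \<partial>N) - 0) < r"
      using Tpos
    proof eventually_elim
      case (elim n)
      have "(\<integral>w. \<bar>?av f n w - (\<integral>y. f y \<partial>\<pi>)\<bar> \<partial>N) \<le>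
          (\<integral>w. \<bar>?av f n w - ?av (h ?R) n w\<bar> + \<bar>?av (h ?R) n w - (\<integral>y. h ?R y \<partial>\<pi>)\<bar> + \<bar>(\<integral>y. h ?R y \<partial>\<pi>) - l\<bar> \<partial>N)"
        using avi[OF R, of n] avfi[of n] unfolding lf
        by (intro integral_mono Bochner_Integration.integrable_add integrable_abs Bochner_Integration.integrable_diff) auto
      also have "\<dots> = (\<integral>w. \<bar>?av f n w - ?av (h ?R) n w\<bar> \<partial>N) + (\<integral>w. \<bar>?av (h ?R) n w - (\<integral>y. h ?R y \<partial>\<pi>)\<bar> \<partial>N) + \<bar>(\<integral>y. h ?R y \<partial>\<pi>) - l\<bar>"
        using avi[OF R, of n] avfi[of n] by (simp add: prob_space)
      also have "\<dots> < r" using avtr[OF R elim(2)] elim(1) i by linarith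
      finally show ?case by simp
    qed
    then show "\<exists>no. \<forall>n\<ge>no. norm ((\<integral>w. \<bar>?av f n w - (\<integral>y. f y \<partial>\<pi>)\<bar> \<partial>N) - 0) < r"
      by (simp add: eventually_sequentially)
  qed
qed

end

section \<open>Maximal inequalities for Gaussian martingales\<close>

context gauss_seq
begin

text \<open>Doob's inequality for a nonnegative process that may grow by \<open>r k\<close> in the
  mean. No stopping time is used: the induction carries along the probability of having reached
  \<open>q\<close> together with the mass of the process where it has not yet done so.\<close>

lemma maximal_inequality:
  fixes S :: "nat \<Rightarrow> 'v \<Rightarrow> real"
  assumes S: "\<And>k. S k \<in> borel_measurable (F (k0 + k))" and S0: "\<And>k w. 0 \<le> S k w"
    and Si: "\<And>k. integrable N (S k)"
    and step: "\<And>k A. A \<in> sets (F (k0 + k)) \<Longrightarrow>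
      (\<integral>w. indicator A w * S (Suc k) w \<partial>N) \<le> (\<integral>w. indicator A w * S k w \<partial>N) + r k"
    and q: "0 < q"
  shows "q * measure N {w\<in>space N. \<exists>k\<le>n. q \<le> S k w} \<le> (\<integral>w. S 0 w \<partial>N) + (\<Sum>k<n. r k)"
proof -
  have Sm[measurable]: "S k \<in> borel_measurable N" for k by (rule measurable_F_N[OF S])
  define B where "B n = {w\<in>space N. \<forall>k\<le>n. S k w < q}" for n
  have BF: "B n \<in> sets (F (k0 + n))" for n
  proof -
    have "B n = {w\<in>space (F (k0 + n)). \<forall>k\<in>{..n}. S k w < q}" by (auto simp: B_def)
    also have "\<dots> \<in> sets (F (k0 + n))"
    proof (rule sets.sets_Collect_finite_All)
      fix k assume "k \<in> {..n}"
      then have [measurable]: "S k \<in> borel_measurable (F (k0 + n))" by (intro measurable_F_mono[OF S]) simp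
      show "{w \<in> space (F (k0 + n)). S k w < q} \<in> sets (F (k0 + n))" by measurable
    qed simp
    finally show ?thesis .
  qed
  have Bm[measurable]: "B n \<in> sets N" for n using BF sets_F_le by blast
  have indS: "integrable N (\<lambda>w. indicator A w * S k w)" if "A \<in> sets N" for A k
    using integrable_mult_indicator[OF that Si[of k]] by simp
  have "q * measure N (space N - B n) + (\<integral>w. indicator (B n) w * S n w \<partial>N) \<le> (\<integral>w. S 0 w \<partial>N) + (\<Sum>k<n. r k)" for n
  proof (induction n)
    case 0
    have "q * measure N (space N - B 0) = (\<integral>w. q * indicator (space N - B 0) w \<partial>N)" by simp
    also have "\<dots> + (\<integral>w. indicator (B 0) w * S 0 w \<partial>N) = (\<integral>w. q * indicator (space N - B 0) w + indicator (B 0) w * S 0 w \<partial>N)"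
      using indS by (intro Bochner_Integration.integral_add[symmetric]) (auto simp: emeasure_eq_measure)
    also have "\<dots> \<le> (\<integral>w. S 0 w \<partial>N)"
    proof (rule integral_mono)
      show "integrable N (\<lambda>w. q * indicator (space N - B 0) w + indicator (B 0) w * S 0 w)"
        using indS by (intro Bochner_Integration.integrable_add) (auto simp: emeasure_eq_measure)
      show "q * indicator (space N - B 0) w + indicator (B 0) w * S 0 w \<le> S 0 w" for w
        using S0[of 0 w] by (auto simp: indicator_def B_def)
    qed (rule Si)
    finally show ?case by simp
  next
    case (Suc n)
    have dec: "B (Suc n) \<subseteq> B n" by (auto simp: B_def)
    have m: "measure N (space N - B (Suc n)) = measure N (space N - B n) + measure N (B n - B (Suc n))"
    proof -
      have "space N - B (Suc n) = (space N - B n) \<union> (B n - B (Suc n))"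
        using dec by (auto simp: B_def)
      then show ?thesis by (simp add: finite_measure_Union Diff_disjoint disjoint_iff)
    qed
    have "q * measure N (B n - B (Suc n)) + (\<integral>w. indicator (B (Suc n)) w * S (Suc n) w \<partial>N)
        = (\<integral>w. q * indicator (B n - B (Suc n)) w \<partial>N) + (\<integral>w. indicator (B (Suc n)) w * S (Suc n) w \<partial>N)"
      by simp
    also have "\<dots> = (\<integral>w. q * indicator (B n - B (Suc n)) w + indicator (B (Suc n)) w * S (Suc n) w \<partial>N)"
      using indS by (intro Bochner_Integration.integral_add[symmetric]) (auto simp: emeasure_eq_measure)
    also have "\<dots> \<le> (\<integral>w. indicator (B n) w * S (Suc n) w \<partial>N)"
    proof (rule integral_mono)
      show "integrable N (\<lambda>w. q * indicator (B n - B (Suc n)) w + indicator (B (Suc n)) w * S (Suc n) w)"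
        using indS by (intro Bochner_Integration.integrable_add) (auto simp: emeasure_eq_measure)
      show "integrable N (\<lambda>w. indicator (B n) w * S (Suc n) w)" by (rule indS) simp
      fix w
      show "q * indicator (B n - B (Suc n)) w + indicator (B (Suc n)) w * S (Suc n) w \<le> indicator (B n) w * S (Suc n) w"
        using dec S0[of "Suc n" w] by (auto simp: indicator_def B_def le_Suc_eq not_less)
    qed
    also have "\<dots> \<le> (\<integral>w. indicator (B n) w * S n w \<partial>N) + r n" by (rule step[OF BF])
    finally show ?case using Suc unfolding m by (simp add: distrib_left)
  qed
  from this[of n] have "q * measure N (space N - B n) \<le> (\<integral>w. S 0 w \<partial>N) + (\<Sum>k<n. r k)"
  proof -
    have "0 \<le> (\<integral>w. indicator (B n) w * S n w \<partial>N)"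
      by (rule Bochner_Integration.integral_nonneg) (use S0 in auto)
    then show ?thesis using \<open>q * measure N (space N - B n) + (\<integral>w. indicator (B n) w * S n w \<partial>N) \<le> (\<integral>w. S 0 w \<partial>N) + (\<Sum>k<n. r k)\<close>
      by linarith
  qed
  also have "space N - B n = {w\<in>space N. \<exists>k\<le>n. q \<le> S k w}" by (auto simp: B_def not_less)
  finally show ?thesis .
qed

section \<open>Martingales with conditionally Gaussian increments\<close>

definition mart :: "(nat \<Rightarrow> 'v \<Rightarrow> real^'n) \<Rightarrow> nat \<Rightarrow> 'v \<Rightarrow> real" where
  "mart c k w = (\<Sum>j<k. c j w \<bullet> \<xi> (Suc j) w)"

definition bracket :: "(nat \<Rightarrow> 'v \<Rightarrow> real^'n) \<Rightarrow> nat \<Rightarrow> 'v \<Rightarrow> real" where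
  "bracket c k w = (\<Sum>j<k. (norm (c j w))\<^sup>2)"

text \<open>Coefficient \<open>c j\<close> multiplies the noise with index \<open>Suc j\<close>, so
  this is predictability.\<close>

definition adapted :: "(nat \<Rightarrow> 'v \<Rightarrow> real^'n) \<Rightarrow> bool" where
  "adapted c \<longleftrightarrow> (\<forall>j. c j \<in> borel_measurable (F j))"

lemma mart_Suc: "mart c (Suc k) w = mart c k w + c k w \<bullet> \<xi> (Suc k) w"
  and bracket_Suc: "bracket c (Suc k) w = bracket c k w + (norm (c k w))\<^sup>2"
  by (simp_all add: mart_def bracket_def)

lemma bracket_mono: "k \<le> l \<Longrightarrow> bracket c k w \<le> bracket c l w"
  unfolding bracket_def by (intro sum_mono2) auto

lemma mart_F: "adapted c \<Longrightarrow> k \<le> l \<Longrightarrow> mart c k \<in> borel_measurable (F l)"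
  unfolding mart_def[abs_def]
  by (intro borel_measurable_sum borel_measurable_inner)
     (auto simp: adapted_def intro: measurable_F_mono F_rv)

text \<open>The bracket is known one step ahead: its value at \<open>Suc l\<close> involves
  coefficients up to index \<open>l\<close> only. \<open>trunc\<close> relies on this to act before
  the bracket passes a level.\<close>

lemma bracket_F:
  assumes "adapted c" "k \<le> Suc l"
  shows "bracket c k \<in> borel_measurable (F l)"
proof -
  have "c j \<in> borel_measurable (F l)" if "j < k" for j
    using assms that by (auto simp: adapted_def intro: measurable_F_mono)
  then show ?thesis
    unfolding bracket_def[abs_def]
    by (intro borel_measurable_sum borel_measurable_power) (auto intro: borel_measurable_norm)
qed

lemma nn_integral_exp_gauss:
  "(\<integral>\<^sup>+z. ennreal (exp (u \<bullet> z)) \<partial>std_gauss) = ennreal (exp ((norm (u :: real^'n))\<^sup>2 / 2))"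
  using has_bochner_integral_std_gauss_exp[of u]
  by (subst nn_integral_eq_integral) (auto simp: has_bochner_integral_iff)

text \<open>The Gaussian moment generating function cancels against the bracket, so the exponential
  keeps its mean exactly on every event of the past. Nonnegative integrals are used because
  integrability is only a consequence.\<close>

lemma exp_mart_step:
  fixes l :: real
  assumes c: "adapted c" and k0: "k0 \<le> k" and A: "A \<in> sets (F k)"
  defines "E \<equiv> \<lambda>k w. exp (l * (mart c k w - mart c k0 w) - l\<^sup>2 / 2 * (bracket c k w - bracket c k0 w))"
  shows "(\<integral>\<^sup>+w. indicator A w * ennreal (E (Suc k) w) \<partial>N) = (\<integral>\<^sup>+w. indicator A w * ennreal (E k w) \<partial>N)"
proof -
  have [measurable]: "c k \<in> borel_measurable (F k)" "mart c k \<in> borel_measurable (F k)" "mart c k0 \<in> borel_measurable (F k)"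
    "bracket c k \<in> borel_measurable (F k)" "bracket c k0 \<in> borel_measurable (F k)" "A \<in> sets (F k)"
    using c k0 A by (auto intro: mart_F bracket_F simp: adapted_def)
  let ?Z = "\<lambda>w. (indicator A w * ennreal (E k w), c k w)"
  have Z: "?Z \<in> measurable (F k) (borel \<Otimes>\<^sub>M borel)"
    unfolding E_def by measurable
  let ?f = "\<lambda>p. fst (fst p) * ennreal (exp (l * (snd (fst p) \<bullet> (snd p :: real^'n)) - l\<^sup>2 / 2 * (norm (snd (fst p)))\<^sup>2))"
  have f: "?f \<in> borel_measurable ((borel \<Otimes>\<^sub>M borel) \<Otimes>\<^sub>M borel)" by measurable
  have eq: "E (Suc k) w = E k w * exp (l * (c k w \<bullet> \<xi> (Suc k) w) - l\<^sup>2 / 2 * (norm (c k w))\<^sup>2)" for w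
    unfolding E_def mart_Suc bracket_Suc exp_add[symmetric] by (simp add: field_simps)
  have "(\<integral>\<^sup>+w. indicator A w * ennreal (E (Suc k) w) \<partial>N) = (\<integral>\<^sup>+w. ?f (?Z w, \<xi> (Suc k) w) \<partial>N)"
    unfolding eq by (simp add: ennreal_mult E_def mult.assoc)
  also have "\<dots> = (\<integral>\<^sup>+w. (\<integral>\<^sup>+z. ?f (?Z w, z) \<partial>std_gauss) \<partial>N)" by (rule nn_integral_next[OF Z f])
  also have "\<dots> = (\<integral>\<^sup>+w. indicator A w * ennreal (E k w) \<partial>N)"
  proof (rule nn_integral_cong)
    fix w
    have e: "exp (l * (c k w \<bullet> z) - l\<^sup>2 / 2 * (norm (c k w))\<^sup>2) = exp (- (l\<^sup>2 / 2 * (norm (c k w))\<^sup>2)) * exp ((l *\<^sub>R c k w) \<bullet> z)" for z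
      by (simp add: exp_add[symmetric])
    have "(\<integral>\<^sup>+z. ennreal (exp (l * (c k w \<bullet> z) - l\<^sup>2 / 2 * (norm (c k w))\<^sup>2)) \<partial>std_gauss) = 1"
    proof -
      let ?a = "- (l\<^sup>2 / 2 * (norm (c k w))\<^sup>2)"
      have "(\<integral>\<^sup>+z. ennreal (exp ?a * exp ((l *\<^sub>R c k w) \<bullet> z)) \<partial>std_gauss) = ennreal (exp ?a) * (\<integral>\<^sup>+z. ennreal (exp ((l *\<^sub>R c k w) \<bullet> z)) \<partial>std_gauss)"
        by (subst nn_integral_cmult[symmetric]) (auto simp: ennreal_mult)
      also have "\<dots> = ennreal (exp ?a * exp ((norm (l *\<^sub>R c k w))\<^sup>2 / 2))"
        by (simp only: nn_integral_exp_gauss ennreal_mult[OF exp_ge_zero exp_ge_zero])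
      also have "exp ?a * exp ((norm (l *\<^sub>R c k w))\<^sup>2 / 2) = 1"
        by (simp add: exp_add[symmetric] power_mult_distrib)
      finally show ?thesis unfolding e by simp
    qed
    then show "(\<integral>\<^sup>+z. ?f (?Z w, z) \<partial>std_gauss) = indicator A w * ennreal (E k w)"
      by (simp add: nn_integral_cmult)
  qed
  finally show ?thesis .
qed

text \<open>On the event in question the exponential martingale must have reached
  \<open>exp (l * \<epsilon> - l\<^sup>2 / 2 * v)\<close>, since the bracket at an earlier time is
  no larger. The sign \<open>s\<close> covers both tails.\<close>

lemma exp_mart_max:
  assumes c: "adapted c" and k: "k0 \<le> k1" and l: "0 < l" and \<epsilon>: "0 < \<epsilon>" and v: "0 \<le> v"
    and s: "s = 1 \<or> s = - 1"
  shows "measure N {w\<in>space N. (\<exists>k\<in>{k0..k1}. \<epsilon> \<le> s * (mart c k w - mart c k0 w)) \<and> bracket c k1 w - bracket c k0 w \<le> v}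
    \<le> exp (l\<^sup>2 / 2 * v - l * \<epsilon>)"
proof -
  let ?l = "s * l"
  define E where "E k w = exp (?l * (mart c k w - mart c k0 w) - ?l\<^sup>2 / 2 * (bracket c k w - bracket c k0 w))" for k w
  define S where "S j = E (k0 + j)" for j
  have SF: "S j \<in> borel_measurable (F (k0 + j))" for j
  proof -
    have [measurable]: "mart c (k0 + j) \<in> borel_measurable (F (k0 + j))" "mart c k0 \<in> borel_measurable (F (k0 + j))"
      "bracket c (k0 + j) \<in> borel_measurable (F (k0 + j))" "bracket c k0 \<in> borel_measurable (F (k0 + j))"
      using c by (auto intro: mart_F bracket_F)
    show ?thesis unfolding S_def E_def[abs_def] by measurable
  qed
  have SN[measurable]: "S j \<in> borel_measurable N" for j by (rule measurable_F_N[OF SF])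
  have st: "(\<integral>\<^sup>+w. indicator A w * ennreal (S (Suc j) w) \<partial>N) = (\<integral>\<^sup>+w. indicator A w * ennreal (S j w) \<partial>N)"
    if "A \<in> sets (F (k0 + j))" for A j
    unfolding S_def E_def using exp_mart_step[OF c _ that, of k0 ?l] by simp
  have S1: "(\<integral>\<^sup>+w. ennreal (S j w) \<partial>N) = 1" for j
  proof (induction j)
    case (Suc j)
    have "(\<integral>\<^sup>+w. ennreal (S (Suc j) w) \<partial>N) = (\<integral>\<^sup>+w. indicator (space N) w * ennreal (S (Suc j) w) \<partial>N)"
      by (intro nn_integral_cong) simp
    also have "\<dots> = (\<integral>\<^sup>+w. indicator (space N) w * ennreal (S j w) \<partial>N)"
      using sets.top[of "F (k0 + j)"] by (intro st) simp
    also have "\<dots> = (\<integral>\<^sup>+w. ennreal (S j w) \<partial>N)" by (intro nn_integral_cong) simp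
    finally show ?case using Suc by simp
  qed (simp add: S_def E_def emeasure_space_1)
  have S0: "0 \<le> S j w" for j w by (simp add: S_def E_def)
  have Si: "integrable N (S j)" for j
    using S1[of j] S0 by (intro integrableI_nonneg) auto
  have eqI: "(\<integral>w. indicator A w * S (Suc j) w \<partial>N) = (\<integral>w. indicator A w * S j w \<partial>N)" if A: "A \<in> sets (F (k0 + j))" for A j
  proof -
    have [measurable]: "A \<in> sets N" using A sets_F_le by blast
    have "ennreal (indicator A w * S i w) = indicator A w * ennreal (S i w)" for i w
      by (simp add: indicator_def)
    then show ?thesis using st[OF A] S0 by (simp add: integral_eq_nn_integral)
  qed
  let ?q = "exp (l * \<epsilon> - l\<^sup>2 / 2 * v)"
  have "?q * measure N {w\<in>space N. \<exists>j\<le>k1 - k0. ?q \<le> S j w} \<le> (\<integral>w. S 0 w \<partial>N) + (\<Sum>j<k1 - k0. 0)"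
    by (rule maximal_inequality[OF SF S0 Si]) (auto simp: eqI)
  also have "\<dots> = 1" by (simp add: S_def E_def prob_space)
  finally have "measure N {w\<in>space N. \<exists>j\<le>k1 - k0. ?q \<le> S j w} \<le> 1 / ?q" by (simp add: field_simps)
  also have "1 / ?q = exp (l\<^sup>2 / 2 * v - l * \<epsilon>)" by (simp add: exp_minus[symmetric] inverse_eq_divide[symmetric])
  finally have b: "measure N {w\<in>space N. \<exists>j\<le>k1 - k0. ?q \<le> S j w} \<le> exp (l\<^sup>2 / 2 * v - l * \<epsilon>)" .
  have "measure N {w\<in>space N. (\<exists>k\<in>{k0..k1}. \<epsilon> \<le> s * (mart c k w - mart c k0 w)) \<and> bracket c k1 w - bracket c k0 w \<le> v}
    \<le> measure N {w\<in>space N. \<exists>j\<le>k1 - k0. ?q \<le> S j w}"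
  proof (rule finite_measure_mono)
    show "{w\<in>space N. (\<exists>k\<in>{k0..k1}. \<epsilon> \<le> s * (mart c k w - mart c k0 w)) \<and> bracket c k1 w - bracket c k0 w \<le> v}
      \<subseteq> {w\<in>space N. \<exists>j\<le>k1 - k0. ?q \<le> S j w}"
    proof safe
      fix w k assume kk: "k \<in> {k0..k1}" and e: "\<epsilon> \<le> s * (mart c k w - mart c k0 w)" and br: "bracket c k1 w - bracket c k0 w \<le> v"
      have "l * \<epsilon> \<le> l * (s * (mart c k w - mart c k0 w))" using e l by (intro mult_left_mono) auto
      moreover have "l\<^sup>2 / 2 * (bracket c k w - bracket c k0 w) \<le> l\<^sup>2 / 2 * v"
        using br bracket_mono[of k k1 c w] kk by (intro mult_left_mono) auto
      moreover have "?l\<^sup>2 = l\<^sup>2" using s by auto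
      ultimately have "?q \<le> S (k - k0) w" unfolding S_def E_def using kk by (simp add: mult_ac)
      then show "\<exists>j\<le>k1 - k0. ?q \<le> S j w" using kk by (intro exI[of _ "k - k0"]) auto
    qed
    show "{w\<in>space N. \<exists>j\<le>k1 - k0. ?q \<le> S j w} \<in> sets N" by measurable
  qed
  then show ?thesis using b by linarith
qed

theorem mart_oscillation:
  assumes c: "adapted c" and k: "k0 \<le> k1" and \<epsilon>: "0 < \<epsilon>" and v: "0 < v"
  shows "measure N {w\<in>space N. (\<exists>k\<in>{k0..k1}. \<epsilon> \<le> \<bar>mart c k w - mart c k0 w\<bar>) \<and> bracket c k1 w - bracket c k0 w \<le> v}
    \<le> 2 * exp (- (\<epsilon>\<^sup>2 / (2 * v)))"
proof -
  have mN[measurable]: "mart c k \<in> borel_measurable N" for k by (rule measurable_F_N[OF mart_F[OF c order_refl]])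
  have bN[measurable]: "bracket c k \<in> borel_measurable N" for k by (rule measurable_F_N[OF bracket_F[OF c]]) (rule le_SucI, rule order_refl)
  let ?A = "\<lambda>s. {w\<in>space N. (\<exists>k\<in>{k0..k1}. \<epsilon> \<le> s * (mart c k w - mart c k0 w)) \<and> bracket c k1 w - bracket c k0 w \<le> v}"
  have Am: "?A s \<in> sets N" for s by measurable
  have "{w\<in>space N. (\<exists>k\<in>{k0..k1}. \<epsilon> \<le> \<bar>mart c k w - mart c k0 w\<bar>) \<and> bracket c k1 w - bracket c k0 w \<le> v} \<subseteq> ?A 1 \<union> ?A (-1)"
    by (auto simp: abs_if split: if_splits)
  then have "measure N {w\<in>space N. (\<exists>k\<in>{k0..k1}. \<epsilon> \<le> \<bar>mart c k w - mart c k0 w\<bar>) \<and> bracket c k1 w - bracket c k0 w \<le> v} \<le> measure N (?A 1 \<union> ?A (-1))"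
    by (intro finite_measure_mono sets.Un Am)
  also have "\<dots> \<le> measure N (?A 1) + measure N (?A (-1))" by (intro measure_Un_le Am)
  \<comment> \<open>The value \<open>l = \<epsilon> / v\<close> minimizes the exponent.\<close>
  also have "\<dots> \<le> exp ((\<epsilon> / v)\<^sup>2 / 2 * v - \<epsilon> / v * \<epsilon>) + exp ((\<epsilon> / v)\<^sup>2 / 2 * v - \<epsilon> / v * \<epsilon>)"
    using \<epsilon> v by (intro add_mono exp_mart_max c k) auto
  also have "(\<epsilon> / v)\<^sup>2 / 2 * v - \<epsilon> / v * \<epsilon> = - (\<epsilon>\<^sup>2 / (2 * v))"
    using v by (simp add: power2_eq_square field_simps)
  finally show ?thesis by simp
qed

end

section \<open>Central limit theorem for blocks of a Gaussian martingale\<close>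

lemma std_normal_prob: "prob_space std_normal_distribution"
  using prob_space_normal_density[of 1 0] by simp

lemma std_normal_abs_moment:
  "integrable std_normal_distribution (\<lambda>z. \<bar>z\<bar>)" "(\<integral>z. \<bar>z\<bar> \<partial>std_normal_distribution) \<le> 1"
proof -
  interpret prob_space std_normal_distribution by (rule std_normal_prob)
  have m: "integrable std_normal_distribution (\<lambda>z. z ^ k)" for k
    by (rule integrable_std_normal_distribution_moment)
  show "integrable std_normal_distribution (\<lambda>z. \<bar>z\<bar>)" using m[of 1] by simp
  have "(\<integral>z. \<bar>z\<bar> \<partial>std_normal_distribution) \<le> sqrt (\<integral>z. z\<^sup>2 \<partial>std_normal_distribution)"
    by (rule integral_abs_le_sqrt) (use m[of 2] in auto)
  then show "(\<integral>z. \<bar>z\<bar> \<partial>std_normal_distribution) \<le> 1"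
    using std_normal_distribution_even_moments(1)[of 1] by simp
qed

lemma gauss_smoothing_diff:
  fixes f :: "real \<Rightarrow> real"
  assumes [measurable]: "f \<in> borel_measurable borel" and B: "\<And>a. \<bar>f a\<bar> \<le> B"
    and L: "\<And>a b. \<bar>f a - f b\<bar> \<le> \<Lambda> * \<bar>a - b\<bar>" and L0: "0 \<le> \<Lambda>"
  shows "\<bar>(\<integral>z. f (m + r * z) \<partial>std_normal_distribution) - (\<integral>z. f (m + s * z) \<partial>std_normal_distribution)\<bar> \<le> \<Lambda> * \<bar>r - s\<bar>"
proof -
  interpret prob_space std_normal_distribution by (rule std_normal_prob)
  have i: "integrable std_normal_distribution (\<lambda>z. f (m + t * z))" for t
    using B by (intro integrable_const_bound[where B=B]) auto
  have "\<bar>(\<integral>z. f (m + r * z) \<partial>std_normal_distribution) - (\<integral>z. f (m + s * z) \<partial>std_normal_distribution)\<bar>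
      = \<bar>\<integral>z. f (m + r * z) - f (m + s * z) \<partial>std_normal_distribution\<bar>"
    using i by (simp only: Bochner_Integration.integral_diff)
  also have "\<dots> \<le> (\<integral>z. \<bar>f (m + r * z) - f (m + s * z)\<bar> \<partial>std_normal_distribution)" by (rule integral_abs_bound)
  also have "\<dots> \<le> (\<integral>z. \<Lambda> * \<bar>r - s\<bar> * \<bar>z\<bar> \<partial>std_normal_distribution)"
  proof (rule integral_mono)
    show "\<bar>f (m + r * z) - f (m + s * z)\<bar> \<le> \<Lambda> * \<bar>r - s\<bar> * \<bar>z\<bar>" for z
      using L[of "m + r * z" "m + s * z"] by (simp add: abs_mult[symmetric] left_diff_distrib mult.assoc)
  qed (use i std_normal_abs_moment(1) in auto)
  also have "\<dots> \<le> \<Lambda> * \<bar>r - s\<bar> * 1"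
    unfolding integral_mult_right_zero using std_normal_abs_moment(2) L0 by (intro mult_left_mono) auto
  finally show ?thesis by simp
qed

context gauss_seq
begin

text \<open>The test looks at the bracket at \<open>Suc j\<close>, which is known at time
  \<open>j\<close>, so the level \<open>v\<close> is never passed. As the bracket of
  \<open>c\<close> does not decrease, coefficients stay off once they have been switched off after
  \<open>k0\<close>.\<close>

definition trunc :: "(nat \<Rightarrow> 'v \<Rightarrow> real^'n) \<Rightarrow> nat \<Rightarrow> real \<Rightarrow> nat \<Rightarrow> 'v \<Rightarrow> real^'n" where
  "trunc c k0 v j w = (if k0 \<le> j \<and> bracket c (Suc j) w - bracket c k0 w \<le> v then c j w else 0)"

lemma adapted_trunc:
  assumes "adapted c" shows "adapted (trunc c k0 v)"
  unfolding adapted_def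
proof
  fix j
  show "trunc c k0 v j \<in> borel_measurable (F j)"
  proof (cases "k0 \<le> j")
    case True
    then have [measurable]: "c j \<in> borel_measurable (F j)" "bracket c (Suc j) \<in> borel_measurable (F j)" "bracket c k0 \<in> borel_measurable (F j)"
      using assms by (auto simp: adapted_def intro!: bracket_F)
    show ?thesis unfolding trunc_def[abs_def] by measurable
  qed (simp add: trunc_def[abs_def])
qed

lemma trunc_before: "k \<le> k0 \<Longrightarrow> mart (trunc c k0 v) k w = 0" "k \<le> k0 \<Longrightarrow> bracket (trunc c k0 v) k w = 0"
  by (auto simp: mart_def bracket_def trunc_def intro!: sum.neutral)

lemma trunc_inactive:
  assumes "k0 \<le> k" "bracket c k w - bracket c k0 w \<le> v"
  shows "mart (trunc c k0 v) k w = mart c k w - mart c k0 w"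
    and "bracket (trunc c k0 v) k w = bracket c k w - bracket c k0 w"
proof -
  have *: "bracket c k w - bracket c k0 w \<le> v \<longrightarrow> mart (trunc c k0 v) k w = mart c k w - mart c k0 w \<and>
     bracket (trunc c k0 v) k w = bracket c k w - bracket c k0 w"
    using assms(1)
  proof (induction k rule: dec_induct)
    case base
    then show ?case using trunc_before[of k0 k0] by simp
  next
    case (step k)
    show ?case
    proof
      assume a: "bracket c (Suc k) w - bracket c k0 w \<le> v"
      then have "bracket c k w - bracket c k0 w \<le> v" using bracket_mono[of k "Suc k" c w] by simp
      moreover have t: "trunc c k0 v k w = c k w" using a step.hyps by (simp only: trunc_def) simp
      ultimately show "mart (trunc c k0 v) (Suc k) w = mart c (Suc k) w - mart c k0 w \<and>
         bracket (trunc c k0 v) (Suc k) w = bracket c (Suc k) w - bracket c k0 w"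
        using step.IH by (simp add: mart_Suc bracket_Suc)
    qed
  qed
  then show "mart (trunc c k0 v) k w = mart c k w - mart c k0 w"
    and "bracket (trunc c k0 v) k w = bracket c k w - bracket c k0 w"
    using assms(2) by auto
qed

lemma bracket_trunc_le:
  assumes v: "0 \<le> v" shows "bracket (trunc c k0 v) k w \<le> v"
proof (induction k)
  case (Suc k)
  show ?case
  proof (cases "k0 \<le> k \<and> bracket c (Suc k) w - bracket c k0 w \<le> v")
    case True
    then show ?thesis using trunc_inactive(2)[of k0 "Suc k" c w v] by simp
  next
    case False
    then have "trunc c k0 v k w = 0" by (auto simp: trunc_def)
    then show ?thesis using Suc by (simp add: bracket_Suc)
  qed
qed (use v in \<open>simp add: bracket_def\<close>)

text \<open>Given \<open>F k\<close> the increment of the martingale is Gaussian with the variance that the bracket gains, so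
  it can be traded for part of the independent Gaussian of variance \<open>v - bracket c k\<close>.\<close>

lemma heat_step:
  fixes f :: "'s \<times> real \<Rightarrow> real"
  assumes c: "adapted c" and k: "k0 \<le> k" and Y: "Y \<in> measurable (F k0) S"
    and f[measurable]: "f \<in> borel_measurable (S \<Otimes>\<^sub>M borel)" and fB: "\<And>p. \<bar>f p\<bar> \<le> B"
    and br: "\<And>\<omega>. bracket c (Suc k) \<omega> \<le> v"
  shows "(\<integral>\<omega>. (\<integral>z. f (Y \<omega>, mart c (Suc k) \<omega> + sqrt (v - bracket c (Suc k) \<omega>) * z) \<partial>std_normal_distribution) \<partial>N)
    = (\<integral>\<omega>. (\<integral>z. f (Y \<omega>, mart c k \<omega> + sqrt (v - bracket c k \<omega>) * z) \<partial>std_normal_distribution) \<partial>N)"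
proof -
  interpret G: prob_space std_normal_distribution by (rule std_normal_prob)
  interpret PG: pair_prob_space "std_gauss :: (real^'n) measure" std_normal_distribution ..
  have [measurable]: "c k \<in> borel_measurable (F k)" "mart c k \<in> borel_measurable (F k)" "bracket c k \<in> borel_measurable (F k)" "Y \<in> measurable (F k) S"
    using c k Y by (auto intro: mart_F bracket_F measurable_F_mono simp: adapted_def)
  \<comment> \<open>All that the integrand needs from the past: the parameter, the position, the
    variance left and the coefficient of the next noise.\<close>
  let ?Z = "\<lambda>\<omega>. (Y \<omega>, (mart c k \<omega>, v - bracket c k \<omega>), c k \<omega>)"
  have Z: "?Z \<in> measurable (F k) (S \<Otimes>\<^sub>M (borel \<Otimes>\<^sub>M borel) \<Otimes>\<^sub>M borel)" by measurable
  let ?g = "\<lambda>p. \<integral>z. f (fst (fst p), fst (fst (snd (fst p))) + snd (snd (fst p)) \<bullet> (snd p :: real^'n)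
      + sqrt (snd (fst (snd (fst p))) - (norm (snd (snd (fst p))))\<^sup>2) * z) \<partial>std_normal_distribution"
  have g: "?g \<in> borel_measurable ((S \<Otimes>\<^sub>M (borel \<Otimes>\<^sub>M borel) \<Otimes>\<^sub>M borel) \<Otimes>\<^sub>M borel)" by measurable
  have gB: "\<bar>?g p\<bar> \<le> B" for p by (rule integral_prob_bounded[OF std_normal_prob]) (rule fB)
  have Zm: "(\<lambda>\<omega>. (?Z \<omega>, \<xi> (Suc k) \<omega>)) \<in> measurable N ((S \<Otimes>\<^sub>M (borel \<Otimes>\<^sub>M borel) \<Otimes>\<^sub>M borel) \<Otimes>\<^sub>M borel)"
    by (intro measurable_Pair measurable_F_N[OF Z] rv_Suc)
  have gi: "integrable N (\<lambda>\<omega>. ?g (?Z \<omega>, \<xi> (Suc k) \<omega>))"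
    by (rule integrable_F_bounded[OF measurable_compose[OF Zm g] gB])
  have eq: "v - bracket c (Suc k) \<omega> = (v - bracket c k \<omega>) - (norm (c k \<omega>))\<^sup>2" for \<omega> by (simp add: bracket_Suc)
  have "(\<integral>\<omega>. (\<integral>z. f (Y \<omega>, mart c (Suc k) \<omega> + sqrt (v - bracket c (Suc k) \<omega>) * z) \<partial>std_normal_distribution) \<partial>N)
      = (\<integral>\<omega>. ?g (?Z \<omega>, \<xi> (Suc k) \<omega>) \<partial>N)"
    unfolding eq mart_Suc by simp
  also have "\<dots> = (\<integral>\<omega>. (\<integral>x. ?g (?Z \<omega>, x) \<partial>std_gauss) \<partial>N)" by (rule integral_next(2)[OF Z g gi])
  also have "\<dots> = (\<integral>\<omega>. (\<integral>z. f (Y \<omega>, mart c k \<omega> + sqrt (v - bracket c k \<omega>) * z) \<partial>std_normal_distribution) \<partial>N)"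
  proof (rule Bochner_Integration.integral_cong[OF refl])
    fix \<omega> assume w: "\<omega> \<in> space N"
    have Yw: "Y \<omega> \<in> space S" using measurable_space[OF Y] w by simp
    let ?r = "v - bracket c k \<omega>"
    have nr: "(norm (c k \<omega>))\<^sup>2 \<le> ?r" using br[of \<omega>] by (simp add: bracket_Suc)
    let ?h = "\<lambda>t. f (Y \<omega>, mart c k \<omega> + t)"
    have h[measurable]: "?h \<in> borel_measurable borel" using Yw by measurable
    have "(\<integral>x. ?g (?Z \<omega>, x) \<partial>std_gauss) = (\<integral>x. (\<integral>z. ?h (c k \<omega> \<bullet> x + sqrt (?r - (norm (c k \<omega>))\<^sup>2) * z) \<partial>std_normal_distribution) \<partial>std_gauss)"
      by (simp add: add.assoc)
    also have "\<dots> = (\<integral>p. ?h (c k \<omega> \<bullet> fst p + sqrt (?r - (norm (c k \<omega>))\<^sup>2) * snd p) \<partial>(std_gauss \<Otimes>\<^sub>M std_normal_distribution))"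
      using fB by (subst PG.integral_fst'[symmetric]) (auto intro!: PG.integrable_const_bound[where B=B])
    also have "\<dots> = (\<integral>t. ?h t \<partial>distr (std_gauss \<Otimes>\<^sub>M std_normal_distribution) borel (\<lambda>(x, z). c k \<omega> \<bullet> x + sqrt (?r - (norm (c k \<omega>))\<^sup>2) * z))"
      by (subst integral_distr) (auto simp: split_beta)
    also have "\<dots> = (\<integral>z. ?h (sqrt ?r * z) \<partial>std_normal_distribution)"
      unfolding distr_gauss_add[OF nr] by (subst integral_distr) auto
    finally show "(\<integral>x. ?g (?Z \<omega>, x) \<partial>std_gauss) = (\<integral>z. f (Y \<omega>, mart c k \<omega> + sqrt ?r * z) \<partial>std_normal_distribution)" .
  qed
  finally show ?thesis .
qed

text \<open>The coefficients are set to zero as soon as the bracket would grow by more than \<open>v + \<delta>\<close>;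
  up to the event on the right-hand side this changes nothing, and \<open>heat_step\<close> becomes exact.\<close>

lemma one_block:
  fixes f :: "'s \<times> real \<Rightarrow> real"
  assumes c: "adapted c" and k: "k0 \<le> k1" and Y: "Y \<in> measurable (F k0) S"
    and f[measurable]: "f \<in> borel_measurable (S \<Otimes>\<^sub>M borel)" and fB: "\<And>p. \<bar>f p\<bar> \<le> B"
    and L: "\<And>y a b. \<bar>f (y, a) - f (y, b)\<bar> \<le> \<Lambda> * \<bar>a - b\<bar>" and L0: "0 \<le> \<Lambda>" and v: "0 \<le> v" and \<delta>: "0 \<le> \<delta>"
  shows "\<bar>(\<integral>w. f (Y w, mart c k1 w - mart c k0 w) \<partial>N) - (\<integral>w. (\<integral>z. f (Y w, sqrt v * z) \<partial>std_normal_distribution) \<partial>N)\<bar>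
    \<le> (2 * B + \<Lambda> * sqrt (v + \<delta>)) * measure N {w\<in>space N. \<delta> < \<bar>bracket c k1 w - bracket c k0 w - v\<bar>} + \<Lambda> * (sqrt (2 * \<delta>) + sqrt \<delta>)"
proof -
  interpret G: prob_space std_normal_distribution by (rule std_normal_prob)
  let ?v = "v + \<delta>"
  define d where "d = trunc c k0 ?v"
  have d: "adapted d" unfolding d_def by (rule adapted_trunc[OF c])
  have dv: "bracket d k w \<le> ?v" for k w unfolding d_def using v \<delta> by (intro bracket_trunc_le) simp
  have [measurable]: "Y \<in> measurable N S" by (rule measurable_F_N[OF Y])
  have [measurable]: "mart d k \<in> borel_measurable N" "bracket d k \<in> borel_measurable N"
    "mart c k \<in> borel_measurable N" "bracket c k \<in> borel_measurable N" for k
    using c d by (auto intro!: measurable_F_N[of _ k] mart_F bracket_F)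
  let ?\<Psi> = "\<lambda>k w. \<integral>z. f (Y w, mart d k w + sqrt (?v - bracket d k w) * z) \<partial>std_normal_distribution"
  \<comment> \<open>At \<open>k0\<close> the truncated martingale and its bracket vanish, so the
    common value is the mean over a Gaussian of full variance \<open>v + \<delta>\<close>; at
    \<open>k1\<close> a variance of at most \<open>2 * \<delta>\<close> is left outside the
    exceptional event.\<close>
  have inv: "(\<integral>w. ?\<Psi> k w \<partial>N) = (\<integral>w. ?\<Psi> k0 w \<partial>N)" if "k0 \<le> k" for k
    using that
  proof (induction k rule: dec_induct)
    case (step k)
    then show ?case using heat_step[OF d _ Y f fB dv, of k] by simp
  qed simp
  have B0: "0 \<le> B" using fB order_trans[OF abs_ge_zero] by blast
  have \<Psi>0: "?\<Psi> k0 w = (\<integral>z. f (Y w, sqrt ?v * z) \<partial>std_normal_distribution)" for w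
    using trunc_before[of k0 k0 c ?v w] by (simp add: d_def)
  let ?X = "\<lambda>w. f (Y w, mart c k1 w - mart c k0 w)"
  let ?bad = "{w\<in>space N. \<delta> < \<bar>bracket c k1 w - bracket c k0 w - v\<bar>}"
  have badm[measurable]: "?bad \<in> sets N" by measurable
  have sm: "\<bar>?\<Psi> k1 w - f (Y w, mart d k1 w)\<bar> \<le> \<Lambda> * sqrt (?v - bracket d k1 w)" if w: "w \<in> space N" for w
  proof -
    have Yw: "Y w \<in> space S" using measurable_space[OF Y] w by simp
    have h: "(\<lambda>t. f (Y w, t)) \<in> borel_measurable borel" using Yw by measurable
    have "\<bar>(\<integral>z. f (Y w, mart d k1 w + sqrt (?v - bracket d k1 w) * z) \<partial>std_normal_distribution)
       - (\<integral>z. f (Y w, mart d k1 w + 0 * z) \<partial>std_normal_distribution)\<bar> \<le> \<Lambda> * \<bar>sqrt (?v - bracket d k1 w) - 0\<bar>"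
      by (rule gauss_smoothing_diff[OF h fB L L0])
    then show ?thesis using dv[of k1 w] by (simp add: G.prob_space[simplified])
  qed
  have pw: "\<bar>?X w - ?\<Psi> k1 w\<bar> \<le> (2 * B + \<Lambda> * sqrt ?v) * indicator ?bad w + \<Lambda> * sqrt (2 * \<delta>)" if w: "w \<in> space N" for w
  proof (cases "w \<in> ?bad")
    case True
    have "\<bar>?\<Psi> k1 w\<bar> \<le> B" by (rule integral_prob_bounded[OF std_normal_prob]) (rule fB)
    then have "\<bar>?X w - ?\<Psi> k1 w\<bar> \<le> 2 * B" using fB[of "(Y w, mart c k1 w - mart c k0 w)"] by linarith
    moreover have "0 \<le> \<Lambda> * sqrt ?v" "0 \<le> \<Lambda> * sqrt (2 * \<delta>)" using L0 v \<delta> by auto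
    ultimately show ?thesis using True by simp
  next
    case False
    then have a: "\<bar>bracket c k1 w - bracket c k0 w - v\<bar> \<le> \<delta>" using w by simp
    then have b: "bracket c k1 w - bracket c k0 w \<le> ?v" by linarith
    note tr = trunc_inactive[OF k b, folded d_def]
    have "\<Lambda> * sqrt (?v - bracket d k1 w) \<le> \<Lambda> * sqrt (2 * \<delta>)"
      using a L0 unfolding tr by (intro mult_left_mono) auto
    then show ?thesis using sm[OF w] False unfolding tr by (simp add: abs_minus_commute)
  qed
  have \<Psi>m: "?\<Psi> k \<in> borel_measurable N" for k by measurable
  have \<Psi>b: "\<bar>?\<Psi> k w\<bar> \<le> B" for k w by (rule integral_prob_bounded[OF std_normal_prob]) (rule fB)
  have iX: "integrable N ?X" by (rule integrable_F_bounded[OF _ fB]) measurable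
  have i\<Psi>: "integrable N (?\<Psi> k)" for k by (rule integrable_F_bounded[OF \<Psi>m \<Psi>b])
  have "\<bar>(\<integral>w. ?X w \<partial>N) - (\<integral>w. ?\<Psi> k1 w \<partial>N)\<bar> = \<bar>\<integral>w. ?X w - ?\<Psi> k1 w \<partial>N\<bar>"
    by (subst Bochner_Integration.integral_diff[OF iX i\<Psi>]) simp
  also have "\<dots> \<le> (\<integral>w. \<bar>?X w - ?\<Psi> k1 w\<bar> \<partial>N)" by (rule integral_abs_bound)
  also have "\<dots> \<le> (\<integral>w. (2 * B + \<Lambda> * sqrt ?v) * indicator ?bad w + \<Lambda> * sqrt (2 * \<delta>) \<partial>N)"
    by (rule integral_mono) (use iX i\<Psi> pw in \<open>auto simp: emeasure_eq_measure\<close>)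
  also have "\<dots> = (2 * B + \<Lambda> * sqrt ?v) * measure N ?bad + \<Lambda> * sqrt (2 * \<delta>)"
    by (subst Bochner_Integration.integral_add) (auto simp: prob_space emeasure_eq_measure)
  finally have 1: "\<bar>(\<integral>w. ?X w \<partial>N) - (\<integral>w. ?\<Psi> k0 w \<partial>N)\<bar> \<le> (2 * B + \<Lambda> * sqrt ?v) * measure N ?bad + \<Lambda> * sqrt (2 * \<delta>)"
    unfolding inv[OF k] .
  let ?\<Phi> = "\<lambda>w. \<integral>z. f (Y w, sqrt v * z) \<partial>std_normal_distribution"
  have i\<Phi>: "integrable N ?\<Phi>"
  proof (rule integrable_F_bounded)
    show "?\<Phi> \<in> borel_measurable N" by measurable
    show "\<bar>?\<Phi> w\<bar> \<le> B" for w by (rule integral_prob_bounded[OF std_normal_prob]) (rule fB)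
  qed
  have pw2: "\<bar>?\<Psi> k0 w - ?\<Phi> w\<bar> \<le> \<Lambda> * sqrt \<delta>" if w: "w \<in> space N" for w
  proof -
    have Yw: "Y w \<in> space S" using measurable_space[OF Y] w by simp
    have h: "(\<lambda>t. f (Y w, t)) \<in> borel_measurable borel" using Yw by measurable
    have "\<bar>?\<Psi> k0 w - ?\<Phi> w\<bar> \<le> \<Lambda> * \<bar>sqrt ?v - sqrt v\<bar>"
      using gauss_smoothing_diff[OF h fB L L0, of 0 "sqrt ?v" "sqrt v"] unfolding \<Psi>0 by simp
    also have "\<dots> \<le> \<Lambda> * sqrt \<delta>"
      using sqrt_add_le_add_sqrt[of v \<delta>] v \<delta> L0 by (intro mult_left_mono) auto
    finally show ?thesis .
  qed
  have "\<bar>(\<integral>w. ?\<Psi> k0 w \<partial>N) - (\<integral>w. ?\<Phi> w \<partial>N)\<bar> = \<bar>\<integral>w. ?\<Psi> k0 w - ?\<Phi> w \<partial>N\<bar>"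
    by (subst Bochner_Integration.integral_diff[OF i\<Psi> i\<Phi>]) simp
  also have "\<dots> \<le> (\<integral>w. \<bar>?\<Psi> k0 w - ?\<Phi> w\<bar> \<partial>N)" by (rule integral_abs_bound)
  also have "\<dots> \<le> (\<integral>w. \<Lambda> * sqrt \<delta> \<partial>N)" by (rule integral_mono) (use i\<Psi> i\<Phi> pw2 in auto)
  also have "\<dots> = \<Lambda> * sqrt \<delta>" by (simp add: prob_space)
  finally show ?thesis using 1 by (simp add: distrib_left)
qed

end

text \<open>The Lipschitz bound forces \<open>G\<close> to depend on the first \<open>m\<close>
  coordinates only. Taking whole sequences as arguments avoids a change of domain when an induction
  changes the number of blocks.\<close>

definition block_fun :: "nat \<Rightarrow> real \<Rightarrow> real \<Rightarrow> ((nat \<Rightarrow> real) \<Rightarrow> real) \<Rightarrow> bool" where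
  "block_fun m B \<Lambda> G \<longleftrightarrow> G \<in> borel_measurable (\<Pi>\<^sub>M i\<in>UNIV. borel) \<and> (\<forall>x. \<bar>G x\<bar> \<le> B) \<and> 0 \<le> \<Lambda> \<and>
     (\<forall>x y. \<bar>G x - G y\<bar> \<le> \<Lambda> * (\<Sum>i<m. \<bar>x i - y i\<bar>))"

lemma block_fun_smooth:
  assumes G: "block_fun (Suc m) B \<Lambda> G"
  shows "block_fun m B \<Lambda> (\<lambda>x. \<integral>z. G (x(m := r * z)) \<partial>std_normal_distribution)"
proof -
  interpret N: prob_space std_normal_distribution by (rule std_normal_prob)
  note [measurable] = G[unfolded block_fun_def, THEN conjunct1]
  have GB: "\<bar>G x\<bar> \<le> B" and L0: "0 \<le> \<Lambda>" and L: "\<bar>G x - G y\<bar> \<le> \<Lambda> * (\<Sum>i<Suc m. \<bar>x i - y i\<bar>)" for x y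
    using G by (auto simp: block_fun_def)
  have upd: "(\<lambda>p. (fst p)(m := r * snd p)) \<in> measurable ((\<Pi>\<^sub>M i\<in>UNIV. borel) \<Otimes>\<^sub>M std_normal_distribution) (\<Pi>\<^sub>M i\<in>(UNIV::nat set). (borel :: real measure))"
    by (rule measurable_fun_upd[where J=UNIV]) (auto cong: measurable_cong_sets)
  have m: "(\<lambda>x. \<integral>z. G (x(m := r * z)) \<partial>std_normal_distribution) \<in> borel_measurable (\<Pi>\<^sub>M i\<in>UNIV. borel)"
    using measurable_compose[OF upd, of G borel] by (intro N.borel_measurable_lebesgue_integral) (simp add: split_beta)
  have i: "integrable std_normal_distribution (\<lambda>z. G (x(m := r * z)))" for x
  proof (rule N.integrable_const_bound[where B=B])
    have "(\<lambda>z. x(m := r * z)) \<in> measurable std_normal_distribution (\<Pi>\<^sub>M i\<in>(UNIV::nat set). (borel :: real measure))"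
      by (rule measurable_fun_upd[where J=UNIV]) (auto simp: space_PiM)
    from measurable_compose[OF this, of G borel]
    show "(\<lambda>z. G (x(m := r * z))) \<in> borel_measurable std_normal_distribution" by simp
  qed (use GB in simp)
  have "\<bar>(\<integral>z. G (x(m := r * z)) \<partial>std_normal_distribution) - (\<integral>z. G (y(m := r * z)) \<partial>std_normal_distribution)\<bar> \<le> \<Lambda> * (\<Sum>i<m. \<bar>x i - y i\<bar>)" for x y
  proof -
    have "(\<integral>z. G (x(m := r * z)) \<partial>std_normal_distribution) - (\<integral>z. G (y(m := r * z)) \<partial>std_normal_distribution) = (\<integral>z. G (x(m := r * z)) - G (y(m := r * z)) \<partial>std_normal_distribution)"
      using i by simp
    also have "\<bar>\<dots>\<bar> \<le> \<Lambda> * (\<Sum>i<m. \<bar>x i - y i\<bar>)"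
    proof (rule integral_prob_bounded[OF std_normal_prob])
      fix z
      show "\<bar>G (x(m := r * z)) - G (y(m := r * z))\<bar> \<le> \<Lambda> * (\<Sum>i<m. \<bar>x i - y i\<bar>)"
        using L[of "x(m := r * z)" "y(m := r * z)"] by simp
    qed
    finally show ?thesis .
  qed
  moreover have "\<bar>\<integral>z. G (x(m := r * z)) \<partial>std_normal_distribution\<bar> \<le> B" for x
    by (rule integral_prob_bounded[OF std_normal_prob]) (rule GB)
  ultimately show ?thesis unfolding block_fun_def using m L0 by blast
qed

lemma block_fun_cong:
  assumes "block_fun m B \<Lambda> G" "\<And>i. i < m \<Longrightarrow> x i = y i"
  shows "G x = G y"
proof -
  have "\<bar>G x - G y\<bar> \<le> \<Lambda> * (\<Sum>i<m. \<bar>x i - y i\<bar>)" using assms(1) unfolding block_fun_def by blast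
  also have "(\<Sum>i<m. \<bar>x i - y i\<bar>) = 0" using assms(2) by (intro sum.neutral) auto
  finally show ?thesis by simp
qed

lemma integral_indep_gauss_last:
  fixes W :: "nat \<Rightarrow> 'u \<Rightarrow> real"
  assumes P: "prob_space P" and ind: "prob_space.indep_vars P (\<lambda>_. borel) W {..<Suc m}"
    and law: "distr P borel (W m) = distr std_normal_distribution borel (\<lambda>z. r * z)"
    and G: "block_fun (Suc m) B \<Lambda> G"
  shows "(\<integral>w. G (\<lambda>i. W i w) \<partial>P) = (\<integral>w. (\<integral>z. G ((\<lambda>i. W i w)(m := r * z)) \<partial>std_normal_distribution) \<partial>P)"
proof -
  interpret P: prob_space P by fact
  interpret N: prob_space std_normal_distribution by (rule std_normal_prob)
  let ?RN = "\<Pi>\<^sub>M i\<in>(UNIV::nat set). (borel :: real measure)"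
  note Gm[measurable] = G[unfolded block_fun_def, THEN conjunct1]
  have GB: "\<bar>G x\<bar> \<le> B" for x using G by (auto simp: block_fun_def)
  let ?A = "vimage_algebra (space P) (\<lambda>w. \<lambda>i\<in>{..<m}. W i w) (PiM {..<m} (\<lambda>_. borel))"
  define Y where "Y w = (\<lambda>i. if i < m then W i w else 0)" for w
  have "(\<lambda>w. \<lambda>i\<in>{..<m}. W i w) \<in> measurable ?A (PiM {..<m} (\<lambda>_. borel))"
    by (rule measurable_vimage_algebra1) (auto simp: space_PiM)
  from measurable_compose[OF this measurable_component_singleton]
  have Wi: "W i \<in> borel_measurable ?A" if "i < m" for i using that by fastforce
  have Y: "Y \<in> measurable ?A ?RN"
    unfolding Y_def[abs_def]
  proof (rule measurable_PiM_single')
    show "(\<lambda>w. if i < m then W i w else 0) \<in> borel_measurable ?A" for i using Wi by (cases "i < m") auto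
  qed (auto simp: space_PiM)
  have dp: "distr P (?RN \<Otimes>\<^sub>M borel) (\<lambda>w. (Y w, W m w)) = distr P ?RN Y \<Otimes>\<^sub>M distr P borel (W m)"
    by (rule P.distr_pair_indep_next[where I="{..<m}" and M'="\<lambda>_. borel"]) (use ind Y in \<open>auto simp: lessThan_Suc\<close>)
  have Wm: "W i \<in> borel_measurable P" if "i < Suc m" for i using ind that by (auto simp: P.indep_vars_def)
  have Ym[measurable]: "Y \<in> measurable P ?RN"
    unfolding Y_def[abs_def]
  proof (rule measurable_PiM_single')
    show "(\<lambda>w. if i < m then W i w else 0) \<in> borel_measurable P" for i using Wm[of i] by (cases "i < m") auto
  qed (auto simp: space_PiM)
  note [measurable] = Wm[of m, simplified]
  have upd[measurable]: "(\<lambda>p. (fst p)(m := snd p)) \<in> measurable (?RN \<Otimes>\<^sub>M borel) ?RN"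
    by (rule measurable_fun_upd[where J=UNIV]) auto
  interpret DY: prob_space "distr P ?RN Y" by (rule P.prob_space_distr) measurable
  interpret DW: prob_space "distr P borel (W m)" by (rule P.prob_space_distr) measurable
  interpret DD: pair_prob_space "distr P ?RN Y" "distr P borel (W m)" ..
  have c1: "G (\<lambda>i. W i w) = G ((Y w)(m := W m w))" for w
    by (rule block_fun_cong[OF G]) (auto simp: Y_def)
  have c2: "G ((\<lambda>i. W i w)(m := z)) = G ((Y w)(m := z))" for w z
    by (rule block_fun_cong[OF G]) (auto simp: Y_def)
  have "(\<integral>w. G (\<lambda>i. W i w) \<partial>P) = (\<integral>p. G ((fst p)(m := snd p)) \<partial>distr P (?RN \<Otimes>\<^sub>M borel) (\<lambda>w. (Y w, W m w)))"
    unfolding c1 by (subst integral_distr) auto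
  also have "\<dots> = (\<integral>y. (\<integral>t. G (y(m := t)) \<partial>distr P borel (W m)) \<partial>distr P ?RN Y)"
    unfolding dp using GB by (subst DD.integral_fst'[symmetric]) (auto intro!: DD.integrable_const_bound[where B=B])
  also have "\<dots> = (\<integral>y. (\<integral>z. G (y(m := r * z)) \<partial>std_normal_distribution) \<partial>distr P ?RN Y)"
    unfolding law
  proof (rule Bochner_Integration.integral_cong[OF refl])
    fix y :: "nat \<Rightarrow> real"
    have "(\<lambda>t. y(m := t)) \<in> measurable borel ?RN"
      by (rule measurable_fun_upd[where J=UNIV]) (auto simp: space_PiM)
    then have [measurable]: "(\<lambda>t. G (y(m := t))) \<in> borel_measurable borel" by (rule measurable_compose) simp
    show "(\<integral>t. G (y(m := t)) \<partial>distr std_normal_distribution borel (\<lambda>z. r * z)) = (\<integral>z. G (y(m := r * z)) \<partial>std_normal_distribution)"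
      by (subst integral_distr) auto
  qed
  also have "\<dots> = (\<integral>w. (\<integral>z. G ((Y w)(m := r * z)) \<partial>std_normal_distribution) \<partial>P)"
    using block_fun_smooth[OF G, of r] by (subst integral_distr) (auto simp: block_fun_def)
  finally show ?thesis unfolding c2 .
qed

context gauss_seq
begin

text \<open>Induction from the last block: given the past before it, its increment may be replaced
  by an independent Gaussian, which leaves the functional \<open>G'\<close> of one block fewer. On
  the side of the limit the same integration over the last variable is exact.\<close>

theorem block_clt:
  fixes c :: "nat \<Rightarrow> nat \<Rightarrow> 'v \<Rightarrow> real^'n" and \<kappa> :: "nat \<Rightarrow> nat \<Rightarrow> nat" and W :: "nat \<Rightarrow> 'u \<Rightarrow> real"
  assumes c: "\<And>n. adapted (c n)" and \<kappa>: "\<And>n. mono (\<kappa> n)" and v: "\<And>i. i < m \<Longrightarrow> 0 \<le> v i"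
    and br: "\<And>i \<delta>. i < m \<Longrightarrow> 0 < \<delta> \<Longrightarrow>
      (\<lambda>n. measure N {w\<in>space N. \<delta> < \<bar>bracket (c n) (\<kappa> n (Suc i)) w - bracket (c n) (\<kappa> n i) w - v i\<bar>}) \<longlonglongrightarrow> 0"
    and P: "prob_space P" and ind: "prob_space.indep_vars P (\<lambda>_. borel) W {..<m}"
    and law: "\<And>i. i < m \<Longrightarrow> distr P borel (W i) = distr std_normal_distribution borel (\<lambda>z. sqrt (v i) * z)"
    and G: "block_fun m B \<Lambda> G"
  shows "(\<lambda>n. \<integral>w. G (\<lambda>i. mart (c n) (\<kappa> n (Suc i)) w - mart (c n) (\<kappa> n i) w) \<partial>N) \<longlonglongrightarrow> (\<integral>w. G (\<lambda>i. W i w) \<partial>P)"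
  using v br ind law G
proof (induction m arbitrary: G)
  case 0
  interpret P: prob_space P by (rule P)
  define g0 where "g0 = G (\<lambda>_. 0)"
  have "G x = g0" for x unfolding g0_def by (rule block_fun_cong[OF 0(5)]) simp
  then show ?case by (simp add: prob_space P.prob_space)
next
  case (Suc m)
  interpret P: prob_space P by (rule P)
  let ?RN = "\<Pi>\<^sub>M i\<in>(UNIV::nat set). (borel :: real measure)"
  let ?D = "\<lambda>n w i. mart (c n) (\<kappa> n (Suc i)) w - mart (c n) (\<kappa> n i) w"
  define G' where "G' x = (\<integral>z. G (x(m := sqrt (v m) * z)) \<partial>std_normal_distribution)" for x
  note G = Suc.prems(5)
  note Gm[measurable] = G[unfolded block_fun_def, THEN conjunct1]
  have GB: "\<bar>G x\<bar> \<le> B" and L0: "0 \<le> \<Lambda>" and L: "\<bar>G x - G y\<bar> \<le> \<Lambda> * (\<Sum>i<Suc m. \<bar>x i - y i\<bar>)" for x y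
    using G by (auto simp: block_fun_def)
  have G': "block_fun m B \<Lambda> G'" unfolding G'_def by (rule block_fun_smooth[OF G])
  have IH: "(\<lambda>n. \<integral>w. G' (?D n w) \<partial>N) \<longlonglongrightarrow> (\<integral>w. G' (\<lambda>i. W i w) \<partial>P)"
    by (rule Suc.IH[OF _ _ P.indep_vars_subset[OF Suc.prems(3)] _ G']) (use Suc.prems in auto)
  have eqP: "(\<integral>w. G' (\<lambda>i. W i w) \<partial>P) = (\<integral>w. G (\<lambda>i. W i w) \<partial>P)"
    unfolding G'_def by (rule integral_indep_gauss_last[OF P Suc.prems(3) Suc.prems(4)[OF lessI] G, symmetric])
  have diff: "\<bar>(\<integral>w. G (?D n w) \<partial>N) - (\<integral>w. G' (?D n w) \<partial>N)\<bar>
      \<le> (2 * B + \<Lambda> * sqrt (v m + \<delta>)) * measure N {w\<in>space N. \<delta> < \<bar>bracket (c n) (\<kappa> n (Suc m)) w - bracket (c n) (\<kappa> n m) w - v m\<bar>}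
        + \<Lambda> * (sqrt (2 * \<delta>) + sqrt \<delta>)" if \<delta>: "0 \<le> \<delta>" for n \<delta>
  proof -
    define Y where "Y w = (\<lambda>i. if i < m then ?D n w i else 0)" for w
    have \<kappa>m: "\<kappa> n i \<le> \<kappa> n j" if "i \<le> j" for i j using \<kappa>[of n] that by (auto simp: mono_def)
    have Y: "Y \<in> measurable (F (\<kappa> n m)) ?RN"
      unfolding Y_def[abs_def]
    proof (rule measurable_PiM_single')
      show "(\<lambda>w. if i < m then ?D n w i else 0) \<in> borel_measurable (F (\<kappa> n m))" for i
        by (cases "i < m") (auto intro!: borel_measurable_diff mart_F[OF c] \<kappa>m)
    qed (auto simp: space_PiM)
    have upd[measurable]: "(\<lambda>p. (fst p)(m := snd p)) \<in> measurable (?RN \<Otimes>\<^sub>M borel) ?RN"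
      by (rule measurable_fun_upd[where J=UNIV]) auto
    let ?f = "\<lambda>p. G ((fst p)(m := snd p))"
    have f: "?f \<in> borel_measurable (?RN \<Otimes>\<^sub>M borel)" by measurable
    have fL: "\<bar>?f (y, a) - ?f (y, b)\<bar> \<le> \<Lambda> * \<bar>a - b\<bar>" for y a b
      using L[of "y(m := a)" "y(m := b)"] by simp
    have c1: "G (?D n w) = ?f (Y w, mart (c n) (\<kappa> n (Suc m)) w - mart (c n) (\<kappa> n m) w)" for w
      by (rule block_fun_cong[OF G]) (auto simp: Y_def)
    have c2: "G' (?D n w) = (\<integral>z. ?f (Y w, sqrt (v m) * z) \<partial>std_normal_distribution)" for w
    proof -
      have "G' (?D n w) = G' (Y w)" by (rule block_fun_cong[OF G']) (auto simp: Y_def)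
      then show ?thesis by (simp add: G'_def)
    qed
    show ?thesis unfolding c1 c2
      by (rule one_block[OF c \<kappa>m[of m "Suc m"] Y f GB fL L0 _ \<delta>]) (use Suc.prems in auto)
  qed
  have "(\<lambda>n. (\<integral>w. G (?D n w) \<partial>N) - (\<integral>w. G' (?D n w) \<partial>N)) \<longlonglongrightarrow> 0"
  proof (rule LIMSEQ_I)
    fix r :: real assume r: "0 < r"
    \<comment> \<open>First \<delta> makes the smoothing error small, then large \<open>n\<close>
      makes the exceptional event rare.\<close>
    have "((\<lambda>\<delta>. \<Lambda> * (sqrt (2 * \<delta>) + sqrt \<delta>)) \<longlongrightarrow> \<Lambda> * (sqrt (2 * 0) + sqrt 0)) (at_right 0)"
      by (intro tendsto_intros)
    then have "\<forall>\<^sub>F \<delta> in at_right 0. \<Lambda> * (sqrt (2 * \<delta>) + sqrt \<delta>) < r / 2"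
      by (rule order_tendstoD(2)) (use r in simp)
    moreover have "\<forall>\<^sub>F \<delta>::real in at_right 0. 0 < \<delta>" by (rule eventually_at_right_less)
    ultimately have ev: "\<forall>\<^sub>F \<delta> in at_right 0. \<Lambda> * (sqrt (2 * \<delta>) + sqrt \<delta>) < r / 2 \<and> 0 < \<delta>"
      by (rule eventually_conj)
    obtain \<delta> where \<delta>: "0 < \<delta>" "\<Lambda> * (sqrt (2 * \<delta>) + sqrt \<delta>) < r / 2"
      using eventually_happens'[OF trivial_limit_at_right_real ev] by blast
    let ?p = "\<lambda>n. measure N {w\<in>space N. \<delta> < \<bar>bracket (c n) (\<kappa> n (Suc m)) w - bracket (c n) (\<kappa> n m) w - v m\<bar>}"
    have "?p \<longlonglongrightarrow> 0" using Suc.prems(2)[of m \<delta>] \<delta> by simp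
    then have "(\<lambda>n. (2 * B + \<Lambda> * sqrt (v m + \<delta>)) * ?p n) \<longlonglongrightarrow> (2 * B + \<Lambda> * sqrt (v m + \<delta>)) * 0"
      by (intro tendsto_mult tendsto_const)
    then have "\<forall>\<^sub>F n in sequentially. (2 * B + \<Lambda> * sqrt (v m + \<delta>)) * ?p n < r / 2"
      by (rule order_tendstoD(2)) (use r in simp)
    then have "\<forall>\<^sub>F n in sequentially. norm ((\<integral>w. G (?D n w) \<partial>N) - (\<integral>w. G' (?D n w) \<partial>N) - 0) < r"
    proof eventually_elim
      case (elim n)
      show ?case using diff[of \<delta> n] elim \<delta> unfolding real_norm_def by linarith
    qed
    then show "\<exists>no. \<forall>n\<ge>no. norm ((\<integral>w. G (?D n w) \<partial>N) - (\<integral>w. G' (?D n w) \<partial>N) - 0) < r"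
      by (simp add: eventually_sequentially)
  qed
  from tendsto_add[OF this IH] show ?case unfolding eqP by simp
qed

end

section \<open>Taylor expansion of the Poisson solution\<close>

text \<open>The Frobenius norm dominates the operator norm: Cauchy-Schwarz in each row.\<close>

lemma norm_matrix_vector_mult_le:
  fixes A :: "real^'n^'m"
  shows "norm (A *v x) \<le> norm A * norm x"
proof -
  have "(norm (A *v x))\<^sup>2 = (\<Sum>i\<in>UNIV. (A $ i \<bullet> x)\<^sup>2)"
    by (simp add: norm_vec_def L2_set_def sum_nonneg matrix_vector_mul_component)
  also have "\<dots> \<le> (\<Sum>i\<in>UNIV. (norm (A $ i))\<^sup>2 * (norm x)\<^sup>2)"
  proof (rule sum_mono)
    fix i
    have "\<bar>A $ i \<bullet> x\<bar> \<le> norm (A $ i) * norm x" by (rule Cauchy_Schwarz_ineq2)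
    then have "\<bar>A $ i \<bullet> x\<bar>\<^sup>2 \<le> (norm (A $ i) * norm x)\<^sup>2" by (intro power_mono) auto
    then show "(A $ i \<bullet> x)\<^sup>2 \<le> (norm (A $ i))\<^sup>2 * (norm x)\<^sup>2" by (simp add: power_mult_distrib)
  qed
  also have "\<dots> = (norm A * norm x)\<^sup>2"
    by (simp add: power_mult_distrib norm_vec_def[of A] L2_set_def sum_nonneg sum_distrib_right)
  finally show ?thesis by (rule power2_le_imp_le) simp
qed

lemma C2_has_derivative:
  fixes \<phi> :: "real^'n \<Rightarrow> real"
  assumes "C2 \<phi>"
  shows "(\<phi> has_derivative (\<lambda>v. grad \<phi> x \<bullet> v)) (at x)"
    and "(grad \<phi> has_derivative (\<lambda>v. hess \<phi> x *v v)) (at x)"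
proof -
  let ?f = "frechet_derivative \<phi> (at x)" and ?g = "frechet_derivative (grad \<phi>) (at x)"
  have d: "(\<phi> has_derivative ?f) (at x)" "(grad \<phi> has_derivative ?g) (at x)"
    using assms by (auto simp: C2_def frechet_derivative_works)
  have lf: "linear ?f" and lg: "linear ?g"
    using d by (auto dest: has_derivative_linear)
  have "?f v = grad \<phi> x \<bullet> v" for v
  proof -
    have "?f v = ?f (\<Sum>i\<in>UNIV. (v $ i) *\<^sub>R axis i 1)"
      by (simp add: basis_expansion scalar_mult_eq_scaleR[symmetric])
    also have "\<dots> = (\<Sum>i\<in>UNIV. (v $ i) *\<^sub>R ?f (axis i 1))"
      by (simp add: linear_sum[OF lf] linear_scale[OF lf])
    also have "\<dots> = grad \<phi> x \<bullet> v" by (simp add: grad_def inner_vec_def mult.commute)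
    finally show ?thesis .
  qed
  then have "?f = (\<lambda>v. grad \<phi> x \<bullet> v)" by auto
  with d(1) show "(\<phi> has_derivative (\<lambda>v. grad \<phi> x \<bullet> v)) (at x)" by simp
  have "?g = (\<lambda>v. hess \<phi> x *v v)" unfolding hess_def using matrix_works[of ?g] lg by (simp add: linear_matrix_vector_mul_eq)
  with d(2) show "(grad \<phi> has_derivative (\<lambda>v. hess \<phi> x *v v)) (at x)" by simp
qed

lemma C2_continuous:
  assumes "C2 \<phi>"
  shows "continuous_on UNIV \<phi>" "continuous_on UNIV (grad \<phi>)" "continuous_on UNIV (hess \<phi>)"
  using C2_has_derivative[OF assms] assms
  by (auto simp: C2_def intro!: continuous_at_imp_continuous_on has_derivative_continuous)

lemma C2_taylor:
  fixes \<phi> :: "real^'n \<Rightarrow> real"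
  assumes "C2 \<phi>"
  obtains t where "0 < t" "t < 1" "\<phi> (x + d) = \<phi> x + grad \<phi> x \<bullet> d + (hess \<phi> (x + t *\<^sub>R d) *v d) \<bullet> d / 2"
proof -
  \<comment> \<open>Value, first and second derivative of \<phi> along the segment, numbered as
    \<open>Maclaurin\<close> expects.\<close>
  define p where "p k s = (if k = 0 then \<phi> (x + s *\<^sub>R d) else if k = 1 then grad \<phi> (x + s *\<^sub>R d) \<bullet> d
      else (hess \<phi> (x + s *\<^sub>R d) *v d) \<bullet> d)" for k :: nat and s :: real
  have line: "((\<lambda>s. x + s *\<^sub>R d) has_derivative (\<lambda>r. r *\<^sub>R d)) (at s)" for s
    by (auto intro!: derivative_eq_intros)
  have D: "DERIV (p k) s :> p (Suc k) s" if "k < 2" for k s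
  proof (cases "k = 0")
    case True
    have "((\<lambda>s. \<phi> (x + s *\<^sub>R d)) has_derivative (\<lambda>r. grad \<phi> (x + s *\<^sub>R d) \<bullet> (r *\<^sub>R d))) (at s)"
      by (rule has_derivative_compose[OF line C2_has_derivative(1)[OF assms]])
    then show ?thesis unfolding has_field_derivative_def using True
      by (simp add: p_def[abs_def] mult_commute_abs)
  next
    case False
    then have k: "k = 1" using that by simp
    have "((\<lambda>s. grad \<phi> (x + s *\<^sub>R d)) has_derivative (\<lambda>r. hess \<phi> (x + s *\<^sub>R d) *v (r *\<^sub>R d))) (at s)"
      by (rule has_derivative_compose[OF line C2_has_derivative(2)[OF assms]])
    then have "((\<lambda>s. grad \<phi> (x + s *\<^sub>R d) \<bullet> d) has_derivative (\<lambda>r. (hess \<phi> (x + s *\<^sub>R d) *v (r *\<^sub>R d)) \<bullet> d)) (at s)"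
      by (rule has_derivative_inner_left)
    then show ?thesis unfolding has_field_derivative_def using k
      by (simp add: p_def[abs_def] matrix_vector_mult_scaleR mult_commute_abs)
  qed
  have "\<exists>t>0. t < 1 \<and> p 0 1 = (\<Sum>m<2. p m 0 / fact m * 1 ^ m) + p 2 t / fact 2 * 1 ^ 2"
    by (rule Maclaurin[where diff=p]) (use D in auto)
  then obtain t where "0 < t" "t < 1" "p 0 1 = (\<Sum>m<2. p m 0 / fact m * 1 ^ m) + p 2 t / fact 2 * 1 ^ 2" by blast
  then show ?thesis by (intro that[of t]) (auto simp: p_def numeral_2_eq_2)
qed

lemma gauss_quadratic_form:
  fixes A :: "real^'n^'n"
  shows "(\<integral>z. z \<bullet> (A *v z) \<partial>std_gauss) = trace A"
proof -
  have eq: "z \<bullet> (A *v z) = (\<Sum>i\<in>UNIV. \<Sum>j\<in>UNIV. A $ i $ j * ((axis i 1 \<bullet> z) * (axis j 1 \<bullet> z)))" for z :: "real^'n"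
    by (simp add: inner_vec_def[of z] matrix_vector_mult_def sum_distrib_left inner_axis' mult_ac)
  have "(\<integral>z. z \<bullet> (A *v z) \<partial>std_gauss) = (\<Sum>i\<in>UNIV. \<Sum>j\<in>UNIV. A $ i $ j * (axis i 1 \<bullet> axis j (1::real)))"
    unfolding eq by (simp add: Bochner_Integration.integral_sum integral_std_gauss_inner2 integrable_std_gauss_inner2)
  also have "\<dots> = (\<Sum>i\<in>UNIV. A $ i $ i)"
    by (intro sum.cong refl) (simp add: inner_axis_axis if_distrib cong: if_cong)
  finally show ?thesis by (simp add: trace_def)
qed

text \<open>A Toeplitz argument: the finitely many large terms are lost against the diverging sum of
  weights.\<close>

lemma weighted_average_null:
  fixes a w :: "nat \<Rightarrow> real"
  assumes a: "a \<longlonglongrightarrow> 0" and w: "\<And>j. 0 \<le> w j" and T: "filterlim (\<lambda>n. \<Sum>j<n. w j) at_top sequentially"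
  shows "(\<lambda>n. (\<Sum>j<n. w j * a j) / (\<Sum>j<n. w j)) \<longlonglongrightarrow> 0"
proof (rule LIMSEQ_I)
  fix r :: real assume r: "0 < r"
  obtain K where K: "\<And>j. j \<ge> K \<Longrightarrow> \<bar>a j\<bar> < r / 2" using LIMSEQ_D[OF a, of "r / 2"] r by auto
  define C where "C = (\<Sum>j<K. w j * \<bar>a j\<bar>)"
  have "(\<lambda>n. C / (\<Sum>j<n. w j)) \<longlonglongrightarrow> 0"
    by (rule tendsto_divide_0[OF tendsto_const filterlim_at_top_imp_at_infinity[OF T]])
  then have "\<forall>\<^sub>F n in sequentially. C / (\<Sum>j<n. w j) < r / 2"
    by (rule order_tendstoD(2)) (use r in simp)
  moreover have "\<forall>\<^sub>F n in sequentially. 0 < (\<Sum>j<n. w j)" using T by (auto simp: filterlim_at_top_dense)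
  ultimately have "\<forall>\<^sub>F n in sequentially. norm ((\<Sum>j<n. w j * a j) / (\<Sum>j<n. w j) - 0) < r"
  proof eventually_elim
    case (elim n)
    have "\<bar>\<Sum>j<n. w j * a j\<bar> \<le> (\<Sum>j<n. w j * \<bar>a j\<bar>)"
      using w by (intro order_trans[OF sum_abs]) (simp add: abs_mult)
    also have "\<dots> \<le> (\<Sum>j<n. w j * (r / 2) + (if j < K then w j * \<bar>a j\<bar> else 0))"
    proof (rule sum_mono)
      fix j
      have "w j * \<bar>a j\<bar> \<le> w j * (r / 2)" if "\<not> j < K" using K[of j] w that by (intro mult_left_mono) auto
      then show "w j * \<bar>a j\<bar> \<le> w j * (r / 2) + (if j < K then w j * \<bar>a j\<bar> else 0)" using w r by auto
    qed
    also have "\<dots> = (\<Sum>j<n. w j) * (r / 2) + (\<Sum>j\<in>{..<n} \<inter> {..<K}. w j * \<bar>a j\<bar>)"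
      by (simp add: sum.distrib sum_distrib_right sum.inter_restrict)
    also have "\<dots> \<le> (\<Sum>j<n. w j) * (r / 2) + C"
      unfolding C_def using w by (intro add_left_mono sum_mono2) auto
    finally have "\<bar>\<Sum>j<n. w j * a j\<bar> / (\<Sum>j<n. w j) \<le> ((\<Sum>j<n. w j) * (r / 2) + C) / (\<Sum>j<n. w j)"
      using elim by (intro divide_right_mono) auto
    also have "\<dots> = r / 2 + C / (\<Sum>j<n. w j)" using elim by (simp add: add_divide_distrib)
    also have "\<dots> < r" using elim by linarith
    finally show ?case using elim by simp
  qed
  then show "\<exists>no. \<forall>n\<ge>no. norm ((\<Sum>j<n. w j * a j) / (\<Sum>j<n. w j) - 0) < r"
    by (simp add: eventually_sequentially)
qed

text \<open>Summation by parts. The weights are nonnegative and increase, so their total variation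
  is at most the last one; the induction follows the sum with its boundary term removed.\<close>

lemma abel_increasing_weights:
  fixes \<psi> w :: "nat \<Rightarrow> real"
  assumes w: "\<And>j. 0 \<le> w j" "\<And>j. w j \<le> w (Suc j)" and \<psi>: "\<And>j. j \<le> Suc k \<Longrightarrow> \<bar>\<psi> j\<bar> \<le> B"
  shows "\<bar>\<Sum>j<Suc k. (\<psi> (Suc j) - \<psi> j) * w j\<bar> \<le> 2 * B * w k"
proof -
  have "k' \<le> k \<Longrightarrow> \<bar>(\<Sum>j<Suc k'. (\<psi> (Suc j) - \<psi> j) * w j) - \<psi> (Suc k') * w k'\<bar> \<le> B * w k'" for k'
  proof (induction k')
    case 0
    then show ?case using \<psi>[of 0] w(1)[of 0] by (simp add: left_diff_distrib abs_mult mult_right_mono)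
  next
    case (Suc k')
    have b: "\<bar>\<psi> (Suc k')\<bar> \<le> B" using Suc.prems by (intro \<psi>) simp
    let ?S = "\<Sum>j<Suc k'. (\<psi> (Suc j) - \<psi> j) * w j"
    have "(\<Sum>j<Suc (Suc k'). (\<psi> (Suc j) - \<psi> j) * w j) - \<psi> (Suc (Suc k')) * w (Suc k')
        = (?S - \<psi> (Suc k') * w k') - \<psi> (Suc k') * (w (Suc k') - w k')"
      by (simp add: algebra_simps)
    also have "\<bar>\<dots>\<bar> \<le> \<bar>?S - \<psi> (Suc k') * w k'\<bar> + \<bar>\<psi> (Suc k') * (w (Suc k') - w k')\<bar>" by (rule abs_triangle_ineq4)
    also have "\<dots> \<le> B * w k' + B * (w (Suc k') - w k')"
      using Suc b w(2)[of k'] by (intro add_mono) (auto simp: abs_mult mult_right_mono)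
    finally show ?case by (simp add: algebra_simps)
  qed
  from this[of k] have "\<bar>(\<Sum>j<Suc k. (\<psi> (Suc j) - \<psi> j) * w j) - \<psi> (Suc k) * w k\<bar> \<le> B * w k" by simp
  moreover have "\<bar>\<psi> (Suc k) * w k\<bar> \<le> B * w k" using \<psi>[of "Suc k"] w(1)[of k] by (simp add: abs_mult mult_right_mono)
  ultimately show ?thesis by linarith
qed

text \<open>\<open>hm\<close> stands for the mean of \<open>h\<close> under \<pi>. The expansion is
  local and works with this number alone, so neither \<pi> nor the diffusion is mentioned.\<close>

locale poisson_sys = em_sys N \<xi> b \<sigma> L \<kappa> \<kappa>' \<sigma>i c0 C0 es
  for N :: "'v measure" and \<xi> :: "nat \<Rightarrow> 'v \<Rightarrow> real^'n" and b \<sigma> L \<kappa> \<kappa>' \<sigma>i c0 C0 es +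
  fixes \<phi> :: "real^'n \<Rightarrow> real" and h :: "real^'n \<Rightarrow> real" and hm :: real and C :: real
  assumes C2: "C2 \<phi>" and h_cont: "continuous_on UNIV h" and gen: "\<And>x. generator b \<sigma> \<phi> x = h x - hm" and C: "0 < C"
    and phi_le: "\<And>x. \<bar>\<phi> x\<bar> \<le> C * (1 + norm x ^ 2)"
    and grad_le: "\<And>x. norm (grad \<phi> x) \<le> C * (1 + norm x ^ 3)"
    and hess_le: "\<And>x. norm (hess \<phi> x) \<le> C * (1 + norm x ^ 4)"
    and hess_lip: "\<And>x y. 0 < norm (y - x) \<Longrightarrow> norm (y - x) \<le> 1 \<Longrightarrow>
      norm (hess \<phi> x - hess \<phi> y) / norm (x - y) \<le> C * (1 + norm x ^ 5)"
begin

lemma norm_le_V: "norm x \<le> V x"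
proof -
  have "2 * norm x * 1 \<le> (norm x)\<^sup>2 + 1\<^sup>2" by (rule sum_squares_bound)
  then have "2 * norm x \<le> (norm x)\<^sup>2 + 1" by simp
  then show ?thesis unfolding V_def using norm_ge_zero[of x] by linarith
qed

lemma one_plus_norm_power_le: "1 + norm x ^ k \<le> 2 * V x ^ k"
proof -
  have "norm x ^ k \<le> V x ^ k" by (intro power_mono norm_le_V) simp
  moreover have "1 \<le> V x ^ k" by (rule one_le_power) simp
  ultimately show ?thesis by linarith
qed

lemma phi_V: "\<bar>\<phi> x\<bar> \<le> C * V x"
  using phi_le[of x] by (simp add: V_def)

lemma grad_V: "norm (grad \<phi> x) \<le> 2 * C * V x ^ 3"
  using order_trans[OF grad_le mult_left_mono[OF one_plus_norm_power_le less_imp_le[OF C]], of x] by (simp add: mult_ac)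

lemma hess_V: "norm (hess \<phi> x) \<le> 2 * C * V x ^ 4"
  using order_trans[OF hess_le mult_left_mono[OF one_plus_norm_power_le less_imp_le[OF C]], of x] by (simp add: mult_ac)

text \<open>Short displacements use the Lipschitz bound of the Hessian. For displacements longer
  than 1 each term is bounded separately by its growth, and lower powers of the displacement are
  raised to the third; the contributions 4, 1, 2 and 1 stay within the 9.\<close>

lemma taylor_remainder:
  "\<bar>\<phi> (x + d) - \<phi> x - grad \<phi> x \<bullet> d - (hess \<phi> x *v d) \<bullet> d / 2\<bar> \<le> 9 * C * V x ^ 5 * norm d ^ 3"
proof (cases "norm d \<le> 1")
  case True
  show ?thesis
  proof (cases "d = 0")
    case False
    obtain t where t: "0 < t" "t < 1" "\<phi> (x + d) = \<phi> x + grad \<phi> x \<bullet> d + (hess \<phi> (x + t *\<^sub>R d) *v d) \<bullet> d / 2"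
      using C2_taylor[OF C2] by blast
    have nt: "0 < norm (t *\<^sub>R d)" "norm (t *\<^sub>R d) \<le> norm d" using t False by (auto simp: mult_left_le_one_le)
    have "norm (hess \<phi> x - hess \<phi> (x + t *\<^sub>R d)) / norm (t *\<^sub>R d) \<le> C * (1 + norm x ^ 5)"
      using hess_lip[of "x + t *\<^sub>R d" x] nt True by simp
    also have "\<dots> \<le> C * (2 * V x ^ 5)" using C by (intro mult_left_mono one_plus_norm_power_le) auto
    finally have "norm (hess \<phi> x - hess \<phi> (x + t *\<^sub>R d)) \<le> C * (2 * V x ^ 5) * norm (t *\<^sub>R d)"
      using nt(1) by (simp add: divide_le_eq)
    also have "\<dots> \<le> C * (2 * V x ^ 5) * norm d" using nt C by (intro mult_left_mono) auto
    finally have hd: "norm (hess \<phi> (x + t *\<^sub>R d) - hess \<phi> x) \<le> C * (2 * V x ^ 5) * norm d"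
      by (simp add: norm_minus_commute)
    have "\<bar>\<phi> (x + d) - \<phi> x - grad \<phi> x \<bullet> d - (hess \<phi> x *v d) \<bullet> d / 2\<bar> = \<bar>((hess \<phi> (x + t *\<^sub>R d) - hess \<phi> x) *v d) \<bullet> d\<bar> / 2"
      unfolding t(3) by (simp add: matrix_vector_mult_diff_rdistrib inner_diff_left diff_divide_distrib[symmetric])
    also have "\<dots> \<le> \<bar>((hess \<phi> (x + t *\<^sub>R d) - hess \<phi> x) *v d) \<bullet> d\<bar>" by simp
    also have "\<dots> \<le> norm ((hess \<phi> (x + t *\<^sub>R d) - hess \<phi> x) *v d) * norm d" by (rule Cauchy_Schwarz_ineq2)
    also have "\<dots> \<le> norm (hess \<phi> (x + t *\<^sub>R d) - hess \<phi> x) * norm d * norm d"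
      by (intro mult_right_mono norm_matrix_vector_mult_le) simp
    also have "\<dots> \<le> C * (2 * V x ^ 5) * norm d * norm d * norm d"
      using hd by (intro mult_right_mono) auto
    also have "\<dots> = 2 * (C * V x ^ 5 * norm d ^ 3)" by (simp add: power3_eq_cube)
    also have "\<dots> \<le> 9 * (C * V x ^ 5 * norm d ^ 3)" using C by (intro mult_right_mono) auto
    finally show ?thesis by simp
  qed simp
next
  case False
  define v n where "v = V x" and "n = norm d"
  have v1: "1 \<le> v" and n1: "1 \<le> n" using False by (auto simp: v_def n_def)
  have n3: "1 \<le> n ^ 3" "n \<le> n ^ 3" "n\<^sup>2 \<le> n ^ 3"
    using n1 power_increasing[of 0 3 n] power_increasing[of 1 3 n] power_increasing[of 2 3 n] by auto
  have v5: "v \<le> v ^ 5" "v ^ 3 \<le> v ^ 5" "v ^ 4 \<le> v ^ 5"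
    using v1 power_increasing[of 1 5 v] power_increasing[of 3 5 v] power_increasing[of 4 5 v] by auto
  have prod: "a * c \<le> v ^ 5 * n ^ 3" if "a \<le> v ^ 5" "0 \<le> a" "c \<le> n ^ 3" "0 \<le> c" for a c
    using that v1 n1 by (intro mult_mono) auto
  have one: "1 * n\<^sup>2 \<le> v ^ 5 * n ^ 3" by (rule prod) (use n3 v5 v1 n1 in auto)
  have vn: "v * 1 \<le> v ^ 5 * n ^ 3" "v ^ 3 * n \<le> v ^ 5 * n ^ 3" "v ^ 4 * n\<^sup>2 \<le> v ^ 5 * n ^ 3"
    by (rule prod; use v5 n3 v1 n1 in simp)+
  have "\<bar>\<phi> (x + d)\<bar> \<le> C * V (x + d)" by (rule phi_V)
  also have "V (x + d) \<le> 2 * v + 2 * n\<^sup>2"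
  proof -
    have "(norm (x + d))\<^sup>2 \<le> (norm x + norm d)\<^sup>2" by (intro power_mono norm_triangle_ineq) simp
    also have "\<dots> \<le> 2 * (norm x)\<^sup>2 + 2 * (norm d)\<^sup>2"
      using sum_squares_bound[of "norm x" "norm d"] by (simp add: power2_sum)
    finally show ?thesis by (simp add: V_def v_def n_def)
  qed
  finally have 1: "\<bar>\<phi> (x + d)\<bar> \<le> C * (4 * (v ^ 5 * n ^ 3))"
    using one vn(1) C by (smt (verit) mult_left_mono mult_1)
  have 2: "\<bar>\<phi> x\<bar> \<le> C * (v ^ 5 * n ^ 3)"
  proof -
    have "C * v \<le> C * (v ^ 5 * n ^ 3)" using vn(1) C by (intro mult_left_mono) auto
    then show ?thesis using phi_V[of x, folded v_def] by linarith
  qed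
  have "\<bar>grad \<phi> x \<bullet> d\<bar> \<le> norm (grad \<phi> x) * norm d" by (rule Cauchy_Schwarz_ineq2)
  also have "\<dots> \<le> 2 * C * v ^ 3 * n" unfolding v_def n_def by (intro mult_right_mono grad_V) simp
  finally have 3: "\<bar>grad \<phi> x \<bullet> d\<bar> \<le> C * (2 * (v ^ 5 * n ^ 3))"
    using mult_left_mono[OF vn(2), of "2 * C"] C by (simp only: mult_ac) linarith
  have "\<bar>(hess \<phi> x *v d) \<bullet> d\<bar> \<le> norm (hess \<phi> x *v d) * norm d" by (rule Cauchy_Schwarz_ineq2)
  also have "\<dots> \<le> norm (hess \<phi> x) * norm d * norm d" by (intro mult_right_mono norm_matrix_vector_mult_le) simp
  also have "\<dots> \<le> 2 * C * v ^ 4 * n * n" unfolding v_def n_def by (intro mult_right_mono hess_V) simp_all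
  finally have 4: "\<bar>(hess \<phi> x *v d) \<bullet> d\<bar> \<le> C * (2 * (v ^ 5 * n ^ 3))"
    using mult_left_mono[OF vn(3), of "2 * C"] C unfolding power2_eq_square by (simp only: mult_ac) linarith
  have "\<bar>\<phi> (x + d) - \<phi> x - grad \<phi> x \<bullet> d - (hess \<phi> x *v d) \<bullet> d / 2\<bar> \<le> \<bar>\<phi> (x + d)\<bar> + \<bar>\<phi> x\<bar> + \<bar>grad \<phi> x \<bullet> d\<bar> + \<bar>(hess \<phi> x *v d) \<bullet> d\<bar> / 2"
    by linarith
  also have "\<dots> \<le> 9 * (C * (v ^ 5 * n ^ 3))" using 1 2 3 4 unfolding mult.left_commute[of C] by linarith
  finally show ?thesis by (simp add: v_def n_def mult_ac)
qed

definition \<zeta> :: "real^'n \<Rightarrow> real^'n \<Rightarrow> real" where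
  "\<zeta> x z = ((\<sigma> *v z) \<bullet> (hess \<phi> x *v (\<sigma> *v z)) - hs_inner (\<sigma> ** transpose \<sigma>) (hess \<phi> x)) / 2"

text \<open>Defined as whatever is left, so that the expansion is an identity and only the size of
  \<rho> has to be estimated.\<close>

definition \<rho> :: "real \<Rightarrow> real^'n \<Rightarrow> real^'n \<Rightarrow> real" where
  "\<rho> e x z = (\<phi> (em_step b \<sigma> e x z) - \<phi> x) / e - (h x - hm) - (grad \<phi> x \<bullet> (\<sigma> *v z)) / sqrt e - \<zeta> x z"

text \<open>The displacement is of order sqrt e, so after division by e the cubic Taylor remainder
  is of order sqrt e, and the terms of the quadratic form that involve the drift are at most of that
  order. The exponent 8 is 5 from the Taylor remainder plus 3 from the cubed displacement.\<close>

lemma \<rho>_bound: "\<exists>D\<ge>0. \<forall>e x z. 0 < e \<and> e \<le> 1 \<longrightarrow> \<bar>\<rho> e x z\<bar> \<le> sqrt e * (D * V x ^ 8 * (1 + norm z) ^ 3)"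
proof -
  define K where "K = norm (b 0) + L + \<kappa>"
  have K0: "0 \<le> K" using L0 \<kappa>0 by (simp add: K_def)
  define D where "D = 9 * C * K ^ 3 + 3 * C * K\<^sup>2"
  have D0: "0 \<le> D" using C K0 by (simp add: D_def)
  have "\<bar>\<rho> e x z\<bar> \<le> sqrt e * (D * V x ^ 8 * (1 + norm z) ^ 3)" if e: "0 < e" "e \<le> 1" for e x z
  proof -
    define s where "s = sqrt e"
    have s: "0 < s" "s \<le> 1" "e = s * s" using e by (auto simp: s_def)
    define v m where "v = V x" and "m = 1 + norm z"
    have v1: "1 \<le> v" and m1: "1 \<le> m" by (auto simp: v_def m_def)
    define H where "H = hess \<phi> x"
    define y where "y = \<sigma> *v z"
    define d where "d = e *\<^sub>R b x + s *\<^sub>R y"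
    have nb: "norm (b x) \<le> (norm (b 0) + L) * v"
    proof -
      have "norm (b x) \<le> norm (b 0) + norm (b x - b 0)" by (metis add_diff_cancel_left' diff_add_cancel norm_triangle_ineq add.commute)
      also have "\<dots> \<le> norm (b 0) + L * norm x" using Lip[of x 0] by simp
      also have "\<dots> \<le> norm (b 0) * v + L * v"
        using v1 norm_le_V[of x] L0 by (intro add_mono mult_left_mono) (auto simp: v_def mult_le_cancel_left1)
      finally show ?thesis by (simp add: distrib_right)
    qed
    have ny: "norm y \<le> \<kappa> * m" using \<kappa>[of z] \<kappa>0 unfolding y_def m_def by (smt (verit) mult_left_mono)
    have vm: "v \<le> v * m" "m \<le> v * m" using v1 m1 by auto
    have nb': "norm (b x) \<le> K * (v * m)"
    proof -
      have "(norm (b 0) + L) * v \<le> K * (v * m)" using vm v1 \<kappa>0 L0 K0 unfolding K_def by (intro mult_mono) auto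
      then show ?thesis using nb by linarith
    qed
    have ny': "norm y \<le> K * (v * m)"
    proof -
      have "\<kappa> * m \<le> K * (v * m)" using vm m1 \<kappa>0 L0 K0 unfolding K_def by (intro mult_mono) auto
      then show ?thesis using ny by linarith
    qed
    have nd: "norm d \<le> s * (K * (v * m))"
    proof -
      have "norm d \<le> e * norm (b x) + s * norm y"
        unfolding d_def using norm_triangle_ineq[of "e *\<^sub>R b x" "s *\<^sub>R y"] e s by simp
      also have "\<dots> \<le> s * norm (b x) + s * norm y"
        using s e by (intro add_right_mono mult_right_mono) (auto simp: mult_left_le_one_le)
      also have "\<dots> \<le> s * ((norm (b 0) + L) * (v * m)) + s * (\<kappa> * (v * m))"
      proof (intro add_mono mult_left_mono)
        show "norm (b x) \<le> (norm (b 0) + L) * (v * m)"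
          using nb mult_left_mono[OF vm(1), of "norm (b 0) + L"] L0 by (simp add: add_nonneg_nonneg)
        show "norm y \<le> \<kappa> * (v * m)" using ny mult_left_mono[OF vm(2) \<kappa>0] by linarith
      qed (use s in auto)
      also have "\<dots> = s * (K * (v * m))" by (simp add: K_def algebra_simps)
      finally show ?thesis .
    qed
    have step: "em_step b \<sigma> e x z = x + d" by (simp add: em_step_def d_def y_def s_def)
    define rem where "rem = \<phi> (x + d) - \<phi> x - grad \<phi> x \<bullet> d - (H *v d) \<bullet> d / 2"
    have rem: "\<bar>rem\<bar> \<le> 9 * C * v ^ 5 * (s * (K * (v * m))) ^ 3"
    proof -
      have "\<bar>rem\<bar> \<le> 9 * C * v ^ 5 * norm d ^ 3" unfolding rem_def H_def v_def by (rule taylor_remainder)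
      also have "\<dots> \<le> 9 * C * v ^ 5 * (s * (K * (v * m))) ^ 3"
        using nd C v1 by (intro mult_left_mono power_mono) auto
      finally show ?thesis .
    qed
    \<comment> \<open>What the quadratic form contains, per unit of the step, besides the square of
      the noise.\<close>
    define q where "q = s * ((H *v b x) \<bullet> y + (H *v y) \<bullet> b x) + e * ((H *v b x) \<bullet> b x)"
    have quad: "(H *v d) \<bullet> d = e * (y \<bullet> (H *v y)) + e * q"
    proof -
      have "(H *v d) \<bullet> d = (e * s) * ((H *v b x) \<bullet> y + (H *v y) \<bullet> b x) + (e * e) * ((H *v b x) \<bullet> b x) + (s * s) * ((H *v y) \<bullet> y)"
        unfolding d_def by (simp add: matrix_vector_right_distrib matrix_vector_mult_scaleR inner_simps algebra_simps)
      then show ?thesis unfolding q_def s(3)[symmetric] by (simp add: algebra_simps inner_commute)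
    qed
    have Hb: "\<bar>(H *v u) \<bullet> w\<bar> \<le> 2 * C * v ^ 4 * ((K * (v * m)) * (K * (v * m)))" if "norm u \<le> K * (v * m)" "norm w \<le> K * (v * m)" for u w
    proof -
      have "\<bar>(H *v u) \<bullet> w\<bar> \<le> norm (H *v u) * norm w" by (rule Cauchy_Schwarz_ineq2)
      also have "\<dots> \<le> (norm H * norm u) * norm w" by (intro mult_right_mono norm_matrix_vector_mult_le) simp
      also have "\<dots> = norm H * (norm u * norm w)" by simp
      also have "\<dots> \<le> 2 * C * v ^ 4 * ((K * (v * m)) * (K * (v * m)))"
        using that K0 v1 m1 C hess_V[of x] unfolding H_def v_def by (intro mult_mono) auto
      finally show ?thesis .
    qed
    define Z where "Z = 2 * C * v ^ 4 * ((K * (v * m)) * (K * (v * m)))"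
    have Z0: "0 \<le> Z" using C v1 by (simp add: Z_def)
    have q: "\<bar>q\<bar> \<le> s * (3 * Z)"
    proof -
      have "\<bar>q\<bar> \<le> s * (\<bar>(H *v b x) \<bullet> y\<bar> + \<bar>(H *v y) \<bullet> b x\<bar>) + e * \<bar>(H *v b x) \<bullet> b x\<bar>"
        unfolding q_def using s e by (intro order_trans[OF abs_triangle_ineq] add_mono) (auto simp: abs_mult)
      also have "\<dots> \<le> s * (Z + Z) + s * Z"
        using Hb[OF nb' ny', folded Z_def] Hb[OF ny' nb', folded Z_def] Hb[OF nb' nb', folded Z_def] s e Z0
        by (intro add_mono mult_mono) (auto simp: mult_left_le_one_le)
      finally show ?thesis by (simp add: mult_ac)
    qed
    have g: "h x - hm = b x \<bullet> grad \<phi> x + hs_inner (\<sigma> ** transpose \<sigma>) H / 2"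
      using gen[of x] by (simp add: generator_def H_def)
    have "\<rho> e x z = rem / e + q / 2"
    proof -
      have "\<phi> (x + d) - \<phi> x = rem + e * (grad \<phi> x \<bullet> b x) + s * (grad \<phi> x \<bullet> y) + (e * (y \<bullet> (H *v y)) + e * q) / 2"
        unfolding rem_def quad by (simp add: d_def inner_simps)
      then have "(\<phi> (x + d) - \<phi> x) / e = rem / e + grad \<phi> x \<bullet> b x + (grad \<phi> x \<bullet> y) / s + (y \<bullet> (H *v y)) / 2 + q / 2"
        using e s by (simp add: add_divide_distrib)
      then show ?thesis
        unfolding \<rho>_def step \<zeta>_def g y_def[symmetric] H_def[symmetric] s_def[symmetric]
        by (simp add: inner_commute diff_divide_distrib)
    qed
    then have "\<bar>\<rho> e x z\<bar> \<le> \<bar>rem\<bar> / e + \<bar>q\<bar> / 2" using e by (simp add: order_trans[OF abs_triangle_ineq])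
    also have "\<dots> \<le> 9 * C * v ^ 5 * (s * (K * (v * m))) ^ 3 / e + s * (3 * Z) / 2"
      using rem q e by (intro add_mono divide_right_mono) auto
    also have "\<dots> = s * (9 * C * K ^ 3 * (v ^ 8 * m ^ 3) + 3 * C * K\<^sup>2 * (v ^ 6 * m\<^sup>2))"
      using s unfolding Z_def s(3) by (simp add: power_mult_distrib power2_eq_square power3_eq_cube) (simp add: field_simps eval_nat_numeral)
    also have "\<dots> \<le> s * (9 * C * K ^ 3 * (v ^ 8 * m ^ 3) + 3 * C * K\<^sup>2 * (v ^ 8 * m ^ 3))"
      using s C K0 v1 m1 by (intro mult_left_mono add_left_mono mult_mono power_increasing) auto
    also have "\<dots> = s * (D * v ^ 8 * m ^ 3)" by (simp add: D_def algebra_simps)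
    finally show ?thesis by (simp add: s_def v_def m_def)
  qed
  with D0 show ?thesis by blast
qed

end

section \<open>Negligible remainder terms\<close>

context em_sys
begin

lemma V_chain_noise_moment:
  assumes \<eta>: "good \<eta>"
  shows "integrable N (\<lambda>w. V (chain \<eta> x k w) ^ p * (1 + norm (\<xi> (Suc k) w)) ^ q)"
    and "(\<integral>w. V (chain \<eta> x k w) ^ p * (1 + norm (\<xi> (Suc k) w)) ^ q \<partial>N)
      = (\<integral>w. V (chain \<eta> x k w) ^ p \<partial>N) * (\<integral>z. (1 + norm (z :: real^'n)) ^ q \<partial>std_gauss)"
proof -
  let ?M = "\<integral>z. (1 + norm (z :: real^'n)) ^ q \<partial>std_gauss"
  let ?f = "\<lambda>p'. V (fst p') ^ p * (1 + norm (snd p' :: real^'n)) ^ q"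
  have M0: "0 \<le> ?M" by (rule Bochner_Integration.integral_nonneg) simp
  have iV: "integrable N (\<lambda>w. V (chain \<eta> x k w) ^ p)" by (rule integrable_V_chain'[OF \<eta>])
  have inner: "(\<integral>\<^sup>+z. ennreal (?f (y, z)) \<partial>std_gauss) = ennreal (V y ^ p * ?M)" for y :: "real^'n"
    by (subst nn_integral_eq_integral) (auto intro!: integrable_mult_right integrable_std_gauss_poly)
  have "(\<integral>\<^sup>+w. ennreal (?f (chain \<eta> x k w, \<xi> (Suc k) w)) \<partial>N) = (\<integral>\<^sup>+w. (\<integral>\<^sup>+z. ennreal (?f (chain \<eta> x k w, z)) \<partial>std_gauss) \<partial>N)"
    by (rule nn_integral_next[OF chain_F, of "\<lambda>p'. ennreal (?f p')"]) measurable
  also have "\<dots> = (\<integral>\<^sup>+w. ennreal (V (chain \<eta> x k w) ^ p * ?M) \<partial>N)" by (simp only: inner)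
  also have "\<dots> < \<infinity>" using iV M0 by (subst nn_integral_eq_integral) auto
  finally show i: "integrable N (\<lambda>w. V (chain \<eta> x k w) ^ p * (1 + norm (\<xi> (Suc k) w)) ^ q)"
    by (intro integrableI_nonneg) auto
  have "(\<integral>w. ?f (chain \<eta> x k w, \<xi> (Suc k) w) \<partial>N) = (\<integral>w. (\<integral>z. ?f (chain \<eta> x k w, z) \<partial>std_gauss) \<partial>N)"
    by (rule integral_next(2)[OF chain_F]) (use i in auto)
  then show "(\<integral>w. V (chain \<eta> x k w) ^ p * (1 + norm (\<xi> (Suc k) w)) ^ q \<partial>N) = (\<integral>w. V (chain \<eta> x k w) ^ p \<partial>N) * ?M"
    by simp
qed

lemma V_chain_noise_moment_bound:
  assumes \<eta>: "good \<eta>"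
  shows "\<exists>D\<ge>0. \<forall>k. (\<integral>w. V (chain \<eta> x k w) ^ p * (1 + norm (\<xi> (Suc k) w)) ^ q \<partial>N) \<le> D"
proof -
  let ?M = "\<integral>z. (1 + norm (z :: real^'n)) ^ q \<partial>std_gauss"
  have M0: "0 \<le> ?M" by (rule Bochner_Integration.integral_nonneg) simp
  obtain D where "0 \<le> D" "\<forall>k. (\<integral>w. V (chain \<eta> x k w) ^ p \<partial>N) \<le> D"
    using V_chain_moment_bound[OF \<eta>, of x p] by blast
  then show ?thesis unfolding V_chain_noise_moment(2)[OF \<eta>] using M0
    by (intro exI[of _ "D * ?M"]) (auto intro: mult_right_mono)
qed

text \<open>The drift of a power of V is at most a multiple of the step, so the bound grows with
  elapsed time and not with the number of steps; this is why (Step-2) features the elapsed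
  time.\<close>

lemma V_chain_max:
  "\<exists>D\<ge>0. \<forall>\<eta> x n q. good \<eta> \<and> 0 < q \<longrightarrow>
     measure N {w\<in>space N. \<exists>k\<le>n. q \<le> V (chain \<eta> x k w) ^ Suc p} \<le> (V x ^ Suc p + D * step_t \<eta> n) / q"
proof -
  obtain D where lc: "lyap_const p D" using lyap_const_exists by blast
  note D0 = lyap_constD(1)[OF lc]
  have "measure N {w\<in>space N. \<exists>k\<le>n. q \<le> V (chain \<eta> x k w) ^ Suc p} \<le> (V x ^ Suc p + D * step_t \<eta> n) / q"
    if \<eta>: "good \<eta>" and q: "0 < q" for \<eta> x n q
  proof -
    have "q * measure N {w\<in>space N. \<exists>k\<le>n. q \<le> V (chain \<eta> x k w) ^ Suc p}
        \<le> (\<integral>w. V (chain \<eta> x 0 w) ^ Suc p \<partial>N) + (\<Sum>k<n. D * \<eta> (Suc k))"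
    proof (rule maximal_inequality[where ?k0.0=0])
      fix k
      show "(\<lambda>w. V (chain \<eta> x k w) ^ Suc p) \<in> borel_measurable (F (0 + k))"
        using chain_F[of \<eta> x k] unfolding add_0 by measurable
      show "integrable N (\<lambda>w. V (chain \<eta> x k w) ^ Suc p)" by (rule integrable_V_chain[OF \<eta>])
      fix A assume A: "A \<in> sets (F (0 + k))"
      have A': "A \<in> sets N" using A sets_F_le by blast
      have "(\<integral>w. indicator A w * V (chain \<eta> x (Suc k) w) ^ Suc p \<partial>N) \<le>
        (1 - c0 * \<eta> (Suc k) / 2) * (\<integral>w. indicator A w * V (chain \<eta> x k w) ^ Suc p \<partial>N) + D * \<eta> (Suc k)"
        using A by (intro V_chain_supermartingale[OF \<eta> lc \<eta>]) (auto simp: indicator_def)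
      also have "\<dots> \<le> 1 * (\<integral>w. indicator A w * V (chain \<eta> x k w) ^ Suc p \<partial>N) + D * \<eta> (Suc k)"
        using c0 goodD(1)[OF \<eta>, of k] by (intro add_right_mono mult_right_mono Bochner_Integration.integral_nonneg) auto
      finally show "(\<integral>w. indicator A w * V (chain \<eta> x (Suc k) w) ^ Suc p \<partial>N) \<le>
        (\<integral>w. indicator A w * V (chain \<eta> x k w) ^ Suc p \<partial>N) + D * \<eta> (Suc k)" by simp
    qed (use q in auto)
    also have "(\<Sum>k<n. D * \<eta> (Suc k)) = D * step_t \<eta> n"
      by (induction n) (auto simp: distrib_left)
    finally show ?thesis using q by (simp add: field_simps prob_space)
  qed
  with D0 show ?thesis by blast
qed

end

context poisson_sys
begin

lemma meas_\<phi> [measurable]: "\<phi> \<in> borel_measurable borel" "grad \<phi> \<in> borel_measurable borel" "h \<in> borel_measurable borel"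
  using C2_continuous[OF C2] h_cont by (auto intro: borel_measurable_continuous_onI)

lemma \<zeta>_meas [measurable]: "(\<lambda>p. \<zeta> (fst p) (snd p)) \<in> borel_measurable (borel \<Otimes>\<^sub>M borel)"
proof -
  have H: "continuous_on UNIV (\<lambda>p::(real^'n) \<times> (real^'n). hess \<phi> (fst p))"
    by (rule continuous_on_compose2[OF C2_continuous(3)[OF C2]]) (auto intro!: continuous_intros)
  have s: "continuous_on UNIV (\<lambda>p::(real^'n) \<times> (real^'n). \<sigma> *v snd p)"
    by (rule continuous_on_compose2[OF linear_continuous_on[OF linear_linear[THEN iffD2, OF matrix_vector_mul_linear]]])
       (auto intro!: continuous_intros)
  have "continuous_on UNIV (\<lambda>p::(real^'n) \<times> (real^'n). \<zeta> (fst p) (snd p))"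
    unfolding \<zeta>_def inner_vec_def matrix_vector_mul_component hs_inner_def trace_def matrix_matrix_mult_def transpose_def
    by (auto intro!: continuous_intros H s)
  then show ?thesis unfolding borel_prod by (rule borel_measurable_continuous_onI)
qed

lemma quad_le: "\<bar>(\<sigma> *v z) \<bullet> (hess \<phi> x *v (\<sigma> *v z))\<bar> \<le> norm (hess \<phi> x) * (\<kappa>\<^sup>2 * (norm z)\<^sup>2)"
proof -
  have "\<bar>(\<sigma> *v z) \<bullet> (hess \<phi> x *v (\<sigma> *v z))\<bar> \<le> norm (\<sigma> *v z) * norm (hess \<phi> x *v (\<sigma> *v z))" by (rule Cauchy_Schwarz_ineq2)
  also have "\<dots> \<le> norm (\<sigma> *v z) * (norm (hess \<phi> x) * norm (\<sigma> *v z))"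
    by (intro mult_left_mono norm_matrix_vector_mult_le) simp
  also have "\<dots> = norm (hess \<phi> x) * (norm (\<sigma> *v z))\<^sup>2" by (simp add: power2_eq_square)
  also have "\<dots> \<le> norm (hess \<phi> x) * (\<kappa> * norm z)\<^sup>2" by (intro mult_left_mono power_mono \<kappa>) auto
  finally show ?thesis by (simp add: power_mult_distrib)
qed

lemma quad_integrable: "integrable std_gauss (\<lambda>z. (\<sigma> *v z) \<bullet> (hess \<phi> x *v (\<sigma> *v z)))"
  by (rule Bochner_Integration.integrable_bound[of _ "\<lambda>z. norm (hess \<phi> x) * (\<kappa>\<^sup>2 * (norm z)\<^sup>2)"])
     (use quad_le in \<open>auto intro!: integrable_mult_right integrable_std_gauss_norm_power intro: order_trans[OF _ abs_ge_self]\<close>)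

lemma quad_integral: "(\<integral>z. (\<sigma> *v z) \<bullet> (hess \<phi> x *v (\<sigma> *v z)) \<partial>std_gauss) = hs_inner (\<sigma> ** transpose \<sigma>) (hess \<phi> x)"
proof -
  let ?H = "hess \<phi> x"
  have "(\<sigma> *v z) \<bullet> (?H *v (\<sigma> *v z)) = z \<bullet> ((transpose \<sigma> ** (?H ** \<sigma>)) *v z)" for z
    by (simp add: matrix_vector_mul_assoc[symmetric]) (metis dot_lmul_matrix inner_commute)
  then have "(\<integral>z. (\<sigma> *v z) \<bullet> (?H *v (\<sigma> *v z)) \<partial>std_gauss) = trace (transpose \<sigma> ** (?H ** \<sigma>))"
    by (simp only: gauss_quadratic_form)
  also have "\<dots> = trace ((?H ** \<sigma>) ** transpose \<sigma>)" by (rule trace_mul_sym)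
  also have "(?H ** \<sigma>) ** transpose \<sigma> = ?H ** (\<sigma> ** transpose \<sigma>)" by (rule matrix_mul_assoc[symmetric])
  also have "trace (?H ** (\<sigma> ** transpose \<sigma>)) = trace ((\<sigma> ** transpose \<sigma>) ** ?H)" by (rule trace_mul_sym)
  finally show ?thesis by (simp add: hs_inner_def matrix_transpose_mul transpose_transpose)
qed

lemma \<zeta>_integral: "integrable std_gauss (\<zeta> x)" "(\<integral>z. \<zeta> x z \<partial>std_gauss) = 0"
  unfolding \<zeta>_def using quad_integrable[of x] by (auto simp: quad_integral std_gauss.prob_space[simplified])

lemma \<zeta>_bound: "\<exists>D\<ge>0. \<forall>x z. (\<zeta> x z)\<^sup>2 \<le> D * (V x ^ 8 * (1 + norm z) ^ 4)"
proof -
  define M2 where "M2 = (\<integral>z. (norm (z::real^'n))\<^sup>2 \<partial>std_gauss)"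
  have M20: "0 \<le> M2" unfolding M2_def by (rule Bochner_Integration.integral_nonneg) simp
  have hs: "\<bar>hs_inner (\<sigma> ** transpose \<sigma>) (hess \<phi> x)\<bar> \<le> norm (hess \<phi> x) * (\<kappa>\<^sup>2 * M2)" for x
  proof -
    have "\<bar>hs_inner (\<sigma> ** transpose \<sigma>) (hess \<phi> x)\<bar> \<le> (\<integral>z. \<bar>(\<sigma> *v z) \<bullet> (hess \<phi> x *v (\<sigma> *v z))\<bar> \<partial>std_gauss)"
      unfolding quad_integral[symmetric] by (rule integral_abs_bound)
    also have "\<dots> \<le> (\<integral>z. norm (hess \<phi> x) * (\<kappa>\<^sup>2 * (norm (z::real^'n))\<^sup>2) \<partial>std_gauss)"
      by (rule integral_mono) (auto intro!: quad_integrable integrable_mult_right integrable_std_gauss_norm_power quad_le)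
    finally show ?thesis by (simp add: M2_def)
  qed
  define D where "D = C * \<kappa>\<^sup>2 * (1 + M2)"
  have D0: "0 \<le> D" using C M20 by (simp add: D_def)
  have "(\<zeta> x z)\<^sup>2 \<le> D\<^sup>2 * (V x ^ 8 * (1 + norm z) ^ 4)" for x z
  proof -
    have n1: "(norm z)\<^sup>2 \<le> (1 + norm z)\<^sup>2" "1 \<le> (1 + norm z)\<^sup>2" by (auto intro: power_mono one_le_power)
    have M: "M2 \<le> M2 * (1 + norm z)\<^sup>2" using mult_left_mono[OF n1(2) M20] by simp
    have "\<bar>\<zeta> x z\<bar> \<le> (\<bar>(\<sigma> *v z) \<bullet> (hess \<phi> x *v (\<sigma> *v z))\<bar> + \<bar>hs_inner (\<sigma> ** transpose \<sigma>) (hess \<phi> x)\<bar>) / 2"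
      unfolding \<zeta>_def by (simp add: abs_triangle_ineq4)
    also have "\<dots> \<le> (norm (hess \<phi> x) * (\<kappa>\<^sup>2 * (norm z)\<^sup>2) + norm (hess \<phi> x) * (\<kappa>\<^sup>2 * M2)) / 2"
      using quad_le[of z x] hs[of x] by (intro divide_right_mono add_mono) auto
    also have "\<dots> = norm (hess \<phi> x) * (\<kappa>\<^sup>2 * ((norm z)\<^sup>2 + M2)) / 2" by (simp add: algebra_simps)
    also have "\<dots> \<le> (2 * C * V x ^ 4) * (\<kappa>\<^sup>2 * ((1 + M2) * (1 + norm z)\<^sup>2)) / 2"
    proof (intro divide_right_mono mult_mono hess_V order_refl)
      show "(norm z)\<^sup>2 + M2 \<le> (1 + M2) * (1 + norm z)\<^sup>2" using n1(1) M unfolding distrib_right mult_1 by linarith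
    qed (use C M20 in auto)
    also have "\<dots> = D * (V x ^ 4 * (1 + norm z)\<^sup>2)" by (simp add: D_def mult_ac)
    finally have "(\<bar>\<zeta> x z\<bar>)\<^sup>2 \<le> (D * (V x ^ 4 * (1 + norm z)\<^sup>2))\<^sup>2" by (intro power_mono) auto
    then show ?thesis by (simp add: power_mult_distrib flip: power_mult)
  qed
  then show ?thesis using D0 by (intro exI[of _ "D\<^sup>2"]) auto
qed

section \<open>The conditionally centred second-order term and the total remainder\<close>

definition Zs :: "(nat \<Rightarrow> real) \<Rightarrow> real^'n \<Rightarrow> nat \<Rightarrow> 'v \<Rightarrow> real" where
  "Zs \<eta> x k w = (\<Sum>j<k. \<zeta> (chain \<eta> x j w) (\<xi> (Suc j) w))"

lemma \<zeta>_F: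
  assumes "j < k" shows "(\<lambda>w. \<zeta> (chain \<eta> x j w) (\<xi> (Suc j) w)) \<in> borel_measurable (F k)"
proof -
  have "(\<lambda>w. (chain \<eta> x j w, \<xi> (Suc j) w)) \<in> measurable (F k) (borel \<Otimes>\<^sub>M borel)"
    using assms by (intro measurable_Pair chain_F_le F_rv) auto
  from measurable_compose[OF this \<zeta>_meas] show ?thesis by simp
qed

lemma Zs_F: "Zs \<eta> x k \<in> borel_measurable (F k)"
  unfolding Zs_def[abs_def] by (intro borel_measurable_sum \<zeta>_F) simp

lemma \<zeta>_sq_integrable:
  assumes \<eta>: "good \<eta>"
  shows "integrable N (\<lambda>w. (\<zeta> (chain \<eta> x j w) (\<xi> (Suc j) w))\<^sup>2)"
proof -
  obtain D where D: "0 \<le> D" "\<And>x z. (\<zeta> x z)\<^sup>2 \<le> D * (V x ^ 8 * (1 + norm z) ^ 4)" using \<zeta>_bound by blast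
  note [measurable] = measurable_F_N[OF \<zeta>_F[OF lessI]]
  show ?thesis
    by (rule Bochner_Integration.integrable_bound[OF integrable_mult_right[OF V_chain_noise_moment(1)[OF \<eta>, of x j 8 4], of D]])
       (use D in auto)
qed

lemma Zs_sq_integrable:
  assumes \<eta>: "good \<eta>"
  shows "integrable N (\<lambda>w. (Zs \<eta> x k w)\<^sup>2)"
proof (induction k)
  case (Suc k)
  let ?z = "\<lambda>w. \<zeta> (chain \<eta> x k w) (\<xi> (Suc k) w)"
  have "integrable N (\<lambda>w. 2 * (Zs \<eta> x k w)\<^sup>2 + 2 * (?z w)\<^sup>2)"
    using Suc \<zeta>_sq_integrable[OF \<eta>, of x k] by simp
  then show ?case
  proof (rule Bochner_Integration.integrable_bound)
    show "AE w in N. norm ((Zs \<eta> x (Suc k) w)\<^sup>2) \<le> norm (2 * (Zs \<eta> x k w)\<^sup>2 + 2 * (?z w)\<^sup>2)"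
    proof (rule AE_I2)
      fix w
      have "(Zs \<eta> x (Suc k) w)\<^sup>2 \<le> 2 * (Zs \<eta> x k w)\<^sup>2 + 2 * (?z w)\<^sup>2"
        using sum_squares_bound[of "Zs \<eta> x k w" "?z w"] by (simp add: Zs_def power2_sum)
      then show "norm ((Zs \<eta> x (Suc k) w)\<^sup>2) \<le> norm (2 * (Zs \<eta> x k w)\<^sup>2 + 2 * (?z w)\<^sup>2)" by simp
    qed
  qed (use measurable_F_N[OF Zs_F] in measurable)
qed (simp add: Zs_def)

text \<open>Kolmogorov's inequality: the new term is centred given the past, so the cross term
  vanishes on every past event and the square grows in the mean by a bounded variance per
  step.\<close>

lemma Zs_max:
  assumes \<eta>: "good \<eta>"
  shows "\<exists>D\<ge>0. \<forall>n q. 0 < q \<longrightarrow> measure N {w\<in>space N. \<exists>k\<le>n. q \<le> (Zs \<eta> x k w)\<^sup>2} \<le> real n * D / q"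
proof -
  obtain D where D: "0 \<le> D" "\<And>x z. (\<zeta> x z)\<^sup>2 \<le> D * (V x ^ 8 * (1 + norm z) ^ 4)" using \<zeta>_bound by blast
  obtain D' where D': "0 \<le> D'" "\<And>k. (\<integral>w. V (chain \<eta> x k w) ^ 8 * (1 + norm (\<xi> (Suc k) w)) ^ 4 \<partial>N) \<le> D'"
    using V_chain_noise_moment_bound[OF \<eta>, of x 8 4] by blast
  let ?z = "\<lambda>k w. \<zeta> (chain \<eta> x k w) (\<xi> (Suc k) w)"
  note [measurable] = measurable_F_N[OF \<zeta>_F[OF lessI]] measurable_F_N[OF Zs_F]
  have Ez: "(\<integral>w. (?z k w)\<^sup>2 \<partial>N) \<le> D * D'" for k
  proof -
    have "(\<integral>w. (?z k w)\<^sup>2 \<partial>N) \<le> (\<integral>w. D * (V (chain \<eta> x k w) ^ 8 * (1 + norm (\<xi> (Suc k) w)) ^ 4) \<partial>N)"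
      by (intro integral_mono \<zeta>_sq_integrable[OF \<eta>] integrable_mult_right V_chain_noise_moment(1)[OF \<eta>] D)
    also have "\<dots> \<le> D * D'" unfolding integral_mult_right_zero using D D' by (intro mult_left_mono) auto
    finally show ?thesis .
  qed
  have "measure N {w\<in>space N. \<exists>k\<le>n. q \<le> (Zs \<eta> x k w)\<^sup>2} \<le> real n * (D * D') / q" if q: "0 < q" for n q
  proof -
    have "q * measure N {w\<in>space N. \<exists>k\<le>n. q \<le> (Zs \<eta> x k w)\<^sup>2} \<le> (\<integral>w. (Zs \<eta> x 0 w)\<^sup>2 \<partial>N) + (\<Sum>k<n. D * D')"
    proof (rule maximal_inequality[where ?k0.0=0])
      fix k
      show "(\<lambda>w. (Zs \<eta> x k w)\<^sup>2) \<in> borel_measurable (F (0 + k))" using Zs_F[of \<eta> x k] unfolding add_0 by measurable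
      show "integrable N (\<lambda>w. (Zs \<eta> x k w)\<^sup>2)" by (rule Zs_sq_integrable[OF \<eta>])
      fix A assume "A \<in> sets (F (0 + k))"
      then have A: "A \<in> sets (F k)" by simp
      have A'[measurable]: "A \<in> sets N" using A sets_F_le by blast
      have iZz: "integrable N (\<lambda>w. Zs \<eta> x k w * ?z k w)"
        by (rule Cauchy_Schwarz_integral(1)) (auto intro: Zs_sq_integrable[OF \<eta>] \<zeta>_sq_integrable[OF \<eta>])
      have ind: "integrable N (\<lambda>w. indicator A w * f w)" if "integrable N f" for f :: "'v \<Rightarrow> real"
        using integrable_mult_indicator[OF A' that] by simp
      have cross: "(\<integral>w. indicator A w * (Zs \<eta> x k w * ?z k w) \<partial>N) = 0"
      proof -
        let ?Y = "\<lambda>w. (indicator A w * Zs \<eta> x k w, chain \<eta> x k w)"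
        have Y: "?Y \<in> measurable (F k) (borel \<Otimes>\<^sub>M borel)"
          using A Zs_F[of \<eta> x k] chain_F[of \<eta> x k] by measurable
        let ?f = "\<lambda>p. fst (fst p) * \<zeta> (snd (fst p)) (snd p)"
        have "(\<lambda>p. (snd (fst p), snd p)) \<in> measurable (((borel::real measure) \<Otimes>\<^sub>M (borel :: (real^'n) measure)) \<Otimes>\<^sub>M (borel :: (real^'n) measure)) (borel \<Otimes>\<^sub>M borel)"
          by measurable
        from measurable_compose[OF this \<zeta>_meas] have f: "?f \<in> borel_measurable ((borel \<Otimes>\<^sub>M borel) \<Otimes>\<^sub>M borel)" by simp
        have fi: "integrable N (\<lambda>w. ?f (?Y w, \<xi> (Suc k) w))" using ind[OF iZz] by (simp add: mult.assoc)
        have "(\<integral>w. ?f (?Y w, \<xi> (Suc k) w) \<partial>N) = (\<integral>w. (\<integral>z. ?f (?Y w, z) \<partial>std_gauss) \<partial>N)"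
          by (rule integral_next(2)[OF Y f fi])
        also have "\<dots> = 0" by (simp add: \<zeta>_integral(2))
        finally show ?thesis by (simp add: mult.assoc)
      qed
      have "(\<integral>w. indicator A w * (Zs \<eta> x (Suc k) w)\<^sup>2 \<partial>N)
          = (\<integral>w. indicator A w * (Zs \<eta> x k w)\<^sup>2 + 2 * (indicator A w * (Zs \<eta> x k w * ?z k w)) + indicator A w * (?z k w)\<^sup>2 \<partial>N)"
        by (intro Bochner_Integration.integral_cong refl) (simp add: Zs_def power2_sum algebra_simps)
      also have "\<dots> = (\<integral>w. indicator A w * (Zs \<eta> x k w)\<^sup>2 \<partial>N) + (\<integral>w. indicator A w * (?z k w)\<^sup>2 \<partial>N)"
        using ind[OF iZz] ind[OF Zs_sq_integrable[OF \<eta>, of x k]] ind[OF \<zeta>_sq_integrable[OF \<eta>, of x k]] by (simp add: cross)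
      also have "(\<integral>w. indicator A w * (?z k w)\<^sup>2 \<partial>N) \<le> (\<integral>w. (?z k w)\<^sup>2 \<partial>N)"
        by (intro integral_mono ind \<zeta>_sq_integrable[OF \<eta>]) (auto simp: indicator_def)
      also have "\<dots> \<le> D * D'" by (rule Ez)
      finally show "(\<integral>w. indicator A w * (Zs \<eta> x (Suc k) w)\<^sup>2 \<partial>N) \<le> (\<integral>w. indicator A w * (Zs \<eta> x k w)\<^sup>2 \<partial>N) + D * D'"
        by simp
    qed (use q in auto)
    then show ?thesis using q by (simp add: Zs_def field_simps)
  qed
  then show ?thesis using D D' by (intro exI[of _ "D * D'"]) auto
qed

text \<open>The gradient sum enters with a plus sign because the martingale approximating the
  centred sum is its negative; \<open>em_coeff\<close> carries the minus sign.\<close>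

definition rem :: "(nat \<Rightarrow> real) \<Rightarrow> real^'n \<Rightarrow> nat \<Rightarrow> 'v \<Rightarrow> real" where
  "rem \<eta> x k w = (\<Sum>j<k. h (chain \<eta> x j w) - hm)
     + (\<Sum>j<k. (grad \<phi> (chain \<eta> x j w) \<bullet> (\<sigma> *v \<xi> (Suc j) w)) / sqrt (\<eta> (Suc j)))"

lemma rem_eq:
  "rem \<eta> x k w = (\<Sum>j<k. (\<phi> (chain \<eta> x (Suc j) w) - \<phi> (chain \<eta> x j w)) * inverse (\<eta> (Suc j)))
     - Zs \<eta> x k w - (\<Sum>j<k. \<rho> (\<eta> (Suc j)) (chain \<eta> x j w) (\<xi> (Suc j) w))"
  unfolding rem_def Zs_def \<rho>_def em_chain_Suc sum.distrib[symmetric] sum_subtractf[symmetric]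
  by (intro sum.cong refl) (simp add: divide_inverse)

text \<open>Summation by parts with the increasing weights 1/\<eta> reduces the sum of differences
  of \<phi> to the size of its largest boundary term, controlled by the maximum of V along the
  path.\<close>

lemma rem_bound:
  assumes st: "steps \<eta>" and k: "k \<le> n" and n: "1 \<le> n" and B: "\<And>j. j \<le> n \<Longrightarrow> V (chain \<eta> x j w) \<le> B"
  shows "\<bar>rem \<eta> x k w\<bar> \<le> 2 * (C * B) / \<eta> n + \<bar>Zs \<eta> x k w\<bar> + (\<Sum>j<n. \<bar>\<rho> (\<eta> (Suc j)) (chain \<eta> x j w) (\<xi> (Suc j) w)\<bar>)"
proof -
  have gd: "good \<eta>" using st by (rule steps_good)
  let ?w = "\<lambda>j. inverse (\<eta> (Suc j))"
  let ?A = "\<Sum>j<k. (\<phi> (chain \<eta> x (Suc j) w) - \<phi> (chain \<eta> x j w)) * ?w j"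
  have \<eta>n: "0 < \<eta> n" using gd n by (simp add: good_def)
  have CB: "0 \<le> C * B" using C order_trans[OF V_nonneg B[of 0]] by simp
  have A: "\<bar>?A\<bar> \<le> 2 * (C * B) / \<eta> n"
  proof (cases k)
    case 0
    then show ?thesis using CB \<eta>n by simp
  next
    case (Suc k')
    have "\<bar>\<Sum>j<Suc k'. (\<phi> (chain \<eta> x (Suc j) w) - \<phi> (chain \<eta> x j w)) * ?w j\<bar> \<le> 2 * (C * B) * ?w k'"
    proof (rule abel_increasing_weights)
      fix j
      show "0 \<le> ?w j" using goodD(1)[OF gd, of j] by simp
      show "?w j \<le> ?w (Suc j)" using goodD(1)[OF gd, of "Suc j"] steps_antimono[OF st, of "Suc j" "Suc (Suc j)"]
        by (intro le_imp_inverse_le) auto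
    next
      fix j assume "j \<le> Suc k'"
      then have "V (chain \<eta> x j w) \<le> B" using k Suc by (intro B) simp
      then have "C * V (chain \<eta> x j w) \<le> C * B" using C by (intro mult_left_mono) auto
      then show "\<bar>\<phi> (chain \<eta> x j w)\<bar> \<le> C * B" using phi_V order_trans by blast
    qed
    also have "\<dots> \<le> 2 * (C * B) * inverse (\<eta> n)"
      using CB \<eta>n steps_antimono[OF st, of k n] k Suc by (intro mult_left_mono le_imp_inverse_le) auto
    finally show ?thesis unfolding Suc by (simp add: divide_inverse)
  qed
  have "\<bar>\<Sum>j<k. \<rho> (\<eta> (Suc j)) (chain \<eta> x j w) (\<xi> (Suc j) w)\<bar> \<le> (\<Sum>j<k. \<bar>\<rho> (\<eta> (Suc j)) (chain \<eta> x j w) (\<xi> (Suc j) w)\<bar>)"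
    by (rule sum_abs)
  also have "\<dots> \<le> (\<Sum>j<n. \<bar>\<rho> (\<eta> (Suc j)) (chain \<eta> x j w) (\<xi> (Suc j) w)\<bar>)"
    using k by (intro sum_mono2) auto
  finally show ?thesis using A unfolding rem_eq by linarith
qed

text \<open>Write sqrt \<eta> as \<eta> divided by sqrt \<eta> and apply Cauchy-Schwarz: the tail of
  the sum of \<eta>^2 is small, the sum of 1/\<eta> is at most T_n, and the finitely many first
  terms are negligible.\<close>

lemma sum_sqrt_steps_negligible:
  assumes st: "steps \<eta>" and sm: "summable (\<lambda>k. (\<eta> (Suc k))\<^sup>2)"
  shows "(\<lambda>n. (\<Sum>j<n. sqrt (\<eta> (Suc j))) / sqrt (step_T \<eta> n)) \<longlonglongrightarrow> 0"
proof (rule LIMSEQ_I)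
  fix r :: real assume r: "0 < r"
  have gd: "good \<eta>" using st by (rule steps_good)
  have T: "filterlim (step_T \<eta>) at_top sequentially" using st by (auto simp: steps_def)
  have T2: "filterlim (\<lambda>n. sqrt (step_T \<eta> n)) at_top sequentially" by (rule filterlim_compose[OF sqrt_at_top T])
  have e0: "0 < \<eta> (Suc j)" for j by (rule goodD(1)[OF gd])
  have "\<exists>K. \<forall>n\<ge>K. norm (\<Sum>i. (\<eta> (Suc (i + n)))\<^sup>2) < (r / 2)\<^sup>2"
    using suminf_exist_split[OF _ sm, of "(r / 2)\<^sup>2"] r by simp
  then obtain K where "norm (\<Sum>i. (\<eta> (Suc (i + K)))\<^sup>2) < (r / 2)\<^sup>2" by blast
  then have K: "(\<Sum>i. (\<eta> (Suc (i + K)))\<^sup>2) < (r / 2)\<^sup>2" by simp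
  have smK: "summable (\<lambda>i. (\<eta> (Suc (i + K)))\<^sup>2)" using summable_ignore_initial_segment[OF sm, of K] by simp
  define B where "B = (\<Sum>j<K. sqrt (\<eta> (Suc j)))"
  have bound: "(\<Sum>j<n. sqrt (\<eta> (Suc j))) \<le> B + sqrt (step_T \<eta> n) * (r / 2)" if "n \<ge> K" for n
  proof -
    have "(\<Sum>j<n. sqrt (\<eta> (Suc j))) = B + (\<Sum>j=K..<n. sqrt (\<eta> (Suc j)))"
      unfolding B_def using that by (simp add: lessThan_atLeast0 sum.atLeastLessThan_concat)
    also have "(\<Sum>j=K..<n. sqrt (\<eta> (Suc j))) = (\<Sum>j=K..<n. sqrt (inverse (\<eta> (Suc j))) * \<eta> (Suc j))"
    proof (rule sum.cong[OF refl])
      fix j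
      have "sqrt (inverse (\<eta> (Suc j))) * \<eta> (Suc j) = inverse (sqrt (\<eta> (Suc j))) * (sqrt (\<eta> (Suc j)) * sqrt (\<eta> (Suc j)))"
        using e0[of j] by (simp add: real_sqrt_inverse)
      also have "\<dots> = sqrt (\<eta> (Suc j))" using e0[of j] by (simp add: field_simps)
      finally show "sqrt (\<eta> (Suc j)) = sqrt (inverse (\<eta> (Suc j))) * \<eta> (Suc j)" ..
    qed
    also have "\<dots> \<le> sqrt ((\<Sum>j=K..<n. (sqrt (inverse (\<eta> (Suc j))))\<^sup>2) * (\<Sum>j=K..<n. (\<eta> (Suc j))\<^sup>2))"
      by (rule real_le_rsqrt) (rule Cauchy_Schwarz_ineq_sum)
    also have "\<dots> \<le> sqrt (step_T \<eta> n * (r / 2)\<^sup>2)"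
    proof (intro real_sqrt_le_mono mult_mono)
      have "(\<Sum>j=K..<n. (sqrt (inverse (\<eta> (Suc j))))\<^sup>2) = (\<Sum>j=K..<n. inverse (\<eta> (Suc j)))"
        using e0 by (intro sum.cong refl) (simp add: less_imp_le)
      also have "\<dots> \<le> step_T \<eta> n" unfolding step_T_eq using e0 by (intro sum_mono2) (auto intro: less_imp_le)
      finally show "(\<Sum>j=K..<n. (sqrt (inverse (\<eta> (Suc j))))\<^sup>2) \<le> step_T \<eta> n" .
      have "(\<Sum>j=K..<n. (\<eta> (Suc j))\<^sup>2) = (\<Sum>i<n - K. (\<eta> (Suc (i + K)))\<^sup>2)"
        by (rule sum.reindex_bij_witness[of _ "\<lambda>i. i + K" "\<lambda>j. j - K"]) auto
      also have "\<dots> \<le> (\<Sum>i. (\<eta> (Suc (i + K)))\<^sup>2)" by (rule sum_le_suminf[OF smK]) auto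
      finally show "(\<Sum>j=K..<n. (\<eta> (Suc j))\<^sup>2) \<le> (r / 2)\<^sup>2" using K by simp
    qed (auto intro: sum_nonneg step_T_nonneg[OF gd])
    also have "\<dots> = sqrt (step_T \<eta> n) * (r / 2)" using r by (simp add: real_sqrt_mult)
    finally show ?thesis by simp
  qed
  have "(\<lambda>n. B / sqrt (step_T \<eta> n)) \<longlonglongrightarrow> 0"
    by (rule tendsto_divide_0[OF tendsto_const filterlim_at_top_imp_at_infinity[OF T2]])
  then have "\<forall>\<^sub>F n in sequentially. B / sqrt (step_T \<eta> n) < r / 2" by (rule order_tendstoD(2)) (use r in simp)
  moreover have "\<forall>\<^sub>F n in sequentially. 0 < sqrt (step_T \<eta> n)" using T by (auto simp: filterlim_at_top_dense)
  moreover have "\<forall>\<^sub>F n in sequentially. n \<ge> K" by (rule eventually_ge_at_top)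
  ultimately have "\<forall>\<^sub>F n in sequentially. norm ((\<Sum>j<n. sqrt (\<eta> (Suc j))) / sqrt (step_T \<eta> n) - 0) < r"
  proof eventually_elim
    case (elim n)
    have "(\<Sum>j<n. sqrt (\<eta> (Suc j))) / sqrt (step_T \<eta> n) \<le> (B + sqrt (step_T \<eta> n) * (r / 2)) / sqrt (step_T \<eta> n)"
      using bound[OF elim(3)] elim(2) by (intro divide_right_mono) auto
    also have "\<dots> = B / sqrt (step_T \<eta> n) + r / 2" using elim(2) by (simp add: add_divide_distrib)
    also have "\<dots> < r" using elim(1) by linarith
    finally have "(\<Sum>j<n. sqrt (\<eta> (Suc j))) / sqrt (step_T \<eta> n) < r" .
    moreover have "0 \<le> (\<Sum>j<n. sqrt (\<eta> (Suc j))) / sqrt (step_T \<eta> n)"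
      using elim(2) e0 by (intro divide_nonneg_pos sum_nonneg) (auto intro: less_imp_le)
    ultimately show ?case by simp
  qed
  then show "\<exists>no. \<forall>n\<ge>no. norm ((\<Sum>j<n. sqrt (\<eta> (Suc j))) / sqrt (step_T \<eta> n) - 0) < r"
    by (simp add: eventually_sequentially)
qed

text \<open>The weighted average of \<eta> with the weights 1/\<eta> is exactly n / T_n.\<close>

lemma n_over_T_negligible:
  assumes st: "steps \<eta>"
  shows "(\<lambda>n. real n / step_T \<eta> n) \<longlonglongrightarrow> 0"
proof -
  have gd: "good \<eta>" using st by (rule steps_good)
  have T: "filterlim (step_T \<eta>) at_top sequentially" and \<eta>0: "\<eta> \<longlonglongrightarrow> 0" using st by (auto simp: steps_def)
  have e0: "0 < \<eta> (Suc j)" for j by (rule goodD(1)[OF gd])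
  have "(\<lambda>n. (\<Sum>j<n. inverse (\<eta> (Suc j)) * \<eta> (Suc j)) / (\<Sum>j<n. inverse (\<eta> (Suc j)))) \<longlonglongrightarrow> 0"
    by (rule weighted_average_null) (use LIMSEQ_Suc[OF \<eta>0] e0 T in \<open>auto simp: step_T_eq[abs_def] less_imp_le\<close>)
  moreover have "inverse (\<eta> (Suc j)) * \<eta> (Suc j) = 1" for j using e0[of j] by simp
  ultimately show ?thesis by (simp add: step_T_eq)
qed

theorem rem_negligible:
  assumes st: "steps \<eta>" and sm: "summable (\<lambda>k. (\<eta> (Suc k))\<^sup>2)"
    and p: "1 < p" "(\<lambda>n. (1 + step_t \<eta> n) powr (1 / p) / (\<eta> n * sqrt (step_T \<eta> n))) \<longlonglongrightarrow> 0"
    and \<delta>: "0 < \<delta>"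
  shows "(\<lambda>n. measure N {\<omega>\<in>space N. \<exists>k\<le>n. \<delta> * sqrt (step_T \<eta> n) < \<bar>rem \<eta> x k \<omega>\<bar>}) \<longlonglongrightarrow> 0"
proof -
  have gd: "good \<eta>" using st by (rule steps_good)
  have e0: "0 < \<eta> (Suc j)" for j by (rule goodD(1)[OF gd])
  have T: "filterlim (step_T \<eta>) at_top sequentially" using st by (auto simp: steps_def)
  let ?T = "step_T \<eta>"
  \<comment> \<open>The Lyapunov estimates are for integer powers; as 1 + t_n is at least 1, a
    larger power only lowers the root in (Step-2).\<close>
  obtain q where q: "p \<le> real (Suc q)" using real_arch_simple[of p] by (metis le_SucI of_nat_le_iff order_trans le_refl)
  obtain D1 where D1: "0 \<le> D1" "\<And>n a. 0 < a \<Longrightarrow> measure N {\<omega>\<in>space N. \<exists>k\<le>n. a \<le> V (chain \<eta> x k \<omega>) ^ Suc q} \<le> (V x ^ Suc q + D1 * step_t \<eta> n) / a"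
    using V_chain_max[of q] gd by blast
  obtain D2 where D2: "0 \<le> D2" "\<And>n a. 0 < a \<Longrightarrow> measure N {\<omega>\<in>space N. \<exists>k\<le>n. a \<le> (Zs \<eta> x k \<omega>)\<^sup>2} \<le> real n * D2 / a"
    using Zs_max[OF gd, of x] by blast
  obtain D3 where D3: "0 \<le> D3" "\<And>e x z. 0 < e \<Longrightarrow> e \<le> 1 \<Longrightarrow> \<bar>\<rho> e x z\<bar> \<le> sqrt e * (D3 * V x ^ 8 * (1 + norm z) ^ 3)"
    using \<rho>_bound by blast
  obtain D4 where D4: "0 \<le> D4" "\<And>k. (\<integral>\<omega>. V (chain \<eta> x k \<omega>) ^ 8 * (1 + norm (\<xi> (Suc k) \<omega>)) ^ 3 \<partial>N) \<le> D4"
    using V_chain_noise_moment_bound[OF gd, of x 8 3] by blast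
  let ?r = "\<lambda>j \<omega>. \<rho> (\<eta> (Suc j)) (chain \<eta> x j \<omega>) (\<xi> (Suc j) \<omega>)"
  let ?W = "\<lambda>j \<omega>. V (chain \<eta> x j \<omega>) ^ 8 * (1 + norm (\<xi> (Suc j) \<omega>)) ^ 3"
  note [measurable] = measurable_F_N[OF Zs_F] measurable_F_N[OF \<zeta>_F[OF lessI]]
  have rm[measurable]: "?r j \<in> borel_measurable N" for j unfolding \<rho>_def by measurable
  have rb: "\<bar>?r j \<omega>\<bar> \<le> sqrt (\<eta> (Suc j)) * D3 * ?W j \<omega>" for j \<omega>
    using D3(2)[OF e0 goodD(3)[OF gd], of j "chain \<eta> x j \<omega>" "\<xi> (Suc j) \<omega>"] by (simp add: mult_ac)
  have ri: "integrable N (\<lambda>\<omega>. \<bar>?r j \<omega>\<bar>)" for j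
    by (rule Bochner_Integration.integrable_bound[OF integrable_mult_right[OF V_chain_noise_moment(1)[OF gd, of x j 8 3], of "sqrt (\<eta> (Suc j)) * D3"]])
       (auto intro!: AE_I2 order_trans[OF rb abs_ge_self])
  have Er: "(\<integral>\<omega>. (\<Sum>j<n. \<bar>?r j \<omega>\<bar>) \<partial>N) \<le> (\<Sum>j<n. sqrt (\<eta> (Suc j))) * (D3 * D4)" for n
  proof -
    have "(\<integral>\<omega>. \<bar>?r j \<omega>\<bar> \<partial>N) \<le> sqrt (\<eta> (Suc j)) * (D3 * D4)" for j
    proof -
      have "(\<integral>\<omega>. \<bar>?r j \<omega>\<bar> \<partial>N) \<le> (\<integral>\<omega>. sqrt (\<eta> (Suc j)) * D3 * ?W j \<omega> \<partial>N)"
        by (intro integral_mono ri integrable_mult_right V_chain_noise_moment(1)[OF gd] rb)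
      also have "\<dots> \<le> sqrt (\<eta> (Suc j)) * D3 * D4"
        unfolding integral_mult_right_zero using D3(1) D4(2)[of j] e0[of j] by (intro mult_left_mono) auto
      finally show ?thesis by (simp add: mult.assoc)
    qed
    then show ?thesis using ri by (simp add: Bochner_Integration.integral_sum sum_distrib_right sum_mono)
  qed
  \<comment> \<open>The level of V at which the boundary term of \<open>rem_bound\<close> equals a
    third of \<open>\<delta> * sqrt (?T n)\<close>.\<close>
  define a where "a n = \<delta> * \<eta> n * sqrt (?T n) / (6 * C)" for n
  let ?bad = "\<lambda>n. {\<omega>\<in>space N. \<exists>k\<le>n. \<delta> * sqrt (?T n) < \<bar>rem \<eta> x k \<omega>\<bar>}"
  have rem_m[measurable]: "rem \<eta> x k \<in> borel_measurable N" for k unfolding rem_def[abs_def] by measurable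
  have bound: "measure N (?bad n) \<le> (V x ^ Suc q + D1 * step_t \<eta> n) / a n ^ Suc q + 9 * D2 / \<delta>\<^sup>2 * (real n / ?T n)
      + 3 * D3 * D4 / \<delta> * ((\<Sum>j<n. sqrt (\<eta> (Suc j))) / sqrt (?T n))" if n: "1 \<le> n" and Tn: "0 < ?T n" for n
  proof -
    have \<eta>n: "0 < \<eta> n" using gd n by (simp add: good_def)
    have a: "0 < a n" using \<eta>n Tn C \<delta> by (simp add: a_def)
    let ?b = "(\<delta> * sqrt (?T n) / 3)"
    have b: "0 < ?b" using Tn \<delta> by simp
    let ?A1 = "{\<omega>\<in>space N. \<exists>k\<le>n. a n ^ Suc q \<le> V (chain \<eta> x k \<omega>) ^ Suc q}"
    let ?A2 = "{\<omega>\<in>space N. \<exists>k\<le>n. ?b\<^sup>2 \<le> (Zs \<eta> x k \<omega>)\<^sup>2}"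
    let ?A3 = "{\<omega>\<in>space N. ?b \<le> (\<Sum>j<n. \<bar>?r j \<omega>\<bar>)}"
    have m: "?A1 \<in> sets N" "?A2 \<in> sets N" "?A3 \<in> sets N" by measurable
    have "?bad n \<subseteq> (?A1 \<union> ?A2) \<union> ?A3"
    proof
      fix \<omega> assume "\<omega> \<in> ?bad n"
      then obtain k where w: "\<omega> \<in> space N" and k: "k \<le> n" "\<delta> * sqrt (?T n) < \<bar>rem \<eta> x k \<omega>\<bar>" by auto
      show "\<omega> \<in> (?A1 \<union> ?A2) \<union> ?A3"
      proof (rule ccontr)
        assume "\<not> ?thesis"
        then have no: "\<forall>j\<le>n. \<not> a n ^ Suc q \<le> V (chain \<eta> x j \<omega>) ^ Suc q" "\<forall>j\<le>n. \<not> ?b\<^sup>2 \<le> (Zs \<eta> x j \<omega>)\<^sup>2" "\<not> ?b \<le> (\<Sum>j<n. \<bar>?r j \<omega>\<bar>)"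
          using w by blast+
        have "V (chain \<eta> x j \<omega>) \<le> a n" if "j \<le> n" for j
          using no(1) that a power_mono[of "a n" "V (chain \<eta> x j \<omega>)" "Suc q"] by (meson nle_le less_imp_le)
        from rem_bound[OF st k(1) n this]
        have "\<bar>rem \<eta> x k \<omega>\<bar> \<le> 2 * (C * a n) / \<eta> n + \<bar>Zs \<eta> x k \<omega>\<bar> + (\<Sum>j<n. \<bar>?r j \<omega>\<bar>)" by blast
        moreover have "2 * (C * a n) / \<eta> n = ?b" using C \<eta>n by (simp add: a_def field_simps)
        moreover have "\<bar>Zs \<eta> x k \<omega>\<bar> < ?b"
          using no(2) k b power_mono[of ?b "\<bar>Zs \<eta> x k \<omega>\<bar>" 2] by (metis power2_abs not_le less_imp_le)
        ultimately show False using no(3) k(2) by linarith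
      qed
    qed
    then have "measure N (?bad n) \<le> measure N ((?A1 \<union> ?A2) \<union> ?A3)" by (intro finite_measure_mono) auto
    also have "\<dots> \<le> measure N ?A1 + measure N ?A2 + measure N ?A3"
      using measure_Un_le[of "?A1 \<union> ?A2" N ?A3] measure_Un_le[of ?A1 N ?A2] m by (simp del: power_Suc)
    also have "measure N ?A1 \<le> (V x ^ Suc q + D1 * step_t \<eta> n) / a n ^ Suc q" by (rule D1(2)) (use a in simp)
    also have "measure N ?A2 \<le> real n * D2 / ?b\<^sup>2" by (rule D2(2)) (use Tn \<delta> in simp)
    also have "measure N ?A3 \<le> (\<integral>\<omega>. (\<Sum>j<n. \<bar>?r j \<omega>\<bar>) \<partial>N) / ?b"
      by (rule integral_Markov_inequality_measure[where A="space N"]) (use ri b in \<open>auto intro!: sum_nonneg\<close>)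
    also have "\<dots> \<le> (\<Sum>j<n. sqrt (\<eta> (Suc j))) * (D3 * D4) / ?b" using Er b by (intro divide_right_mono) auto
    finally have "measure N (?bad n) \<le> (V x ^ Suc q + D1 * step_t \<eta> n) / a n ^ Suc q + real n * D2 / ?b\<^sup>2 + (\<Sum>j<n. sqrt (\<eta> (Suc j))) * (D3 * D4) / ?b"
      by simp
    moreover have "real n * D2 / ?b\<^sup>2 = 9 * D2 / \<delta>\<^sup>2 * (real n / ?T n)"
      using Tn by (simp add: power_mult_distrib power_divide mult_ac)
    moreover have "(\<Sum>j<n. sqrt (\<eta> (Suc j))) * (D3 * D4) / ?b = 3 * D3 * D4 / \<delta> * ((\<Sum>j<n. sqrt (\<eta> (Suc j))) / sqrt (?T n))"
      by (simp add: mult_ac)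
    ultimately show ?thesis by linarith
  qed
  have first: "(\<lambda>n. (V x ^ Suc q + D1 * step_t \<eta> n) / a n ^ Suc q) \<longlonglongrightarrow> 0"
  proof -
    define K where "K = (V x ^ Suc q + D1) * (6 * C / \<delta>) ^ Suc q"
    let ?u = "\<lambda>n. (1 + step_t \<eta> n) powr (1 / p) / (\<eta> n * sqrt (?T n))"
    have lim: "(\<lambda>n. K * ?u n ^ Suc q) \<longlonglongrightarrow> K * 0 ^ Suc q" by (intro tendsto_intros p(2))
    have t0: "0 \<le> step_t \<eta> n" for n unfolding step_t_def using gd by (intro sum_nonneg) (auto simp: good_def less_imp_le)
    have Tpos: "\<forall>\<^sub>F n in sequentially. 0 < ?T n" using T by (auto simp: filterlim_at_top_dense)
    have le: "\<forall>\<^sub>F n in sequentially. (V x ^ Suc q + D1 * step_t \<eta> n) / a n ^ Suc q \<le> K * ?u n ^ Suc q"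
      using Tpos eventually_ge_at_top[of 1]
    proof eventually_elim
      case (elim n)
      have \<eta>n: "0 < \<eta> n" using gd elim by (simp add: good_def)
      have g0: "0 < \<eta> n * sqrt (?T n)" using \<eta>n elim by simp
      have "1 + step_t \<eta> n = ((1 + step_t \<eta> n) powr (1 / real (Suc q))) ^ Suc q"
        using t0[of n] by (simp add: powr_realpow[symmetric] powr_powr add_pos_nonneg del: power_Suc)
      also have "\<dots> \<le> ((1 + step_t \<eta> n) powr (1 / p)) ^ Suc q"
        using t0[of n] p(1) q by (intro power_mono powr_mono frac_le) auto
      finally have 1: "1 + step_t \<eta> n \<le> ((1 + step_t \<eta> n) powr (1 / p)) ^ Suc q" .
      have V1: "1 \<le> V x ^ Suc q" by (rule one_le_power) simp
      have "V x ^ Suc q + D1 * step_t \<eta> n \<le> (V x ^ Suc q + D1) * (1 + step_t \<eta> n)"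
        using D1(1) t0[of n] V1 by (simp add: algebra_simps del: power_Suc)
      also have "\<dots> \<le> (V x ^ Suc q + D1) * ((1 + step_t \<eta> n) powr (1 / p)) ^ Suc q"
        using 1 D1(1) V1 by (intro mult_left_mono) auto
      finally have "(V x ^ Suc q + D1 * step_t \<eta> n) / a n ^ Suc q \<le> (V x ^ Suc q + D1) * ((1 + step_t \<eta> n) powr (1 / p)) ^ Suc q / a n ^ Suc q"
        using g0 C \<delta> by (intro divide_right_mono zero_le_power) (auto simp: a_def mult.assoc)
      also have "\<dots> = K * ?u n ^ Suc q"
      proof -
        have "a n = (\<eta> n * sqrt (?T n)) / (6 * C / \<delta>)" using \<delta> C by (simp add: a_def)
        then show ?thesis by (simp add: K_def power_divide power_mult_distrib mult_ac del: power_Suc)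
      qed
      finally show ?case .
    qed
    have nn: "\<forall>\<^sub>F n in sequentially. 0 \<le> (V x ^ Suc q + D1 * step_t \<eta> n) / a n ^ Suc q"
      using eventually_ge_at_top[of 1]
    proof eventually_elim
      case (elim n)
      have "0 < \<eta> n" using gd elim by (simp add: good_def)
      then have "0 \<le> a n" using C \<delta> step_T_nonneg[OF gd, of n] by (simp add: a_def)
      then show ?case using D1(1) t0[of n] by (intro divide_nonneg_nonneg add_nonneg_nonneg) auto
    qed
    show ?thesis by (rule tendsto_sandwich[OF nn le tendsto_const]) (use lim in simp)
  qed
  have lim: "(\<lambda>n. (V x ^ Suc q + D1 * step_t \<eta> n) / a n ^ Suc q + 9 * D2 / \<delta>\<^sup>2 * (real n / ?T n)
      + 3 * D3 * D4 / \<delta> * ((\<Sum>j<n. sqrt (\<eta> (Suc j))) / sqrt (?T n))) \<longlonglongrightarrow> 0 + 9 * D2 / \<delta>\<^sup>2 * 0 + 3 * D3 * D4 / \<delta> * 0"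
    by (intro tendsto_add tendsto_mult tendsto_const first n_over_T_negligible[OF st] sum_sqrt_steps_negligible[OF st sm])
  have Tpos: "\<forall>\<^sub>F n in sequentially. 0 < ?T n" using T by (auto simp: filterlim_at_top_dense)
  have ev: "\<forall>\<^sub>F n in sequentially. measure N (?bad n) \<le> (V x ^ Suc q + D1 * step_t \<eta> n) / a n ^ Suc q + 9 * D2 / \<delta>\<^sup>2 * (real n / ?T n)
      + 3 * D3 * D4 / \<delta> * ((\<Sum>j<n. sqrt (\<eta> (Suc j))) / sqrt (?T n))"
    using Tpos eventually_ge_at_top[of 1] by eventually_elim (rule bound)
  show ?thesis
    by (rule tendsto_sandwich[OF _ ev tendsto_const]) (use lim in \<open>auto intro!: always_eventually\<close>)
qed

end

section \<open>Weak convergence on the Skorohod space\<close>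

text \<open>The uniform distance, capped at 1 so that the supremum is taken over a bounded set
  whatever the functions are.\<close>

definition sup_dist :: "(real \<Rightarrow> real) \<Rightarrow> (real \<Rightarrow> real) \<Rightarrow> real" where
  "sup_dist x y = (SUP t\<in>{0..1}. min 1 \<bar>x t - y t\<bar>)"

lemma sup_dist_ge: "t \<in> {0..1} \<Longrightarrow> min 1 \<bar>x t - y t\<bar> \<le> sup_dist x y"
  unfolding sup_dist_def by (intro cSUP_upper bdd_aboveI[of _ 1]) auto

lemma sup_dist_le: "(\<And>t. t \<in> {0..1} \<Longrightarrow> min 1 \<bar>x t - y t\<bar> \<le> e) \<Longrightarrow> sup_dist x y \<le> e"
  unfolding sup_dist_def by (rule cSUP_least) auto

lemma sup_dist_nonneg [simp]: "0 \<le> sup_dist x y"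
  using sup_dist_ge[of 0 x y] by auto

lemma sup_dist_refl [simp]: "sup_dist x x = 0"
  using sup_dist_le[of x x 0] sup_dist_nonneg[of x x] by auto

lemma sup_dist_commute: "sup_dist x y = sup_dist y x"
  unfolding sup_dist_def by (simp add: abs_minus_commute)

lemma sup_dist_triangle: "sup_dist x z \<le> sup_dist x y + sup_dist y z"
proof (rule sup_dist_le)
  fix t :: real assume "t \<in> {0..1}"
  then show "min 1 \<bar>x t - z t\<bar> \<le> sup_dist x y + sup_dist y z"
    using sup_dist_ge[of t x y] sup_dist_ge[of t y z] sup_dist_nonneg[of x y] sup_dist_nonneg[of y z]
    by (auto simp: min_def split: if_splits)
qed

text \<open>The identity serves as time change; \<open>e < 1\<close> makes the cap in
  \<open>sup_dist\<close> harmless.\<close>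

lemma skorohod_dist_le:
  assumes "0 < e" "e < 1" "sup_dist x y \<le> e"
  shows "skorohod_dist x y \<le> e"
  unfolding skorohod_dist_def
proof (rule cInf_lower)
  have "\<bar>x t - y t\<bar> \<le> e" if "t \<in> {0..1}" for t
    using sup_dist_ge[OF that, of x y] assms by (auto simp: min_def split: if_splits)
  then show "e \<in> {e. 0 < e \<and> (\<exists>\<mu>. strict_mono_on {0..1} \<mu> \<and> continuous_on {0..1} \<mu> \<and> \<mu> ` {0..1} = {0..1} \<and>
        (\<forall>t\<in>{0..1}. \<bar>\<mu> t - t\<bar> \<le> e \<and> \<bar>x t - y (\<mu> t)\<bar> \<le> e))}"
    using assms by (auto intro!: exI[of _ "\<lambda>t. t"] strict_mono_onI)
qed (auto intro: bdd_belowI[of _ 0])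

lemma skorohod_open_sup_dist:
  assumes U: "openin skorohod_topology U" and x: "x \<in> U"
  shows "\<exists>e>0. \<forall>y\<in>D01. sup_dist x y < e \<longrightarrow> y \<in> U"
proof -
  obtain e where e: "0 < e" "\<forall>y\<in>D01. skorohod_dist x y < e \<longrightarrow> y \<in> U"
    using U x unfolding openin_skorohod_topology by blast
  have "y \<in> U" if "y \<in> D01" "sup_dist x y < min (e / 2) (1 / 2)" for y
  proof -
    have "skorohod_dist x y \<le> min (e / 2) (1 / 2)" by (rule skorohod_dist_le) (use e that in auto)
    then show ?thesis using e that(1) by auto
  qed
  then show ?thesis using e(1) by (intro exI[of _ "min (e / 2) (1 / 2)"]) auto
qed

lemma skorohod_continuous_sup_dist:
  assumes F: "continuous_map skorohod_topology euclideanreal F" and x: "x \<in> D01" and r: "0 < r"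
  shows "\<exists>e>0. \<forall>y\<in>D01. sup_dist x y < e \<longrightarrow> \<bar>F y - F x\<bar> < r"
proof -
  have "openin skorohod_topology {y \<in> topspace skorohod_topology. F y \<in> ball (F x) r}"
    by (rule openin_continuous_map_preimage[OF F]) (simp add: open_openin[symmetric])
  from skorohod_open_sup_dist[OF this, of x] x r show ?thesis
    unfolding topspace_skorohod_topology by (auto simp: dist_real_def abs_minus_commute)
qed

section \<open>Paths constant on grid intervals\<close>

definition step_path :: "nat \<Rightarrow> (nat \<Rightarrow> real) \<Rightarrow> real \<Rightarrow> real" where
  "step_path m x = (\<lambda>t\<in>{0..1}. x (nat \<lfloor>real m * t\<rfloor>))"

lemma step_path_index: "t \<in> {0..1} \<Longrightarrow> nat \<lfloor>real m * t\<rfloor> \<le> m"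
  using mult_left_mono[of t 1 "real m"] by (simp add: nat_le_iff) linarith

lemma step_path_D01: "step_path m x \<in> D01"
proof -
  have r: "(step_path m x \<longlongrightarrow> step_path m x t) (at_right t)" if t: "t \<in> {0..<1}" for t
  proof (rule tendsto_eventually)
    \<comment> \<open>The next jump or the right end, whichever comes first; for
      \<open>m = 0\<close> the path is constant.\<close>
    define u where "u = (if m = 0 then 1 else min 1 ((of_int \<lfloor>real m * t\<rfloor> + 1) / real m))"
    have u: "t < u" "u \<le> 1" using t floor_correct[of "real m * t"] by (auto simp: u_def pos_less_divide_eq mult.commute)
    show "\<forall>\<^sub>F s in at_right t. step_path m x s = step_path m x t"
      unfolding eventually_at_right_field
    proof (intro exI[of _ u] conjI u allI impI)
      fix s assume s: "t < s" "s < u"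
      have "\<lfloor>real m * s\<rfloor> = \<lfloor>real m * t\<rfloor>"
      proof (cases "m = 0")
        case False
        then have "real m * s < of_int \<lfloor>real m * t\<rfloor> + 1" using s by (simp add: u_def field_simps)
        moreover have "real m * t \<le> real m * s" using s by (intro mult_left_mono) auto
        ultimately show ?thesis by linarith
      qed simp
      then show "step_path m x s = step_path m x t" using s u t by (simp add: step_path_def)
    qed
  qed
  have l: "\<exists>l. (step_path m x \<longlongrightarrow> l) (at_left t)" if t: "t \<in> {0<..1}" for t
  proof (rule exI, rule tendsto_eventually)
    \<comment> \<open>The last jump strictly before \<open>t\<close>: because of the ceiling a jump
      at \<open>t\<close> itself is not counted.\<close>
    define u where "u = (if m = 0 then 0 else max 0 ((of_int \<lceil>real m * t\<rceil> - 1) / real m))"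
    have u: "u < t" "0 \<le> u" using t by (auto simp: u_def field_simps) linarith+
    show "\<forall>\<^sub>F s in at_left t. step_path m x s = x (nat (\<lceil>real m * t\<rceil> - (if m = 0 then 0 else 1)))"
      unfolding eventually_at_left_field
    proof (intro exI[of _ u] conjI u allI impI)
      fix s assume s: "u < s" "s < t"
      have "\<lfloor>real m * s\<rfloor> = \<lceil>real m * t\<rceil> - (if m = 0 then 0 else 1)"
      proof (cases "m = 0")
        case False
        then have "of_int \<lceil>real m * t\<rceil> - 1 < real m * s" using s by (simp add: u_def field_simps)
        moreover have "real m * s < real m * t" using s False by simp
        ultimately show ?thesis unfolding if_not_P[OF False] by linarith
      qed simp
      then show "step_path m x s = x (nat (\<lceil>real m * t\<rceil> - (if m = 0 then 0 else 1)))" using s u t by (simp add: step_path_def)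
    qed
  qed
  show ?thesis using r l by (auto simp: D01_def step_path_def)
qed

lemma continuous_D01:
  assumes g: "continuous_on {0..1} g" shows "(\<lambda>t\<in>{0..1}. g t) \<in> D01"
proof -
  have w: "(restrict g {0..1} \<longlongrightarrow> g t) (at t within {0..1})" if "t \<in> {0..1}" for t
  proof (rule Lim_transform_eventually)
    show "(g \<longlongrightarrow> g t) (at t within {0..1})" using g that by (simp add: continuous_on_def)
    show "\<forall>\<^sub>F s in at t within {0..1}. g s = restrict g {0..1} s" by (auto simp: eventually_at_filter)
  qed
  have "(restrict g {0..1} \<longlongrightarrow> g t) (at_right t)" if t: "t \<in> {0..<1}" for t
  proof (rule filterlim_mono[OF w order_refl])
    have "at_right t = at t within {t..1}" using t by (simp add: at_within_Icc_at_right)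
    also have "\<dots> \<le> at t within {0..1}" using t by (intro at_le) auto
    finally show "at_right t \<le> at t within {0..1}" .
  qed (use t in auto)
  moreover have "(restrict g {0..1} \<longlongrightarrow> g t) (at_left t)" if t: "t \<in> {0<..1}" for t
  proof (rule filterlim_mono[OF w order_refl])
    have "at_left t = at t within {0..t}" using t by (simp add: at_within_Icc_at_left)
    also have "\<dots> \<le> at t within {0..1}" using t by (intro at_le) auto
    finally show "at_left t \<le> at t within {0..1}" .
  qed (use t in auto)
  ultimately show ?thesis by (fastforce simp: D01_def)
qed

lemma step_path_uniform:
  assumes g: "continuous_on {0..1} g"
  shows "(\<lambda>m. sup_dist (step_path m (\<lambda>k. g (real k / real m))) (\<lambda>t\<in>{0..1}. g t)) \<longlonglongrightarrow> 0"
proof (rule LIMSEQ_I)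
  fix r :: real assume r: "0 < r"
  have "uniformly_continuous_on {0..1} g" using g by (rule compact_uniformly_continuous) simp
  then obtain d where d: "0 < d" "\<And>s t. s \<in> {0..1} \<Longrightarrow> t \<in> {0..1} \<Longrightarrow> dist s t < d \<Longrightarrow> dist (g s) (g t) < r / 2"
    unfolding uniformly_continuous_on_def using r by (metis half_gt_zero)
  obtain m0 :: nat where m0: "1 / d < real m0" using reals_Archimedean2 by blast
  have "sup_dist (step_path m (\<lambda>k. g (real k / real m))) (\<lambda>t\<in>{0..1}. g t) \<le> r / 2" if m: "m0 \<le> m" for m
  proof (rule sup_dist_le)
    fix t :: real assume t: "t \<in> {0..1}"
    have mp: "1 / d < real m" using m m0 by linarith
    have mp': "0 < real m" using mp d(1) by (smt (verit) divide_pos_pos)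
    let ?s = "real (nat \<lfloor>real m * t\<rfloor>) / real m"
    have s: "?s \<in> {0..1}" using step_path_index[OF t, of m] mp' by simp
    have f: "real (nat \<lfloor>real m * t\<rfloor>) \<le> real m * t" "real m * t \<le> real (nat \<lfloor>real m * t\<rfloor>) + 1"
      using t by (auto simp: of_nat_nat)
    have "?s \<le> t" using f(1) mp' by (simp add: field_simps)
    moreover have "t \<le> (real (nat \<lfloor>real m * t\<rfloor>) + 1) / real m" using f(2) mp' by (simp add: pos_le_divide_eq mult.commute)
    then have "t - ?s \<le> 1 / real m" by (simp add: add_divide_distrib)
    moreover have "1 / real m < d" using mp mp' d(1) by (simp add: field_simps)
    ultimately have "dist ?s t < d" by (simp add: dist_real_def)
    from d(2)[OF s t this] show "min 1 \<bar>step_path m (\<lambda>k. g (real k / real m)) t - (\<lambda>t\<in>{0..1}. g t) t\<bar> \<le> r / 2"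
      using t by (simp add: step_path_def dist_real_def min_def)
  qed
  then show "\<exists>m0. \<forall>m\<ge>m0. norm (sup_dist (step_path m (\<lambda>k. g (real k / real m))) (\<lambda>t\<in>{0..1}. g t) - 0) < r"
    using r by (intro exI[of _ m0]) fastforce
qed

section \<open>Functionals that are Lipschitz for the uniform distance\<close>

definition lip_D :: "real \<Rightarrow> ((real \<Rightarrow> real) \<Rightarrow> real) \<Rightarrow> bool" where
  "lip_D k F \<longleftrightarrow> 0 \<le> k \<and> (\<forall>x\<in>D01. \<forall>y\<in>D01. \<bar>F x - F y\<bar> \<le> k * sup_dist x y)"

lemma lip_D_D: "lip_D k F \<Longrightarrow> x \<in> D01 \<Longrightarrow> y \<in> D01 \<Longrightarrow> \<bar>F x - F y\<bar> \<le> k * sup_dist x y"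
  by (simp add: lip_D_def)

text \<open>An infimum of functions with a common Lipschitz constant; the lower bound
  \<open>B\<close> keeps it finite.\<close>

lemma inf_convolution_lip:
  assumes A: "A \<noteq> {}" and G: "\<And>y. y \<in> A \<Longrightarrow> B \<le> G y" and k: "0 \<le> k"
  shows "lip_D k (\<lambda>x. INF y\<in>A. G y + k * sup_dist x y)"
proof -
  let ?g = "\<lambda>x. INF y\<in>A. G y + k * sup_dist x y"
  have bdd: "bdd_below ((\<lambda>y. G y + k * sup_dist x y) ` A)" for x
    using G k by (intro bdd_belowI[of _ B]) (auto intro: add_increasing2)
  have g: "?g x - k * sup_dist x x' \<le> ?g x'" for x x'
  proof (rule cINF_greatest[OF A])
    fix y assume y: "y \<in> A"
    have "?g x \<le> G y + k * sup_dist x y" by (rule cINF_lower[OF bdd y])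
    also have "\<dots> \<le> G y + k * (sup_dist x x' + sup_dist x' y)" using k sup_dist_triangle by (intro add_left_mono mult_left_mono) auto
    finally show "?g x - k * sup_dist x x' \<le> G y + k * sup_dist x' y" by (simp add: distrib_left)
  qed
  have "\<bar>?g x - ?g x'\<bar> \<le> k * sup_dist x x'" for x x'
    using g[of x x'] g[of x' x] unfolding sup_dist_commute[of x' x] by linarith
  then show ?thesis using k by (simp add: lip_D_def)
qed

lemma step_path_dist: "sup_dist (step_path m x) (step_path m y) \<le> (\<Sum>i\<le>m. \<bar>x i - y i\<bar>)"
proof (rule sup_dist_le)
  fix t :: real assume t: "t \<in> {0..1}"
  have "\<bar>x (nat \<lfloor>real m * t\<rfloor>) - y (nat \<lfloor>real m * t\<rfloor>)\<bar> \<le> (\<Sum>i\<le>m. \<bar>x i - y i\<bar>)"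
    by (rule member_le_sum[of _ _ "\<lambda>i. \<bar>x i - y i\<bar>"]) (use step_path_index[OF t, of m] in auto)
  then show "min 1 \<bar>step_path m x t - step_path m y t\<bar> \<le> (\<Sum>i\<le>m. \<bar>x i - y i\<bar>)" using t by (simp add: step_path_def)
qed

lemma lip_step_path:
  assumes F: "lip_D k F" shows "\<bar>F (step_path m x) - F (step_path m y)\<bar> \<le> k * (\<Sum>i\<le>m. \<bar>x i - y i\<bar>)"
  using lip_D_D[OF F step_path_D01 step_path_D01, of m x m y] mult_left_mono[OF step_path_dist[of m x y], of k] F
  by (auto simp: lip_D_def)

lemma step_path_measurable:
  assumes F: "lip_D k F"
  shows "(\<lambda>x. F (step_path m x)) \<in> borel_measurable (\<Pi>\<^sub>M i\<in>UNIV. borel)"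
proof -
  have "((\<lambda>y. F (step_path m y)) \<longlongrightarrow> F (step_path m x)) (at x)" for x
  proof (rule Lim_null_comparison[THEN LIM_zero_cancel])
    show "\<forall>\<^sub>F y in at x. norm (F (step_path m y) - F (step_path m x)) \<le> k * (\<Sum>i\<le>m. \<bar>y i - x i\<bar>)"
      using lip_step_path[OF F] by (intro always_eventually) auto
    have c: "((\<lambda>y. y i) \<longlongrightarrow> x i) (at x)" for i
      using continuous_on_product_coordinates[of i, where 'b=real] by (simp add: continuous_on_def)
    have "((\<lambda>y. k * (\<Sum>i\<le>m. \<bar>y i - x i\<bar>)) \<longlongrightarrow> k * (\<Sum>i\<le>m. \<bar>x i - x i\<bar>)) (at x)" by (intro tendsto_intros c)
    then show "((\<lambda>y. k * (\<Sum>i\<le>m. \<bar>y i - x i\<bar>)) \<longlongrightarrow> 0) (at x)" by simp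
  qed
  then have "continuous_on UNIV (\<lambda>x. F (step_path m x))" by (simp add: continuous_on_def)
  then have "(\<lambda>x. F (step_path m x)) \<in> borel_measurable borel" by (rule borel_measurable_continuous_onI)
  then show ?thesis by (simp add: measurable_cong_sets[OF sets_PiM_equal_borel refl])
qed

lemma lip_step_path_meas:
  assumes F: "lip_D k F" and S: "\<And>i. S i \<in> borel_measurable M"
  shows "(\<lambda>w. F (step_path m (\<lambda>i. S i w))) \<in> borel_measurable M"
proof (rule measurable_compose[OF _ step_path_measurable[OF F]])
  show "(\<lambda>w i. S i w) \<in> measurable M (\<Pi>\<^sub>M i\<in>UNIV. borel)" using S by (intro measurable_PiM_single') auto
qed

lemma lip_continuous_meas:
  assumes F: "lip_D k F" and Z: "\<And>w. w \<in> space M \<Longrightarrow> continuous_on {0..1} (\<lambda>t. Z t w)"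
    and m: "\<And>t. t \<in> {0..1} \<Longrightarrow> Z t \<in> borel_measurable M"
  shows "\<And>w. w \<in> space M \<Longrightarrow> (\<lambda>m. F (step_path m (\<lambda>k. Z (real k / real m) w))) \<longlonglongrightarrow> F (\<lambda>t\<in>{0..1}. Z t w)"
    and "(\<lambda>w. F (\<lambda>t\<in>{0..1}. Z t w)) \<in> borel_measurable M"
    and "\<And>m. (\<lambda>w. F (step_path m (\<lambda>k. Z (real k / real m) w))) \<in> borel_measurable M"
proof -
  show l: "(\<lambda>m. F (step_path m (\<lambda>k. Z (real k / real m) w))) \<longlonglongrightarrow> F (\<lambda>t\<in>{0..1}. Z t w)" if "w \<in> space M" for w
  proof (rule Lim_null_comparison[THEN LIM_zero_cancel])
    show "\<forall>\<^sub>F m in sequentially. norm (F (step_path m (\<lambda>k. Z (real k / real m) w)) - F (\<lambda>t\<in>{0..1}. Z t w))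
      \<le> k * sup_dist (step_path m (\<lambda>k. Z (real k / real m) w)) (\<lambda>t\<in>{0..1}. Z t w)"
      using lip_D_D[OF F step_path_D01 continuous_D01[OF Z[OF that]]] by (intro always_eventually) auto
    show "(\<lambda>m. k * sup_dist (step_path m (\<lambda>k. Z (real k / real m) w)) (\<lambda>t\<in>{0..1}. Z t w)) \<longlonglongrightarrow> 0"
      using tendsto_mult_left[OF step_path_uniform[OF Z[OF that]], of k] by simp
  qed
  show m: "(\<lambda>w. F (step_path m (\<lambda>k. Z (real k / real m) w))) \<in> borel_measurable M" for m
  proof -
    \<comment> \<open>Indices beyond \<open>m\<close> are never read by \<open>step_path\<close>,
      but would lead outside [0, 1], where measurability of \<open>Z\<close> is not known.\<close>
    have "step_path m (\<lambda>k. Z (real (min k m) / real m) w) = step_path m (\<lambda>k. Z (real k / real m) w)" for w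
      using step_path_index[of _ m] by (auto simp: step_path_def fun_eq_iff min_def)
    moreover have "(\<lambda>w. F (step_path m (\<lambda>k. Z (real (min k m) / real m) w))) \<in> borel_measurable M"
      by (rule lip_step_path_meas[OF F]) (auto intro!: m simp: divide_le_eq)
    ultimately show ?thesis by simp
  qed
  show "(\<lambda>w. F (\<lambda>t\<in>{0..1}. Z t w)) \<in> borel_measurable M"
    by (rule borel_measurable_LIMSEQ_real[OF l m])
qed

text \<open>A Skorohod open set is open for \<open>sup_dist\<close>; hence it is the set where the
  distance to its complement is positive, and that distance is a functional of the kind tested in
  the premise.\<close>

lemma measurable_skorohodI:
  assumes D: "\<And>w. w \<in> space M \<Longrightarrow> Z w \<in> D01"
    and lip: "\<And>F. lip_D 1 F \<Longrightarrow> (\<lambda>w. F (Z w)) \<in> borel_measurable M"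
  shows "Z \<in> measurable M skorohod_borel"
  unfolding skorohod_borel_def
proof (rule measurable_measure_of)
  show "{U. openin skorohod_topology U} \<subseteq> Pow D01" by (auto simp: openin_skorohod_topology)
  show "Z \<in> space M \<rightarrow> D01" using D by auto
  fix U assume "U \<in> {U. openin skorohod_topology U}"
  then have U: "openin skorohod_topology U" by simp
  show "Z -` U \<inter> space M \<in> sets M"
  proof (cases "D01 - U = {}")
    case True
    then have "Z -` U \<inter> space M = space M" using D by auto
    then show ?thesis by simp
  next
    case False
    let ?f = "\<lambda>x. INF y\<in>D01 - U. 0 + 1 * sup_dist x y"
    have m: "(\<lambda>w. ?f (Z w)) \<in> borel_measurable M"
      by (rule lip[OF inf_convolution_lip[of _ 0]]) (use False in auto)
    have "Z w \<in> U \<longleftrightarrow> 0 < ?f (Z w)" if "w \<in> space M" for w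
    proof
      assume "Z w \<in> U"
      then obtain e where e: "0 < e" "\<forall>y\<in>D01. sup_dist (Z w) y < e \<longrightarrow> y \<in> U" using skorohod_open_sup_dist[OF U] by blast
      have "e \<le> ?f (Z w)" by (rule cINF_greatest) (use False e in \<open>auto simp: not_less\<close>)
      then show "0 < ?f (Z w)" using e by simp
    next
      assume p: "0 < ?f (Z w)"
      show "Z w \<in> U"
      proof (rule ccontr)
        assume "Z w \<notin> U"
        then have "?f (Z w) \<le> 0 + 1 * sup_dist (Z w) (Z w)"
          using D[OF that] by (intro cINF_lower bdd_belowI[of _ 0]) auto
        then show False using p by simp
      qed
    qed
    then have "Z -` U \<inter> space M = {w\<in>space M. 0 < ?f (Z w)}" by auto
    also have "\<dots> \<in> sets M" using m by measurable
    finally show ?thesis .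
  qed
qed

lemma space_skorohod_borel: "space skorohod_borel = D01"
  unfolding skorohod_borel_def by (rule space_measure_of) (auto simp: openin_skorohod_topology)

lemma skorohod_continuous_measurable:
  assumes F: "continuous_map skorohod_topology euclideanreal F"
  shows "F \<in> borel_measurable skorohod_borel"
proof (rule borel_measurableI)
  fix S :: "real set" assume "open S"
  then have "openin skorohod_topology {y \<in> topspace skorohod_topology. F y \<in> S}"
    by (intro openin_continuous_map_preimage[OF F]) (simp add: open_openin[symmetric])
  moreover have "F -` S \<inter> space skorohod_borel = {y \<in> topspace skorohod_topology. F y \<in> S}"
    by (auto simp: topspace_skorohod_topology space_skorohod_borel)
  ultimately show "F -` S \<inter> space skorohod_borel \<in> sets skorohod_borel"
    unfolding skorohod_borel_def by (auto simp: openin_skorohod_topology subset_iff)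
qed

text \<open>Points far from \<open>x\<close> are penalized beyond the bound of \<open>F\<close>, and
  points near it have nearly the same value; hence the infima tend to \<open>F x\<close> from
  below.\<close>

lemma inf_convolution_tendsto:
  assumes F: "continuous_map skorohod_topology euclideanreal F" and B: "\<And>x. x \<in> D01 \<Longrightarrow> \<bar>F x\<bar> \<le> B" and x: "x \<in> D01"
  shows "(\<lambda>k::nat. INF y\<in>D01. F y + real k * sup_dist x y) \<longlonglongrightarrow> F x"
    and "- B \<le> (INF y\<in>D01. F y + real k * sup_dist x y)" "(INF y\<in>D01. F y + real k * sup_dist x y) \<le> F x"
proof -
  let ?F = "\<lambda>k::nat. INF y\<in>D01. F y + real k * sup_dist x y"
  have ge: "- B \<le> F y" if "y \<in> D01" for y using B[OF that] by linarith
  show l: "- B \<le> ?F k" for k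
    using x ge by (intro cINF_greatest) (auto intro: add_increasing2)
  have "?F k \<le> F x + real k * sup_dist x x" for k
    using x ge by (intro cINF_lower bdd_belowI[of _ "- B"]) (auto intro: add_increasing2)
  then show le: "?F k \<le> F x" for k by simp
  show "?F \<longlonglongrightarrow> F x"
  proof (rule LIMSEQ_I)
    fix r :: real assume r: "0 < r"
    have r2: "0 < r / 2" using r by simp
    obtain e where e: "0 < e" "\<forall>y\<in>D01. sup_dist x y < e \<longrightarrow> \<bar>F y - F x\<bar> < r / 2"
      using skorohod_continuous_sup_dist[OF F x r2] by blast
    obtain k0 :: nat where k0: "2 * B / e < real k0" using reals_Archimedean2 by blast
    have "F x - r / 2 \<le> ?F k" if k: "k0 \<le> k" for k
    proof (rule cINF_greatest)
      fix y assume y: "y \<in> D01"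
      show "F x - r / 2 \<le> F y + real k * sup_dist x y"
      proof (cases "sup_dist x y < e")
        case True
        then have "\<bar>F y - F x\<bar> < r / 2" using e y by blast
        moreover have "0 \<le> real k * sup_dist x y" by simp
        ultimately show ?thesis by linarith
      next
        case False
        have "2 * B \<le> real k * e" using k0 k e(1) by (simp add: divide_less_eq) (smt (verit) mult_right_mono of_nat_mono)
        also have "\<dots> \<le> real k * sup_dist x y" using False by (intro mult_left_mono) auto
        finally show ?thesis using B[OF x] B[OF y] r by linarith
      qed
    qed (use x in auto)
    then show "\<exists>k0. \<forall>k\<ge>k0. norm (?F k - F x) < r"
      using le r by (intro exI[of _ k0]) (auto simp: abs_less_iff intro: le_less_trans, fastforce)
  qed
qed

text \<open>A functional that is Lipschitz for \<open>sup_dist\<close> need not be measurable for the Skorohod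
  topology, which is why \<open>Yl\<close> and \<open>Zl\<close> are separate assumptions.\<close>

lemma skorohod_liminf:
  assumes N: "prob_space N" and P: "prob_space P"
    and Y: "\<And>n. Y n \<in> measurable N skorohod_borel" and Z: "Z \<in> measurable P skorohod_borel"
    and Yl: "\<And>n k F. lip_D k F \<Longrightarrow> (\<lambda>w. F (Y n w)) \<in> borel_measurable N"
    and Zl: "\<And>k F. lip_D k F \<Longrightarrow> (\<lambda>w. F (Z w)) \<in> borel_measurable P"
    and lim: "\<And>k B F. lip_D k F \<Longrightarrow> (\<And>x. x \<in> D01 \<Longrightarrow> \<bar>F x\<bar> \<le> B) \<Longrightarrow> (\<lambda>n. \<integral>w. F (Y n w) \<partial>N) \<longlonglongrightarrow> (\<integral>w. F (Z w) \<partial>P)"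
    and F: "continuous_map skorohod_topology euclideanreal F" and B: "\<And>x. x \<in> D01 \<Longrightarrow> \<bar>F x\<bar> \<le> B" and r: "0 < r"
  shows "\<forall>\<^sub>F n in sequentially. (\<integral>w. F (Z w) \<partial>P) - r < (\<integral>w. F (Y n w) \<partial>N)"
proof -
  interpret N: prob_space N by fact
  interpret P: prob_space P by fact
  let ?F = "\<lambda>k::nat. \<lambda>x. INF y\<in>D01. F y + real k * sup_dist x y"
  note Fm = skorohod_continuous_measurable[OF F]
  have YD: "w \<in> space N \<Longrightarrow> Y n w \<in> D01" for n w using measurable_space[OF Y] by (simp add: space_skorohod_borel)
  have ZD: "w \<in> space P \<Longrightarrow> Z w \<in> D01" for w using measurable_space[OF Z] by (simp add: space_skorohod_borel)
  have lip: "lip_D (real k) (?F k)" for k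
    by (rule inf_convolution_lip[of _ "- B"]) (use step_path_D01 B in \<open>auto simp: abs_le_iff minus_le_iff\<close>)
  have Fb: "\<bar>?F k x\<bar> \<le> B" if "x \<in> D01" for k x
    using inf_convolution_tendsto(2,3)[OF F B that, of k] B[OF that] by linarith
  have "(\<lambda>k. \<integral>w. ?F k (Z w) \<partial>P) \<longlonglongrightarrow> (\<integral>w. F (Z w) \<partial>P)"
  proof (rule integral_dominated_convergence[where w="\<lambda>_. B"])
    show "AE w in P. (\<lambda>k. ?F k (Z w)) \<longlonglongrightarrow> F (Z w)" by (rule AE_I2) (rule inf_convolution_tendsto(1)[OF F B ZD])
    show "AE w in P. norm (?F k (Z w)) \<le> B" for k using Fb ZD by (intro AE_I2) auto
  qed (use measurable_compose[OF Z Fm] Zl[OF lip] in auto)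
  then have "\<forall>\<^sub>F k in sequentially. (\<integral>w. F (Z w) \<partial>P) - r < (\<integral>w. ?F k (Z w) \<partial>P)"
    by (rule order_tendstoD(1)) (use r in simp)
  then obtain k where k: "(\<integral>w. F (Z w) \<partial>P) - r < (\<integral>w. ?F k (Z w) \<partial>P)"
    by (meson eventually_sequentially order_refl)
  have "\<forall>\<^sub>F n in sequentially. (\<integral>w. F (Z w) \<partial>P) - r < (\<integral>w. ?F k (Y n w) \<partial>N)"
    by (rule order_tendstoD(1)[OF lim[OF lip Fb] k])
  then show ?thesis
  proof eventually_elim
    case (elim n)
    have "(\<integral>w. ?F k (Y n w) \<partial>N) \<le> (\<integral>w. F (Y n w) \<partial>N)"
    proof (rule integral_mono)
      show "integrable N (\<lambda>w. ?F k (Y n w))" by (rule N.integrable_const_bound[of _ B]) (use Fb YD Yl[OF lip] in auto)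
      show "integrable N (\<lambda>w. F (Y n w))" by (rule N.integrable_const_bound[of _ B]) (use B YD measurable_compose[OF Y Fm] in auto)
    qed (rule inf_convolution_tendsto(3)[OF F B YD])
    then show ?case using elim by linarith
  qed
qed

text \<open>Inf-convolutions approximate from below and control the limit inferior only; the upper
  bound comes from the same argument for \<open>- F\<close>.\<close>

lemma converges_weakly_D_lip:
  assumes N: "prob_space N" and P: "prob_space P"
    and Y: "\<And>n. Y n \<in> measurable N skorohod_borel" and Z: "Z \<in> measurable P skorohod_borel"
    and Yl: "\<And>n k F. lip_D k F \<Longrightarrow> (\<lambda>w. F (Y n w)) \<in> borel_measurable N"
    and Zl: "\<And>k F. lip_D k F \<Longrightarrow> (\<lambda>w. F (Z w)) \<in> borel_measurable P"
    and lim: "\<And>k B F. lip_D k F \<Longrightarrow> (\<And>x. x \<in> D01 \<Longrightarrow> \<bar>F x\<bar> \<le> B) \<Longrightarrow> (\<lambda>n. \<integral>w. F (Y n w) \<partial>N) \<longlonglongrightarrow> (\<integral>w. F (Z w) \<partial>P)"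
  shows "converges_weakly_D N Y P Z"
  unfolding converges_weakly_D_def
proof (intro conjI allI impI Y Z)
  fix F assume "continuous_map skorohod_topology euclideanreal F \<and> bounded (F ` D01)"
  then have F: "continuous_map skorohod_topology euclideanreal F" and "bounded (F ` D01)" by auto
  then obtain B where B: "\<And>x. x \<in> D01 \<Longrightarrow> \<bar>F x\<bar> \<le> B" by (auto simp: bounded_iff)
  have F': "continuous_map skorohod_topology euclideanreal (\<lambda>x. - F x)" using F by (intro continuous_intros)
  show "(\<lambda>n. \<integral>w. F (Y n w) \<partial>N) \<longlonglongrightarrow> (\<integral>w. F (Z w) \<partial>P)"
  proof (rule LIMSEQ_I)
    fix r :: real assume r: "0 < r"
    have "\<forall>\<^sub>F n in sequentially. (\<integral>w. F (Z w) \<partial>P) - r < (\<integral>w. F (Y n w) \<partial>N)" 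
      by (rule skorohod_liminf[OF N P Y Z _ _ _ F B r]) (fact Yl Zl lim)+
    moreover have "\<forall>\<^sub>F n in sequentially. (\<integral>w. - F (Z w) \<partial>P) - r < (\<integral>w. - F (Y n w) \<partial>N)" 
      by (rule skorohod_liminf[OF N P Y Z _ _ _ F' _ r, where B=B]) (fact Yl Zl lim | use B in simp)+
    ultimately have "\<forall>\<^sub>F n in sequentially. norm ((\<integral>w. F (Y n w) \<partial>N) - (\<integral>w. F (Z w) \<partial>P)) < r"
      by eventually_elim (auto simp: abs_less_iff)
    then show "\<exists>n0. \<forall>n\<ge>n0. norm ((\<integral>w. F (Y n w) \<partial>N) - (\<integral>w. F (Z w) \<partial>P)) < r" by (simp add: eventually_sequentially)
  qed
qed

section \<open>Functional limit theorem for Gaussian martingale arrays\<close>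

lemma std_gauss_real: "(std_gauss :: real measure) = std_normal_distribution"
  by (simp add: std_gauss_def gaussian_density_def)

lemma (in prob_space) integral_diff_bad_set:
  fixes f g :: "'a \<Rightarrow> real"
  assumes [measurable]: "f \<in> borel_measurable M" "g \<in> borel_measurable M" "A \<in> sets M"
    and f: "\<And>\<omega>. \<omega> \<in> space M \<Longrightarrow> \<bar>f \<omega>\<bar> \<le> B" and g: "\<And>\<omega>. \<omega> \<in> space M \<Longrightarrow> \<bar>g \<omega>\<bar> \<le> B"
    and fg: "\<And>\<omega>. \<omega> \<in> space M \<Longrightarrow> \<omega> \<notin> A \<Longrightarrow> \<bar>f \<omega> - g \<omega>\<bar> \<le> e" and e: "0 \<le> e"
  shows "\<bar>expectation f - expectation g\<bar> \<le> e + 2 * B * prob A"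
proof -
  have fi: "integrable M f" "integrable M g" using f g by (auto intro!: integrable_const_bound[of _ B])
  have "\<bar>expectation f - expectation g\<bar> \<le> (\<integral>\<omega>. \<bar>f \<omega> - g \<omega>\<bar> \<partial>M)"
    using integral_abs_bound[of M "\<lambda>\<omega>. f \<omega> - g \<omega>"] fi by simp
  also have "\<dots> \<le> (\<integral>\<omega>. e + 2 * B * indicator A \<omega> \<partial>M)"
  proof (rule integral_mono)
    fix \<omega> assume w: "\<omega> \<in> space M"
    show "\<bar>f \<omega> - g \<omega>\<bar> \<le> e + 2 * B * indicator A \<omega>"
      using fg[OF w] f[OF w] g[OF w] e by (cases "\<omega> \<in> A") auto
  qed (use fi in \<open>auto simp: emeasure_eq_measure\<close>)
  also have "\<dots> = e + 2 * B * prob A"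
    by (subst Bochner_Integration.integral_add) (auto simp: prob_space emeasure_eq_measure)
  finally show ?thesis .
qed

text \<open>In \<open>osc_small\<close> this makes the probability for a block quadratic in its
  variance, enough for the sum over the blocks to vanish.\<close>

lemma exp_neg_le: "0 < x \<Longrightarrow> exp (- x) \<le> 2 / x\<^sup>2" for x :: real
proof -
  assume x: "0 < x"
  have "x\<^sup>2 / 2 \<le> exp x" using exp_lower_Taylor_quadratic[of x] x by linarith
  then have "inverse (exp x) \<le> inverse (x\<^sup>2 / 2)" using x by (intro le_imp_inverse_le) auto
  then show ?thesis by (simp add: exp_minus)
qed

lemma brownian_increments:
  fixes W :: "real \<Rightarrow> 'u \<Rightarrow> real"
  assumes W: "brownian_motion P W" and s: "0 \<le> s" and r0: "0 \<le> r 0" and r: "\<And>i. i < m \<Longrightarrow> r i < r (Suc i)"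
  defines "D \<equiv> \<lambda>i w. s * (W (r (Suc i)) w - W (r i) w)"
  shows "prob_space.indep_vars P (\<lambda>_. borel) D {..<m}"
    and "\<And>i. i < m \<Longrightarrow> distr P borel (D i) = distr std_normal_distribution borel (\<lambda>z. sqrt (s\<^sup>2 * (r (Suc i) - r i)) * z)"
proof -
  interpret P: prob_space P using W by (simp add: brownian_motion_def)
  \<comment> \<open>\<open>brownian_motion\<close> speaks of infinite strictly increasing sequences;
    beyond \<open>m\<close> the times are continued by unit steps.\<close>
  define q where "q i = (if i \<le> m then r i else r m + real (i - m))" for i
  have "q i < q (Suc i)" for i
    using r[of i] by (cases i m rule: linorder_cases) (auto simp: q_def Suc_diff_le)
  then have q: "strict_mono q" "0 \<le> q 0" using r0 by (auto simp: strict_mono_Suc_iff q_def)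
  have "P.indep_vars (\<lambda>_. borel) (\<lambda>i w. W (q (Suc i)) w - W (q i) w) {..<m}"
    using W q unfolding brownian_motion_def by blast
  then have "P.indep_vars (\<lambda>_. borel) (\<lambda>i w. s * (W (q (Suc i)) w - W (q i) w)) {..<m}"
    by (rule P.indep_vars_compose2) auto
  then show "P.indep_vars (\<lambda>_. borel) D {..<m}"
    by (rule P.indep_vars_cong[THEN iffD1, rotated -1]) (auto simp: q_def D_def)
  fix i assume i: "i < m"
  have "0 \<le> r i" using i
  proof (induction i)
    case (Suc i)
    then show ?case using r[of i] by simp
  qed (rule r0)
  then have dist: "distributed P lborel (\<lambda>w. W (r (Suc i)) w - W (r i) w) (gaussian_density (r (Suc i) - r i))"
    using W r[OF i] unfolding brownian_motion_def by blast
  let ?d = "r (Suc i) - r i"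
  have d: "0 < ?d" using r[OF i] by simp
  have m: "(\<lambda>w. W (r (Suc i)) w - W (r i) w) \<in> borel_measurable P" using distributed_measurable[OF dist] by simp
  have "distr std_normal_distribution borel (\<lambda>z. sqrt (s\<^sup>2 * ?d) * z)
      = distr (distr P borel (\<lambda>w. (1 / sqrt ?d) *\<^sub>R (W (r (Suc i)) w - W (r i) w))) borel (\<lambda>z. sqrt (s\<^sup>2 * ?d) * z)"
    unfolding distributed_gaussian_scale[OF dist d] std_gauss_real ..
  also have "\<dots> = distr P borel (\<lambda>w. sqrt (s\<^sup>2 * ?d) * ((1 / sqrt ?d) *\<^sub>R (W (r (Suc i)) w - W (r i) w)))"
    using m by (subst distr_distr) (auto simp: comp_def)
  also have "\<dots> = distr P borel (D i)" using d s by (simp add: D_def real_sqrt_mult)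
  finally show "distr P borel (D i) = distr std_normal_distribution borel (\<lambda>z. sqrt (s\<^sup>2 * ?d) * z)" ..
qed

lemma block_fun_step_path:
  assumes F: "lip_D k F" and B: "\<And>x. x \<in> D01 \<Longrightarrow> \<bar>F x\<bar> \<le> B"
  shows "block_fun m B (k * real (Suc m)) (\<lambda>x. F (step_path m (\<lambda>j. \<Sum>i<j. x i)))"
  unfolding block_fun_def
proof (intro conjI allI)
  show "(\<lambda>x. F (step_path m (\<lambda>j. \<Sum>i<j. x i))) \<in> borel_measurable (\<Pi>\<^sub>M i\<in>UNIV. borel)"
    by (rule lip_step_path_meas[OF F]) measurable
  show "\<bar>F (step_path m (\<lambda>j. \<Sum>i<j. x i))\<bar> \<le> B" for x by (rule B[OF step_path_D01])
  have k: "0 \<le> k" using F by (simp add: lip_D_def)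
  then show "0 \<le> k * real (Suc m)" by simp
  fix x y :: "nat \<Rightarrow> real"
  have "\<bar>F (step_path m (\<lambda>j. \<Sum>i<j. x i)) - F (step_path m (\<lambda>j. \<Sum>i<j. y i))\<bar> \<le> k * (\<Sum>j\<le>m. \<bar>(\<Sum>i<j. x i) - (\<Sum>i<j. y i)\<bar>)"
    by (rule lip_step_path[OF F])
  also have "\<dots> \<le> k * (\<Sum>j\<le>m. (\<Sum>i<m. \<bar>x i - y i\<bar>))"
  proof (intro mult_left_mono sum_mono k)
    fix j assume "j \<in> {..m}"
    then have j: "j \<le> m" by simp
    have "\<bar>(\<Sum>i<j. x i) - (\<Sum>i<j. y i)\<bar> \<le> (\<Sum>i<j. \<bar>x i - y i\<bar>)" unfolding sum_subtractf[symmetric] by (rule sum_abs)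
    also have "\<dots> \<le> (\<Sum>i<m. \<bar>x i - y i\<bar>)" using j by (intro sum_mono2) auto
    finally show "\<bar>(\<Sum>i<j. x i) - (\<Sum>i<j. y i)\<bar> \<le> (\<Sum>i<m. \<bar>x i - y i\<bar>)" .
  qed
  also have "\<dots> = k * real (Suc m) * (\<Sum>i<m. \<bar>x i - y i\<bar>)" by simp
  finally show "\<bar>F (step_path m (\<lambda>j. \<Sum>i<j. x i)) - F (step_path m (\<lambda>j. \<Sum>i<j. y i))\<bar> \<le> k * real (Suc m) * (\<Sum>i<m. \<bar>x i - y i\<bar>)" .
qed

section \<open>Block grids and martingale arrays\<close>

definition grid :: "nat \<Rightarrow> nat \<Rightarrow> nat \<Rightarrow> nat" where
  "grid m n l = nat \<lfloor>real n * (real l / real m)\<rfloor>"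

lemma grid_0 [simp]: "grid m n 0 = 0" by (simp add: grid_def)

lemma grid_last: "0 < m \<Longrightarrow> grid m n m = n" by (simp add: grid_def)

lemma mono_grid: "mono (grid m n)"
  unfolding grid_def by (intro monoI nat_mono floor_mono mult_left_mono divide_right_mono) auto

text \<open>At t = 1 there is no block to the right of the grid point \<open>m\<close>; the second
  alternative covers this case.\<close>

lemma grid_bounds:
  fixes m n :: nat and t :: real
  assumes m: "0 < m" and t: "t \<in> {0..1}"
  defines "l \<equiv> nat \<lfloor>real m * t\<rfloor>" and "k \<equiv> nat \<lfloor>real n * t\<rfloor>"
  shows "l < m \<and> k \<in> {grid m n l..grid m n (Suc l)} \<or> k = grid m n l"
proof (cases "l < m")
  case True
  have "real l \<le> real m * t" "real m * t \<le> real (Suc l)" using t unfolding l_def by (auto, linarith)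
  then have "real l / real m \<le> t" "t \<le> real (Suc l) / real m" using m by (auto simp: field_simps)
  then have "grid m n l \<le> k" "k \<le> grid m n (Suc l)"
    unfolding grid_def k_def by (intro nat_mono floor_mono mult_left_mono; simp)+
  then show ?thesis using True by simp
next
  case False
  then have l: "l = m" using step_path_index[OF t, of m] by (simp add: l_def)
  have "real l \<le> real m * t" using t unfolding l_def by simp
  then have "t = 1" using m t l by simp
  then show ?thesis using m l by (simp add: k_def grid_last)
qed

locale mart_array = gauss_seq N \<xi> for N :: "'v measure" and \<xi> :: "nat \<Rightarrow> 'v \<Rightarrow> real^'n" +
  fixes c :: "nat \<Rightarrow> nat \<Rightarrow> 'v \<Rightarrow> real^'n" and a :: "real \<Rightarrow> real" and s :: real
  assumes c: "\<And>n. adapted (c n)" and s: "0 \<le> s"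
    and a0: "a 0 = 0" and a_mono: "strict_mono_on {0..1} a" and a_cont: "continuous_on {0..1} a"
    and br: "\<And>t \<delta>. t \<in> {0..1} \<Longrightarrow> 0 < \<delta> \<Longrightarrow>
      (\<lambda>n. measure N {w\<in>space N. \<delta> < \<bar>bracket (c n) (nat \<lfloor>real n * t\<rfloor>) w - s\<^sup>2 * a t\<bar>}) \<longlonglongrightarrow> 0"
begin

definition v :: "nat \<Rightarrow> nat \<Rightarrow> real" where
  "v m i = s\<^sup>2 * (a (real (Suc i) / real m) - a (real i / real m))"

lemma a_less: "i < m \<Longrightarrow> a (real i / real m) < a (real (Suc i) / real m)"
  by (rule strict_mono_onD[OF a_mono]) (auto simp: divide_simps)

lemma a_nonneg: "t \<in> {0..1} \<Longrightarrow> 0 \<le> a t"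
  using strict_mono_onD[OF a_mono, of 0 t] a0 by (cases "t = 0") auto

lemma v_nonneg: "i < m \<Longrightarrow> 0 \<le> v m i" using a_less[of i m] by (simp add: v_def)

lemma mart_N [measurable]: "mart (c n) k \<in> borel_measurable N"
  by (rule measurable_F_N[OF mart_F[OF c order_refl]])

lemma bracket_N [measurable]: "bracket (c n) k \<in> borel_measurable N"
  by (rule measurable_F_N[OF bracket_F[OF c, of k k]]) simp

lemma bracket_increment:
  assumes i: "i < m" and \<delta>: "0 < \<delta>"
  shows "(\<lambda>n. measure N {w\<in>space N. \<delta> < \<bar>bracket (c n) (grid m n (Suc i)) w - bracket (c n) (grid m n i) w - v m i\<bar>}) \<longlonglongrightarrow> 0"
    (is "(\<lambda>n. measure N (?E n)) \<longlonglongrightarrow> 0")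
proof -
  let ?A = "\<lambda>j n. {w\<in>space N. \<delta> / 2 < \<bar>bracket (c n) (grid m n j) w - s\<^sup>2 * a (real j / real m)\<bar>}"
  have lim: "(\<lambda>n. measure N (?A j n)) \<longlonglongrightarrow> 0" if "j \<le> m" for j
    unfolding grid_def by (rule br) (use that i \<delta> in auto)
  have le: "measure N (?E n) \<le> measure N (?A (Suc i) n) + measure N (?A i n)" for n
  proof -
    have "?E n \<subseteq> ?A (Suc i) n \<union> ?A i n"
    proof
      fix w assume "w \<in> ?E n"
      then have w: "w \<in> space N" and e: "\<delta> < \<bar>bracket (c n) (grid m n (Suc i)) w - bracket (c n) (grid m n i) w - v m i\<bar>" by auto
      have "\<delta> / 2 < \<bar>bracket (c n) (grid m n (Suc i)) w - s\<^sup>2 * a (real (Suc i) / real m)\<bar>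
          \<or> \<delta> / 2 < \<bar>bracket (c n) (grid m n i) w - s\<^sup>2 * a (real i / real m)\<bar>"
        using e unfolding v_def right_diff_distrib by linarith
      then show "w \<in> ?A (Suc i) n \<union> ?A i n" using w by blast
    qed
    then have "measure N (?E n) \<le> measure N (?A (Suc i) n \<union> ?A i n)" by (intro finite_measure_mono) auto
    also have "\<dots> \<le> measure N (?A (Suc i) n) + measure N (?A i n)" by (rule measure_Un_le) auto
    finally show ?thesis .
  qed
  have "(\<lambda>n. measure N (?A (Suc i) n) + measure N (?A i n)) \<longlonglongrightarrow> 0"
    using tendsto_add[OF lim[of "Suc i"] lim[of i]] i by simp
  then show ?thesis by (rule Lim_null_comparison[rotated]) (use le in \<open>auto intro!: always_eventually\<close>)
qed

definition osc :: "nat \<Rightarrow> real \<Rightarrow> nat \<Rightarrow> 'v set" where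
  "osc m \<epsilon> n = {w\<in>space N. \<exists>l<m. \<exists>k\<in>{grid m n l..grid m n (Suc l)}. \<epsilon> \<le> \<bar>mart (c n) k w - mart (c n) (grid m n l) w\<bar>}"

lemma osc_sets [measurable]: "osc m \<epsilon> n \<in> sets N" unfolding osc_def by measurable

text \<open>The exponential inequality bounds the probability of a large oscillation in a block by a
  multiple of the squared variance of the block. With the added tolerance the variances sum up to
  \<open>K\<close>, and each is small on a fine grid by uniform continuity of \<open>a\<close>, so
  the sum of the squares is small.\<close>

lemma osc_small:
  assumes \<epsilon>: "0 < \<epsilon>" and r: "0 < r"
  shows "\<exists>m0>0. \<forall>m\<ge>m0. \<forall>\<^sub>F n in sequentially. measure N (osc m \<epsilon> n) < r"
proof -
  define K where "K = s\<^sup>2 * a 1 + 1"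
  have K: "0 < K" using a_nonneg[of 1] by (simp add: K_def add_nonneg_pos)
  \<comment> \<open>Makes \<open>32 * \<gamma> / \<epsilon> ^ 4 * K\<close> equal to
    \<open>r / 2\<close>.\<close>
  define \<gamma> where "\<gamma> = r * \<epsilon> ^ 4 / (64 * K)"
  have \<gamma>: "0 < \<gamma>" using r \<epsilon> K by (simp add: \<gamma>_def)
  have "uniformly_continuous_on {0..1} a" using a_cont by (rule compact_uniformly_continuous) simp
  moreover have g: "0 < \<gamma> / (s\<^sup>2 + 1)" using \<gamma> by (simp add: add_nonneg_pos)
  ultimately obtain d where d: "0 < d" "\<And>t t'. t \<in> {0..1} \<Longrightarrow> t' \<in> {0..1} \<Longrightarrow> dist t' t < d \<Longrightarrow> dist (a t') (a t) < \<gamma> / (s\<^sup>2 + 1)"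
    unfolding uniformly_continuous_on_def by metis
  obtain m1 :: nat where m1: "max (1 / d) (1 / \<gamma>) < real m1" using reals_Archimedean2 by blast
  have "\<forall>\<^sub>F n in sequentially. measure N (osc m \<epsilon> n) < r" if mm: "m \<ge> Suc m1" for m
  proof -
    have m: "0 < m" "1 / d < real m" "1 / \<gamma> < real m" using mm m1 by auto
    have m': "1 / real m < d" "1 / real m < \<gamma>" using m d(1) \<gamma> by (auto simp: field_simps)
    \<comment> \<open>The summand \<open>1 / real m\<close> is the tolerance for the bracket and
      keeps the variance positive when \<open>s = 0\<close>; over all blocks it adds up to
      1.\<close>
    let ?w = "\<lambda>l. v m l + 1 / real m"
    have w0: "0 < ?w l" if "l < m" for l using v_nonneg[OF that] m by (simp add: add_nonneg_pos)
    have w\<gamma>: "?w l \<le> 2 * \<gamma>" if l: "l < m" for l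
    proof -
      have "dist (a (real (Suc l) / real m)) (a (real l / real m)) < \<gamma> / (s\<^sup>2 + 1)"
        by (rule d(2)) (use l m m' in \<open>auto simp: dist_real_def diff_divide_distrib[symmetric]\<close>)
      then have "(s\<^sup>2 + 1) * (a (real (Suc l) / real m) - a (real l / real m)) \<le> (s\<^sup>2 + 1) * (\<gamma> / (s\<^sup>2 + 1))"
        by (intro mult_left_mono) (auto simp: dist_real_def)
      also have "(s\<^sup>2 + 1) * (\<gamma> / (s\<^sup>2 + 1)) = \<gamma>" by (simp add: add_nonneg_eq_0_iff)
      finally have "v m l \<le> \<gamma>" using a_less[OF l] by (simp add: v_def distrib_right)
      then show ?thesis using m' by simp
    qed
    have sumw: "(\<Sum>l<m. ?w l) = K"
    proof -
      have "(\<Sum>l<m. v m l) = s\<^sup>2 * (\<Sum>l<m. a (real (Suc l) / real m) - a (real l / real m))" by (simp add: v_def sum_distrib_left)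
      also have "(\<Sum>l<m. a (real (Suc l) / real m) - a (real l / real m)) = a (real m / real m) - a (real 0 / real m)"
        by (rule sum_lessThan_telescope)
      finally show ?thesis using m by (simp add: sum.distrib K_def a0)
    qed
    have main: "(\<Sum>l<m. 2 * exp (- (\<epsilon>\<^sup>2 / (2 * ?w l)))) \<le> r / 2"
    proof -
      have "2 * exp (- (\<epsilon>\<^sup>2 / (2 * ?w l))) \<le> 32 * \<gamma> / \<epsilon> ^ 4 * ?w l" if l: "l < m" for l
      proof -
        have gen: "2 * (2 / (\<epsilon>\<^sup>2 / (2 * w))\<^sup>2) = 16 / \<epsilon> ^ 4 * (w * w)" for w
          by (simp add: power_divide power_mult_distrib power2_eq_square power4_eq_xxxx)
        have "2 * exp (- (\<epsilon>\<^sup>2 / (2 * ?w l))) \<le> 2 * (2 / (\<epsilon>\<^sup>2 / (2 * ?w l))\<^sup>2)"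
          using w0[OF l] \<epsilon> by (intro mult_left_mono exp_neg_le) auto
        also have "\<dots> = 16 / \<epsilon> ^ 4 * (?w l * ?w l)" by (rule gen)
        also have "\<dots> \<le> 16 / \<epsilon> ^ 4 * (2 * \<gamma> * ?w l)" using w0[OF l] w\<gamma>[OF l] \<epsilon> by (intro mult_left_mono mult_right_mono) auto
        finally show ?thesis by simp
      qed
      then have "(\<Sum>l<m. 2 * exp (- (\<epsilon>\<^sup>2 / (2 * ?w l)))) \<le> (\<Sum>l<m. 32 * \<gamma> / \<epsilon> ^ 4 * ?w l)" by (intro sum_mono) auto
      also have "\<dots> = 32 * \<gamma> / \<epsilon> ^ 4 * K" unfolding sum_distrib_left[symmetric] sumw ..
      also have "\<dots> = r / 2" using \<epsilon> K by (simp add: \<gamma>_def)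
      finally show ?thesis .
    qed
    let ?br = "\<lambda>l n. {\<omega>\<in>space N. 1 / real m < \<bar>bracket (c n) (grid m n (Suc l)) \<omega> - bracket (c n) (grid m n l) \<omega> - v m l\<bar>}"
    let ?o = "\<lambda>l n. {\<omega>\<in>space N. (\<exists>k\<in>{grid m n l..grid m n (Suc l)}. \<epsilon> \<le> \<bar>mart (c n) k \<omega> - mart (c n) (grid m n l) \<omega>\<bar>) \<and>
      bracket (c n) (grid m n (Suc l)) \<omega> - bracket (c n) (grid m n l) \<omega> \<le> ?w l}"
    have "measure N (osc m \<epsilon> n) \<le> r / 2 + (\<Sum>l<m. measure N (?br l n))" for n
    proof -
      have "osc m \<epsilon> n \<subseteq> (\<Union>l<m. ?o l n \<union> ?br l n)" by (force simp: osc_def abs_less_iff not_less)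
      then have "measure N (osc m \<epsilon> n) \<le> measure N (\<Union>l<m. ?o l n \<union> ?br l n)" by (intro finite_measure_mono) auto
      also have "\<dots> \<le> (\<Sum>l<m. measure N (?o l n \<union> ?br l n))" by (rule finite_measure_subadditive_finite) auto
      also have "\<dots> \<le> (\<Sum>l<m. measure N (?o l n) + measure N (?br l n))" by (intro sum_mono measure_Un_le) auto
      also have "\<dots> \<le> (\<Sum>l<m. 2 * exp (- (\<epsilon>\<^sup>2 / (2 * ?w l))) + measure N (?br l n))"
        using monoD[OF mono_grid, of _ _ m n] \<epsilon> w0 by (intro sum_mono add_right_mono mart_oscillation c) auto
      finally show ?thesis using main by (simp add: sum.distrib)
    qed
    moreover have "(\<lambda>n. r / 2 + (\<Sum>l<m. measure N (?br l n))) \<longlonglongrightarrow> r / 2 + (\<Sum>l<m. 0)"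
      using m by (intro tendsto_intros bracket_increment) auto
    then have "\<forall>\<^sub>F n in sequentially. r / 2 + (\<Sum>l<m. measure N (?br l n)) < r"
      by (rule order_tendstoD(2)) (use r in simp)
    ultimately show ?thesis by (auto elim!: eventually_mono intro: le_less_trans)
  qed
  then show ?thesis by (intro exI[of _ "Suc m1"]) auto
qed

lemma bm_path:
  fixes W :: "real \<Rightarrow> 'u \<Rightarrow> real"
  assumes W: "brownian_motion P W"
  shows "w \<in> space P \<Longrightarrow> continuous_on {0..1} (\<lambda>t. s * W (a t) w)"
    and "t \<in> {0..1} \<Longrightarrow> (\<lambda>w. s * W (a t) w) \<in> borel_measurable P"
proof -
  assume w: "w \<in> space P"
  have "continuous_on {0..} (\<lambda>t. W t w)" using W w unfolding brownian_motion_def by blast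
  then have "continuous_on {0..1} (\<lambda>t. W (a t) w)"
    by (rule continuous_on_compose2[OF _ a_cont]) (use a_nonneg in auto)
  then show "continuous_on {0..1} (\<lambda>t. s * W (a t) w)" by (intro continuous_intros)
next
  assume t: "t \<in> {0..1}"
  have "W (a t) \<in> borel_measurable P" using W a_nonneg[OF t] unfolding brownian_motion_def by blast
  then show "(\<lambda>w. s * W (a t) w) \<in> borel_measurable P" by measurable
qed

lemma bm_path_lip:
  fixes W :: "real \<Rightarrow> 'u \<Rightarrow> real"
  assumes W: "brownian_motion P W" and H: "lip_D k H"
  shows "\<And>w. w \<in> space P \<Longrightarrow> (\<lambda>m. H (step_path m (\<lambda>j. s * W (a (real j / real m)) w))) \<longlonglongrightarrow> H (\<lambda>t\<in>{0..1}. s * W (a t) w)"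
    and "(\<lambda>w. H (\<lambda>t\<in>{0..1}. s * W (a t) w)) \<in> borel_measurable P"
    and "\<And>m. (\<lambda>w. H (step_path m (\<lambda>j. s * W (a (real j / real m)) w))) \<in> borel_measurable P"
  using lip_continuous_meas[where Z="\<lambda>t w. s * W (a t) w", OF H bm_path(1)[OF W] bm_path(2)[OF W]] by blast+

lemma mart_path_limit:
  fixes W :: "real \<Rightarrow> 'u \<Rightarrow> real"
  assumes W: "brownian_motion P W" and H: "lip_D k H" and B: "\<And>x. x \<in> D01 \<Longrightarrow> \<bar>H x\<bar> \<le> B"
  shows "(\<lambda>n. \<integral>w. H (step_path m (\<lambda>j. mart (c n) (grid m n j) w)) \<partial>N)
    \<longlonglongrightarrow> (\<integral>w. H (step_path m (\<lambda>j. s * W (a (real j / real m)) w)) \<partial>P)"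
proof -
  interpret P: prob_space P using W by (simp add: brownian_motion_def)
  let ?D = "\<lambda>i w. s * (W (a (real (Suc i) / real m)) w - W (a (real i / real m)) w)"
  let ?G = "\<lambda>x. H (step_path m (\<lambda>j. \<Sum>i<j. x i))"
  have "(\<lambda>n. \<integral>w. ?G (\<lambda>i. mart (c n) (grid m n (Suc i)) w - mart (c n) (grid m n i) w) \<partial>N) \<longlonglongrightarrow> (\<integral>w. ?G (\<lambda>i. ?D i w) \<partial>P)"
  proof (rule block_clt[OF c mono_grid _ _ _ _ _ block_fun_step_path[OF H B]])
    show "prob_space P" by (rule P.prob_space_axioms)
    show "P.indep_vars (\<lambda>_. borel) ?D {..<m}"
      by (rule brownian_increments(1)[OF W s]) (use a_less a0 in auto)
    show "distr P borel (?D i) = distr std_normal_distribution borel (\<lambda>z. sqrt (v m i) * z)" if "i < m" for i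
      unfolding v_def by (rule brownian_increments(2)[OF W s _ _ that]) (use a_less a0 in auto)
  qed (use v_nonneg bracket_increment in auto)
  also have "(\<lambda>n. \<integral>w. ?G (\<lambda>i. mart (c n) (grid m n (Suc i)) w - mart (c n) (grid m n i) w) \<partial>N)
      = (\<lambda>n. \<integral>w. H (step_path m (\<lambda>j. mart (c n) (grid m n j) w)) \<partial>N)"
  proof -
    have "(\<Sum>i<j. mart (c n) (grid m n (Suc i)) w - mart (c n) (grid m n i) w) = mart (c n) (grid m n j) w" for j n w
      using sum_lessThan_telescope[of "\<lambda>i. mart (c n) (grid m n i) w" j] by (simp add: mart_def[of _ 0])
    then show ?thesis by simp
  qed
  also have "(\<integral>w. ?G (\<lambda>i. ?D i w) \<partial>P) = (\<integral>w. H (step_path m (\<lambda>j. s * W (a (real j / real m)) w)) \<partial>P)"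
  proof (rule integral_cong_AE)
    show 1: "(\<lambda>w. H (step_path m (\<lambda>j. s * W (a (real j / real m)) w))) \<in> borel_measurable P"
      by (rule bm_path_lip(3)[OF W H])
    \<comment> \<open>The sum telescopes to the Brownian motion minus its value at 0, which vanishes
      only almost surely; hence the equality almost everywhere.\<close>
    have tel: "(\<Sum>i<j. ?D i w) = s * (W (a (real j / real m)) w - W (a 0) w)" for j w
      using sum_lessThan_telescope[of "\<lambda>i. W (a (real i / real m)) w" j] by (simp add: sum_distrib_left[symmetric])
    have D: "?D i \<in> borel_measurable P" if "i < m" for i
      using bm_path(2)[OF W, of "real (Suc i) / real m"] bm_path(2)[OF W, of "real i / real m"] that
      by (simp add: right_diff_distrib)
    have "step_path m (\<lambda>j. \<Sum>i<j. ?D i w) = step_path m (\<lambda>j. \<Sum>i<min j m. ?D i w)" for w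
      using step_path_index[of _ m] by (auto simp: step_path_def fun_eq_iff min_def)
    then show "(\<lambda>w. ?G (\<lambda>i. ?D i w)) \<in> borel_measurable P"
      by (simp only:) (intro lip_step_path_meas[OF H] borel_measurable_sum D, simp)
    have "AE w in P. W 0 w = 0" using W by (simp add: brownian_motion_def)
    then show "AE w in P. ?G (\<lambda>i. ?D i w) = H (step_path m (\<lambda>j. s * W (a (real j / real m)) w))"
      unfolding tel a0 by eventually_elim simp
  qed
  finally show ?thesis .
qed

theorem mart_fclt:
  fixes W :: "real \<Rightarrow> 'u \<Rightarrow> real" and S :: "nat \<Rightarrow> nat \<Rightarrow> 'v \<Rightarrow> real"
  assumes W: "brownian_motion P W" and S: "\<And>n k. S n k \<in> borel_measurable N"
    and rem: "\<And>\<delta>. 0 < \<delta> \<Longrightarrow> (\<lambda>n. measure N {\<omega>\<in>space N. \<exists>k\<le>n. \<delta> < \<bar>S n k \<omega> - mart (c n) k \<omega>\<bar>}) \<longlonglongrightarrow> 0"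
  shows "converges_weakly_D N (\<lambda>n \<omega>. step_path n (\<lambda>k. S n k \<omega>)) P (\<lambda>\<omega>. \<lambda>t\<in>{0..1}. s * W (a t) \<omega>)"
proof -
  interpret P: prob_space P using W by (simp add: brownian_motion_def)
  note [measurable] = S
  note Zl = bm_path_lip[OF W]
  have Yl: "(\<lambda>\<omega>. H (step_path m (\<lambda>k. S n k \<omega>))) \<in> borel_measurable N" if "lip_D k H" for k H m n
    by (rule lip_step_path_meas[OF that S])
  show ?thesis
  proof (rule converges_weakly_D_lip)
    show "prob_space N" "prob_space P" by (rule prob_space_axioms P.prob_space_axioms)+
    show "(\<lambda>\<omega>. step_path n (\<lambda>k. S n k \<omega>)) \<in> measurable N skorohod_borel" for n
      by (rule measurable_skorohodI) (rule step_path_D01, rule Yl)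
    show "(\<lambda>\<omega>. \<lambda>t\<in>{0..1}. s * W (a t) \<omega>) \<in> measurable P skorohod_borel"
      by (rule measurable_skorohodI) (rule continuous_D01[OF bm_path(1)[OF W]], assumption, rule Zl(2))
    fix k B H assume H: "lip_D k H" and B: "\<And>x. x \<in> D01 \<Longrightarrow> \<bar>H x\<bar> \<le> B"
    let ?A = "\<lambda>m n. \<integral>\<omega>. H (step_path m (\<lambda>j. mart (c n) (grid m n j) \<omega>)) \<partial>N"
    let ?B = "\<lambda>m. \<integral>\<omega>. H (step_path m (\<lambda>j. s * W (a (real j / real m)) \<omega>)) \<partial>P"
    let ?Z = "\<integral>\<omega>. H (\<lambda>t\<in>{0..1}. s * W (a t) \<omega>) \<partial>P"
    have B0: "0 \<le> B" using B[OF step_path_D01[of 0 "\<lambda>_. 0"]] by linarith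
    have k0: "0 \<le> k" using H by (simp add: lip_D_def)
    have BZ: "?B \<longlonglongrightarrow> ?Z"
    proof (rule integral_dominated_convergence[where w="\<lambda>_. B"])
      show "AE \<omega> in P. (\<lambda>m. H (step_path m (\<lambda>j. s * W (a (real j / real m)) \<omega>))) \<longlonglongrightarrow> H (\<lambda>t\<in>{0..1}. s * W (a t) \<omega>)"
        by (rule AE_I2) (rule Zl(1)[OF H])
      show "AE \<omega> in P. norm (H (step_path m (\<lambda>j. s * W (a (real j / real m)) \<omega>))) \<le> B" for m
        using B[OF step_path_D01] by simp
      show "(\<lambda>\<omega>. H (step_path m (\<lambda>j. s * W (a (real j / real m)) \<omega>))) \<in> borel_measurable P" for m
        by (rule Zl(3)[OF H])
    qed (use Zl(2)[OF H] in auto)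
    show "(\<lambda>n. \<integral>\<omega>. H (step_path n (\<lambda>k. S n k \<omega>)) \<partial>N) \<longlonglongrightarrow> ?Z"
    proof (rule LIMSEQ_I)
      fix r :: real assume r: "0 < r"
      \<comment> \<open>The two deviations of size \<epsilon> cost at most r/4 by the Lipschitz
        bound, and two events of probability below \<open>q\<close> another r/4. Adding 1 to
        \<open>k\<close> and to \<open>B\<close> keeps the denominators positive.\<close>
      define \<epsilon> where "\<epsilon> = r / (8 * (k + 1))"
      define q where "q = r / (16 * (B + 1))"
      have \<epsilon>: "0 < \<epsilon>" and q: "0 < q" using r k0 B0 by (auto simp: \<epsilon>_def q_def)
      have \<epsilon>': "k * (2 * \<epsilon>) \<le> r / 4" using r k0 by (simp add: \<epsilon>_def field_simps)
      have q': "2 * B * (2 * q) \<le> r / 4" using r B0 by (simp add: q_def field_simps)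
      obtain m0 where m0: "0 < m0" "\<forall>m\<ge>m0. \<forall>\<^sub>F n in sequentially. measure N (osc m \<epsilon> n) < q"
        using osc_small[OF \<epsilon> q] by blast
      have "\<forall>\<^sub>F m in sequentially. dist (?B m) ?Z < r / 4" using r by (intro tendstoD[OF BZ]) auto
      then obtain m1 where "\<forall>m\<ge>m1. dist (?B m) ?Z < r / 4" unfolding eventually_sequentially by blast
      then obtain m where m: "0 < m" "\<forall>\<^sub>F n in sequentially. measure N (osc m \<epsilon> n) < q" "dist (?B m) ?Z < r / 4"
        using m0 by (meson le_cases less_le_trans order_refl)
      let ?R = "\<lambda>n. {\<omega>\<in>space N. \<exists>k\<le>n. \<epsilon> < \<bar>S n k \<omega> - mart (c n) k \<omega>\<bar>}"
      have "\<forall>\<^sub>F n in sequentially. dist (?A m n) (?B m) < r / 4"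
        using r by (intro tendstoD[OF mart_path_limit[OF W H B]]) auto
      moreover have "\<forall>\<^sub>F n in sequentially. measure N (?R n) < q" by (rule order_tendstoD(2)[OF rem[OF \<epsilon>] q])
      ultimately have "\<forall>\<^sub>F n in sequentially. norm ((\<integral>\<omega>. H (step_path n (\<lambda>k. S n k \<omega>)) \<partial>N) - ?Z) < r"
        using m(2)
      proof eventually_elim
        case (elim n)
        have "\<bar>(\<integral>\<omega>. H (step_path n (\<lambda>k. S n k \<omega>)) \<partial>N) - ?A m n\<bar> \<le> k * (2 * \<epsilon>) + 2 * B * measure N (?R n \<union> osc m \<epsilon> n)"
        proof (rule integral_diff_bad_set)
          show "(\<lambda>\<omega>. H (step_path m (\<lambda>j. mart (c n) (grid m n j) \<omega>))) \<in> borel_measurable N"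
            by (rule lip_step_path_meas[OF H mart_N])
          fix \<omega> assume w: "\<omega> \<in> space N" and g: "\<omega> \<notin> ?R n \<union> osc m \<epsilon> n"
          have gr: "\<bar>S n j \<omega> - mart (c n) j \<omega>\<bar> \<le> \<epsilon>" if "j \<le> n" for j using g w that by (auto simp: not_less)
          have go: "\<bar>mart (c n) j \<omega> - mart (c n) (grid m n l) \<omega>\<bar> < \<epsilon>" if "l < m" "j \<in> {grid m n l..grid m n (Suc l)}" for j l
            using g w that unfolding osc_def by (auto simp: not_le)
          have "sup_dist (step_path n (\<lambda>k. S n k \<omega>)) (step_path m (\<lambda>j. mart (c n) (grid m n j) \<omega>)) \<le> 2 * \<epsilon>"
          proof (rule sup_dist_le)
            fix t :: real assume t: "t \<in> {0..1}"
            let ?l = "nat \<lfloor>real m * t\<rfloor>" and ?j = "nat \<lfloor>real n * t\<rfloor>"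
            have "\<bar>mart (c n) ?j \<omega> - mart (c n) (grid m n ?l) \<omega>\<bar> \<le> \<epsilon>"
              using grid_bounds[OF m(1) t, of n] go[of ?l ?j] \<epsilon> by auto
            then have "\<bar>S n ?j \<omega> - mart (c n) (grid m n ?l) \<omega>\<bar> \<le> 2 * \<epsilon>"
              using gr[OF step_path_index[OF t]] by linarith
            then show "min 1 \<bar>step_path n (\<lambda>k. S n k \<omega>) t - step_path m (\<lambda>j. mart (c n) (grid m n j) \<omega>) t\<bar> \<le> 2 * \<epsilon>"
              using t by (simp add: step_path_def min_le_iff_disj)
          qed
          then show "\<bar>H (step_path n (\<lambda>k. S n k \<omega>)) - H (step_path m (\<lambda>j. mart (c n) (grid m n j) \<omega>))\<bar> \<le> k * (2 * \<epsilon>)"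
            using lip_D_D[OF H step_path_D01 step_path_D01] k0 by (meson mult_left_mono order_trans)
        qed (use Yl[OF H] B[OF step_path_D01] k0 \<epsilon> in auto)
        moreover have "measure N (?R n \<union> osc m \<epsilon> n) \<le> measure N (?R n) + measure N (osc m \<epsilon> n)" by (rule measure_Un_le) auto
        then have "2 * B * measure N (?R n \<union> osc m \<epsilon> n) \<le> 2 * B * (2 * q)" using elim B0 by (intro mult_left_mono) auto
        ultimately have "\<bar>(\<integral>\<omega>. H (step_path n (\<lambda>k. S n k \<omega>)) \<partial>N) - ?A m n\<bar> \<le> r / 4 + r / 4" using \<epsilon>' q' by linarith
        then show ?case using elim(1) m(3) r unfolding dist_real_def real_norm_def by linarith
      qed
      then show "\<exists>n0. \<forall>n\<ge>n0. norm ((\<integral>\<omega>. H (step_path n (\<lambda>k. S n k \<omega>)) \<partial>N) - ?Z) < r" by (simp add: eventually_sequentially)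
    qed
  qed (use Yl Zl(2) in auto)
qed

end

section \<open>Functional limit theorem for the Euler--Maruyama chain\<close>

locale clt_sys = sde_sys N \<xi> b \<sigma> L \<kappa> \<kappa>' \<sigma>i c0 C0 es M B X \<pi> + poisson_sys N \<xi> b \<sigma> L \<kappa> \<kappa>' \<sigma>i c0 C0 es \<phi> h hm C
  for N :: "'v measure" and \<xi> :: "nat \<Rightarrow> 'v \<Rightarrow> real^'n" and b \<sigma> L \<kappa> \<kappa>' \<sigma>i c0 C0 es
    and M :: "'w measure" and B X \<pi> \<phi> h hm C
begin

definition fsq :: "real^'n \<Rightarrow> real" where
  "fsq y = (norm (transpose \<sigma> *v grad \<phi> y))\<^sup>2"

lemma fsq_cont: "continuous_on UNIV fsq"
  unfolding fsq_def[abs_def]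
  by (intro continuous_intros continuous_on_compose2[OF linear_continuous_on[OF linear_linear[THEN iffD2, OF matrix_vector_mul_linear]] C2_continuous(2)[OF C2]])
     auto

lemma fsq_V: "fsq y \<le> (norm (transpose \<sigma>) * (2 * C))\<^sup>2 * V y ^ 6"
proof -
  have "norm (transpose \<sigma> *v grad \<phi> y) \<le> norm (transpose \<sigma>) * (2 * C * V y ^ 3)"
    by (rule order_trans[OF norm_matrix_vector_mult_le]) (intro mult_left_mono grad_V norm_ge_zero)
  then have "fsq y \<le> (norm (transpose \<sigma>) * (2 * C * V y ^ 3))\<^sup>2" unfolding fsq_def by (intro power_mono) auto
  then show ?thesis by (simp add: power_mult_distrib mult_ac flip: power_mult)
qed

lemma fsq_nonneg: "0 \<le> fsq y" by (simp add: fsq_def)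

lemma fsq_chain_integrable:
  assumes \<eta>: "good \<eta>" shows "integrable N (\<lambda>w. fsq (chain \<eta> x j w))"
proof (rule Bochner_Integration.integrable_bound[OF integrable_mult_right[OF integrable_V_chain'[OF \<eta>, of x j 6], of "(norm (transpose \<sigma>) * (2 * C))\<^sup>2"]])
  show "(\<lambda>w. fsq (chain \<eta> x j w)) \<in> borel_measurable N"
    by (rule measurable_compose[OF chain_N borel_measurable_continuous_onI[OF fsq_cont]])
  show "AE w in N. norm (fsq (chain \<eta> x j w)) \<le> norm ((norm (transpose \<sigma>) * (2 * C))\<^sup>2 * V (chain \<eta> x j w) ^ 6)"
    using fsq_V fsq_nonneg by (intro AE_I2) (auto intro: order_trans[OF _ abs_ge_self])
qed

text \<open>A triangular array: row \<open>n\<close> is normalized by T_n at all of its times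
  \<open>k\<close>.\<close>

definition em_coeff :: "(nat \<Rightarrow> real) \<Rightarrow> real^'n \<Rightarrow> nat \<Rightarrow> nat \<Rightarrow> 'v \<Rightarrow> real^'n" where
  "em_coeff \<eta> x n j w = - (1 / (sqrt (\<eta> (Suc j)) * sqrt (step_T \<eta> n))) *\<^sub>R (transpose \<sigma> *v grad \<phi> (chain \<eta> x j w))"

lemma em_coeff_adapted: "adapted (em_coeff \<eta> x n)"
proof -
  have g: "(\<lambda>w. grad \<phi> (chain \<eta> x j w)) \<in> borel_measurable (F j)" for j
    by (rule measurable_compose[OF chain_F meas_\<phi>(2)])
  show ?thesis unfolding adapted_def em_coeff_def[abs_def]
    by (intro allI borel_measurable_scaleR borel_measurable_const borel_measurable_matrix_vector_mult g)
qed

lemma mart_em_coeff: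
  "mart (em_coeff \<eta> x n) k w = ((\<Sum>j<k. h (chain \<eta> x j w) - hm) - rem \<eta> x k w) / sqrt (step_T \<eta> n)"
proof -
  have "(transpose \<sigma> *v u) \<bullet> z = u \<bullet> (\<sigma> *v z)" for u z :: "real^'n"
    by (metis dot_lmul_matrix transpose_matrix_vector)
  then show ?thesis
    by (simp add: mart_def em_coeff_def rem_def sum_divide_distrib sum_negf)
qed

lemma bracket_em_coeff:
  assumes "good \<eta>"
  shows "bracket (em_coeff \<eta> x n) k w = (\<Sum>j<k. inverse (\<eta> (Suc j)) * fsq (chain \<eta> x j w)) / step_T \<eta> n"
  unfolding bracket_def em_coeff_def fsq_def sum_divide_distrib
  using goodD(1)[OF assms] step_T_nonneg[OF assms, of n]
  by (intro sum.cong refl) (simp add: power_mult_distrib power_divide inverse_eq_divide less_imp_le)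

lemma step_T_mono: "good \<eta> \<Longrightarrow> k \<le> n \<Longrightarrow> step_T \<eta> k \<le> step_T \<eta> n"
  unfolding step_T_eq by (intro sum_mono2) (auto simp: less_imp_le[OF goodD(1)])

text \<open>The bracket at time k is the weighted average up to k times T_k / T_n. The law of large
  numbers treats the first factor along k growing with n, the convergence to \<alpha> the
  second.\<close>

lemma bracket_limit:
  assumes st: "steps \<eta>" and t: "t \<in> {0..1}" and a0: "t = 0 \<Longrightarrow> \<alpha> = 0"
    and lim: "(\<lambda>n. step_T \<eta> (nat \<lfloor>real n * t\<rfloor>) / step_T \<eta> n) \<longlonglongrightarrow> \<alpha>" and \<delta>: "0 < \<delta>"
  shows "(\<lambda>n. measure N {w\<in>space N. \<delta> < \<bar>bracket (em_coeff \<eta> x n) (nat \<lfloor>real n * t\<rfloor>) w - (\<integral>y. fsq y \<partial>\<pi>) * \<alpha>\<bar>}) \<longlonglongrightarrow> 0"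
    (is "(\<lambda>n. measure N (?E n)) \<longlonglongrightarrow> 0")
proof -
  have gd: "good \<eta>" using st by (rule steps_good)
  let ?k = "\<lambda>n. nat \<lfloor>real n * t\<rfloor>" and ?T = "step_T \<eta>" and ?p = "\<integral>y. fsq y \<partial>\<pi>"
  let ?S = "\<lambda>n w. \<Sum>j<n. inverse (\<eta> (Suc j)) * fsq (chain \<eta> x j w)"
  define e where "e n = (\<integral>w. \<bar>?S n w / ?T n - ?p\<bar> \<partial>N)" for n
  have e: "e \<longlonglongrightarrow> 0" unfolding e_def[abs_def] by (rule LLN(2)[OF st fsq_cont fsq_nonneg fsq_V])
  have Si: "integrable N (?S n)" for n using fsq_chain_integrable[OF gd] by simp
  have bi: "integrable N (\<lambda>w. \<bar>bracket (em_coeff \<eta> x n) k w - ?p * \<alpha>\<bar>)" for n k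
    unfolding bracket_em_coeff[OF gd] using Si by simp
  have alg: "A * q - p * \<alpha> = (A - p) * q + p * (q - \<alpha>)" for A q p :: real by (simp add: algebra_simps)
  have bound: "(\<integral>w. \<bar>bracket (em_coeff \<eta> x n) (?k n) w - ?p * \<alpha>\<bar> \<partial>N)
      \<le> e (?k n) * (?T (?k n) / ?T n) + \<bar>?p\<bar> * \<bar>?T (?k n) / ?T n - \<alpha>\<bar>" for n
  proof -
    let ?q = "?T (?k n) / ?T n"
    have q0: "0 \<le> ?q" using step_T_nonneg[OF gd] by simp
    have "\<bar>bracket (em_coeff \<eta> x n) (?k n) w - ?p * \<alpha>\<bar> \<le> \<bar>?S (?k n) w / ?T (?k n) - ?p\<bar> * ?q + \<bar>?p\<bar> * \<bar>?q - \<alpha>\<bar>" for w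
    proof -
      \<comment> \<open>Division by T_k is harmless: T_k vanishes only for k = 0, when the sum is
        empty.\<close>
      have S0: "?S (?k n) w / ?T n = ?S (?k n) w / ?T (?k n) * ?q"
      proof (cases "?T (?k n) = 0")
        case True
        have "?k n = 0"
        proof (rule ccontr)
          assume "?k n \<noteq> 0"
          then have "?T 1 \<le> ?T (?k n)" by (intro step_T_mono gd) linarith
          then show False using True goodD(1)[OF gd, of 0] by (simp add: step_T_eq)
        qed
        then show ?thesis by simp
      qed simp
      have eq: "bracket (em_coeff \<eta> x n) (?k n) w - ?p * \<alpha> = (?S (?k n) w / ?T (?k n) - ?p) * ?q + ?p * (?q - \<alpha>)"
        unfolding bracket_em_coeff[OF gd] S0 by (rule alg)
      have "\<bar>bracket (em_coeff \<eta> x n) (?k n) w - ?p * \<alpha>\<bar> \<le> \<bar>(?S (?k n) w / ?T (?k n) - ?p) * ?q\<bar> + \<bar>?p * (?q - \<alpha>)\<bar>"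
        unfolding eq by (rule abs_triangle_ineq)
      then show ?thesis unfolding abs_mult abs_of_nonneg[OF q0] .
    qed
    then have "(\<integral>w. \<bar>bracket (em_coeff \<eta> x n) (?k n) w - ?p * \<alpha>\<bar> \<partial>N)
        \<le> (\<integral>w. \<bar>?S (?k n) w / ?T (?k n) - ?p\<bar> * ?q + \<bar>?p\<bar> * \<bar>?q - \<alpha>\<bar> \<partial>N)"
      using Si by (intro integral_mono bi) auto
    also have "\<dots> = e (?k n) * ?q + \<bar>?p\<bar> * \<bar>?q - \<alpha>\<bar>"
      unfolding e_def using Si by (subst Bochner_Integration.integral_add) (auto simp: prob_space)
    finally show ?thesis .
  qed
  \<comment> \<open>For t = 0 the index stays 0 and the law of large numbers says nothing, but then
    the factor T_0 / T_n is 0.\<close>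
  have lim1: "(\<lambda>n. e (?k n) * (?T (?k n) / ?T n)) \<longlonglongrightarrow> 0"
  proof (cases "t = 0")
    case True
    then show ?thesis by (simp add: step_T_eq)
  next
    case False
    then have "0 < t" using t by simp
    then have "filterlim (\<lambda>n. t * real n) at_top sequentially"
      by (intro filterlim_tendsto_pos_mult_at_top[OF tendsto_const _ filterlim_real_sequentially])
    then have "filterlim (\<lambda>n. nat \<lfloor>t * real n\<rfloor>) sequentially sequentially"
      by (intro filterlim_compose[OF filterlim_nat_sequentially] filterlim_compose[OF filterlim_floor_sequentially])
    then have "filterlim ?k sequentially sequentially" by (simp add: mult.commute)
    then have "(\<lambda>n. e (?k n)) \<longlonglongrightarrow> 0" by (rule filterlim_compose[OF e])
    from tendsto_mult[OF this lim] show ?thesis by simp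
  qed
  have "(\<lambda>n. (e (?k n) * (?T (?k n) / ?T n) + \<bar>?p\<bar> * \<bar>?T (?k n) / ?T n - \<alpha>\<bar>) / \<delta>) \<longlonglongrightarrow> (0 + \<bar>?p\<bar> * \<bar>\<alpha> - \<alpha>\<bar>) / \<delta>"
    using \<delta> by (intro tendsto_intros lim1 lim) auto
  then have l: "(\<lambda>n. (e (?k n) * (?T (?k n) / ?T n) + \<bar>?p\<bar> * \<bar>?T (?k n) / ?T n - \<alpha>\<bar>) / \<delta>) \<longlonglongrightarrow> 0" by simp
  have le: "measure N (?E n) \<le> (e (?k n) * (?T (?k n) / ?T n) + \<bar>?p\<bar> * \<bar>?T (?k n) / ?T n - \<alpha>\<bar>) / \<delta>" for n
  proof -
    have m: "bracket (em_coeff \<eta> x n) (?k n) \<in> borel_measurable N"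
      unfolding bracket_em_coeff[OF gd, abs_def] using Si[of "?k n"] by measurable
    have "measure N (?E n) \<le> measure N {w\<in>space N. \<delta> \<le> \<bar>bracket (em_coeff \<eta> x n) (?k n) w - ?p * \<alpha>\<bar>}"
      using m by (intro finite_measure_mono) auto
    also have "\<dots> \<le> (\<integral>w. \<bar>bracket (em_coeff \<eta> x n) (?k n) w - ?p * \<alpha>\<bar> \<partial>N) / \<delta>"
      by (rule integral_Markov_inequality_measure[where A="space N"]) (use bi \<delta> in auto)
    also have "\<dots> \<le> (e (?k n) * (?T (?k n) / ?T n) + \<bar>?p\<bar> * \<bar>?T (?k n) / ?T n - \<alpha>\<bar>) / \<delta>"
      using bound \<delta> by (intro divide_right_mono) auto
    finally show ?thesis .
  qed
  show ?thesis by (rule Lim_null_comparison[OF _ l]) (use le in \<open>auto intro!: always_eventually\<close>)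
qed

theorem em_fclt:
  fixes W :: "real \<Rightarrow> 'u \<Rightarrow> real"
  assumes st: "steps \<eta>" and sm: "summable (\<lambda>k. (\<eta> (Suc k))\<^sup>2)"
    and p: "1 < p" "(\<lambda>n. (1 + step_t \<eta> n) powr (1 / p) / (\<eta> n * sqrt (step_T \<eta> n))) \<longlonglongrightarrow> 0"
    and lim: "\<And>t. t \<in> {0..1} \<Longrightarrow> (\<lambda>n. step_T \<eta> (nat \<lfloor>real n * t\<rfloor>) / step_T \<eta> n) \<longlonglongrightarrow> a t"
    and a: "a 0 = 0" "strict_mono_on {0..1} a" "continuous_on {0..1} a"
    and W: "brownian_motion P W"
  shows "converges_weakly_D N (\<lambda>n w. step_path n (\<lambda>k. (\<Sum>j<k. h (chain \<eta> x j w) - hm) / sqrt (step_T \<eta> n)))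
    P (\<lambda>w. \<lambda>t\<in>{0..1}. sqrt (\<integral>y. (norm (transpose \<sigma> *v grad \<phi> y))\<^sup>2 \<partial>\<pi>) * W (a t) w)"
proof -
  let ?p = "\<integral>y. fsq y \<partial>\<pi>"
  have p0: "0 \<le> ?p" by (intro Bochner_Integration.integral_nonneg fsq_nonneg)
  interpret A: mart_array N \<xi> "em_coeff \<eta> x" a "sqrt ?p"
  proof unfold_locales
    fix t \<delta> :: real assume "t \<in> {0..1}" "0 < \<delta>"
    then show "(\<lambda>n. measure N {w\<in>space N. \<delta> < \<bar>bracket (em_coeff \<eta> x n) (nat \<lfloor>real n * t\<rfloor>) w - (sqrt ?p)\<^sup>2 * a t\<bar>}) \<longlonglongrightarrow> 0"
      using bracket_limit[OF st _ _ lim] a(1) p0 by simp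
  qed (use em_coeff_adapted a p0 in auto)
  have "converges_weakly_D N (\<lambda>n w. step_path n (\<lambda>k. (\<Sum>j<k. h (chain \<eta> x j w) - hm) / sqrt (step_T \<eta> n)))
    P (\<lambda>w. \<lambda>t\<in>{0..1}. sqrt ?p * W (a t) w)"
  proof (rule A.mart_fclt[OF W])
    show "(\<lambda>w. (\<Sum>j<k. h (chain \<eta> x j w) - hm) / sqrt (step_T \<eta> n)) \<in> borel_measurable N" for n k by measurable
    fix \<delta> :: real assume \<delta>: "0 < \<delta>"
    have m[measurable]: "rem \<eta> x k \<in> borel_measurable N" for k unfolding rem_def[abs_def] by measurable
    have le: "measure N {w\<in>space N. \<exists>k\<le>n. \<delta> < \<bar>(\<Sum>j<k. h (chain \<eta> x j w) - hm) / sqrt (step_T \<eta> n) - mart (em_coeff \<eta> x n) k w\<bar>}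
        \<le> measure N {w\<in>space N. \<exists>k\<le>n. \<delta> * sqrt (step_T \<eta> n) < \<bar>rem \<eta> x k w\<bar>}" for n
    proof (rule finite_measure_mono)
      show "{w\<in>space N. \<exists>k\<le>n. \<delta> < \<bar>(\<Sum>j<k. h (chain \<eta> x j w) - hm) / sqrt (step_T \<eta> n) - mart (em_coeff \<eta> x n) k w\<bar>}
        \<subseteq> {w\<in>space N. \<exists>k\<le>n. \<delta> * sqrt (step_T \<eta> n) < \<bar>rem \<eta> x k w\<bar>}"
      proof safe
        fix w k assume k: "k \<le> n" and d: "\<delta> < \<bar>(\<Sum>j<k. h (chain \<eta> x j w) - hm) / sqrt (step_T \<eta> n) - mart (em_coeff \<eta> x n) k w\<bar>"
        have "(\<Sum>j<k. h (chain \<eta> x j w) - hm) / sqrt (step_T \<eta> n) - mart (em_coeff \<eta> x n) k w = rem \<eta> x k w / sqrt (step_T \<eta> n)"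
          by (simp add: mart_em_coeff diff_divide_distrib)
        then have d': "\<delta> < \<bar>rem \<eta> x k w\<bar> / sqrt (step_T \<eta> n)" using d step_T_nonneg[OF steps_good[OF st], of n] by simp
        \<comment> \<open>A vanishing T_n would make the quotient 0 by convention, against
          \<open>0 < \<delta>\<close>.\<close>
        then have "0 < sqrt (step_T \<eta> n)" using \<delta> step_T_nonneg[OF steps_good[OF st], of n] by (cases "step_T \<eta> n = 0") auto
        then have "\<delta> * sqrt (step_T \<eta> n) < \<bar>rem \<eta> x k w\<bar>" using d' by (simp add: pos_less_divide_eq)
        then show "\<exists>k\<le>n. \<delta> * sqrt (step_T \<eta> n) < \<bar>rem \<eta> x k w\<bar>" using k by blast
      qed
    qed measurable
    show "(\<lambda>n. measure N {w\<in>space N. \<exists>k\<le>n. \<delta> < \<bar>(\<Sum>j<k. h (chain \<eta> x j w) - hm) / sqrt (step_T \<eta> n) - mart (em_coeff \<eta> x n) k w\<bar>}) \<longlonglongrightarrow> 0"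
      by (rule Lim_null_comparison[OF _ rem_negligible[OF st sm p \<delta>, of x]]) (use le in \<open>auto intro!: always_eventually\<close>)
  qed
  then show ?thesis by (simp add: fsq_def)
qed

end

text \<open>Dissipativity and Young's inequality give the rate \<open>K1\<close> for the inner
  product term. By the linear growth of \<open>b\<close>, the quadratic term of the Euler step
  spoils at most half of it when \<open>e \<le> K1 / (4 * L\<^sup>2)\<close>; hence the rate
  \<open>K1 / 2\<close>.\<close>

lemma euler_drift:
  fixes b :: "real^'n \<Rightarrow> real^'n"
  assumes L: "0 < L" "\<And>x y. norm (b x - b y) \<le> L * norm (x - y)"
    and K: "0 < K1" "0 \<le> K2" "\<And>x y. (b x - b y) \<bullet> (x - y) \<le> - K1 * (norm (x - y))\<^sup>2 + K2"
    and e: "0 < e" "e \<le> 1" "e \<le> K1 / (4 * L\<^sup>2)"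
  shows "V (x + e *\<^sub>R b x) \<le> (1 - K1 / 2 * e) * V x + (2 * K2 + (norm (b 0))\<^sup>2 / K1 + 2 * (norm (b 0))\<^sup>2 + K1 / 2) * e"
proof -
  define n where "n = norm x" define m where "m = norm (b 0)"
  have n0: "0 \<le> n" and m0: "0 \<le> m" by (auto simp: n_def m_def)
  have "x \<bullet> b x = (b x - b 0) \<bullet> (x - 0) + b 0 \<bullet> x" by (simp add: inner_diff_left inner_commute[of x])
  also have "\<dots> \<le> - K1 * n\<^sup>2 + K2 + m * n"
    using K(3)[of x 0] norm_cauchy_schwarz[of "b 0" x] by (simp add: n_def m_def)
  also have "m * n \<le> K1 * n\<^sup>2 / 2 + m\<^sup>2 / K1 / 2"
  proof -
    have "0 \<le> (K1 * n - m)\<^sup>2 / (2 * K1)" using K by simp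
    also have "\<dots> = K1 * n\<^sup>2 / 2 + m\<^sup>2 / K1 / 2 - m * n" using K by (simp add: power2_diff field_simps) (simp add: power2_eq_square algebra_simps)
    finally show ?thesis by simp
  qed
  finally have xb: "2 * (x \<bullet> b x) \<le> - K1 * n\<^sup>2 + (2 * K2 + m\<^sup>2 / K1)" by simp
  have "norm (b x) \<le> m + L * n"
    using norm_triangle_ineq[of "b 0" "b x - b 0"] L(2)[of x 0] by (simp add: m_def n_def)
  then have "(norm (b x))\<^sup>2 \<le> (m + L * n)\<^sup>2" by (intro power_mono) auto
  also have "\<dots> \<le> 2 * m\<^sup>2 + 2 * (L * n)\<^sup>2" using sum_squares_bound[of m "L * n"] by (simp add: power2_sum)
  finally have "e\<^sup>2 * (norm (b x))\<^sup>2 \<le> e\<^sup>2 * (2 * m\<^sup>2 + 2 * (L * n)\<^sup>2)" by (intro mult_left_mono) auto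
  also have "\<dots> = (e * e) * (2 * m\<^sup>2) + e * (e * (2 * L\<^sup>2) * n\<^sup>2)" by (simp add: power2_eq_square algebra_simps)
  also have "\<dots> \<le> e * (2 * m\<^sup>2) + e * (K1 / 2 * n\<^sup>2)"
  proof (intro add_mono mult_left_mono mult_right_mono)
    show "e * e \<le> e" using e by (simp add: mult_left_le)
    show "e * (2 * L\<^sup>2) \<le> K1 / 2" using e(3) L(1) by (simp add: field_simps)
  qed (use e in auto)
  finally have bb: "e\<^sup>2 * (norm (b x))\<^sup>2 \<le> e * (2 * m\<^sup>2) + e * (K1 / 2 * n\<^sup>2)" .
  have "(norm (x + e *\<^sub>R b x))\<^sup>2 = n\<^sup>2 + e * (2 * (x \<bullet> b x)) + e\<^sup>2 * (norm (b x))\<^sup>2"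
    unfolding n_def power2_norm_eq_inner
    by (simp add: inner_add_left inner_add_right inner_commute[of "b x" x] power2_eq_square algebra_simps)
  also have "\<dots> \<le> n\<^sup>2 + e * (- K1 * n\<^sup>2 + (2 * K2 + m\<^sup>2 / K1)) + (e * (2 * m\<^sup>2) + e * (K1 / 2 * n\<^sup>2))"
    using xb bb e by (intro add_mono mult_left_mono order_refl) auto
  finally show ?thesis unfolding V_def n_def[symmetric] m_def[symmetric] by (simp add: algebra_simps add_divide_distrib)
qed

text \<open>The steps are below 1, so a lower exponent gives a larger power, whence the summability
  of the squares. The last claim holds because 1/(\<eta>_n^2 T_n) is at most the square of the
  sequence in (Step-2), whose numerator is at least 1.\<close>

lemma steps_conditions:
  fixes \<eta> :: "nat \<Rightarrow> real"
  assumes pos: "\<forall>k\<ge>1. 0 < \<eta> k \<and> \<eta> k < 1" and s0: "step0 \<eta>" and s1: "step1 \<eta>"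
    and p: "1 < p" "(\<lambda>n. (1 + step_t \<eta> n) powr (1 / p) / (\<eta> n * sqrt (step_T \<eta> n))) \<longlonglongrightarrow> 0"
  shows "summable (\<lambda>k. (\<eta> (Suc k))\<^sup>2)" "\<eta> \<longlonglongrightarrow> 0" "filterlim (step_T \<eta>) at_top sequentially"
    "(\<lambda>n. 1 / ((\<eta> n)\<^sup>2 * step_T \<eta> n)) \<longlonglongrightarrow> 0"
proof -
  have e: "0 < \<eta> (Suc k)" "\<eta> (Suc k) < 1" for k using pos by auto
  obtain \<epsilon> where \<epsilon>: "0 < \<epsilon>" "\<epsilon> < 1" "summable (\<lambda>k. \<eta> (Suc k) powr (2 - \<epsilon>))" using s1 unfolding step1_def by blast
  show sm: "summable (\<lambda>k. (\<eta> (Suc k))\<^sup>2)"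
  proof (rule summable_comparison_test'[OF \<epsilon>(3)])
    fix k
    have "\<eta> (Suc k) powr 2 \<le> \<eta> (Suc k) powr (2 - \<epsilon>)" using e[of k] \<epsilon> by (intro powr_mono') auto
    then show "norm ((\<eta> (Suc k))\<^sup>2) \<le> \<eta> (Suc k) powr (2 - \<epsilon>)" using e[of k] by simp
  qed
  have "(\<lambda>k. sqrt ((\<eta> (Suc k))\<^sup>2)) \<longlonglongrightarrow> sqrt 0" by (intro tendsto_intros summable_LIMSEQ_zero sm)
  then have "(\<lambda>k. \<eta> (Suc k)) \<longlonglongrightarrow> 0" using e by (simp add: less_imp_le)
  then show "\<eta> \<longlonglongrightarrow> 0" by (rule LIMSEQ_imp_Suc)
  have "real n \<le> step_T \<eta> n" for n
  proof -
    have "(\<Sum>j<n. 1) \<le> (\<Sum>j<n. inverse (\<eta> (Suc j)))" using e by (intro sum_mono) (simp add: one_le_inverse less_imp_le)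
    then show ?thesis by (simp add: step_T_eq)
  qed
  then show T: "filterlim (step_T \<eta>) at_top sequentially"
    by (intro filterlim_at_top_mono[OF filterlim_real_sequentially]) auto
  show "(\<lambda>n. 1 / ((\<eta> n)\<^sup>2 * step_T \<eta> n)) \<longlonglongrightarrow> 0"
  proof (rule Lim_null_comparison)
    let ?u = "\<lambda>n. (1 + step_t \<eta> n) powr (1 / p) / (\<eta> n * sqrt (step_T \<eta> n))"
    show "(\<lambda>n. (?u n)\<^sup>2) \<longlonglongrightarrow> 0" using tendsto_power[OF p(2), of 2] by simp
    have "\<forall>\<^sub>F n in sequentially. 0 < step_T \<eta> n" using T by (auto simp: filterlim_at_top_dense)
    then show "\<forall>\<^sub>F n in sequentially. norm (1 / ((\<eta> n)\<^sup>2 * step_T \<eta> n)) \<le> (?u n)\<^sup>2"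
    proof eventually_elim
      case (elim n)
      have "0 \<le> step_t \<eta> n" unfolding step_t_def using pos by (intro sum_nonneg) (auto simp: less_imp_le)
      then have "1 \<le> (1 + step_t \<eta> n) powr (1 / p)" using p(1) by (intro ge_one_powr_ge_zero) auto
      then have "1 \<le> ((1 + step_t \<eta> n) powr (1 / p))\<^sup>2" by (rule one_le_power)
      then have "1 / ((\<eta> n)\<^sup>2 * step_T \<eta> n) \<le> ((1 + step_t \<eta> n) powr (1 / p))\<^sup>2 / ((\<eta> n)\<^sup>2 * step_T \<eta> n)"
        using elim by (intro divide_right_mono) auto
      then show ?case using elim by (simp add: power_divide power_mult_distrib)
    qed
  qed
qed

lemma empirical_step_path:
  fixes h :: "'a::euclidean_space \<Rightarrow> real"
  assumes h: "h \<in> borel_measurable borel"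
  shows "(\<lambda>t\<in>{0..1}. real (nat \<lfloor>real n * t\<rfloor>) / T * ((\<integral>y. h y \<partial>empirical_measure \<theta> (nat \<lfloor>real n * t\<rfloor>)) - c))
    = step_path n (\<lambda>k. (\<Sum>j<k. h (\<theta> j) - c) / T)"
proof -
  have "real k / T * ((\<Sum>j<k. h (\<theta> j)) / real k - c) = (\<Sum>j<k. h (\<theta> j) - c) / T" for k
  \<comment> \<open>For \<open>k = 0\<close> both sides vanish: the factor \<open>real k\<close> is
    0, whatever the integral over the null measure.\<close>
  proof (cases "k = 0")
    case False
    then have "real k * ((\<Sum>j<k. h (\<theta> j)) / real k - c) = (\<Sum>j<k. h (\<theta> j) - c)"
      by (simp add: sum_subtractf right_diff_distrib)
    then show ?thesis by (simp only: times_divide_eq_left)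
  qed simp
  then show ?thesis unfolding step_path_def integral_empirical_measure[OF h] by presburger
qed

theorem theorem2p7:
  fixes b :: "real^'n \<Rightarrow> real^'n" and \<sigma> :: "real^'n^'n" and h :: "real^'n \<Rightarrow> real"
  assumes "coeff_assumption b \<sigma>"
    and "\<exists>C. C-lipschitz_on UNIV h"
  shows "\<exists>\<eta>\<^sub>s>0.
    \<forall>(M::'w measure) B X \<pi> \<phi>.
      brownian_motion M B \<and> (\<forall>x. strong_solution M B b \<sigma> x (X x)) \<and>
      invariant_measure M X \<pi> \<and> poisson_solution b \<sigma> \<pi> h \<phi> \<longrightarrow>
    (\<forall>(N::'v measure) \<xi> x \<eta> a (P::'u measure) (W :: real \<Rightarrow> 'u \<Rightarrow> real).
      iid_std_gaussian N \<xi> \<and>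
      (\<forall>k\<ge>1. 0 < \<eta> k \<and> \<eta> k < 1) \<and> step0 \<eta> \<and> step1 \<eta> \<and> step2 \<eta> \<and> \<eta> 1 \<le> \<eta>\<^sub>s \<and>
      (\<forall>t\<in>{0..1}. a t \<in> {0..1} \<and>
         (\<lambda>n. step_T \<eta> (nat \<lfloor>real n * t\<rfloor>) / step_T \<eta> n) \<longlonglongrightarrow> a t) \<and>
      time_change 1 a \<and> brownian_motion P W \<longrightarrow>
      converges_weakly_D
        N (\<lambda>n \<omega>. \<lambda>t\<in>{0..1}. real (nat \<lfloor>real n * t\<rfloor>) / sqrt (step_T \<eta> n) *
             ((\<integral>y. h y \<partial>empirical_measure (\<lambda>k. em_chain b \<sigma> \<eta> x \<xi> k \<omega>) (nat \<lfloor>real n * t\<rfloor>))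
              - (\<integral>y. h y \<partial>\<pi>)))
        P (\<lambda>\<omega>. \<lambda>t\<in>{0..1}.
             sqrt (\<integral>y. (norm (transpose \<sigma> *v grad \<phi> y))\<^sup>2 \<partial>\<pi>) * W (a t) \<omega>))"
proof -
  obtain L where L: "0 < L" "\<And>x y. norm (b x - b y) \<le> L * norm (x - y)"
    using assms(1) unfolding coeff_assumption_def by blast
  obtain K1 K2 where K: "0 < K1" "0 \<le> K2" "\<And>x y. (b x - b y) \<bullet> (x - y) \<le> - K1 * (norm (x - y))\<^sup>2 + K2"
    using assms(1) unfolding coeff_assumption_def by blast
  obtain \<sigma>i where \<sigma>i: "\<sigma> ** \<sigma>i = mat 1"
    using assms(1) unfolding coeff_assumption_def invertible_def by blast
  have bc: "continuous_on UNIV b" using assms(1) unfolding coeff_assumption_def by blast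
  have hc: "continuous_on UNIV h" using assms(2) by (auto intro: lipschitz_on_continuous_on)
  have hm: "h \<in> borel_measurable borel" using hc by (rule borel_measurable_continuous_onI)
  \<comment> \<open>Steps at most 1, the step restriction of \<open>euler_drift\<close>, and
    \<open>c0 * es \<le> 1\<close> for the rate \<open>c0 = K1 / 2\<close>.\<close>
  define es where "es = min 1 (min (K1 / (4 * L\<^sup>2)) (2 / K1))"
  define C0 where "C0 = 2 * K2 + (norm (b 0))\<^sup>2 / K1 + 2 * (norm (b 0))\<^sup>2 + K1 / 2"
  have es: "0 < es" "es \<le> 1" "es \<le> K1 / (4 * L\<^sup>2)" "K1 / 2 * es \<le> 1"
  proof -
    have "K1 / 2 * es \<le> K1 / 2 * (2 / K1)" using K by (intro mult_left_mono) (auto simp: es_def)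
    then show "K1 / 2 * es \<le> 1" using K by simp
  qed (use L K in \<open>auto simp: es_def\<close>)
  have C0: "0 \<le> C0" using K by (auto simp: C0_def)
  show ?thesis
  proof (intro exI[of _ es] conjI es(1) allI impI, elim conjE)
    fix M :: "'w measure" and B :: "real \<Rightarrow> 'w \<Rightarrow> real^'n" and X \<pi> \<phi> and N :: "'v measure"
      and \<xi> :: "nat \<Rightarrow> 'v \<Rightarrow> real^'n" and x \<eta> a and P :: "'u measure" and W :: "real \<Rightarrow> 'u \<Rightarrow> real"
    assume bm: "brownian_motion M B" and sol: "\<forall>x. strong_solution M B b \<sigma> x (X x)"
      and inv: "invariant_measure M X \<pi>" and ps: "poisson_solution b \<sigma> \<pi> h \<phi>"
      and iid: "iid_std_gaussian N \<xi>" and pos: "\<forall>k\<ge>1. 0 < \<eta> k \<and> \<eta> k < 1"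
      and s0: "step0 \<eta>" and s1: "step1 \<eta>" and s2: "step2 \<eta>" and \<eta>1: "\<eta> 1 \<le> es"
      and lim: "\<forall>t\<in>{0..1}. a t \<in> {0..1} \<and> (\<lambda>n. step_T \<eta> (nat \<lfloor>real n * t\<rfloor>) / step_T \<eta> n) \<longlonglongrightarrow> a t"
      and tc: "time_change 1 a" and W: "brownian_motion P W"
    obtain C where C: "0 < C"
      "\<And>x. \<bar>\<phi> x\<bar> \<le> C * (1 + norm x ^ 2)" "\<And>x. norm (grad \<phi> x) \<le> C * (1 + norm x ^ 3)"
      "\<And>x. norm (hess \<phi> x) \<le> C * (1 + norm x ^ 4)"
      "\<And>x y. 0 < norm (y - x) \<Longrightarrow> norm (y - x) \<le> 1 \<Longrightarrow> norm (hess \<phi> x - hess \<phi> y) / norm (x - y) \<le> C * (1 + norm x ^ 5)"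
      using ps unfolding poisson_solution_def by blast
    interpret gauss_seq N \<xi> by (rule iid_std_gaussian_imp_gauss_seq[OF iid])
    \<comment> \<open>The Frobenius norms of \<open>\<sigma>\<close> and of its inverse serve as
      \<kappa> and \<kappa>'; the mean of \<open>h\<close> under \<pi> is inserted for
      \<open>hm\<close>.\<close>
    interpret clt_sys N \<xi> b \<sigma> L "norm \<sigma>" "norm \<sigma>i" \<sigma>i "K1 / 2" C0 es M B X \<pi> \<phi> h "\<integral>y. h y \<partial>\<pi>" C
    proof unfold_locales
      show "b \<in> borel_measurable borel" using bc by (rule borel_measurable_continuous_onI)
      show "\<sigma> *v (\<sigma>i *v z) = z" for z by (simp add: matrix_vector_mul_assoc \<sigma>i)
      show "V (x + e *\<^sub>R b x) \<le> (1 - K1 / 2 * e) * V x + C0 * e" if "0 < e" "e \<le> es" for x e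
        unfolding C0_def by (rule euler_drift[OF L K]) (use that es in auto)
      show "C2 \<phi>" "generator b \<sigma> \<phi> y = h y - (\<integral>y. h y \<partial>\<pi>)" for y using ps unfolding poisson_solution_def by blast+
    qed (use L K es C0 C bm sol inv hc norm_matrix_vector_mult_le in auto)
    obtain p where p: "1 < p" "(\<lambda>n. (1 + step_t \<eta> n) powr (1 / p) / (\<eta> n * sqrt (step_T \<eta> n))) \<longlonglongrightarrow> 0"
      using s2 unfolding step2_def by blast
    note sc = steps_conditions[OF pos s0 s1 p]
    have dec: "\<forall>k\<ge>1. \<eta> (Suc k) \<le> \<eta> k" using s0 unfolding step0_def by blast
    have "\<eta> (Suc k) \<le> es" for k
    proof (induction k)
      case (Suc k)
      then show ?case using dec[rule_format, of "Suc k"] by simp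
    qed (use \<eta>1 in simp)
    then have "good \<eta>" unfolding good_def using pos by (metis Suc_le_D One_nat_def)
    then have st: "steps \<eta>" unfolding steps_def using dec sc by blast
    show "converges_weakly_D
        N (\<lambda>n \<omega>. \<lambda>t\<in>{0..1}. real (nat \<lfloor>real n * t\<rfloor>) / sqrt (step_T \<eta> n) *
             ((\<integral>y. h y \<partial>empirical_measure (\<lambda>k. em_chain b \<sigma> \<eta> x \<xi> k \<omega>) (nat \<lfloor>real n * t\<rfloor>))
              - (\<integral>y. h y \<partial>\<pi>)))
        P (\<lambda>\<omega>. \<lambda>t\<in>{0..1}.
             sqrt (\<integral>y. (norm (transpose \<sigma> *v grad \<phi> y))\<^sup>2 \<partial>\<pi>) * W (a t) \<omega>)"
      unfolding empirical_step_path[OF hm]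
      by (rule em_fclt[OF st sc(1) p _ _ _ _ W]) (use lim tc in \<open>auto simp: time_change_def\<close>)
  qed
qed

end
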